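(* Let $\mathcal{H}$ be a finite set of $2$-connected planar graphs. If there exists a planar $\mathcal{H}$-subgraph-free graph that is not $4$-choosable, then $4$-Regular List Colouring is NP-complete when restricted to planar $\mathcal{H}$-subgraph-free graphs.
   Context: A colouring of a graph $G=(V,E)$ is a map $c:V\to\{1,2,\dots\}$ with $c(u)\neq c(v)$ for every edge $uv$. A list assignment $L$ gives each vertex $u$ a set $L(u)\subseteq\{1,2,\dots\}$; a colouring $c$ respects $L$ if $c(u)\in L(u)$ for all $u$. $L$ is $\ell$-regular if $|L(u)|=\ell$ for every vertex $u$. For a fixed integer $\ell\ge1$, the problem $\ell$-Regular List Colouring takes as input a graph $G$ with an $\ell$-regular list assignment $L$ and asks whether $G$ has a colouring respecting $L$. A graph is $\ell$-choosable if for every $\ell$-regular list assignment $L$ there is a colouring respecting $L$. For a set of graphs $\mathcal{H}$, a graph is $\mathcal{H}$-subgraph-free if it contains no (not necessarily induced) subgraph isomorphic to a graph in $\mathcal{H}$. A graph is $2$-connected if it has at least three vertices, is connected, and has no vertex whose removal disconnects it. *)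

theory Defs
  imports
    "HOL-Analysis.Analysis"
    "HOL-Computational_Algebra.Polynomial"
    "Graph_Theory.Digraph_Isomorphism"
begin

section \<open>Graphs\<close>

text \<open>
  A finite simple undirected graph is a \<^locale>\<open>pair_graph\<close>: every edge is represented by the two
  arcs \<open>(u, v)\<close> and \<open>(v, u)\<close>. The unqualified name \<open>connected\<close> would be ambiguous between
  topological connectedness and connectedness of graphs.
\<close>

definition two_connected :: "'a pair_pre_digraph \<Rightarrow> bool" where
  "two_connected G \<longleftrightarrow>
     pair_graph G \<and> card (pverts G) \<ge> 3 \<and> Digraph_Component.connected (with_proj G) \<and>
     (\<forall>v\<in>pverts G. Digraph_Component.connected (pre_digraph.del_vert (with_proj G) v))"

definition subgraph_free :: "'a pair_pre_digraph set \<Rightarrow> 'b pair_pre_digraph \<Rightarrow> bool" where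
  "subgraph_free \<H> G \<longleftrightarrow>
     \<not> (\<exists>K. subgraph (with_proj K) (with_proj G) \<and>
          (\<exists>H\<in>\<H>. digraph_iso (with_proj K) (with_proj H)))"

text \<open>
  A drawing in the plane, identified with \<^typ>\<open>complex\<close>. The arcs are indexed by the unordered
  pairs \<open>{u, v}\<close>, so that the two directions of an edge are drawn by the same arc.
\<close>

definition planar :: "'a pair_pre_digraph \<Rightarrow> bool" where
  "planar G \<longleftrightarrow>
     pair_graph G \<and>
     (\<exists>(p :: 'a \<Rightarrow> complex) (\<gamma> :: 'a set \<Rightarrow> real \<Rightarrow> complex).
        inj_on p (pverts G) \<and>
        (\<forall>(u, v)\<in>parcs G.
           arc (\<gamma> {u, v}) \<and>
           {pathstart (\<gamma> {u, v}), pathfinish (\<gamma> {u, v})} = {p u, p v} \<and>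
           path_image (\<gamma> {u, v}) \<inter> p ` pverts G = {p u, p v}) \<and>
        (\<forall>(u, v)\<in>parcs G. \<forall>(x, y)\<in>parcs G. {u, v} \<noteq> {x, y} \<longrightarrow>
           path_image (\<gamma> {u, v}) \<inter> path_image (\<gamma> {x, y}) \<subseteq> p ` pverts G))"


section \<open>List colouring\<close>

definition colouring :: "'a pair_pre_digraph \<Rightarrow> ('a \<Rightarrow> nat) \<Rightarrow> bool" where
  "colouring G c \<longleftrightarrow> (\<forall>u\<in>pverts G. 1 \<le> c u) \<and> (\<forall>(u, v)\<in>parcs G. c u \<noteq> c v)"

definition respects_lists :: "'a pair_pre_digraph \<Rightarrow> ('a \<Rightarrow> nat set) \<Rightarrow> ('a \<Rightarrow> nat) \<Rightarrow> bool" where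
  "respects_lists G L c \<longleftrightarrow> (\<forall>u\<in>pverts G. c u \<in> L u)"

definition regular_assignment :: "nat \<Rightarrow> 'a pair_pre_digraph \<Rightarrow> ('a \<Rightarrow> nat set) \<Rightarrow> bool" where
  "regular_assignment l G L \<longleftrightarrow>
     (\<forall>u\<in>pverts G. L u \<subseteq> {1..} \<and> finite (L u) \<and> card (L u) = l)"

definition choosable :: "nat \<Rightarrow> 'a pair_pre_digraph \<Rightarrow> bool" where
  "choosable l G \<longleftrightarrow>
     (\<forall>L. regular_assignment l G L \<longrightarrow> (\<exists>c. colouring G c \<and> respects_lists G L c))"


section \<open>Polynomial-time Turing machines\<close>

text \<open>
  Deterministic multi-tape machines with tapes that are infinite in both directions. Symbol
  \<open>0\<close> is the blank, \<open>1\<close> and \<open>2\<close> are the input bits. The states are \<open>0, \<dots>, states M\<close>, where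
  \<open>0\<close> is initial and \<open>states M\<close> is the only halting state.
\<close>

datatype move = MoveLeft | Stay | MoveRight

record tm =
  tapes :: nat
  states :: nat
  symbols :: nat
  delta :: "nat \<Rightarrow> nat list \<Rightarrow> nat \<times> (nat \<times> move) list"

text \<open>Only the finite part of the transition function described here is ever used in a run.\<close>

definition wf_tm :: "tm \<Rightarrow> bool" where
  "wf_tm M \<longleftrightarrow>
     1 \<le> tapes M \<and> 3 \<le> symbols M \<and>
     (\<forall>q<states M. \<forall>rs. length rs = tapes M \<and> set rs \<subseteq> {..<symbols M} \<longrightarrow>
        (case delta M q rs of (q', acts) \<Rightarrow>
           q' \<le> states M \<and> length acts = tapes M \<and> fst ` set acts \<subseteq> {..<symbols M}))"

type_synonym tape = "(int \<Rightarrow> nat) \<times> int"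

fun shift :: "move \<Rightarrow> int \<Rightarrow> int" where
  "shift MoveLeft h = h - 1"
| "shift Stay h = h"
| "shift MoveRight h = h + 1"

fun act :: "nat \<times> move \<Rightarrow> tape \<Rightarrow> tape" where
  "act (s, m) (t, h) = (t(h := s), shift m h)"

fun step :: "tm \<Rightarrow> nat \<times> tape list \<Rightarrow> nat \<times> tape list" where
  "step M (q, ts) =
     (if q < states M then
        case delta M q (map (\<lambda>(t, h). t h) ts) of (q', acts) \<Rightarrow> (q', map2 act acts ts)
      else (q, ts))"

definition written :: "bool list \<Rightarrow> int \<Rightarrow> nat" where
  "written x i =
     (if 0 \<le> i \<and> i < int (length x) then if x ! nat i then 2 else 1 else 0)"

definition start :: "tm \<Rightarrow> bool list \<Rightarrow> nat \<times> tape list" where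
  "start M x = (0, (written x, 0) # replicate (tapes M - 1) (\<lambda>_. 0, 0))"

text \<open>
  The input is on the first tape and the output on the last one. Halted configurations are fixed
  points of \<^const>\<open>step\<close>, so it suffices to inspect the run at the time bound.
\<close>

definition poly_time :: "(bool list \<Rightarrow> bool list) \<Rightarrow> bool" where
  "poly_time f \<longleftrightarrow>
     (\<exists>M (p :: nat poly). wf_tm M \<and>
        (\<forall>x. case (step M ^^ poly p (length x)) (start M x) of (q, ts) \<Rightarrow>
           q = states M \<and> fst (last ts) = written (f x)))"


section \<open>NP-completeness\<close>

text \<open>Self-delimiting pairing: the bits of \<open>x\<close> are doubled, and \<open>01\<close> separates them from \<open>w\<close>.\<close>

definition pair :: "bool list \<Rightarrow> bool list \<Rightarrow> bool list" where
  "pair x w = concat (map (\<lambda>b. [b, b]) x) @ [False, True] @ w"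

lemma pair_ne: "pair x w \<noteq> []"
  by (simp add: pair_def)

lemma pair_inject: "pair x w = pair y v \<longleftrightarrow> x = y \<and> w = v"
proof (induction x arbitrary: y)
  case Nil
  then show ?case by (cases y) (auto simp: pair_def)
next
  case (Cons a x)
  then show ?case by (cases y) (auto simp: pair_def)
qed

definition class_P :: "bool list set set" where
  "class_P = {A. poly_time (\<lambda>x. [x \<in> A])}"

definition class_NP :: "bool list set set" where
  "class_NP =
     {A. \<exists>B\<in>class_P. \<exists>p :: nat poly. \<forall>x.
        x \<in> A \<longleftrightarrow> (\<exists>w. length w \<le> poly p (length x) \<and> pair x w \<in> B)}"

text \<open>
  A decision problem consists of a set of (encoded) instances and the subset of yes-instances;
  restricting a problem to a class of inputs shrinks both sets. As the inputs of a
  restricted problem are instances by assumption, membership in NP only concerns the answer on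
  instances, whereas a reduction must always produce an instance.
\<close>

record problem =
  instances :: "bool list set"
  yes :: "bool list set"

definition in_NP :: "problem \<Rightarrow> bool" where
  "in_NP Q \<longleftrightarrow> (\<exists>A\<in>class_NP. yes Q = instances Q \<inter> A)"

definition NP_hard :: "problem \<Rightarrow> bool" where
  "NP_hard Q \<longleftrightarrow>
     (\<forall>A\<in>class_NP. \<exists>f. poly_time f \<and> (\<forall>x. f x \<in> instances Q \<and> (x \<in> A \<longleftrightarrow> f x \<in> yes Q)))"

definition NP_complete :: "problem \<Rightarrow> bool" where
  "NP_complete Q \<longleftrightarrow> in_NP Q \<and> NP_hard Q"


section \<open>The problem Regular List Colouring\<close>

fun bits :: "nat \<Rightarrow> bool list" where
  "bits n = (if n = 0 then [] else odd n # bits (n div 2))"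

declare bits.simps [simp del]

lemma bits_0: "bits 0 = []"
  by (simp add: bits.simps)

lemma bits_pos: "n \<noteq> 0 \<Longrightarrow> bits n = odd n # bits (n div 2)"
  by (subst bits.simps) (erule if_not_P)

lemma bits_inject: "bits m = bits n \<longleftrightarrow> m = n"
proof (induction m arbitrary: n rule: less_induct)
  case (less m)
  show ?case
  proof (cases "m = 0 \<or> n = 0")
    case True
    then show ?thesis by (cases "m = 0"; cases "n = 0") (simp_all add: bits_0 bits_pos)
  next
    case False
    then have "bits m = bits n \<longleftrightarrow> odd m = odd n \<and> m div 2 = n div 2"
      using less.IH[of "m div 2" "n div 2"]
      by (simp add: bits_pos[of m] bits_pos[of n])
    also have "\<dots> \<longleftrightarrow> m = n" by presburger
    finally show ?thesis .
  qed
qed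

fun encode_nats :: "nat list \<Rightarrow> bool list" where
  "encode_nats [] = []"
| "encode_nats (n # ns) = pair (bits n) (encode_nats ns)"

lemma encode_nats_inject: "encode_nats ms = encode_nats ns \<longleftrightarrow> ms = ns"
proof (induction ms arbitrary: ns)
  case Nil
  show ?case by (cases ns) (simp_all add: pair_ne pair_ne[symmetric])
next
  case (Cons m ms)
  then show ?case by (cases ns) (simp_all add: pair_ne pair_inject bits_inject)
qed

text \<open>
  An input graph has vertices \<open>0, \<dots>, n - 1\<close>. The encoding consists of \<open>n\<close>, the adjacency matrix,
  and the lists of the vertices, with colours in binary. As \<open>l\<close> is fixed and all lists have
  size \<open>l\<close>, no separators between the lists are needed.
\<close>

definition encode :: "nat pair_pre_digraph \<Rightarrow> (nat \<Rightarrow> nat set) \<Rightarrow> bool list" where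
  "encode G L =
     (let n = card (pverts G) in
      encode_nats
        (n # [if (u, v) \<in> parcs G then 1 else 0. u \<leftarrow> [0..<n], v \<leftarrow> [0..<n]]
           @ concat (map (\<lambda>u. sorted_list_of_set (L u)) [0..<n])))"

definition regular_input :: "nat \<Rightarrow> nat pair_pre_digraph \<Rightarrow> (nat \<Rightarrow> nat set) \<Rightarrow> bool" where
  "regular_input l G L \<longleftrightarrow>
     pair_graph G \<and> pverts G = {..<card (pverts G)} \<and> regular_assignment l G L"

definition regular_list_colouring :: "nat \<Rightarrow> nat pair_pre_digraph set \<Rightarrow> problem" where
  "regular_list_colouring l \<G> =
     \<lparr>instances = {encode G L | G L. G \<in> \<G> \<and> regular_input l G L},
      yes = {encode G L | G L. G \<in> \<G> \<and> regular_input l G L \<and>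
               (\<exists>c. colouring G c \<and> respects_lists G L c)}\<rparr>"

end

theory Submission
  imports Defs
begin

text \<open>
  A graph that is not \<open>4\<close>-choosable yields a forcing gadget: an \<open>\<H>\<close>-subgraph-free planar graph with lists in
  whose respecting colourings some vertex always has the same colour. Joining copies of the gadget
  by single edges to a vertex with too long a list, after renaming colours, deletes colours from
  that list. As the new edges are bridges, they lie in no \<open>2\<close>-connected subgraph, and they keep the graph planar
  because a planar graph can be drawn with a prescribed vertex on the outer face. It therefore
  suffices to reduce satisfiability to list colouring with lists of size at most \<open>4\<close> on planar
  graphs whose \<open>2\<close>-connected subgraphs are large. The graph is a grid whose rows are clauses and
  whose columns are variables; the edges are replaced by bundles of long paths, each of which excludes
  one pair of colours at its ends. The grid is regular enough that the reduction is given by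
  expressions with bounded sums, which Turing machines evaluate in polynomial time.
  Membership in NP uses a certificate that holds, for each vertex, the index of its colour in its list.
\<close>


section \<open>Expressions with bounded sums\<close>

text \<open>The obstacle is that satisfiability is not planar, and no crossing gadget is used. Two
  bits meet in every cell: the value of a variable, travelling down, and whether the clause is
  already satisfied, travelling right; four colours hold both. A row scans its clause from left to
  right, so clauses may have any length. Four colours give 16 pairs, hence 16 paths between adjacent
  cells can impose any relation. Inner vertices have degree at most 2, so a 2-connected subgraph
  that contains one of them contains its whole path, and the paths are made longer than every order
  in \<H>. NP-hardness quantifies over all of NP and over concrete machines, so Cook-Levin is proved
  with a reduction that is itself a machine. All running times rest on one fact: if loops only run
  up to values that were already computed by such sums, all values are polynomially bounded and can
  be kept in unary registers. Colours of an input may be exponentially large, so the verifier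
  compares bit strings instead of numbers.\<close>

text \<open>
  Variables are de Bruijn indices: \<open>Sum\<close> and \<open>OFor\<close> bind the variable \<open>0\<close> and shift the others, which is
  why \<open>\<rho> \<circ> Suc\<close> and \<open>\<rho> 0\<close> occur together below.
\<close>

datatype expr = Const nat | Var nat | Len | Bit expr | Add expr expr | Sub expr expr | Sum expr expr

primrec eval :: "expr \<Rightarrow> bool list \<Rightarrow> (nat \<Rightarrow> nat) \<Rightarrow> nat" where
  "eval (Const c) x \<rho> = c"
| "eval (Var v) x \<rho> = \<rho> v"
| "eval Len x \<rho> = length x"
| "eval (Bit e) x \<rho> = of_bool (eval e x \<rho> < length x \<and> x ! eval e x \<rho>)"
| "eval (Add a b) x \<rho> = eval a x \<rho> + eval b x \<rho>"
| "eval (Sub a b) x \<rho> = eval a x \<rho> - eval b x \<rho>"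
| "eval (Sum a b) x \<rho> = (\<Sum>m<eval a x \<rho>. eval b x (case_nat m \<rho>))"

datatype oprog = Emit "bool list" | OSeq oprog oprog | OIf expr oprog oprog | OFor expr oprog

primrec oeval :: "oprog \<Rightarrow> bool list \<Rightarrow> (nat \<Rightarrow> nat) \<Rightarrow> bool list" where
  "oeval (Emit bs) x \<rho> = bs"
| "oeval (OSeq p q) x \<rho> = oeval p x \<rho> @ oeval q x \<rho>"
| "oeval (OIf e p q) x \<rho> = (if eval e x \<rho> \<noteq> 0 then oeval p x \<rho> else oeval q x \<rho>)"
| "oeval (OFor e p) x \<rho> = concat (map (\<lambda>m. oeval p x (case_nat m \<rho>)) [0..<eval e x \<rho>])"

section \<open>Register programs with running times\<close>

datatype test = NonZero | BitOne | InRange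

primrec holds :: "test \<Rightarrow> bool list \<Rightarrow> nat \<Rightarrow> bool" where
  "holds NonZero x n \<longleftrightarrow> n \<noteq> 0"
| "holds BitOne x n \<longleftrightarrow> n < length x \<and> x ! n"
| "holds InRange x n \<longleftrightarrow> n < length x"

datatype com = Skip | Inc nat | Dec nat | Out bool | Seq com com
  | Cond test nat com com | Loop test nat com

type_synonym store = "(nat \<Rightarrow> nat) \<times> bool list"

text \<open>The costs are those of the flat code into which programs are compiled: a conditional
  whose test succeeds and every round of a loop pay for the test and for the jump behind the body.
  This makes \<open>mrun_exec\<close> exact.\<close>

inductive exec :: "bool list \<Rightarrow> com \<Rightarrow> store \<Rightarrow> nat \<Rightarrow> store \<Rightarrow> bool" for x where
  Skip: "exec x Skip s 0 s"
| Inc: "exec x (Inc r) (\<sigma>, out) 1 (\<sigma>(r := Suc (\<sigma> r)), out)"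
| Dec: "exec x (Dec r) (\<sigma>, out) 1 (\<sigma>(r := \<sigma> r - 1), out)"
| Out: "exec x (Out b) (\<sigma>, out) 1 (\<sigma>, out @ [b])"
| Seq: "exec x c s t s' \<Longrightarrow> exec x d s' t' s'' \<Longrightarrow> exec x (Seq c d) s (t + t') s''"
| CondT: "holds q x (\<sigma> r) \<Longrightarrow> exec x c (\<sigma>, out) t s' \<Longrightarrow> exec x (Cond q r c d) (\<sigma>, out) (t + 2) s'"
| CondF: "\<not> holds q x (\<sigma> r) \<Longrightarrow> exec x d (\<sigma>, out) t s' \<Longrightarrow> exec x (Cond q r c d) (\<sigma>, out) (t + 1) s'"
| LoopF: "\<not> holds q x (\<sigma> r) \<Longrightarrow> exec x (Loop q r c) (\<sigma>, out) 1 (\<sigma>, out)"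
| LoopT: "holds q x (\<sigma> r) \<Longrightarrow> exec x c (\<sigma>, out) t s' \<Longrightarrow> exec x (Loop q r c) s' t' s'' \<Longrightarrow>
    exec x (Loop q r c) (\<sigma>, out) (t + 2 + t') s''"

text \<open>Upper bounds compose under sequencing and iteration, while the exact time of a compiled
  expression depends on the values that occur.\<close>

definition execb :: "bool list \<Rightarrow> com \<Rightarrow> store \<Rightarrow> nat \<Rightarrow> store \<Rightarrow> bool" where
  "execb x c s B s' \<longleftrightarrow> (\<exists>t\<le>B. exec x c s t s')"

lemma execb_mono: "execb x c s B s' \<Longrightarrow> B \<le> B' \<Longrightarrow> execb x c s B' s'"
  unfolding execb_def using le_trans by blast

lemma execb_Skip: "execb x Skip s 0 s"
  unfolding execb_def using exec.Skip by blast

lemma execb_Inc: "s' = (\<sigma>(r := Suc (\<sigma> r)), out) \<Longrightarrow> execb x (Inc r) (\<sigma>, out) 1 s'"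
  unfolding execb_def using exec.Inc by blast

lemma execb_Dec: "s' = (\<sigma>(r := \<sigma> r - 1), out) \<Longrightarrow> execb x (Dec r) (\<sigma>, out) 1 s'"
  unfolding execb_def using exec.Dec by blast

lemma execb_Out: "execb x (Out b) (\<sigma>, out) 1 (\<sigma>, out @ [b])"
  unfolding execb_def using exec.Out by blast

lemma execb_Seq: "execb x c s B s' \<Longrightarrow> execb x d s' B' s'' \<Longrightarrow> execb x (Seq c d) s (B + B') s''"
  unfolding execb_def by (meson add_mono exec.Seq)

lemma execb_Cond:
  assumes "holds q x (\<sigma> r) \<Longrightarrow> execb x c (\<sigma>, out) B s'"
    and "\<not> holds q x (\<sigma> r) \<Longrightarrow> execb x d (\<sigma>, out) B s'"
  shows "execb x (Cond q r c d) (\<sigma>, out) (B + 2) s'"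
proof (cases "holds q x (\<sigma> r)")
  case True
  with assms obtain t where "t \<le> B" "exec x c (\<sigma>, out) t s'" unfolding execb_def by blast
  then have "exec x (Cond q r c d) (\<sigma>, out) (t + 2) s'" "t + 2 \<le> B + 2"
    using exec.CondT[of q x \<sigma> r c out t s' d] True by auto
  then show ?thesis unfolding execb_def by blast
next
  case False
  with assms obtain t where "t \<le> B" "exec x d (\<sigma>, out) t s'" unfolding execb_def by blast
  then have "exec x (Cond q r c d) (\<sigma>, out) (t + 1) s'" "t + 1 \<le> B + 2"
    using exec.CondF[of q x \<sigma> r d out t s' c] False by auto
  then show ?thesis unfolding execb_def by blast
qed

text \<open>The run is given in advance as the sequence \<open>S\<close> of stores before each
  round, which replaces an invariant. A round costs its body, the test and the jump back; the last
  test costs 1.\<close>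

lemma execb_Loop:
  assumes "\<And>i. i < n \<Longrightarrow> holds q x (fst (S i) r)" "\<not> holds q x (fst (S n) r)"
    and "\<And>i. i < n \<Longrightarrow> execb x c (S i) B (S (Suc i))"
  shows "execb x (Loop q r c) (S 0) (n * (B + 2) + 1) (S n)"
  using assms
proof (induction n arbitrary: S)
  case 0
  obtain \<sigma> out where "S 0 = (\<sigma>, out)" by fastforce
  with 0 show ?case unfolding execb_def using exec.LoopF[of q x \<sigma> r c out] by auto
next
  case (Suc n)
  obtain \<sigma> out where S0: "S 0 = (\<sigma>, out)" by fastforce
  have "execb x (Loop q r c) (S (Suc 0)) (n * (B + 2) + 1) (S (Suc n))"
    using Suc.IH[of "\<lambda>i. S (Suc i)"] Suc.prems by simp
  then obtain t' where t': "t' \<le> n * (B + 2) + 1" "exec x (Loop q r c) (S (Suc 0)) t' (S (Suc n))"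
    unfolding execb_def by blast
  obtain t where t: "t \<le> B" "exec x c (S 0) t (S (Suc 0))"
    using Suc.prems(3)[of 0] unfolding execb_def by blast
  have "exec x (Loop q r c) (S 0) (t + 2 + t') (S (Suc n))"
    using exec.LoopT[of q x \<sigma> r c out t "S (Suc 0)" t' "S (Suc n)"] S0 Suc.prems(1)[of 0] t t' by simp
  then show ?case unfolding execb_def using t t' by (intro exI[of _ "t + 2 + t'"]) auto
qed

section \<open>Compilation of expressions and output programs into register programs\<close>

definition clear :: "nat \<Rightarrow> com" where "clear k = Loop NonZero k (Dec k)"

lemma execb_clear: "execb x (clear k) (\<sigma>, out) (3 * \<sigma> k + 1) (\<sigma>(k := 0), out)"
proof -
  let ?S = "\<lambda>i. (\<sigma>(k := \<sigma> k - i), out)"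
  have "execb x (Loop NonZero k (Dec k)) (?S 0) (\<sigma> k * (1 + 2) + 1) (?S (\<sigma> k))"
    by (rule execb_Loop[where S = "?S" and n = "\<sigma> k"]) (simp, simp, rule execb_Dec, auto simp: fun_eq_iff)
  then show ?thesis unfolding clear_def by (simp add: mult.commute numeral_3_eq_3)
qed

text \<open>The value is added to register \<open>r\<close>. Registers from \<open>k\<close> on form
  a stack of scratch space, zero before and after, and \<open>m\<close> tells where the variables
  live. Reading a register destroys it, so \<open>Var\<close> moves the value to both
  \<open>k\<close> and \<open>r\<close> and then restores it from \<open>k\<close>.\<close>

primrec cexp :: "expr \<Rightarrow> (nat \<Rightarrow> nat) \<Rightarrow> nat \<Rightarrow> nat \<Rightarrow> com" where
  "cexp (Const c) m r k = ((Seq (Inc r)) ^^ c) Skip"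
| "cexp (Var v) m r k =
     Seq (Loop NonZero (m v) (Seq (Dec (m v)) (Seq (Inc k) (Inc r))))
         (Loop NonZero k (Seq (Dec k) (Inc (m v))))"
| "cexp Len m r k = Seq (Loop InRange k (Seq (Inc k) (Inc r))) (clear k)"
| "cexp (Bit e) m r k = Seq (cexp e m k (k + 1)) (Seq (Cond BitOne k (Inc r) Skip) (clear k))"
| "cexp (Add a b) m r k = Seq (cexp a m r k) (cexp b m r k)"
| "cexp (Sub a b) m r k =
     Seq (cexp a m k (k + 2)) (Seq (cexp b m (k + 1) (k + 2))
       (Seq (Loop NonZero (k + 1) (Seq (Dec (k + 1)) (Dec k)))
            (Loop NonZero k (Seq (Dec k) (Inc r)))))"
| "cexp (Sum a b) m r k =
     Seq (cexp a m k (k + 2))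
       (Seq (Loop NonZero k (Seq (Dec k) (Seq (cexp b (case_nat (k + 1) m) r (k + 2)) (Inc (k + 1)))))
            (clear (k + 1)))"

primrec coprog :: "oprog \<Rightarrow> (nat \<Rightarrow> nat) \<Rightarrow> nat \<Rightarrow> com" where
  "coprog (Emit bs) m k = foldr (\<lambda>b. Seq (Out b)) bs Skip"
| "coprog (OSeq p q) m k = Seq (coprog p m k) (coprog q m k)"
| "coprog (OIf e p q) m k =
     Seq (cexp e m k (k + 1)) (Cond NonZero k (Seq (clear k) (coprog p m k)) (coprog q m k))"
| "coprog (OFor e p) m k =
     Seq (cexp e m k (k + 2))
       (Seq (Loop NonZero k (Seq (Dec k) (Seq (coprog p (case_nat (k + 1) m) (k + 2)) (Inc (k + 1)))))
            (clear (k + 1)))"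

definition bounded_env :: "bool list \<Rightarrow> (nat \<Rightarrow> nat) \<Rightarrow> nat \<Rightarrow> bool" where
  "bounded_env x \<rho> N \<longleftrightarrow> length x \<le> N \<and> (\<forall>v. \<rho> v \<le> N)"

lemma poly_nat_mono: "m \<le> n \<Longrightarrow> poly p m \<le> poly p (n::nat)"
  by (induction p) (auto intro!: add_mono mult_mono)

lemma bounded_env_case_nat:
  "bounded_env x \<rho> N \<Longrightarrow> m \<le> M \<Longrightarrow> bounded_env x (case_nat m \<rho>) (N + M)"
  unfolding bounded_env_def by (auto split: nat.split intro: trans_le_add1 trans_le_add2)

text \<open>A sum has polynomially many terms, and its index, being below that number, only enlarges
  the environment polynomially. This is what makes unary registers affordable.\<close>

lemma eval_bound:
  "\<exists>V::nat poly. \<forall>x \<rho> N. bounded_env x \<rho> N \<longrightarrow> eval e x \<rho> \<le> poly V N"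
proof (induction e)
  case (Const c)
  then show ?case by (intro exI[of _ "[:c:]"]) simp
next
  case (Var v)
  then show ?case by (intro exI[of _ "[:0, 1:]"]) (simp add: bounded_env_def)
next
  case Len
  then show ?case by (intro exI[of _ "[:0, 1:]"]) (simp add: bounded_env_def)
next
  case (Bit e)
  then show ?case by (intro exI[of _ "[:1:]"]) simp
next
  case (Add a b)
  then obtain V W :: "nat poly" where "\<forall>x \<rho> N. bounded_env x \<rho> N \<longrightarrow> eval a x \<rho> \<le> poly V N"
    "\<forall>x \<rho> N. bounded_env x \<rho> N \<longrightarrow> eval b x \<rho> \<le> poly W N" by blast
  then show ?case by (intro exI[of _ "V + W"]) (simp add: add_mono)
next
  case (Sub a b)
  then obtain V :: "nat poly" where "\<forall>x \<rho> N. bounded_env x \<rho> N \<longrightarrow> eval a x \<rho> \<le> poly V N"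
    by blast
  then show ?case by (intro exI[of _ V]) (auto intro: le_trans[OF diff_le_self])
next
  case (Sum a b)
  then obtain V W :: "nat poly" where V: "\<forall>x \<rho> N. bounded_env x \<rho> N \<longrightarrow> eval a x \<rho> \<le> poly V N"
    and W: "\<forall>x \<rho> N. bounded_env x \<rho> N \<longrightarrow> eval b x \<rho> \<le> poly W N" by blast
  show ?case
  proof (intro exI[of _ "V * pcompose W ([:0, 1:] + V)"] allI impI)
    fix x \<rho> N assume b: "bounded_env x \<rho> N"
    have "eval b x (case_nat m \<rho>) \<le> poly W (N + poly V N)" if "m < eval a x \<rho>" for m
      using W bounded_env_case_nat[OF b, of m "poly V N"] that V b by (meson le_trans less_imp_le)
    then have "eval (Sum a b) x \<rho> \<le> (\<Sum>m<eval a x \<rho>. poly W (N + poly V N))"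
      unfolding eval.simps by (intro sum_mono) simp
    also have "\<dots> \<le> poly V N * poly W (N + poly V N)"
      using V b by simp
    finally show "eval (Sum a b) x \<rho> \<le> poly (V * pcompose W ([:0, 1:] + V)) N"
      by (simp add: poly_pcompose)
  qed
qed

definition fresh_from :: "nat \<Rightarrow> (nat \<Rightarrow> nat) \<Rightarrow> (nat \<Rightarrow> nat) \<Rightarrow> bool" where
  "fresh_from k m \<sigma> \<longleftrightarrow> (\<forall>v. m v < k) \<and> (\<forall>i\<ge>k. \<sigma> i = 0)"

text \<open>The polynomial is fixed before the input, the register map and the stack height, so that
  one bound serves every iteration of an enclosing sum.\<close>

definition cexp_in_time :: "expr \<Rightarrow> nat poly \<Rightarrow> bool" where
  "cexp_in_time e T \<longleftrightarrow> (\<forall>x m r k \<sigma> out N. fresh_from k m \<sigma> \<longrightarrow> r < k \<longrightarrow> (\<forall>v. m v \<noteq> r) \<longrightarrow>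
     bounded_env x (\<sigma> \<circ> m) N \<longrightarrow>
     execb x (cexp e m r k) (\<sigma>, out) (poly T N) (\<sigma>(r := \<sigma> r + eval e x (\<sigma> \<circ> m)), out))"

lemma cexp_in_timeD:
  assumes "cexp_in_time e T" "fresh_from k m \<sigma>" "r < k" "\<And>v. m v \<noteq> r" "bounded_env x (\<sigma> \<circ> m) N"
    and "\<sigma>' = \<sigma>(r := \<sigma> r + eval e x (\<sigma> \<circ> m))"
  shows "execb x (cexp e m r k) (\<sigma>, out) (poly T N) (\<sigma>', out)"
  using assms unfolding cexp_in_time_def by blast

lemma cexp_in_time_Const: "\<exists>T. cexp_in_time (Const c) T"
proof -
  have *: "execb x (((Seq (Inc r)) ^^ c) Skip) (\<sigma>, out) c (\<sigma>(r := \<sigma> r + c), out)" for x r \<sigma> out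
  proof (induction c arbitrary: \<sigma>)
    case 0
    then show ?case by (simp add: execb_Skip)
  next
    case (Suc c)
    have "execb x (Seq (Inc r) (((Seq (Inc r)) ^^ c) Skip)) (\<sigma>, out) (1 + c) (\<sigma>(r := \<sigma> r + Suc c), out)"
      by (rule execb_Seq[OF execb_Inc[OF refl]])
        (use Suc[of "\<sigma>(r := Suc (\<sigma> r))"] in \<open>simp del: fun_upd_apply add: fun_upd_same\<close>)
    then show ?case by (simp del: fun_upd_apply)
  qed
  have "cexp_in_time (Const c) [:c:]" unfolding cexp_in_time_def using * by simp
  then show ?thesis ..
qed

lemma cexp_in_time_Var: "\<exists>T. cexp_in_time (Var v) T"
proof -
  have "cexp_in_time (Var v) [:2, 9:]" unfolding cexp_in_time_def
  proof (intro allI impI)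
    fix x m r k \<sigma> and out :: "bool list" and N
    assume f: "fresh_from k m \<sigma>" and r: "r < k" "\<forall>v. m v \<noteq> r" and b: "bounded_env x (\<sigma> \<circ> m) N"
    let ?n = "\<sigma> (m v)"
    have k: "m v < k" "\<sigma> k = 0" "r \<noteq> m v" "?n \<le> N" using f r b unfolding fresh_from_def bounded_env_def by auto
    \<comment> \<open>\<open>?S\<close> and \<open>?U\<close> are the stores after \<open>i\<close>
      rounds of the draining and of the restoring loop.\<close>
    let ?S = "\<lambda>i. (\<sigma>(m v := ?n - i, k := i, r := \<sigma> r + i), out)"
    let ?U = "\<lambda>i. (\<sigma>(m v := i, k := ?n - i, r := \<sigma> r + ?n), out)"
    have "execb x (Loop NonZero (m v) (Seq (Dec (m v)) (Seq (Inc k) (Inc r)))) (?S 0) (?n * (3 + 2) + 1) (?S ?n)"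
    proof (rule execb_Loop[where S = "?S" and n = "?n"])
      fix i assume "i < ?n"
      have "execb x (Seq (Dec (m v)) (Seq (Inc k) (Inc r))) (?S i) (1 + (1 + 1)) (?S (Suc i))"
        by (rule execb_Seq[OF execb_Dec[OF refl] execb_Seq[OF execb_Inc[OF refl] execb_Inc]])
          (use k r in \<open>auto simp: fun_eq_iff\<close>)
      then show "execb x (Seq (Dec (m v)) (Seq (Inc k) (Inc r))) (?S i) 3 (?S (Suc i))"
        by (rule execb_mono) simp
    qed (use k r in auto)
    moreover have "execb x (Loop NonZero k (Seq (Dec k) (Inc (m v)))) (?U 0) (?n * (2 + 2) + 1) (?U ?n)"
    proof (rule execb_Loop[where S = "?U" and n = "?n"])
      fix i assume "i < ?n"
      have "execb x (Seq (Dec k) (Inc (m v))) (?U i) (1 + 1) (?U (Suc i))"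
        by (rule execb_Seq[OF execb_Dec[OF refl] execb_Inc])
          (use k r in \<open>auto simp: fun_eq_iff\<close>)
      then show "execb x (Seq (Dec k) (Inc (m v))) (?U i) 2 (?U (Suc i))"
        by (rule execb_mono) simp
    qed (use k r in auto)
    moreover have "?S 0 = (\<sigma>, out)" "?S ?n = ?U 0" using k by (auto simp: fun_eq_iff)
    moreover have "?U ?n = (\<sigma>(r := \<sigma> r + eval (Var v) x (\<sigma> \<circ> m)), out)"
      using k by (auto simp: fun_eq_iff)
    ultimately have "execb x (cexp (Var v) m r k) (\<sigma>, out) (?n * (3 + 2) + 1 + (?n * (2 + 2) + 1))
       (\<sigma>(r := \<sigma> r + eval (Var v) x (\<sigma> \<circ> m)), out)"
      unfolding cexp.simps using execb_Seq by metis
    then show "execb x (cexp (Var v) m r k) (\<sigma>, out) (poly [:2, 9:] N)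
       (\<sigma>(r := \<sigma> r + eval (Var v) x (\<sigma> \<circ> m)), out)"
      by (rule execb_mono) (use k in \<open>simp add: mult.commute\<close>)
  qed
  then show ?thesis ..
qed

lemma cexp_in_time_Len: "\<exists>T. cexp_in_time Len T"
proof -
  have "cexp_in_time Len [:2, 7:]" unfolding cexp_in_time_def
  proof (intro allI impI)
    fix x m r k \<sigma> and out :: "bool list" and N
    assume f: "fresh_from k m \<sigma>" and r: "r < k" "\<forall>v. m v \<noteq> r" and b: "bounded_env x (\<sigma> \<circ> m) N"
    let ?n = "length x"
    have k: "\<sigma> k = 0" "?n \<le> N" using f r b unfolding fresh_from_def bounded_env_def by auto
    let ?S = "\<lambda>i. (\<sigma>(k := i, r := \<sigma> r + i), out)"
    have "execb x (Loop InRange k (Seq (Inc k) (Inc r))) (?S 0) (?n * (2 + 2) + 1) (?S ?n)"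
    proof (rule execb_Loop[where S = "?S" and n = "?n"])
      fix i assume "i < ?n"
      have "execb x (Seq (Inc k) (Inc r)) (?S i) (1 + 1) (?S (Suc i))"
        by (rule execb_Seq[OF execb_Inc[OF refl] execb_Inc])
          (use k r in \<open>auto simp: fun_eq_iff\<close>)
      then show "execb x (Seq (Inc k) (Inc r)) (?S i) 2 (?S (Suc i))"
        by (rule execb_mono) simp
    qed (use k r in auto)
    moreover have "?S 0 = (\<sigma>, out)" using k by (auto simp: fun_eq_iff)
    moreover have "execb x (clear k) (?S ?n) (3 * ?n + 1) (\<sigma>(r := \<sigma> r + eval Len x (\<sigma> \<circ> m)), out)"
      using execb_clear[of x k "\<sigma>(k := ?n, r := \<sigma> r + ?n)" out] k r
      by (simp add: fun_upd_twist fun_upd_idem)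
    ultimately have "execb x (cexp Len m r k) (\<sigma>, out) (?n * (2 + 2) + 1 + (3 * ?n + 1))
       (\<sigma>(r := \<sigma> r + eval Len x (\<sigma> \<circ> m)), out)"
      unfolding cexp.simps using execb_Seq by metis
    then show "execb x (cexp Len m r k) (\<sigma>, out) (poly [:2, 7:] N)
       (\<sigma>(r := \<sigma> r + eval Len x (\<sigma> \<circ> m)), out)"
      by (rule execb_mono) (use k in simp)
  qed
  then show ?thesis ..
qed

lemma cexp_in_time_Bit:
  assumes "cexp_in_time e T"
  shows "\<exists>T. cexp_in_time (Bit e) T"
proof -
  obtain V :: "nat poly" where V: "\<And>x \<rho> N. bounded_env x \<rho> N \<Longrightarrow> eval e x \<rho> \<le> poly V N"
    using eval_bound by blast
  have "cexp_in_time (Bit e) (T + [:4:] + smult 3 V)" unfolding cexp_in_time_def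
  proof (intro allI impI)
    fix x m r k \<sigma> and out :: "bool list" and N
    assume f: "fresh_from k m \<sigma>" and r: "r < k" "\<forall>v. m v \<noteq> r" and b: "bounded_env x (\<sigma> \<circ> m) N"
    have k: "\<sigma> k = 0" "\<And>v. m v < k" using f r unfolding fresh_from_def by auto
    let ?v = "eval e x (\<sigma> \<circ> m)"
    let ?w = "eval (Bit e) x (\<sigma> \<circ> m)"
    have "execb x (cexp e m k (k + 1)) (\<sigma>, out) (poly T N) (\<sigma>(k := ?v), out)"
      by (rule cexp_in_timeD[OF assms]) (use f b k in \<open>auto simp: fresh_from_def less_Suc_eq dest: less_not_refl3\<close>)
    moreover have "execb x (Cond BitOne k (Inc r) Skip) (\<sigma>(k := ?v), out) (1 + 2) (\<sigma>(k := ?v, r := \<sigma> r + ?w), out)"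
    proof (rule execb_Cond)
      assume h: "holds BitOne x ((\<sigma>(k := ?v)) k)"
      show "execb x (Inc r) (\<sigma>(k := ?v), out) 1 (\<sigma>(k := ?v, r := \<sigma> r + ?w), out)"
        by (rule execb_Inc) (use h r in auto)
    next
      assume h: "\<not> holds BitOne x ((\<sigma>(k := ?v)) k)"
      then have "\<sigma>(k := ?v, r := \<sigma> r + ?w) = \<sigma>(k := ?v)" using r by (auto simp: fun_eq_iff)
      then show "execb x Skip (\<sigma>(k := ?v), out) 1 (\<sigma>(k := ?v, r := \<sigma> r + ?w), out)"
        using execb_mono[OF execb_Skip] by simp
    qed
    moreover have "execb x (clear k) (\<sigma>(k := ?v, r := \<sigma> r + ?w), out) (3 * ?v + 1) (\<sigma>(r := \<sigma> r + ?w), out)"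
      using execb_clear[of x k "\<sigma>(k := ?v, r := \<sigma> r + ?w)" out] k r
      by (simp add: fun_upd_twist fun_upd_idem)
    ultimately have "execb x (cexp (Bit e) m r k) (\<sigma>, out) (poly T N + (1 + 2 + (3 * ?v + 1)))
       (\<sigma>(r := \<sigma> r + ?w), out)"
      unfolding cexp.simps by (intro execb_Seq)
    then show "execb x (cexp (Bit e) m r k) (\<sigma>, out) (poly (T + [:4:] + smult 3 V) N)
       (\<sigma>(r := \<sigma> r + ?w), out)"
      by (rule execb_mono) (use V[OF b] in simp)
  qed
  then show ?thesis ..
qed

lemma cexp_in_time_Add:
  assumes "cexp_in_time a T" "cexp_in_time b U"
  shows "\<exists>T. cexp_in_time (Add a b) T"
proof -
  have "cexp_in_time (Add a b) (T + U)" unfolding cexp_in_time_def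
  proof (intro allI impI)
    fix x m r k \<sigma> and out :: "bool list" and N
    assume f: "fresh_from k m \<sigma>" and r: "r < k" "\<forall>v. m v \<noteq> r" and b: "bounded_env x (\<sigma> \<circ> m) N"
    let ?\<sigma> = "\<sigma>(r := \<sigma> r + eval a x (\<sigma> \<circ> m))"
    have *: "?\<sigma> \<circ> m = \<sigma> \<circ> m" using r by (auto simp: fun_eq_iff)
    have "execb x (cexp a m r k) (\<sigma>, out) (poly T N) (?\<sigma>, out)"
      by (rule cexp_in_timeD[OF assms(1)]) (use f r b in auto)
    moreover have "execb x (cexp b m r k) (?\<sigma>, out) (poly U N) (\<sigma>(r := \<sigma> r + eval (Add a b) x (\<sigma> \<circ> m)), out)"
      by (rule cexp_in_timeD[OF assms(2)]) (use f r b * in \<open>auto simp: fresh_from_def\<close>)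
    ultimately show "execb x (cexp (Add a b) m r k) (\<sigma>, out) (poly (T + U) N)
       (\<sigma>(r := \<sigma> r + eval (Add a b) x (\<sigma> \<circ> m)), out)"
      unfolding cexp.simps poly_add by (rule execb_Seq)
  qed
  then show ?thesis ..
qed

lemma cexp_in_time_Sub:
  assumes "cexp_in_time a T" "cexp_in_time b U"
  shows "\<exists>T. cexp_in_time (Sub a b) T"
proof -
  obtain V W :: "nat poly" where V: "\<And>x \<rho> N. bounded_env x \<rho> N \<Longrightarrow> eval a x \<rho> \<le> poly V N"
    and W: "\<And>x \<rho> N. bounded_env x \<rho> N \<Longrightarrow> eval b x \<rho> \<le> poly W N"
    using eval_bound by metis
  have "cexp_in_time (Sub a b) (T + U + smult 4 W + smult 4 V + [:2:])" unfolding cexp_in_time_def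
  proof (intro allI impI)
    fix x m r k \<sigma> and out :: "bool list" and N
    assume f: "fresh_from k m \<sigma>" and r: "r < k" "\<forall>v. m v \<noteq> r" and b: "bounded_env x (\<sigma> \<circ> m) N"
    have k: "\<sigma> k = 0" "\<sigma> (Suc k) = 0" "\<And>v. m v < k" using f r unfolding fresh_from_def by auto
    have k': "m v \<noteq> k" "m v \<noteq> Suc k" for v using k(3)[of v] by auto
    let ?A = "eval a x (\<sigma> \<circ> m)" and ?B = "eval b x (\<sigma> \<circ> m)"
    have c: "\<sigma>(k := ?A) \<circ> m = \<sigma> \<circ> m" using k' by (auto simp: fun_eq_iff)
    have 1: "execb x (cexp a m k (k + 2)) (\<sigma>, out) (poly T N) (\<sigma>(k := ?A), out)"
      by (rule cexp_in_timeD[OF assms(1)]) (use f b k k' in \<open>auto simp: fresh_from_def less_SucI\<close>)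
    have 2: "execb x (cexp b m (k + 1) (k + 2)) (\<sigma>(k := ?A), out) (poly U N) (\<sigma>(k := ?A, k + 1 := ?B), out)"
      by (rule cexp_in_timeD[OF assms(2)]) (use f b k k' c in \<open>auto simp: fresh_from_def less_SucI\<close>)
    \<comment> \<open>Both registers go down once per unit of the subtrahend; since
      \<open>Dec\<close> stops at 0, the result is the truncated difference.\<close>
    let ?S = "\<lambda>i. (\<sigma>(k := ?A - i, k + 1 := ?B - i), out)"
    have "execb x (Loop NonZero (k + 1) (Seq (Dec (k + 1)) (Dec k))) (?S 0) (?B * (2 + 2) + 1) (?S ?B)"
    proof (rule execb_Loop[where S = "?S" and n = "?B"])
      fix i assume "i < ?B"
      have "execb x (Seq (Dec (k + 1)) (Dec k)) (?S i) (1 + 1) (?S (Suc i))"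
        by (rule execb_Seq[OF execb_Dec[OF refl] execb_Dec]) (auto simp: fun_eq_iff)
      then show "execb x (Seq (Dec (k + 1)) (Dec k)) (?S i) 2 (?S (Suc i))"
        by (rule execb_mono) simp
    qed auto
    then have 3: "execb x (Loop NonZero (k + 1) (Seq (Dec (k + 1)) (Dec k))) (\<sigma>(k := ?A, k + 1 := ?B), out) (?B * (2 + 2) + 1) (?S ?B)"
      by simp
    let ?n = "?A - ?B"
    let ?S' = "\<lambda>i. (\<sigma>(k := ?n - i, r := \<sigma> r + i), out)"
    have "execb x (Loop NonZero k (Seq (Dec k) (Inc r))) (?S' 0) (?n * (2 + 2) + 1) (?S' ?n)"
    proof (rule execb_Loop[where S = "?S'" and n = "?n"])
      fix i assume "i < ?n"
      have "execb x (Seq (Dec k) (Inc r)) (?S' i) (1 + 1) (?S' (Suc i))"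
        by (rule execb_Seq[OF execb_Dec[OF refl] execb_Inc]) (use r in \<open>auto simp: fun_eq_iff\<close>)
      then show "execb x (Seq (Dec k) (Inc r)) (?S' i) 2 (?S' (Suc i))"
        by (rule execb_mono) simp
    qed (use r in auto)
    moreover have "?S ?B = ?S' 0" using k r by (auto simp: fun_eq_iff)
    moreover have "?S' ?n = (\<sigma>(r := \<sigma> r + eval (Sub a b) x (\<sigma> \<circ> m)), out)" using k r by (auto simp: fun_eq_iff)
    ultimately have "execb x (Loop NonZero k (Seq (Dec k) (Inc r))) (?S ?B) (?n * (2 + 2) + 1)
       (\<sigma>(r := \<sigma> r + eval (Sub a b) x (\<sigma> \<circ> m)), out)" by metis
    with 1 2 3 have "execb x (cexp (Sub a b) m r k) (\<sigma>, out)
       (poly T N + (poly U N + (?B * (2 + 2) + 1 + (?n * (2 + 2) + 1))))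
       (\<sigma>(r := \<sigma> r + eval (Sub a b) x (\<sigma> \<circ> m)), out)"
      unfolding cexp.simps by (intro execb_Seq)
    then show "execb x (cexp (Sub a b) m r k) (\<sigma>, out) (poly (T + U + smult 4 W + smult 4 V + [:2:]) N)
       (\<sigma>(r := \<sigma> r + eval (Sub a b) x (\<sigma> \<circ> m)), out)"
      by (rule execb_mono) (use V[OF b] W[OF b] in simp)
  qed
  then show ?thesis ..
qed

lemma cexp_in_time_Sum:
  assumes "cexp_in_time a T" "cexp_in_time b U"
  shows "\<exists>T. cexp_in_time (Sum a b) T"
proof -
  obtain V :: "nat poly" where V: "\<And>x \<rho> N. bounded_env x \<rho> N \<Longrightarrow> eval a x \<rho> \<le> poly V N"
    using eval_bound by metis
  \<comment> \<open>The body runs in an environment that also holds the index, which is at most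
    \<open>poly V N\<close>, so its bound is taken at \<open>N + poly V N\<close>.\<close>
  let ?U = "pcompose U ([:0, 1:] + V)"
  have "cexp_in_time (Sum a b) (T + V * (?U + [:4:]) + smult 3 V + [:2:])" unfolding cexp_in_time_def
  proof (intro allI impI)
    fix x m r k \<sigma> and out :: "bool list" and N
    assume f: "fresh_from k m \<sigma>" and r: "r < k" "\<forall>v. m v \<noteq> r" and b: "bounded_env x (\<sigma> \<circ> m) N"
    have k: "\<sigma> k = 0" "\<sigma> (Suc k) = 0" "\<And>v. m v < k" using f r unfolding fresh_from_def by auto
    have k': "m v \<noteq> k" "m v \<noteq> Suc k" for v using k(3)[of v] by auto
    let ?n = "eval a x (\<sigma> \<circ> m)"
    let ?m = "case_nat (k + 1) m"
    let ?f = "\<lambda>i. eval b x (case_nat i (\<sigma> \<circ> m))"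
    have 1: "execb x (cexp a m k (k + 2)) (\<sigma>, out) (poly T N) (\<sigma>(k := ?n), out)"
      by (rule cexp_in_timeD[OF assms(1)]) (use f b k k' in \<open>auto simp: fresh_from_def less_SucI\<close>)
    let ?S = "\<lambda>i. (\<sigma>(k := ?n - i, k + 1 := i, r := \<sigma> r + (\<Sum>j<i. ?f j)), out)"
    let ?B = "1 + (poly U (N + poly V N) + 1)"
    have "execb x (Loop NonZero k (Seq (Dec k) (Seq (cexp b ?m r (k + 2)) (Inc (k + 1)))))
       (?S 0) (?n * (?B + 2) + 1) (?S ?n)"
    proof (rule execb_Loop[where S = "?S" and n = "?n"])
      fix i assume i: "i < ?n"
      let ?\<sigma> = "\<sigma>(k := ?n - Suc i, k + 1 := i, r := \<sigma> r + (\<Sum>j<i. ?f j))"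
      have e: "?\<sigma> \<circ> ?m = case_nat i (\<sigma> \<circ> m)"
        using r k' by (auto simp: fun_eq_iff split: nat.split)
      have "execb x (Dec k) (?S i) 1 (?\<sigma>, out)"
        by (rule execb_Dec) (use r in \<open>auto simp: fun_eq_iff\<close>)
      moreover have "execb x (cexp b ?m r (k + 2)) (?\<sigma>, out) (poly U (N + poly V N))
          (\<sigma>(k := ?n - Suc i, k + 1 := i, r := \<sigma> r + (\<Sum>j<Suc i. ?f j)), out)"
      proof (rule cexp_in_timeD[OF assms(2)])
        show "fresh_from (k + 2) ?m ?\<sigma>"
          using f r k by (auto simp: fresh_from_def less_SucI split: nat.split)
        show "?m v \<noteq> r" for v using r by (auto split: nat.split)
        show "bounded_env x (?\<sigma> \<circ> ?m) (N + poly V N)"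
          unfolding e by (rule bounded_env_case_nat[OF b]) (use i V[OF b] in linarith)
        show "\<sigma>(k := ?n - Suc i, k + 1 := i, r := \<sigma> r + (\<Sum>j<Suc i. ?f j)) =
            ?\<sigma>(r := ?\<sigma> r + eval b x (?\<sigma> \<circ> ?m))"
          unfolding e by (auto simp: fun_eq_iff)
      qed (use r in auto)
      moreover have "execb x (Inc (k + 1)) (\<sigma>(k := ?n - Suc i, k + 1 := i, r := \<sigma> r + (\<Sum>j<Suc i. ?f j)), out) 1 (?S (Suc i))"
        by (rule execb_Inc) (use r in \<open>auto simp: fun_eq_iff\<close>)
      ultimately show "execb x (Seq (Dec k) (Seq (cexp b ?m r (k + 2)) (Inc (k + 1)))) (?S i) ?B (?S (Suc i))"
        by (intro execb_Seq)
    qed (use r in auto)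
    moreover have "?S 0 = (\<sigma>(k := ?n), out)" using k r by (auto simp: fun_eq_iff)
    ultimately have 2: "execb x (Loop NonZero k (Seq (Dec k) (Seq (cexp b ?m r (k + 2)) (Inc (k + 1)))))
       (\<sigma>(k := ?n), out) (?n * (?B + 2) + 1) (?S ?n)" by metis
    have 3: "execb x (clear (k + 1)) (?S ?n) (3 * ?n + 1) (\<sigma>(r := \<sigma> r + eval (Sum a b) x (\<sigma> \<circ> m)), out)"
    proof -
      have "(\<sigma>(k := ?n - ?n, k + 1 := ?n, r := \<sigma> r + (\<Sum>j<?n. ?f j)))(k + 1 := 0) = \<sigma>(r := \<sigma> r + eval (Sum a b) x (\<sigma> \<circ> m))"
        using k r by (auto simp: fun_eq_iff)
      then show ?thesis
        using execb_clear[of x "k + 1" "\<sigma>(k := ?n - ?n, k + 1 := ?n, r := \<sigma> r + (\<Sum>j<?n. ?f j))" out] r by simp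
    qed
    have "execb x (cexp (Sum a b) m r k) (\<sigma>, out)
       (poly T N + ((?n * (?B + 2) + 1) + (3 * ?n + 1)))
       (\<sigma>(r := \<sigma> r + eval (Sum a b) x (\<sigma> \<circ> m)), out)"
      unfolding cexp.simps by (rule execb_Seq[OF 1 execb_Seq[OF 2 3]])
    moreover have "?n * (?B + 2) \<le> poly V N * (?B + 2)" using V[OF b] by (rule mult_right_mono) simp
    ultimately show "execb x (cexp (Sum a b) m r k) (\<sigma>, out) (poly (T + V * (?U + [:4:]) + smult 3 V + [:2:]) N)
       (\<sigma>(r := \<sigma> r + eval (Sum a b) x (\<sigma> \<circ> m)), out)"
      by (elim execb_mono) (use V[OF b] in \<open>simp add: poly_pcompose algebra_simps\<close>)
  qed
  then show ?thesis ..
qed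

lemma cexp_in_time: "\<exists>T. cexp_in_time e T"
  by (induction e) (metis cexp_in_time_Const cexp_in_time_Var cexp_in_time_Len cexp_in_time_Bit
      cexp_in_time_Add cexp_in_time_Sub cexp_in_time_Sum)+

definition coprog_in_time :: "oprog \<Rightarrow> nat poly \<Rightarrow> bool" where
  "coprog_in_time p T \<longleftrightarrow> (\<forall>x m k \<sigma> out N. fresh_from k m \<sigma> \<longrightarrow> bounded_env x (\<sigma> \<circ> m) N \<longrightarrow>
     execb x (coprog p m k) (\<sigma>, out) (poly T N) (\<sigma>, out @ oeval p x (\<sigma> \<circ> m)))"

lemma coprog_in_timeD:
  assumes "coprog_in_time p T" "fresh_from k m \<sigma>" "bounded_env x (\<sigma> \<circ> m) N"
    and "out' = out @ oeval p x (\<sigma> \<circ> m)"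
  shows "execb x (coprog p m k) (\<sigma>, out) (poly T N) (\<sigma>, out')"
  using assms unfolding coprog_in_time_def by blast

lemma coprog_in_time: "\<exists>T. coprog_in_time p T"
proof (induction p)
  case (Emit bs)
  have "execb x (foldr (\<lambda>b. Seq (Out b)) bs Skip) (\<sigma>, out) (length bs) (\<sigma>, out @ bs)" for x \<sigma> out
  proof (induction bs arbitrary: out)
    case Nil
    then show ?case by (simp add: execb_Skip)
  next
    case (Cons b bs)
    show ?case using execb_Seq[OF execb_Out Cons.IH[of "out @ [b]"]] by simp
  qed
  then have "coprog_in_time (Emit bs) [:length bs:]" unfolding coprog_in_time_def by simp
  then show ?case ..
next
  case (OSeq p q)
  then obtain T U where TU: "coprog_in_time p T" "coprog_in_time q U" by blast
  have "coprog_in_time (OSeq p q) (T + U)" unfolding coprog_in_time_def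
  proof (intro allI impI)
    fix x m k \<sigma> and out :: "bool list" and N
    assume "fresh_from k m \<sigma>" "bounded_env x (\<sigma> \<circ> m) N"
    then show "execb x (coprog (OSeq p q) m k) (\<sigma>, out) (poly (T + U) N) (\<sigma>, out @ oeval (OSeq p q) x (\<sigma> \<circ> m))"
      unfolding coprog.simps poly_add
      by (intro execb_Seq[OF coprog_in_timeD[OF TU(1)] coprog_in_timeD[OF TU(2)]]) auto
  qed
  then show ?case ..
next
  case (OIf e p q)
  then obtain T U where TU: "coprog_in_time p T" "coprog_in_time q U" by blast
  obtain W where W: "cexp_in_time e W" using cexp_in_time by blast
  obtain V :: "nat poly" where V: "\<And>x \<rho> N. bounded_env x \<rho> N \<Longrightarrow> eval e x \<rho> \<le> poly V N"
    using eval_bound by metis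
  have "coprog_in_time (OIf e p q) (W + T + U + smult 3 V + [:3:])" unfolding coprog_in_time_def
  proof (intro allI impI)
    fix x m k \<sigma> and out :: "bool list" and N
    assume f: "fresh_from k m \<sigma>" and b: "bounded_env x (\<sigma> \<circ> m) N"
    have k: "\<sigma> k = 0" "\<And>v. m v < k" using f unfolding fresh_from_def by auto
    let ?n = "eval e x (\<sigma> \<circ> m)"
    let ?out = "out @ oeval (OIf e p q) x (\<sigma> \<circ> m)"
    let ?B = "3 * poly V N + 1 + poly T N + poly U N"
    have 1: "execb x (cexp e m k (k + 1)) (\<sigma>, out) (poly W N) (\<sigma>(k := ?n), out)"
      by (rule cexp_in_timeD[OF W]) (use f b k in \<open>auto simp: fresh_from_def less_Suc_eq dest: less_not_refl3\<close>)
    have "execb x (Cond NonZero k (Seq (clear k) (coprog p m k)) (coprog q m k)) (\<sigma>(k := ?n), out) (?B + 2) (\<sigma>, ?out)"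
    proof (rule execb_Cond)
      assume h: "holds NonZero x ((\<sigma>(k := ?n)) k)"
      have "execb x (clear k) (\<sigma>(k := ?n), out) (3 * ?n + 1) (\<sigma>, out)"
        using execb_clear[of x k "\<sigma>(k := ?n)" out] k by (simp add: fun_upd_idem)
      moreover have "execb x (coprog p m k) (\<sigma>, out) (poly T N) (\<sigma>, ?out)"
        by (rule coprog_in_timeD[OF TU(1) f b]) (use h in simp)
      ultimately have "execb x (Seq (clear k) (coprog p m k)) (\<sigma>(k := ?n), out) (3 * ?n + 1 + poly T N) (\<sigma>, ?out)"
        by (rule execb_Seq)
      then show "execb x (Seq (clear k) (coprog p m k)) (\<sigma>(k := ?n), out) ?B (\<sigma>, ?out)"
        by (rule execb_mono) (use V[OF b] in simp)
    next
      assume h: "\<not> holds NonZero x ((\<sigma>(k := ?n)) k)"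
      then have "\<sigma>(k := ?n) = \<sigma>" using k by (auto simp: fun_eq_iff)
      moreover have "execb x (coprog q m k) (\<sigma>, out) (poly U N) (\<sigma>, ?out)"
        by (rule coprog_in_timeD[OF TU(2) f b]) (use h in simp)
      ultimately show "execb x (coprog q m k) (\<sigma>(k := ?n), out) ?B (\<sigma>, ?out)"
        using execb_mono by fastforce
    qed
    then have "execb x (coprog (OIf e p q) m k) (\<sigma>, out) (poly W N + (?B + 2)) (\<sigma>, ?out)"
      unfolding coprog.simps by (rule execb_Seq[OF 1])
    then show "execb x (coprog (OIf e p q) m k) (\<sigma>, out) (poly (W + T + U + smult 3 V + [:3:]) N) (\<sigma>, ?out)"
      by (rule execb_mono) simp
  qed
  then show ?case ..
next
  case (OFor a p)
  then obtain U where U: "coprog_in_time p U" by blast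
  obtain T where T: "cexp_in_time a T" using cexp_in_time by blast
  obtain V :: "nat poly" where V: "\<And>x \<rho> N. bounded_env x \<rho> N \<Longrightarrow> eval a x \<rho> \<le> poly V N"
    using eval_bound by metis
  let ?U = "pcompose U ([:0, 1:] + V)"
  have "coprog_in_time (OFor a p) (T + V * (?U + [:4:]) + smult 3 V + [:2:])" unfolding coprog_in_time_def
  proof (intro allI impI)
    fix x m k \<sigma> and out :: "bool list" and N
    assume f: "fresh_from k m \<sigma>" and b: "bounded_env x (\<sigma> \<circ> m) N"
    have k: "\<sigma> k = 0" "\<sigma> (Suc k) = 0" "\<And>v. m v < k" using f unfolding fresh_from_def by auto
    have k': "m v \<noteq> k" "m v \<noteq> Suc k" for v using k(3)[of v] by auto
    let ?n = "eval a x (\<sigma> \<circ> m)"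
    let ?m = "case_nat (k + 1) m"
    let ?f = "\<lambda>i. oeval p x (case_nat i (\<sigma> \<circ> m))"
    let ?F = "\<lambda>i. out @ concat (map ?f [0..<i])"
    have 1: "execb x (cexp a m k (k + 2)) (\<sigma>, out) (poly T N) (\<sigma>(k := ?n), out)"
      by (rule cexp_in_timeD[OF T]) (use f b k k' in \<open>auto simp: fresh_from_def less_SucI\<close>)
    let ?S = "\<lambda>i. (\<sigma>(k := ?n - i, k + 1 := i), ?F i)"
    let ?B = "1 + (poly U (N + poly V N) + 1)"
    have "execb x (Loop NonZero k (Seq (Dec k) (Seq (coprog p ?m (k + 2)) (Inc (k + 1)))))
       (?S 0) (?n * (?B + 2) + 1) (?S ?n)"
    proof (rule execb_Loop[where S = "?S" and n = "?n"])
      fix i assume i: "i < ?n"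
      let ?\<sigma> = "\<sigma>(k := ?n - Suc i, k + 1 := i)"
      have e: "?\<sigma> \<circ> ?m = case_nat i (\<sigma> \<circ> m)"
        using k' by (auto simp: fun_eq_iff split: nat.split)
      have "execb x (Dec k) (?S i) 1 (?\<sigma>, ?F i)"
        by (rule execb_Dec) (auto simp: fun_eq_iff)
      moreover have "execb x (coprog p ?m (k + 2)) (?\<sigma>, ?F i) (poly U (N + poly V N)) (?\<sigma>, ?F (Suc i))"
      proof (rule coprog_in_timeD[OF U])
        show "fresh_from (k + 2) ?m ?\<sigma>"
          using f k by (auto simp: fresh_from_def less_SucI split: nat.split)
        show "bounded_env x (?\<sigma> \<circ> ?m) (N + poly V N)"
          unfolding e by (rule bounded_env_case_nat[OF b]) (use i V[OF b] in linarith)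
        show "?F (Suc i) = ?F i @ oeval p x (?\<sigma> \<circ> ?m)" unfolding e by simp
      qed
      moreover have "execb x (Inc (k + 1)) (?\<sigma>, ?F (Suc i)) 1 (?S (Suc i))"
        by (rule execb_Inc) (auto simp: fun_eq_iff)
      ultimately show "execb x (Seq (Dec k) (Seq (coprog p ?m (k + 2)) (Inc (k + 1)))) (?S i) ?B (?S (Suc i))"
        by (intro execb_Seq)
    qed auto
    moreover have "?S 0 = (\<sigma>(k := ?n), out)" using k by (auto simp: fun_eq_iff)
    ultimately have 2: "execb x (Loop NonZero k (Seq (Dec k) (Seq (coprog p ?m (k + 2)) (Inc (k + 1)))))
       (\<sigma>(k := ?n), out) (?n * (?B + 2) + 1) (?S ?n)" by metis
    have 3: "execb x (clear (k + 1)) (?S ?n) (3 * ?n + 1) (\<sigma>, ?F ?n)"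
    proof -
      have "(\<sigma>(k := ?n - ?n, k + 1 := ?n))(k + 1 := 0) = \<sigma>" using k by (auto simp: fun_eq_iff)
      then show ?thesis
        using execb_clear[of x "k + 1" "\<sigma>(k := ?n - ?n, k + 1 := ?n)" "?F ?n"] by simp
    qed
    have "execb x (coprog (OFor a p) m k) (\<sigma>, out)
       (poly T N + ((?n * (?B + 2) + 1) + (3 * ?n + 1))) (\<sigma>, ?F ?n)"
      unfolding coprog.simps by (rule execb_Seq[OF 1 execb_Seq[OF 2 3]])
    moreover have "?n * (?B + 2) \<le> poly V N * (?B + 2)" using V[OF b] by (rule mult_right_mono) simp
    ultimately show "execb x (coprog (OFor a p) m k) (\<sigma>, out) (poly (T + V * (?U + [:4:]) + smult 3 V + [:2:]) N)
       (\<sigma>, out @ oeval (OFor a p) x (\<sigma> \<circ> m))"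
      unfolding oeval.simps
      by (elim execb_mono) (use V[OF b] in \<open>simp add: poly_pcompose algebra_simps\<close>)
  qed
  then show ?case ..
qed


section \<open>Counter programs and Turing machines\<close>

datatype instr = INC nat | DEC nat | OUT bool | TST test nat nat | JMP nat

primrec csize :: "com \<Rightarrow> nat" where
  "csize Skip = 0"
| "csize (Inc r) = 1"
| "csize (Dec r) = 1"
| "csize (Out b) = 1"
| "csize (Seq c d) = csize c + csize d"
| "csize (Cond q r c d) = csize c + csize d + 2"
| "csize (Loop q r c) = csize c + 2"

text \<open>Jump targets are absolute, so \<open>a\<close> has to be the address at which the code
  will stand. A \<open>TST\<close> falls through on success and jumps on failure.\<close>

primrec compile :: "com \<Rightarrow> nat \<Rightarrow> instr list" where
  "compile Skip a = []"
| "compile (Inc r) a = [INC r]"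
| "compile (Dec r) a = [DEC r]"
| "compile (Out b) a = [OUT b]"
| "compile (Seq c d) a = compile c a @ compile d (a + csize c)"
| "compile (Cond q r c d) a =
     TST q r (a + csize c + 2) # compile c (a + 1) @ JMP (a + csize c + csize d + 2) # compile d (a + csize c + 2)"
| "compile (Loop q r c) a = TST q r (a + csize c + 2) # compile c (a + 1) @ [JMP a]"

lemma length_compile [simp]: "length (compile c a) = csize c"
  by (induction c arbitrary: a) auto

primrec istep :: "instr \<Rightarrow> bool list \<Rightarrow> nat \<Rightarrow> store \<Rightarrow> nat \<times> store" where
  "istep (INC r) x pc s = (pc + 1, (fst s)(r := Suc (fst s r)), snd s)"
| "istep (DEC r) x pc s = (pc + 1, (fst s)(r := fst s r - 1), snd s)"
| "istep (OUT b) x pc s = (pc + 1, fst s, snd s @ [b])"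
| "istep (TST q r j) x pc s = (if holds q x (fst s r) then pc + 1 else j, s)"
| "istep (JMP j) x pc s = (j, s)"

definition mstep :: "instr list \<Rightarrow> bool list \<Rightarrow> nat \<times> store \<Rightarrow> nat \<times> store" where
  "mstep P x = (\<lambda>(pc, s). if pc < length P then istep (P ! pc) x pc s else (pc, s))"

definition code_at :: "instr list \<Rightarrow> nat \<Rightarrow> instr list \<Rightarrow> bool" where
  "code_at P a is \<longleftrightarrow> (\<exists>ys zs. P = ys @ is @ zs \<and> length ys = a)"

lemma code_at_append: "code_at P a (is @ js) \<Longrightarrow> code_at P a is \<and> code_at P (a + length is) js"
  unfolding code_at_def by (metis append_assoc length_append)

lemma code_at_Cons:
  assumes "code_at P a (i # is)"
  shows "a < length P \<and> P ! a = i \<and> code_at P (Suc a) is"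
proof -
  obtain ys zs where "P = ys @ i # is @ zs" "length ys = a"
    using assms unfolding code_at_def by auto
  moreover from this have "code_at P (Suc a) is"
    unfolding code_at_def by (intro exI[of _ "ys @ [i]"] exI[of _ zs]) simp
  ultimately show ?thesis by (auto simp: nth_append)
qed

lemma code_at_self: "code_at P 0 P"
  unfolding code_at_def by simp

definition mrun :: "instr list \<Rightarrow> bool list \<Rightarrow> nat \<times> store \<Rightarrow> nat \<Rightarrow> nat \<times> store \<Rightarrow> bool" where
  "mrun P x c t c' \<longleftrightarrow> (mstep P x ^^ t) c = c'"

lemma mrun_trans: "mrun P x a t b \<Longrightarrow> mrun P x b u c \<Longrightarrow> mrun P x a (t + u) c"
  unfolding mrun_def by (auto simp: add.commute[of t] funpow_add)

lemma mrun_1: "mstep P x a = b \<Longrightarrow> mrun P x a 1 b"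
  unfolding mrun_def by simp

lemma mrun_exec:
  "exec x c s t s' \<Longrightarrow> code_at P a (compile c a) \<Longrightarrow> mrun P x (a, s) t (a + csize c, s')"
proof (induction arbitrary: a rule: exec.induct)
  case (Skip s)
  then show ?case by (simp add: mrun_def)
next
  case (Inc r \<sigma> out)
  then show ?case by (auto intro!: mrun_1[unfolded One_nat_def] simp: mstep_def dest!: code_at_Cons)
next
  case (Dec r \<sigma> out)
  then show ?case by (auto intro!: mrun_1[unfolded One_nat_def] simp: mstep_def dest!: code_at_Cons)
next
  case (Out b \<sigma> out)
  then show ?case by (auto intro!: mrun_1[unfolded One_nat_def] simp: mstep_def dest!: code_at_Cons)
next
  case (Seq c s t s' d t' s'')
  have "code_at P a (compile c a)" "code_at P (a + csize c) (compile d (a + csize c))"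
    using Seq.prems code_at_append[of P a "compile c a" "compile d (a + csize c)"] by auto
  from mrun_trans[OF Seq.IH(1)[OF this(1)] Seq.IH(2)[OF this(2)]] show ?case
    by (simp add: add.assoc)
next
  case (CondT q \<sigma> r c out t s' d)
  let ?b = "a + csize c + 1"
  note c1 = code_at_Cons[OF CondT.prems[unfolded compile.simps]]
  note c2 = code_at_append[OF c1[THEN conjunct2, THEN conjunct2]]
  note c3 = code_at_Cons[OF c2[THEN conjunct2]]
  have a: "a < length P" "P ! a = TST q r (a + csize c + 2)" "code_at P (a + 1) (compile c (a + 1))"
    "?b < length P" "P ! ?b = JMP (a + csize c + csize d + 2)"
    using c1 c2 c3 by simp_all
  have "mrun P x (a, \<sigma>, out) (1 + (t + 1)) (a + csize c + csize d + 2, s')"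
    using a CondT.hyps CondT.IH[OF a(3)]
    by (intro mrun_trans[OF mrun_1 mrun_trans[OF _ mrun_1]]) (auto simp: mstep_def)
  then show ?case by (simp add: add.assoc)
next
  case (CondF q \<sigma> r d out t s' c)
  note c1 = code_at_Cons[OF CondF.prems[unfolded compile.simps]]
  note c2 = code_at_append[OF c1[THEN conjunct2, THEN conjunct2]]
  note c3 = code_at_Cons[OF c2[THEN conjunct2]]
  have a: "a < length P" "P ! a = TST q r (a + csize c + 2)" "code_at P (a + csize c + 2) (compile d (a + csize c + 2))"
    using c1 c2 c3 by simp_all
  have "mrun P x (a, \<sigma>, out) (1 + t) (a + csize c + 2 + csize d, s')"
    using a CondF.hyps CondF.IH[OF a(3)]
    by (intro mrun_trans[OF mrun_1]) (auto simp: mstep_def)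
  then show ?case by (simp add: algebra_simps)
next
  case (LoopF q \<sigma> r c out)
  then show ?case by (auto intro!: mrun_1[unfolded One_nat_def] simp: mstep_def dest!: code_at_Cons)
next
  case (LoopT q \<sigma> r c out t s' t' s'')
  let ?b = "a + csize c + 1"
  note c1 = code_at_Cons[OF LoopT.prems[unfolded compile.simps]]
  note c2 = code_at_append[OF c1[THEN conjunct2, THEN conjunct2]]
  note c3 = code_at_Cons[OF c2[THEN conjunct2]]
  have a: "a < length P" "P ! a = TST q r (a + csize c + 2)" "code_at P (a + 1) (compile c (a + 1))"
    "?b < length P" "P ! ?b = JMP a"
    using c1 c2 c3 by simp_all
  have "mrun P x (a, \<sigma>, out) (1 + (t + (1 + t'))) (a + csize (Loop q r c), s'')"
    using a LoopT.hyps LoopT.IH(1)[OF a(3)] LoopT.IH(2)[OF LoopT.prems]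
    by (intro mrun_trans[OF mrun_1 mrun_trans[OF _ mrun_trans[OF mrun_1]]]) (auto simp: mstep_def)
  then show ?case by simp
qed

text \<open>The target \<open>l\<close>, just behind the code, is legal: jumping there means
  halting.\<close>

primrec instr_ok :: "nat \<Rightarrow> nat \<Rightarrow> instr \<Rightarrow> bool" where
  "instr_ok k l (INC r) \<longleftrightarrow> r < k"
| "instr_ok k l (DEC r) \<longleftrightarrow> r < k"
| "instr_ok k l (OUT b) \<longleftrightarrow> True"
| "instr_ok k l (TST q r j) \<longleftrightarrow> r < k \<and> j \<le> l"
| "instr_ok k l (JMP j) \<longleftrightarrow> j \<le> l"

lemma instr_ok_mono: "instr_ok k l i \<Longrightarrow> k \<le> k' \<Longrightarrow> l \<le> l' \<Longrightarrow> instr_ok k' l' i"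
  by (cases i) auto

lemma instr_ok_all_mono:
  "\<forall>i\<in>set is. instr_ok k l i \<Longrightarrow> k \<le> k' \<Longrightarrow> l \<le> l' \<Longrightarrow> \<forall>i\<in>set is. instr_ok k' l' i"
  using instr_ok_mono by blast

lemma instr_ok_compile: "\<exists>k. \<forall>i\<in>set (compile c a). instr_ok k (a + csize c) i"
proof (induction c arbitrary: a)
  case (Seq c d)
  from Seq(1)[of a] Seq(2)[of "a + csize c"] obtain k k' where
    c: "\<forall>i\<in>set (compile c a). instr_ok k (a + csize c) i"
    and d: "\<forall>i\<in>set (compile d (a + csize c)). instr_ok k' (a + csize c + csize d) i" by auto
  let ?k = "max k k'" and ?l = "a + csize (Seq c d)"
  have "\<forall>i\<in>set (compile c a). instr_ok ?k ?l i" by (rule instr_ok_all_mono[OF c]) auto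
  moreover have "\<forall>i\<in>set (compile d (a + csize c)). instr_ok ?k ?l i" by (rule instr_ok_all_mono[OF d]) auto
  ultimately show ?case by (intro exI[of _ ?k]) auto
next
  case (Cond q r c d)
  from Cond(1)[of "a + 1"] Cond(2)[of "a + csize c + 2"] obtain k k' where
    c: "\<forall>i\<in>set (compile c (a + 1)). instr_ok k (a + 1 + csize c) i"
    and d: "\<forall>i\<in>set (compile d (a + csize c + 2)). instr_ok k' (a + csize c + 2 + csize d) i" by metis
  let ?k = "Suc (max (max k k') r)" and ?l = "a + csize (Cond q r c d)"
  have "\<forall>i\<in>set (compile c (a + 1)). instr_ok ?k ?l i" by (rule instr_ok_all_mono[OF c]) auto
  moreover have "\<forall>i\<in>set (compile d (a + csize c + 2)). instr_ok ?k ?l i" by (rule instr_ok_all_mono[OF d]) auto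
  ultimately show ?case by (intro exI[of _ ?k]) auto
next
  case (Loop q r c)
  from Loop(1)[of "a + 1"] obtain k where
    c: "\<forall>i\<in>set (compile c (a + 1)). instr_ok k (a + 1 + csize c) i" by metis
  let ?k = "Suc (max k r)" and ?l = "a + csize (Loop q r c)"
  have "\<forall>i\<in>set (compile c (a + 1)). instr_ok ?k ?l i" by (rule instr_ok_all_mono[OF c]) auto
  then show ?case by (intro exI[of _ ?k]) auto
next
  case (Inc r)
  show ?case by (intro exI[of _ "Suc r"]) simp
next
  case (Dec r)
  show ?case by (intro exI[of _ "Suc r"]) simp
qed simp_all

section \<open>Simulation of flat code by a machine with one tape per register\<close>

text \<open>
  Every register is a tape that holds a copy of the input; the value of the register is the head
  position. The symbols \<open>3\<close>, \<open>4\<close>, \<open>5\<close> are marked variants of \<open>0\<close>, \<open>1\<close>, \<open>2\<close> and occupy cell \<open>0\<close>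
  of the register tapes.
\<close>

definition marked :: "bool list \<Rightarrow> int \<Rightarrow> nat" where
  "marked x i = (if i = 0 then written x 0 + 3 else written x i)"

text \<open>The one symbol under the head decides every test: marked symbols occur only in cell 0,
  the bit \<open>True\<close> is \<open>2\<close> or \<open>5\<close>, and \<open>0\<close> or
  \<open>3\<close> lies outside the input.\<close>

primrec test_symbol :: "test \<Rightarrow> nat \<Rightarrow> bool" where
  "test_symbol NonZero s \<longleftrightarrow> s < 3"
| "test_symbol BitOne s \<longleftrightarrow> s = 2 \<or> s = 5"
| "test_symbol InRange s \<longleftrightarrow> s \<noteq> 0 \<and> s \<noteq> 3"

lemma written_less: "written x i < 3"
  unfolding written_def by auto

lemma test_symbol_marked: "test_symbol q (marked x (int n)) \<longleftrightarrow> holds q x n"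
  by (cases q) (auto simp: marked_def written_def)

text \<open>A marked symbol tells \<open>DEC\<close> that the register is 0, where the head must
  stay. Tape \<open>k\<close> is the output tape; its head only moves right and always stands behind
  the last bit.\<close>

primrec instr_acts :: "nat \<Rightarrow> instr \<Rightarrow> nat list \<Rightarrow> nat \<Rightarrow> nat \<times> move" where
  "instr_acts k (INC r) rs i = (rs ! i, if i = r then MoveRight else Stay)"
| "instr_acts k (DEC r) rs i = (rs ! i, if i = r \<and> rs ! i < 3 then MoveLeft else Stay)"
| "instr_acts k (OUT b) rs i = (if i = k then (if b then 2 else 1, MoveRight) else (rs ! i, Stay))"
| "instr_acts k (TST q r j) rs i = (rs ! i, Stay)"
| "instr_acts k (JMP j) rs i = (rs ! i, Stay)"

primrec instr_next :: "instr \<Rightarrow> nat list \<Rightarrow> nat \<Rightarrow> nat" where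
  "instr_next (INC r) rs pc = pc + 1"
| "instr_next (DEC r) rs pc = pc + 1"
| "instr_next (OUT b) rs pc = pc + 1"
| "instr_next (TST q r j) rs pc = (if test_symbol q (rs ! r) then pc + 1 else j)"
| "instr_next (JMP j) rs pc = j"

definition tape_acts :: "nat \<Rightarrow> (nat \<Rightarrow> nat \<times> move) \<Rightarrow> (nat \<times> move) list" where
  "tape_acts k f = map f [0..<Suc k]"

text \<open>States \<open>0\<close>, \<open>1\<close>, \<open>2\<close> copy the input to all registers and rewind; state \<open>pc + 3\<close> executes instruction \<open>pc\<close>.\<close>

definition machine :: "nat \<Rightarrow> instr list \<Rightarrow> tm" where
  "machine k P = \<lparr>tapes = Suc k, states = length P + 3, symbols = 6,
     delta = (\<lambda>q rs.
       if q = 0 then (1, tape_acts k (\<lambda>i. if i < k then (if rs ! 0 < 3 then rs ! 0 + 3 else rs ! 0, MoveRight) else (rs ! i, Stay)))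
       else if q = 1 then
         if rs ! 0 \<noteq> 0 then (1, tape_acts k (\<lambda>i. if i < k then (rs ! 0, MoveRight) else (rs ! i, Stay)))
         else (2, tape_acts k (\<lambda>i. (rs ! i, if i < k then MoveLeft else Stay)))
       else if q = 2 then
         if rs ! 0 < 3 then (2, tape_acts k (\<lambda>i. (rs ! i, if i < k then MoveLeft else Stay)))
         else (3, tape_acts k (\<lambda>i. (rs ! i, Stay)))
       else (instr_next (P ! (q - 3)) rs (q - 3) + 3, tape_acts k (instr_acts k (P ! (q - 3)) rs)))\<rparr>"

lemma wf_machine:
  assumes "0 < k" "\<forall>i\<in>set P. instr_ok k (length P) i"
  shows "wf_tm (machine k P)"
proof -
  have s: "rs ! i < 6" if "length rs = Suc k" "set rs \<subseteq> {..<6}" "i < Suc k" for rs :: "nat list" and i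
    using that by (metis lessThan_iff nth_mem subsetD)
  have 1: "fst (instr_acts k j rs i) < 6" if "length rs = Suc k" "set rs \<subseteq> {..<6}" "i < Suc k" for rs i j
    using s[OF that] by (cases j) auto
  have 2: "instr_next (P ! (q - 3)) rs (q - 3) \<le> length P" if "q < length P + 3" "\<not> q < 3" for q rs
  proof -
    have "P ! (q - 3) \<in> set P" using that by (intro nth_mem) simp
    then have "instr_ok k (length P) (P ! (q - 3))" using assms by blast
    then show ?thesis using that by (cases "P ! (q - 3)") auto
  qed
  show ?thesis
    unfolding wf_tm_def
  proof (intro conjI allI impI)
    fix q rs assume q: "q < states (machine k P)" and rs: "length rs = tapes (machine k P) \<and> set rs \<subseteq> {..<symbols (machine k P)}"
    have rs': "length rs = Suc k" "set rs \<subseteq> {..<6}" using rs by (auto simp: machine_def)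
    have q': "q < length P + 3" using q by (simp add: machine_def)
    show "case delta (machine k P) q rs of (q', acts) \<Rightarrow>
           q' \<le> states (machine k P) \<and> length acts = tapes (machine k P) \<and> fst ` set acts \<subseteq> {..<symbols (machine k P)}"
      using s[OF rs'] 1[OF rs'] 2[OF q'] s[OF rs', of 0]
      by (auto simp: machine_def tape_acts_def less_Suc_eq Ball_def)
  qed (auto simp: machine_def)
qed

definition reg_conf :: "nat \<Rightarrow> bool list \<Rightarrow> nat \<times> store \<Rightarrow> nat \<times> tape list" where
  "reg_conf k x = (\<lambda>(pc, \<sigma>, out). (pc + 3,
     map (\<lambda>i. if i < k then (marked x, int (\<sigma> i)) else (written out, int (length out))) [0..<Suc k]))"

lemma map2_map_map: "map2 f (map g xs) (map h xs) = map (\<lambda>x. f (g x) (h x)) xs"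
  by (induction xs) auto

lemma written_snoc: "(written out)(int (length out) := if b then 2 else 1) = written (out @ [b])"
  by (rule ext) (auto simp: written_def nth_append split: if_splits)

lemma marked_ge_3: "marked x i \<ge> 3 \<longleftrightarrow> i = 0"
  using written_less[of x i] unfolding marked_def by auto

lemma step_machine_instr:
  assumes "pc < length P" "instr_ok k (length P) (P ! pc)"
  shows "step (machine k P) (reg_conf k x (pc, \<sigma>, out)) = reg_conf k x (istep (P ! pc) x pc (\<sigma>, out))"
proof -
  let ?T = "\<lambda>i. if i < k then (marked x, int (\<sigma> i)) else (written out, int (length out))"
  let ?rs = "map (\<lambda>(t, h). t h) (map ?T [0..<Suc k])"
  have rs: "?rs ! i = (if i < k then marked x (int (\<sigma> i)) else written out (int (length out)))" if "i < Suc k" for i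
    using that by (simp del: upt_Suc)
  have "step (machine k P) (reg_conf k x (pc, \<sigma>, out)) =
     (instr_next (P ! pc) ?rs pc + 3, map (\<lambda>i. act (instr_acts k (P ! pc) ?rs i) (?T i)) [0..<Suc k])"
    using assms(1) unfolding reg_conf_def tape_acts_def machine_def
    by (simp add: map2_map_map del: upt_Suc)
  also have "\<dots> = reg_conf k x (istep (P ! pc) x pc (\<sigma>, out))"
  proof -
    have "instr_next (P ! pc) ?rs pc = fst (istep (P ! pc) x pc (\<sigma>, out))"
      using assms(2) rs by (cases "P ! pc") (auto simp: test_symbol_marked simp del: upt_Suc)
    moreover have "act (instr_acts k (P ! pc) ?rs i) (?T i) =
       (if i < k then (marked x, int (fst (snd (istep (P ! pc) x pc (\<sigma>, out))) i))
        else (written (snd (snd (istep (P ! pc) x pc (\<sigma>, out)))), int (length (snd (snd (istep (P ! pc) x pc (\<sigma>, out)))))))"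
      if "i < Suc k" for i
      using assms(2) rs[OF that] that marked_ge_3[of x "int (\<sigma> i)"]
      by (cases "P ! pc") (auto simp: written_snoc simp del: upt_Suc simp flip: not_less)
    ultimately show ?thesis
      unfolding reg_conf_def by (auto simp: split_beta simp del: upt_Suc)
  qed
  finally show ?thesis .
qed

text \<open>The identity also covers a program that has run past its end, where both sides stand
  still; hence it can be iterated without a case distinction.\<close>

lemma step_machine:
  assumes "\<forall>i\<in>set P. instr_ok k (length P) i"
  shows "step (machine k P) (reg_conf k x c) = reg_conf k x (mstep P x c)"
proof -
  obtain pc \<sigma> out where c: "c = (pc, \<sigma>, out)" by (metis surj_pair)
  show ?thesis
  proof (cases "pc < length P")
    case True
    then show ?thesis using step_machine_instr[OF True] assms nth_mem[OF True]
      by (auto simp: c mstep_def)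
  next
    case False
    then show ?thesis by (auto simp: c mstep_def reg_conf_def machine_def)
  qed
qed

lemma steps_machine:
  assumes "\<forall>i\<in>set P. instr_ok k (length P) i"
  shows "(step (machine k P) ^^ t) (reg_conf k x c) = reg_conf k x ((mstep P x ^^ t) c)"
  by (induction t) (simp_all add: step_machine[OF assms])

text \<open>After the first step tape 0 already is the marked input, because only its cell 0 had to
  change; the other register tapes hold the part \<open>f\<close> copied so far.\<close>

definition init_conf :: "nat \<Rightarrow> bool list \<Rightarrow> nat \<Rightarrow> int \<Rightarrow> (int \<Rightarrow> nat) \<Rightarrow> nat \<times> tape list" where
  "init_conf k x q h f = (q, map (\<lambda>i. if i < k then (if i = 0 then marked x else f, h) else (\<lambda>_. 0, 0)) [0..<Suc k])"

definition copied :: "bool list \<Rightarrow> nat \<Rightarrow> int \<Rightarrow> nat" where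
  "copied x j i = (if i < int j then marked x i else 0)"

lemma start_machine:
  assumes "0 < k"
  shows "step (machine k P) (start (machine k P) x) = init_conf k x 1 1 (copied x 1)"
proof -
  have "start (machine k P) x = (0, map (\<lambda>i. if i = 0 then (written x, 0) else (\<lambda>_. 0, 0)) [0..<Suc k])"
    using assms by (auto simp: start_def machine_def intro!: nth_equalityI simp: nth_Cons simp del: upt_Suc split: nat.split)
  then show ?thesis using written_less[of x 0] assms
    apply (simp add: init_conf_def machine_def tape_acts_def map2_map_map del: upt_Suc)
    apply (auto simp: fun_eq_iff copied_def marked_def written_def simp del: upt_Suc)
    done
qed

lemma copy_machine:
  assumes "0 < k" "1 \<le> j" "j < length x"
  shows "step (machine k P) (init_conf k x 1 (int j) (copied x j)) = init_conf k x 1 (int (Suc j)) (copied x (Suc j))"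
proof -
  have m: "marked x (int j) = written x (int j)" "written x (int j) \<noteq> 0" using assms by (auto simp: marked_def written_def)
  show ?thesis using assms m
    apply (simp add: init_conf_def machine_def tape_acts_def map2_map_map del: upt_Suc)
    apply (auto simp: fun_eq_iff copied_def simp del: upt_Suc)
    done
qed

lemma copied_all: "length x \<le> j \<Longrightarrow> 1 \<le> j \<Longrightarrow> copied x j = marked x"
  by (auto simp: fun_eq_iff copied_def marked_def written_def)

lemma copied_end:
  assumes "0 < k" "1 \<le> j" "length x \<le> j"
  shows "step (machine k P) (init_conf k x 1 (int j) (copied x j)) = init_conf k x 2 (int (j - 1)) (marked x)"
proof -
  have m: "marked x (int j) = 0" using assms by (auto simp: marked_def written_def)
  show ?thesis using assms m
    apply (simp add: init_conf_def machine_def tape_acts_def map2_map_map copied_all del: upt_Suc)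
    apply (auto simp: of_nat_diff fun_eq_iff simp del: upt_Suc)
    done
qed

lemma rewind_machine:
  assumes "0 < k"
  shows "step (machine k P) (init_conf k x 2 (int (Suc j)) (marked x)) = init_conf k x 2 (int j) (marked x)"
proof -
  have m: "marked x (1 + int j) < 3" using marked_ge_3[of x "1 + int j"] by linarith
  then show ?thesis using assms
    apply (simp add: init_conf_def machine_def tape_acts_def map2_map_map del: upt_Suc)
    apply (auto simp: fun_eq_iff simp del: upt_Suc)
    done
qed

lemma rewound_machine:
  assumes "0 < k"
  shows "step (machine k P) (init_conf k x 2 0 (marked x)) = reg_conf k x (0, \<lambda>_. 0, [])"
proof -
  have m: "\<not> marked x 0 < 3" using marked_ge_3[of x 0] by simp
  then show ?thesis using assms
    apply (simp add: init_conf_def reg_conf_def machine_def tape_acts_def map2_map_map del: upt_Suc)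
    apply (auto simp: fun_eq_iff written_def simp del: upt_Suc)
    done
qed

text \<open>Cell 0 is marked even if the input is empty, hence the maximum. Copying takes
  \<open>max 1 (length x)\<close> steps, turning round one, going back
  \<open>max 1 (length x) - 1\<close>, and leaving state 2 one.\<close>

lemma init_machine:
  assumes "0 < k"
  shows "(step (machine k P) ^^ (2 * max 1 (length x) + 1)) (start (machine k P) x) = reg_conf k x (0, \<lambda>_. 0, [])"
proof -
  let ?s = "step (machine k P)" and ?n = "max 1 (length x)"
  have 1: "(?s ^^ Suc j) (start (machine k P) x) = init_conf k x 1 (int (Suc j)) (copied x (Suc j))" if "j < ?n" for j
    using that
  proof (induction j)
    case 0
    then show ?case using start_machine[OF assms] by simp
  next
    case (Suc j)
    then show ?case using copy_machine[OF assms, of "Suc j" x] by simp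
  qed
  have 2: "(?s ^^ ?n) (start (machine k P) x) = init_conf k x 1 (int ?n) (copied x ?n)"
    using 1[of "?n - 1"] by (simp del: funpow.simps)
  have 3: "(?s ^^ Suc ?n) (start (machine k P) x) = init_conf k x 2 (int (?n - 1)) (marked x)"
    using 2 copied_end[OF assms, of ?n x] by simp
  have 4: "(?s ^^ j) (init_conf k x 2 (int j) (marked x)) = init_conf k x 2 0 (marked x)" for j
  proof (induction j)
    case (Suc j)
    then show ?case unfolding funpow_Suc_right comp_apply rewind_machine[OF assms] .
  qed simp
  have "(?s ^^ (1 + (?n - 1) + Suc ?n)) (start (machine k P) x) = reg_conf k x (0, \<lambda>_. 0, [])"
    unfolding funpow_add comp_apply 3 4 using rewound_machine[OF assms] by simp
  moreover have "1 + (?n - 1) + Suc ?n = 2 * ?n + 1" by simp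
  ultimately show ?thesis by metis
qed

theorem poly_time_oeval: "poly_time (\<lambda>x. oeval p x (\<lambda>_. 0))"
proof -
  let ?c = "coprog p (\<lambda>_. 0) 1"
  let ?P = "compile ?c 0"
  obtain T where T: "coprog_in_time p T" using coprog_in_time by blast
  obtain k0 where "\<forall>i\<in>set ?P. instr_ok k0 (0 + csize ?c) i" using instr_ok_compile by blast
  then have ok: "\<forall>i\<in>set ?P. instr_ok (Suc k0) (length ?P) i"
    by (auto intro: instr_ok_mono)
  let ?M = "machine (Suc k0) ?P"
  \<comment> \<open>\<open>[:3, 2:]\<close> pays for the copying phase, as
    \<open>2 * max 1 n + 1 \<le> 2 * n + 3\<close>.\<close>
  have "case (step ?M ^^ poly ([:3, 2:] + T) (length x)) (start ?M x) of (q, ts) \<Rightarrow>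
           q = states ?M \<and> fst (last ts) = written (oeval p x (\<lambda>_. 0))" for x
  proof -
    let ?s = "step ?M"
    have "execb x ?c (\<lambda>_. 0, []) (poly T (length x)) (\<lambda>_. 0, [] @ oeval p x ((\<lambda>_. 0) \<circ> (\<lambda>_. 0)))"
      by (rule coprog_in_timeD[OF T]) (auto simp: fresh_from_def bounded_env_def)
    then obtain t where t: "t \<le> poly T (length x)" "exec x ?c (\<lambda>_. 0, []) t (\<lambda>_. 0, oeval p x (\<lambda>_. 0))"
      unfolding execb_def by (auto simp: comp_def)
    let ?end = "reg_conf (Suc k0) x (length ?P, \<lambda>_. 0, oeval p x (\<lambda>_. 0))"
    have "(mstep ?P x ^^ t) (0, \<lambda>_. 0, []) = (length ?P, \<lambda>_. 0, oeval p x (\<lambda>_. 0))"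
      using mrun_exec[OF t(2) code_at_self] unfolding mrun_def by simp
    then have e: "(?s ^^ (t + (2 * max 1 (length x) + 1))) (start ?M x) = ?end"
      unfolding funpow_add comp_apply init_machine[OF zero_less_Suc, unfolded funpow_add comp_apply]
      using steps_machine[OF ok] by simp
    have "?s ?end = ?end" using step_machine[OF ok] by (simp add: mstep_def)
    then have f: "(?s ^^ j) ?end = ?end" for j by (induction j) auto
    \<comment> \<open>The time that is left over is spent in the halting configuration, a fixed
      point.\<close>
    have "poly ([:3, 2:] + T) (length x) = (poly ([:3, 2:] + T) (length x) - (t + (2 * max 1 (length x) + 1))) + (t + (2 * max 1 (length x) + 1))"
      using t(1) by (simp add: max_def)
    then have "(?s ^^ poly ([:3, 2:] + T) (length x)) (start ?M x) = ?end"
      using e f by (metis comp_apply funpow_add)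
    moreover have "fst ?end = states ?M" "fst (last (snd ?end)) = written (oeval p x (\<lambda>_. 0))"
      by (auto simp: reg_conf_def machine_def)
    ultimately show ?thesis by (simp add: split_beta)
  qed
  then show ?thesis unfolding poly_time_def using wf_machine[OF _ ok] by blast
qed


section \<open>Polynomial-time definability\<close>

text \<open>With the expression hidden behind a quantifier, functions are recognised as definable by
  applying closure lemmas with \<open>intro\<close>; no expression is ever written out.\<close>

definition pdef :: "(bool list \<Rightarrow> (nat \<Rightarrow> nat) \<Rightarrow> nat) \<Rightarrow> bool" where
  "pdef F \<longleftrightarrow> (\<exists>e. \<forall>x \<rho>. eval e x \<rho> = F x \<rho>)"

definition pdefb :: "(bool list \<Rightarrow> (nat \<Rightarrow> nat) \<Rightarrow> bool) \<Rightarrow> bool" where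
  "pdefb P \<longleftrightarrow> pdef (\<lambda>x \<rho>. of_bool (P x \<rho>))"

definition odef :: "(bool list \<Rightarrow> (nat \<Rightarrow> nat) \<Rightarrow> bool list) \<Rightarrow> bool" where
  "odef F \<longleftrightarrow> (\<exists>p. \<forall>x \<rho>. oeval p x \<rho> = F x \<rho>)"

primrec rename :: "expr \<Rightarrow> (nat \<Rightarrow> nat) \<Rightarrow> expr" where
  "rename (Const c) f = Const c"
| "rename (Var v) f = Var (f v)"
| "rename Len f = Len"
| "rename (Bit e) f = Bit (rename e f)"
| "rename (Add a b) f = Add (rename a f) (rename b f)"
| "rename (Sub a b) f = Sub (rename a f) (rename b f)"
| "rename (Sum a b) f = Sum (rename a f) (rename b (case_nat 0 (\<lambda>v. Suc (f v))))"

lemma eval_rename: "eval (rename e f) x \<rho> = eval e x (\<rho> \<circ> f)"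
proof (induction e arbitrary: f \<rho>)
  case (Sum a b)
  have "case_nat m \<rho> \<circ> case_nat 0 (\<lambda>v. Suc (f v)) = case_nat m (\<rho> \<circ> f)" for m
    by (auto simp: fun_eq_iff split: nat.split)
  then show ?case unfolding rename.simps eval.simps Sum.IH by (intro sum.cong) auto
qed auto

lemma pdef_weaken: "pdef f \<Longrightarrow> pdef (\<lambda>x \<rho>. f x (\<rho> \<circ> Suc))"
  unfolding pdef_def by (metis eval_rename)

lemma pdef_const: "pdef (\<lambda>x \<rho>. c)"
  unfolding pdef_def by (rule exI[of _ "Const c"]) simp

lemma pdef_var: "pdef (\<lambda>x \<rho>. \<rho> v)"
  unfolding pdef_def by (rule exI[of _ "Var v"]) simp

lemma pdef_len: "pdef (\<lambda>x \<rho>. length x)"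
  unfolding pdef_def by (rule exI[of _ "Len"]) simp

lemma pdef_add: "pdef f \<Longrightarrow> pdef g \<Longrightarrow> pdef (\<lambda>x \<rho>. f x \<rho> + g x \<rho>)"
  unfolding pdef_def by (metis eval.simps(5))

lemma pdef_Suc: "pdef f \<Longrightarrow> pdef (\<lambda>x \<rho>. Suc (f x \<rho>))"
  using pdef_add[of f "\<lambda>x \<rho>. 1"] by (simp add: pdef_const)

lemma pdef_sub: "pdef f \<Longrightarrow> pdef g \<Longrightarrow> pdef (\<lambda>x \<rho>. f x \<rho> - g x \<rho>)"
  unfolding pdef_def by (metis eval.simps(6))

lemma pdefb_bit: "pdef f \<Longrightarrow> pdefb (\<lambda>x \<rho>. f x \<rho> < length x \<and> x ! f x \<rho>)"
  unfolding pdefb_def pdef_def by (metis eval.simps(4))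

lemma case_nat_Suc: "case_nat m \<rho> \<circ> Suc = \<rho>"
  by (simp add: fun_eq_iff)

text \<open>The body receives the outer environment and the index as separate arguments, so that
  \<open>g\<close> can be read off an ordinary sum by unification. In the premise the index has
  become variable 0 and the others are shifted.\<close>

lemma pdef_sum:
  assumes "pdef f" "pdef (\<lambda>x \<rho>. g x (\<rho> \<circ> Suc) (\<rho> 0))"
  shows "pdef (\<lambda>x \<rho>. \<Sum>m<f x \<rho>. g x \<rho> m)"
proof -
  obtain a b where ab: "\<And>x \<rho>. eval a x \<rho> = f x \<rho>" "\<And>x \<rho>. eval b x \<rho> = g x (\<rho> \<circ> Suc) (\<rho> 0)"
    using assms unfolding pdef_def by auto
  show ?thesis unfolding pdef_def by (rule exI[of _ "Sum a b"]) (simp add: ab case_nat_Suc)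
qed

lemma pdef_mult: "pdef f \<Longrightarrow> pdef g \<Longrightarrow> pdef (\<lambda>x \<rho>. f x \<rho> * g x \<rho>)"
  using pdef_sum[of f "\<lambda>x \<rho> m. g x \<rho>"] by (simp add: pdef_weaken)

lemma pdefb_not: "pdefb P \<Longrightarrow> pdefb (\<lambda>x \<rho>. \<not> P x \<rho>)"
proof -
  assume "pdefb P"
  then have "pdef (\<lambda>x \<rho>. 1 - of_bool (P x \<rho>))" unfolding pdefb_def by (intro pdef_sub pdef_const)
  moreover have "1 - of_bool b = (of_bool (\<not> b) :: nat)" for b by simp
  ultimately show ?thesis unfolding pdefb_def by simp
qed

lemma pdefb_conj: "pdefb P \<Longrightarrow> pdefb Q \<Longrightarrow> pdefb (\<lambda>x \<rho>. P x \<rho> \<and> Q x \<rho>)"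
  unfolding pdefb_def of_bool_conj by (rule pdef_mult)

lemma pdefb_disj: "pdefb P \<Longrightarrow> pdefb Q \<Longrightarrow> pdefb (\<lambda>x \<rho>. P x \<rho> \<or> Q x \<rho>)"
  using pdefb_not[OF pdefb_conj[OF pdefb_not pdefb_not]] by force

lemma pdefb_imp: "pdefb P \<Longrightarrow> pdefb Q \<Longrightarrow> pdefb (\<lambda>x \<rho>. P x \<rho> \<longrightarrow> Q x \<rho>)"
  using pdefb_disj[OF pdefb_not] unfolding imp_conv_disj .

lemma pdefb_iff: "pdefb P \<Longrightarrow> pdefb Q \<Longrightarrow> pdefb (\<lambda>x \<rho>. P x \<rho> \<longleftrightarrow> Q x \<rho>)"
  unfolding iff_conv_conj_imp by (intro pdefb_conj pdefb_imp)

lemma pdefb_const: "pdefb (\<lambda>x \<rho>. c)"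
  unfolding pdefb_def by (rule pdef_const)

lemma pdefb_le: 
  assumes "pdef f" "pdef g"
  shows "pdefb (\<lambda>x \<rho>. f x \<rho> \<le> g x \<rho>)"
proof -
  have "of_bool (f x \<rho> \<le> g x \<rho>) = 1 - (f x \<rho> - g x \<rho>)" for x \<rho> by simp
  with assms show ?thesis unfolding pdefb_def by (simp only: pdef_sub pdef_const)
qed

lemma pdefb_less: "pdef f \<Longrightarrow> pdef g \<Longrightarrow> pdefb (\<lambda>x \<rho>. f x \<rho> < g x \<rho>)"
  using pdefb_le[OF pdef_Suc] by (simp add: Suc_le_eq)

lemma pdefb_eq: "pdef f \<Longrightarrow> pdef g \<Longrightarrow> pdefb (\<lambda>x \<rho>. f x \<rho> = g x \<rho>)"
  unfolding order_eq_iff by (intro pdefb_conj pdefb_le)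

lemma pdefb_ex:
  assumes "pdef f" "pdefb (\<lambda>x \<rho>. P x (\<rho> \<circ> Suc) (\<rho> 0))"
  shows "pdefb (\<lambda>x \<rho>. \<exists>m<f x \<rho>. P x \<rho> m)"
proof -
  have "(\<exists>m<f x \<rho>. P x \<rho> m) \<longleftrightarrow> 0 < (\<Sum>m<f x \<rho>. (of_bool (P x \<rho> m) :: nat))" for x \<rho>
    by (subst bot_nat_0.not_eq_extremum[symmetric], subst sum_eq_0_iff) auto
  moreover have "pdefb (\<lambda>x \<rho>. 0 < (\<Sum>m<f x \<rho>. (of_bool (P x \<rho> m) :: nat)))"
    using assms unfolding pdefb_def[of "\<lambda>x \<rho>. P x (\<rho> \<circ> Suc) (\<rho> 0)"]
    by (intro pdefb_less pdef_const pdef_sum)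
  ultimately show ?thesis by simp
qed

lemma pdefb_all:
  assumes "pdef f" "pdefb (\<lambda>x \<rho>. P x (\<rho> \<circ> Suc) (\<rho> 0))"
  shows "pdefb (\<lambda>x \<rho>. \<forall>m<f x \<rho>. P x \<rho> m)"
  using pdefb_not[OF pdefb_ex[OF assms(1), of "\<lambda>x \<rho> m. \<not> P x \<rho> m"]] assms(2) by (simp add: pdefb_not)

lemma pdef_if:
  assumes "pdefb P" "pdef f" "pdef g"
  shows "pdef (\<lambda>x \<rho>. if P x \<rho> then f x \<rho> else g x \<rho>)"
proof -
  have "(if P x \<rho> then f x \<rho> else g x \<rho>) = of_bool (P x \<rho>) * f x \<rho> + of_bool (\<not> P x \<rho>) * g x \<rho>" for x \<rho>
    by simp
  then show ?thesis
    using assms(1) pdefb_not[OF assms(1)] assms(2,3) unfolding pdefb_def by (simp only: pdef_add pdef_mult)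
qed

text \<open>The quotient counts the positive multiples of \<open>b\<close> up to \<open>a\<close>,
  and at most \<open>a\<close> candidates need to be tried, so it becomes a bounded sum.\<close>

lemma div_eq_card: "0 < b \<Longrightarrow> a div b = (\<Sum>m<a. of_bool (Suc m * b \<le> a))" for a b :: nat
proof -
  assume b: "0 < b"
  have *: "Suc m * b \<le> a \<longleftrightarrow> m < a div b" for m
    using less_eq_div_iff_mult_less_eq[OF b, of "Suc m" a] by (simp add: Suc_le_eq)
  have "(\<Sum>m<a. of_bool (Suc m * b \<le> a)) = card {m. m < a \<and> m < a div b}"
    unfolding * by (subst sum_of_bool_eq) (auto intro!: arg_cong[where f = card])
  also have "{m. m < a \<and> m < a div b} = {..<a div b}" by (auto intro: less_le_trans)
  finally show ?thesis by simp
qed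

lemma pdef_div:
  assumes "pdef f" "pdef g"
  shows "pdef (\<lambda>x \<rho>. f x \<rho> div g x \<rho>)"
proof -
  have "f x \<rho> div g x \<rho> = (if 0 < g x \<rho> then \<Sum>m<f x \<rho>. of_bool (Suc m * g x \<rho> \<le> f x \<rho>) else 0)" for x \<rho>
    by (simp add: div_eq_card)
  moreover have "pdef (\<lambda>x \<rho>. if 0 < g x \<rho> then \<Sum>m<f x \<rho>. of_bool (Suc m * g x \<rho> \<le> f x \<rho>) else 0)"
    using assms pdef_weaken[OF assms(1)] pdef_weaken[OF assms(2)]
    by (intro pdef_if pdefb_less pdef_const pdef_sum pdefb_le[unfolded pdefb_def] pdef_mult pdef_Suc pdef_var)
  ultimately show ?thesis by simp
qed

lemma pdef_mod: "pdef f \<Longrightarrow> pdef g \<Longrightarrow> pdef (\<lambda>x \<rho>. f x \<rho> mod g x \<rho>)"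
  using pdef_sub[OF _ pdef_mult[OF pdef_div], of f f g g] by (simp add: minus_div_mult_eq_mod)

lemma pdefb_odd: "pdef f \<Longrightarrow> pdefb (\<lambda>x \<rho>. odd (f x \<rho>))"
  unfolding odd_iff_mod_2_eq_one by (intro pdefb_eq pdef_mod pdef_const)

lemma pdef_poly: "pdef f \<Longrightarrow> pdef (\<lambda>x \<rho>. poly p (f x \<rho>))"
  by (induction p) (auto intro: pdef_const pdef_add pdef_mult)

text \<open>\<open>h\<close> is arbitrary: below a fixed bound it is a finite table, hard-wired into
  the expression. This is how the gadget, about which nothing is known but its existence, enters a
  computable reduction.\<close>

lemma pdef_table: "pdef f \<Longrightarrow> pdef (\<lambda>x \<rho>. if f x \<rho> < K then h (f x \<rho>) else 0)"
proof (induction K)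
  case 0
  then show ?case by (simp add: pdef_const)
next
  case (Suc K)
  have "(if f x \<rho> < Suc K then h (f x \<rho>) else 0) = (if f x \<rho> = K then h K else if f x \<rho> < K then h (f x \<rho>) else 0)" for x \<rho>
    by auto
  with Suc show ?case by (simp only: pdef_if pdefb_eq pdef_const)
qed

lemma pdefb_table:
  assumes "pdef f"
  shows "pdefb (\<lambda>x \<rho>. f x \<rho> < K \<and> P (f x \<rho>))"
proof -
  have "(if n < K then of_bool (P n) else 0) = (of_bool (n < K \<and> P n) :: nat)" for n by simp
  with pdef_table[OF assms, of K "\<lambda>i. of_bool (P i)"] show ?thesis unfolding pdefb_def by simp
qed

lemma pdefb_Bex_list: "(\<And>a. a \<in> set as \<Longrightarrow> pdefb (P a)) \<Longrightarrow> pdefb (\<lambda>x \<rho>. \<exists>a\<in>set as. P a x \<rho>)"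
  by (induction as) (auto intro: pdefb_const pdefb_disj)

lemma odef_Emit: "odef (\<lambda>x \<rho>. bs)"
  unfolding odef_def by (rule exI[of _ "Emit bs"]) simp

lemma odef_append: "odef F \<Longrightarrow> odef G \<Longrightarrow> odef (\<lambda>x \<rho>. F x \<rho> @ G x \<rho>)"
  unfolding odef_def by (metis oeval.simps(2))

lemma odef_if:
  assumes "pdefb P" "odef F" "odef G"
  shows "odef (\<lambda>x \<rho>. if P x \<rho> then F x \<rho> else G x \<rho>)"
proof -
  obtain e p q where "\<And>x \<rho>. eval e x \<rho> = of_bool (P x \<rho>)" "\<And>x \<rho>. oeval p x \<rho> = F x \<rho>" "\<And>x \<rho>. oeval q x \<rho> = G x \<rho>"
    using assms unfolding pdefb_def pdef_def odef_def by auto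
  then show ?thesis unfolding odef_def by (intro exI[of _ "OIf e p q"]) simp
qed

lemma odef_for:
  assumes "pdef f" "odef (\<lambda>x \<rho>. g x (\<rho> \<circ> Suc) (\<rho> 0))"
  shows "odef (\<lambda>x \<rho>. concat (map (g x \<rho>) [0..<f x \<rho>]))"
proof -
  obtain e p where "\<And>x \<rho>. eval e x \<rho> = f x \<rho>" "\<And>x \<rho>. oeval p x \<rho> = g x (\<rho> \<circ> Suc) (\<rho> 0)"
    using assms unfolding pdef_def odef_def by auto
  then show ?thesis unfolding odef_def by (intro exI[of _ "OFor e p"]) (simp add: case_nat_Suc)
qed

lemma odef_table:
  "pdef f \<Longrightarrow> (\<And>i. i < K \<Longrightarrow> odef (G i)) \<Longrightarrow> odef (\<lambda>x \<rho>. if f x \<rho> < K then G (f x \<rho>) x \<rho> else [])"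
proof (induction K)
  case 0
  then show ?case by (simp add: odef_Emit)
next
  case (Suc K)
  have "(if f x \<rho> < Suc K then G (f x \<rho>) x \<rho> else []) = (if f x \<rho> = K then G K x \<rho> else if f x \<rho> < K then G (f x \<rho>) x \<rho> else [])" for x \<rho>
    by auto
  then show ?case using odef_if[OF pdefb_eq[OF Suc.prems(1) pdef_const[of K]] Suc.prems(2)[of K] Suc.IH] Suc.prems
    by simp
qed

lemma poly_time_odef: "odef F \<Longrightarrow> poly_time (\<lambda>x. F x (\<lambda>_. 0))"
proof -
  assume "odef F"
  then obtain p where "\<And>x \<rho>. oeval p x \<rho> = F x \<rho>" unfolding odef_def by auto
  then show ?thesis using poly_time_oeval[of p] by simp
qed

lemma class_P_pdefb: "pdefb (\<lambda>x \<rho>. P x) \<Longrightarrow> {x. P x} \<in> class_P"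
proof -
  assume "pdefb (\<lambda>x \<rho>. P x)"
  from poly_time_odef[OF odef_if[OF this odef_Emit odef_Emit]]
  have "poly_time (\<lambda>x. if P x then [True] else [False])" by simp
  moreover have "(\<lambda>x. if P x then [True] else [False]) = (\<lambda>x. [x \<in> {x. P x}])" by auto
  ultimately show ?thesis unfolding class_P_def by simp
qed

section \<open>Binary notation\<close>

lemma less_length_bits: "i < length (bits n) \<longleftrightarrow> 2 ^ i \<le> n"
proof (induction n arbitrary: i rule: less_induct)
  case (less n)
  show ?case
  proof (cases "n = 0")
    case False
    then show ?thesis using less.IH[of "n div 2"]
      by (cases i) (auto simp: bits_pos less_eq_div_iff_mult_less_eq mult.commute)
  qed (simp add: bits_0)
qed

lemma nth_bits: "i < length (bits n) \<Longrightarrow> bits n ! i = odd (n div 2 ^ i)"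
proof (induction n arbitrary: i rule: less_induct)
  case (less n)
  show ?case
  proof (cases "n = 0")
    case False
    then show ?thesis using less.IH[of "n div 2"] less.prems
      by (cases i) (auto simp: bits_pos div_mult2_eq)
  qed (use less in \<open>simp add: bits_0\<close>)
qed

definition power_of_two :: "nat \<Rightarrow> bool" where
  "power_of_two m \<longleftrightarrow> (\<exists>i. m = 2 ^ i)"

text \<open>Having no odd divisor other than 1 is a condition with bounded quantifiers, whereas the
  exponent is not accessible to expressions.\<close>

lemma power_of_two_iff: "power_of_two m \<longleftrightarrow> m \<noteq> 0 \<and> (\<forall>d<Suc m. m mod d = 0 \<longrightarrow> d = 1 \<or> \<not> odd d)"
proof
  assume "power_of_two m"
  then obtain i where "m = 2 ^ i" unfolding power_of_two_def by blast
  then show "m \<noteq> 0 \<and> (\<forall>d<Suc m. m mod d = 0 \<longrightarrow> d = 1 \<or> \<not> odd d)"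
    using divides_primepow_nat[of 2 _ i] by (auto simp: mod_eq_0_iff_dvd)
next
  assume *: "m \<noteq> 0 \<and> (\<forall>d<Suc m. m mod d = 0 \<longrightarrow> d = 1 \<or> \<not> odd d)"
  obtain i r where ir: "m = 2 ^ i * r" "odd r"
    using * prime_power_canonical[of 2 m] by (auto simp: mult.commute)
  then have "r dvd m" "r \<le> m" by auto
  then have "r = 1" using * ir by (metis dvd_imp_mod_0 le_imp_less_Suc)
  then show "power_of_two m" using ir unfolding power_of_two_def by auto
qed

lemma pdefb_power_of_two: 
  assumes "pdef f"
  shows "pdefb (\<lambda>x \<rho>. power_of_two (f x \<rho>))"
  unfolding power_of_two_iff
  using assms pdef_weaken[OF assms]
  by (intro pdefb_conj pdefb_not pdefb_all pdefb_imp pdefb_disj pdefb_eq pdef_const pdef_mod pdef_Suc pdef_var pdefb_odd)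

lemma filter_power_of_two: "filter power_of_two [0..<Suc n] = map (\<lambda>i. 2 ^ i) [0..<length (bits n)]"
proof (rule sorted_distinct_set_unique)
  show "sorted (filter power_of_two [0..<Suc n])" by (intro sorted_wrt_filter) (simp del: upt_Suc)
  show "sorted (map (\<lambda>i. 2 ^ i :: nat) [0..<length (bits n)])"
    unfolding sorted_map by (rule sorted_wrt_mono_rel[of _ "(\<le>)"]) auto
  show "distinct (map (\<lambda>i. 2 ^ i :: nat) [0..<length (bits n)])"
    by (auto simp: distinct_map inj_on_def)
  show "set (filter power_of_two [0..<Suc n]) = set (map (\<lambda>i. 2 ^ i) [0..<length (bits n)])"
    by (auto simp: less_length_bits power_of_two_def simp del: upt_Suc)
qed simp

lemma concat_map_filter: "concat (map (\<lambda>m. if P m then g m else []) xs) = concat (map g (filter P xs))"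
  by (induction xs) auto

text \<open>A loop over all \<open>m \<le> n\<close> emits a digit whenever \<open>m\<close> is a
  power of two; increasing order is the order of \<open>bits\<close>, lowest digit first. The loop
  has \<open>n + 1\<close> rounds, which is acceptable because the values of definable functions are
  polynomial.\<close>

lemma odef_bits:
  assumes "pdef f"
  shows "odef (\<lambda>x \<rho>. concat (map (\<lambda>b. [b, b]) (bits (f x \<rho>))))"
proof -
  have "concat (map (\<lambda>b. [b, b]) (bits n)) =
      concat (map (\<lambda>m. if power_of_two m then if odd (n div m) then [True, True] else [False, False] else []) [0..<Suc n])" for n
  proof -
    have "map (\<lambda>b. [b, b]) (bits n) = map (\<lambda>i. [odd (n div 2 ^ i), odd (n div 2 ^ i)]) [0..<length (bits n)]"
      by (rule nth_equalityI) (auto simp: nth_bits)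
    moreover have "(if c then [True, True] else [False, False]) = [c, c]" for c by simp
    ultimately show ?thesis
      unfolding concat_map_filter filter_power_of_two map_map by (simp add: o_def)
  qed
  moreover have "odef (\<lambda>x \<rho>. concat (map (\<lambda>m. if power_of_two m then if odd (f x \<rho> div m) then [True, True] else [False, False] else []) [0..<Suc (f x \<rho>)]))"
    using assms pdef_weaken[OF assms]
    by (intro odef_for pdef_Suc odef_if pdefb_power_of_two pdef_var pdefb_odd pdef_div odef_Emit)
  ultimately show ?thesis by presburger
qed


section \<open>Plane drawings\<close>

lemma pair_graph_iff:
  "pair_graph G \<longleftrightarrow> finite (pverts G) \<and>
     (\<forall>(u, v)\<in>parcs G. u \<in> pverts G \<and> v \<in> pverts G \<and> u \<noteq> v \<and> (v, u) \<in> parcs G)"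
proof
  assume "pair_graph G"
  then interpret pair_graph G .
  show "finite (pverts G) \<and> (\<forall>(u, v)\<in>parcs G. u \<in> pverts G \<and> v \<in> pverts G \<and> u \<noteq> v \<and> (v, u) \<in> parcs G)"
    using pair_finite_verts by (auto dest: in_arcsD1 in_arcsD2 no_loops' arcs_symmetric)
next
  assume *: "finite (pverts G) \<and> (\<forall>(u, v)\<in>parcs G. u \<in> pverts G \<and> v \<in> pverts G \<and> u \<noteq> v \<and> (v, u) \<in> parcs G)"
  then have "parcs G \<subseteq> pverts G \<times> pverts G" by auto
  then have "finite (parcs G)" using * finite_subset by blast
  then show "pair_graph G"
    using * by unfold_locales (auto simp: symmetric_def intro: symI)
qed

definition drawing :: "'a pair_pre_digraph \<Rightarrow> ('a \<Rightarrow> complex) \<Rightarrow> ('a set \<Rightarrow> real \<Rightarrow> complex) \<Rightarrow> bool" where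
  "drawing G p \<gamma> \<longleftrightarrow>
     inj_on p (pverts G) \<and>
     (\<forall>(u, v)\<in>parcs G.
        arc (\<gamma> {u, v}) \<and>
        {pathstart (\<gamma> {u, v}), pathfinish (\<gamma> {u, v})} = {p u, p v} \<and>
        path_image (\<gamma> {u, v}) \<inter> p ` pverts G = {p u, p v}) \<and>
     (\<forall>(u, v)\<in>parcs G. \<forall>(x, y)\<in>parcs G. {u, v} \<noteq> {x, y} \<longrightarrow>
        path_image (\<gamma> {u, v}) \<inter> path_image (\<gamma> {x, y}) \<subseteq> p ` pverts G)"

lemma planar_iff: "planar G \<longleftrightarrow> pair_graph G \<and> (\<exists>p \<gamma>. drawing G p \<gamma>)"
  unfolding planar_def drawing_def ..

lemma drawingI:
  assumes "inj_on p (pverts G)"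
    and "\<And>u v. (u, v) \<in> parcs G \<Longrightarrow> arc (\<gamma> {u, v})"
    and "\<And>u v. (u, v) \<in> parcs G \<Longrightarrow> {pathstart (\<gamma> {u, v}), pathfinish (\<gamma> {u, v})} = {p u, p v}"
    and "\<And>u v. (u, v) \<in> parcs G \<Longrightarrow> path_image (\<gamma> {u, v}) \<inter> p ` pverts G \<subseteq> {p u, p v}"
    and "\<And>u v x y. (u, v) \<in> parcs G \<Longrightarrow> (x, y) \<in> parcs G \<Longrightarrow> {u, v} \<noteq> {x, y} \<Longrightarrow>
        path_image (\<gamma> {u, v}) \<inter> path_image (\<gamma> {x, y}) \<subseteq> p ` pverts G"
    and "pair_graph G"
  shows "drawing G p \<gamma>"
proof -
  have *: "path_image (\<gamma> {u, v}) \<inter> p ` pverts G = {p u, p v}" if uv: "(u, v) \<in> parcs G" for u v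
  proof -
    have "p u \<in> path_image (\<gamma> {u, v})" "p v \<in> path_image (\<gamma> {u, v})"
      using assms(3)[OF uv] by (metis insert_iff pathfinish_in_path_image pathstart_in_path_image singletonD)+
    moreover have "u \<in> pverts G" "v \<in> pverts G" using uv assms(6) unfolding pair_graph_iff by auto
    ultimately show ?thesis using assms(4)[OF uv] by blast
  qed
  show ?thesis unfolding drawing_def Ball_def split_paired_All prod.case
    by (intro conjI allI impI) (rule assms(1), erule assms(2), erule assms(3), erule *, erule (2) assms(5))
qed

lemma drawingD:
  assumes "drawing G p \<gamma>"
  shows "inj_on p (pverts G)"
    and "(u, v) \<in> parcs G \<Longrightarrow> arc (\<gamma> {u, v})"
    and "(u, v) \<in> parcs G \<Longrightarrow> {pathstart (\<gamma> {u, v}), pathfinish (\<gamma> {u, v})} = {p u, p v}"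
    and "(u, v) \<in> parcs G \<Longrightarrow> path_image (\<gamma> {u, v}) \<inter> p ` pverts G = {p u, p v}"
    and "(u, v) \<in> parcs G \<Longrightarrow> (x, y) \<in> parcs G \<Longrightarrow> {u, v} \<noteq> {x, y} \<Longrightarrow>
        path_image (\<gamma> {u, v}) \<inter> path_image (\<gamma> {x, y}) \<subseteq> p ` pverts G"
  using assms unfolding drawing_def Ball_def split_paired_All prod.case by blast+

section \<open>Drawings under renaming and under homeomorphisms\<close>

definition map_graph :: "('a \<Rightarrow> 'b) \<Rightarrow> 'a pair_pre_digraph \<Rightarrow> 'b pair_pre_digraph" where
  "map_graph f G = \<lparr>pverts = f ` pverts G, parcs = map_prod f f ` parcs G\<rparr>"

lemma map_graph_simps [simp]:
  "pverts (map_graph f G) = f ` pverts G"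
  "parcs (map_graph f G) = map_prod f f ` parcs G"
  unfolding map_graph_def by auto

lemma pair_graph_map_graph: "pair_graph G \<Longrightarrow> inj_on f (pverts G) \<Longrightarrow> pair_graph (map_graph f G)"
  unfolding pair_graph_iff by (auto simp: inj_on_def image_iff) force

lemma planar_map_graph:
  assumes "planar G" "inj_on f (pverts G)"
  shows "planar (map_graph f G)"
proof -
  obtain p \<gamma> where d: "drawing G p \<gamma>" and g: "pair_graph G" using assms(1) unfolding planar_iff by blast
  let ?g = "the_inv_into (pverts G) f"
  have inv: "?g (f x) = x" if "x \<in> pverts G" for x using the_inv_into_f_f[OF assms(2) that] .
  have e: "u \<in> pverts G" "v \<in> pverts G" if "(u, v) \<in> parcs G" for u v
    using that g unfolding pair_graph_iff by auto
  have im: "(p \<circ> ?g) ` f ` pverts G = p ` pverts G"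
    by (simp add: image_image inv cong: image_cong)
  have "drawing (map_graph f G) (p \<circ> ?g) (\<lambda>s. \<gamma> (?g ` s))"
  proof (rule drawingI)
    show "inj_on (p \<circ> ?g) (pverts (map_graph f G))"
      using drawingD(1)[OF d] by (auto simp: inj_on_def inv)
    fix u' v' assume "(u', v') \<in> parcs (map_graph f G)"
    then obtain u v where uv: "(u, v) \<in> parcs G" "u' = f u" "v' = f v" by auto
    have uv': "?g ` {u', v'} = {u, v}" "?g u' = u" "?g v' = v" using uv e[OF uv(1)] inv by auto
    show "arc (\<gamma> (?g ` {u', v'}))" unfolding uv' using drawingD(2)[OF d uv(1)] .
    show "{pathstart (\<gamma> (?g ` {u', v'})), pathfinish (\<gamma> (?g ` {u', v'}))} = {(p \<circ> ?g) u', (p \<circ> ?g) v'}"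
      unfolding uv'(1) using drawingD(3)[OF d uv(1)] uv' by simp
    show "path_image (\<gamma> (?g ` {u', v'})) \<inter> (p \<circ> ?g) ` pverts (map_graph f G) \<subseteq> {(p \<circ> ?g) u', (p \<circ> ?g) v'}"
      unfolding uv'(1) map_graph_simps im using drawingD(4)[OF d uv(1)] uv' by simp
    fix x' y' assume "(x', y') \<in> parcs (map_graph f G)" and ne: "{u', v'} \<noteq> {x', y'}"
    then obtain x y where xy: "(x, y) \<in> parcs G" "x' = f x" "y' = f y" by auto
    have xy': "?g ` {x', y'} = {x, y}" using xy e[OF xy(1)] inv by auto
    have "{u, v} \<noteq> {x, y}" using ne uv xy by (metis image_empty image_insert)
    then show "path_image (\<gamma> (?g ` {u', v'})) \<inter> path_image (\<gamma> (?g ` {x', y'})) \<subseteq> (p \<circ> ?g) ` pverts (map_graph f G)"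
      unfolding uv'(1) xy' map_graph_simps im using drawingD(5)[OF d uv(1) xy(1)] by blast
  qed (use pair_graph_map_graph[OF g assms(2)] in auto)
  then show ?thesis using pair_graph_map_graph[OF g assms(2)] unfolding planar_iff by blast
qed

definition drawn :: "'a pair_pre_digraph \<Rightarrow> ('a \<Rightarrow> complex) \<Rightarrow> ('a set \<Rightarrow> real \<Rightarrow> complex) \<Rightarrow> complex set" where
  "drawn G p \<gamma> = p ` pverts G \<union> (\<Union>(u, v)\<in>parcs G. path_image (\<gamma> {u, v}))"

lemma drawnI: 
  "x \<in> pverts G \<Longrightarrow> p x \<in> drawn G p \<gamma>"
  "(u, v) \<in> parcs G \<Longrightarrow> path_image (\<gamma> {u, v}) \<subseteq> drawn G p \<gamma>"
  unfolding drawn_def by auto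

lemma compact_drawn:
  assumes "pair_graph G" "drawing G p \<gamma>"
  shows "compact (drawn G p \<gamma>)"
proof -
  have "finite (pverts G)" "finite (parcs G)"
    using assms(1) unfolding pair_graph_def pair_digraph_def pair_fin_digraph_def pair_fin_digraph_axioms_def by auto
  then show ?thesis unfolding drawn_def using drawingD(2)[OF assms(2)]
    by (intro compact_Un finite_imp_compact[of "p ` _"] finite_imageI compact_UN) (auto intro: compact_arc_image)
qed

lemma drawing_homeo:
  assumes d: "drawing G p \<gamma>" and c: "continuous_on S h" and i: "inj_on h S" and S: "drawn G p \<gamma> \<subseteq> S"
    and g: "pair_graph G"
  shows "drawing G (h \<circ> p) (\<lambda>e. h \<circ> \<gamma> e)" and "drawn G (h \<circ> p) (\<lambda>e. h \<circ> \<gamma> e) = h ` drawn G p \<gamma>"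
proof -
  have pS: "p ` pverts G \<subseteq> S" and eS: "path_image (\<gamma> {u, v}) \<subseteq> S" if "(u, v) \<in> parcs G" for u v
    using S that unfolding drawn_def by auto
  have pS': "p ` pverts G \<subseteq> S" using S unfolding drawn_def by auto
  have im: "path_image (h \<circ> \<gamma> e) = h ` path_image (\<gamma> e)" for e by (rule path_image_compose)
  show "drawing G (h \<circ> p) (\<lambda>e. h \<circ> \<gamma> e)"
  proof (rule drawingI)
    show "inj_on (h \<circ> p) (pverts G)"
      using drawingD(1)[OF d] i pS' by (meson comp_inj_on inj_on_subset)
    fix u v assume uv: "(u, v) \<in> parcs G"
    have a: "arc (\<gamma> {u, v})" using drawingD(2)[OF d uv] .
    show "arc (h \<circ> \<gamma> {u, v})"
      using a eS[OF uv] c i unfolding arc_def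
      by (metis comp_inj_on continuous_on_subset inj_on_subset path_continuous_image path_image_def)
    show "{pathstart (h \<circ> \<gamma> {u, v}), pathfinish (h \<circ> \<gamma> {u, v})} = {(h \<circ> p) u, (h \<circ> p) v}"
      using drawingD(3)[OF d uv] by (auto simp: pathstart_compose pathfinish_compose doubleton_eq_iff)
    show "path_image (h \<circ> \<gamma> {u, v}) \<inter> (h \<circ> p) ` pverts G \<subseteq> {(h \<circ> p) u, (h \<circ> p) v}"
      unfolding im image_comp[symmetric]
      using drawingD(4)[OF d uv] inj_on_image_Int[OF i eS[OF uv] pS'] by auto
    fix x y assume xy: "(x, y) \<in> parcs G" "{u, v} \<noteq> {x, y}"
    show "path_image (h \<circ> \<gamma> {u, v}) \<inter> path_image (h \<circ> \<gamma> {x, y}) \<subseteq> (h \<circ> p) ` pverts G"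
      unfolding im image_comp[symmetric]
      using image_mono[OF drawingD(5)[OF d uv xy], of h] unfolding inj_on_image_Int[OF i eS[OF uv] eS[OF xy(1)]] .
  qed (fact g)
  show "drawn G (h \<circ> p) (\<lambda>e. h \<circ> \<gamma> e) = h ` drawn G p \<gamma>"
    unfolding drawn_def im by (auto simp: image_Un image_UN)
qed

section \<open>Straightening a drawing around a vertex\<close>

lemma radial_segments_Int:
  fixes c :: "'a::real_normed_vector"
  assumes "dist c a = r" "dist c b = r" "0 < r" "a \<noteq> b"
    and "z \<in> closed_segment c a" "z \<in> closed_segment c b"
  shows "z = c"
proof -
  obtain s where s: "0 \<le> s" "z = (1 - s) *\<^sub>R c + s *\<^sub>R a" using assms(5) unfolding closed_segment_def by auto
  obtain t where t: "0 \<le> t" "z = (1 - t) *\<^sub>R c + t *\<^sub>R b" using assms(6) unfolding closed_segment_def by auto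
  have zs: "z - c = s *\<^sub>R (a - c)" using s by (simp add: algebra_simps)
  have zt: "z - c = t *\<^sub>R (b - c)" using t by (simp add: algebra_simps)
  have "norm (z - c) = s * r" using zs s(1) assms(1) by (simp add: dist_norm norm_minus_commute)
  moreover have "norm (z - c) = t * r" using zt t(1) assms(2) by (simp add: dist_norm norm_minus_commute)
  ultimately have "s = t" using assms(3) by simp
  then have "s *\<^sub>R (a - c) = s *\<^sub>R (b - c)" using zs zt by metis
  then have "s = 0 \<or> a - c = b - c" by (metis scaleR_cancel_left)
  then have "s = 0" using assms(4) by simp
  then show ?thesis using zs by simp
qed

lemma radial_segment_sphere:
  fixes c :: "'a::real_normed_vector"
  assumes "dist c a = r" "0 < r" "z \<in> closed_segment c a" "dist c z = r"
  shows "z = a"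
proof -
  obtain s where s: "0 \<le> s" "z = (1 - s) *\<^sub>R c + s *\<^sub>R a" using assms(3) unfolding closed_segment_def by auto
  have "z - c = s *\<^sub>R (a - c)" using s by (simp add: algebra_simps)
  then have "norm (z - c) = s * r" using s(1) assms(1) by (simp add: dist_norm norm_minus_commute)
  then have "s = 1" using assms(2,4) by (simp add: dist_norm norm_minus_commute)
  then show ?thesis using s by simp
qed

text \<open>The part of the arc inside the disc is replaced by a radius, so that nothing is assumed about how the arc approaches \<open>c\<close>.\<close>

lemma radial_end:
  fixes g :: "real \<Rightarrow> complex"
  assumes "arc g" "pathstart g = w" "pathfinish g = c" "w \<notin> cball c r" "0 < r"
  obtains g' q A where "arc g'" "pathstart g' = c" "pathfinish g' = w"
    "path_image g' = closed_segment c q \<union> A" "A \<subseteq> path_image g" "A \<inter> cball c r = {q}" "dist c q = r"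
proof -
  have pg: "path g" using assms(1) by (rule arc_imp_path)
  have "pathfinish g \<notin> - cball c r" using assms(3,5) by simp
  \<comment> \<open>\<open>t\<close> is the time at which the arc, run from \<open>w\<close>, first
    meets the disc; the part up to \<open>t\<close> is kept.\<close>
  then obtain t where t: "0 \<le> t" "t \<le> 1" and before': "\<And>x. 0 \<le> x \<and> x < t \<Longrightarrow> g x \<in> interior (- cball c r)"
    and at: "g t \<notin> interior (- cball c r)" "t = 0 \<or> g t \<in> closure (- cball c r)"
    by (rule subpath_to_frontier_explicit[OF pg]) (rule that)
  note before = before'[OF conjI]
  have int: "interior (- cball c r) = - cball c r" by (rule interior_open) (rule open_Compl, rule closed_cball)
  have t0: "t \<noteq> 0" using at(1) assms(2,4) unfolding int by (auto simp: pathstart_def)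
  have "- cball c r \<subseteq> - ball c r" by auto
  then have "closure (- cball c r) \<subseteq> - ball c r" by (intro closure_minimal) auto
  then have q: "dist c (g t) = r" using at t0 unfolding int by auto
  let ?A = "g ` {0..t}"
  let ?g = "linepath c (g t) +++ reversepath (subpath 0 t g)"
  have im: "path_image (subpath 0 t g) = ?A" using t by (simp add: path_image_subpath)
  have A: "?A \<inter> cball c r = {g t}"
  proof -
    have "x = t" if "0 \<le> x" "x \<le> t" "g x \<in> cball c r" for x
      using before[of x] that unfolding int by fastforce
    then have "z = g t" if "z \<in> ?A \<inter> cball c r" for z
      using that by (metis IntE atLeastAtMost_iff imageE)
    moreover have "g t \<in> ?A \<inter> cball c r" using q t by auto
    ultimately show ?thesis by blast
  qed
  have "closed_segment c (g t) \<subseteq> cball c r"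
    by (rule closed_segment_subset) (use q assms(5) in auto)
  then have "closed_segment c (g t) \<inter> ?A \<subseteq> {g t}" using A by blast
  moreover have "c \<noteq> g t" using q assms(5) by auto
  moreover have "arc (subpath 0 t g)" using assms(1) t t0 by (intro arc_subpath_arc) auto
  ultimately have "arc ?g"
    using im by (intro arc_join arc_linepath arc_reversepath) auto
  moreover have "path_image ?g = closed_segment c (g t) \<union> ?A"
    using im by (subst path_image_join) auto
  moreover have "?A \<subseteq> path_image g" using t unfolding path_image_def by (intro image_mono) auto
  moreover have "g 0 = w" using assms(2) by (simp add: pathstart_def)
  then have "pathfinish ?g = w" by simp
  ultimately show ?thesis using that[of ?g "g t" ?A] A q by simp
qed

lemma cball_disjoint_compact:
  fixes K :: "'a::heine_borel set"
  assumes "compact K" "c \<notin> K"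
  shows "\<exists>r>0. cball c r \<inter> K = {}"
proof -
  have "open (- K)" using compact_imp_closed[OF assms(1)] by auto
  then obtain r where "0 < r" "cball c r \<subseteq> - K" using assms(2) open_contains_cball by blast
  then show ?thesis by blast
qed

text \<open>In a small disc around \<open>p u\<close> only arcs at \<open>u\<close> can occur, and
  each of them is replaced by a radius from its first entry point. Different arcs have different
  entry points, because a common one would be a crossing that is not a vertex. What remains in the
  disc is a finite star.\<close>

lemma drawing_star:
  assumes g: "pair_graph G" and d: "drawing G p \<gamma>" and u: "u \<in> pverts G"
  obtains \<gamma>' r Q where "0 < r" "drawing G p \<gamma>'" "finite Q" "Q \<subseteq> sphere (p u) r"
    "drawn G p \<gamma>' \<inter> cball (p u) r \<subseteq> {p u} \<union> (\<Union>q\<in>Q. closed_segment (p u) q)"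
proof -
  let ?c = "p u"
  \<comment> \<open>Everything that the disc has to avoid: the other vertices and the edges that do
    not end in \<open>u\<close>.\<close>
  let ?K = "p ` (pverts G - {u}) \<union> (\<Union>(x, y)\<in>{(x, y)\<in>parcs G. u \<noteq> x \<and> u \<noteq> y}. path_image (\<gamma> {x, y}))"
  have fin: "finite (pverts G)" "finite (parcs G)"
    using g unfolding pair_graph_def pair_digraph_def pair_fin_digraph_def pair_fin_digraph_axioms_def by auto
  have V: "x \<in> pverts G" "y \<in> pverts G" "x \<noteq> y" "(y, x) \<in> parcs G" if "(x, y) \<in> parcs G" for x y
    using that g unfolding pair_graph_iff by auto
  have pinj: "p x = p y \<longleftrightarrow> x = y" if "x \<in> pverts G" "y \<in> pverts G" for x y
    using drawingD(1)[OF d] that by (auto simp: inj_on_def)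
  have "finite {(x, y)\<in>parcs G. u \<noteq> x \<and> u \<noteq> y}" by (rule finite_subset[OF _ fin(2)]) auto
  then have cK: "compact ?K" using fin drawingD(2)[OF d]
    by (intro compact_Un finite_imp_compact[of "p ` _"] finite_imageI compact_UN) (auto intro: compact_arc_image)
  have cn: "?c \<notin> ?K"
  proof -
    have "?c \<notin> p ` (pverts G - {u})" using drawingD(1)[OF d] u by (auto simp: inj_on_def)
    moreover have "?c \<notin> path_image (\<gamma> {x, y})" if xy: "(x, y) \<in> parcs G" "u \<noteq> x" "u \<noteq> y" for x y
    proof
      assume "?c \<in> path_image (\<gamma> {x, y})"
      then have "?c \<in> {p x, p y}" using drawingD(4)[OF d xy(1)] u by blast
      then show False using xy V[OF xy(1)] pinj u by auto
    qed
    ultimately show ?thesis by auto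
  qed
  from cball_disjoint_compact[OF cK cn] obtain r where r: "0 < r" and rK: "cball ?c r \<inter> ?K = {}"
    by (elim exE conjE) (rule that)
  have K0: "z \<in> cball ?c r \<Longrightarrow> z \<notin> ?K" for z by (rule iffD1[OF disjoint_iff rK, rule_format])
  have K1: "p x \<notin> cball ?c r" if "x \<in> pverts G" "x \<noteq> u" for x
  proof -
    have "p x \<in> ?K" using that by (intro UnI1 imageI) simp
    then show ?thesis using K0 by (rule contrapos_pn)
  qed
  have K2: "z \<notin> cball ?c r" if "(x, y) \<in> parcs G" "u \<noteq> x" "u \<noteq> y" "z \<in> path_image (\<gamma> {x, y})" for x y z
  proof -
    have "z \<in> ?K" using that by (intro UnI2 UN_I[of "(x, y)"]) auto
    then show ?thesis using K0 by (rule contrapos_pn)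
  qed
  define N where "N = {v. (u, v) \<in> parcs G}"
  have "\<exists>g' q A. arc g' \<and> pathstart g' = ?c \<and> pathfinish g' = p v \<and> path_image g' = closed_segment ?c q \<union> A \<and>
      A \<subseteq> path_image (\<gamma> {u, v}) \<and> A \<inter> cball ?c r = {q} \<and> dist ?c q = r" if v: "v \<in> N" for v
  proof -
    have uv: "(u, v) \<in> parcs G" using v by (simp add: N_def)
    have out: "p v \<notin> cball ?c r" using K1 V[OF uv] by metis
    have ends: "{pathstart (\<gamma> {u, v}), pathfinish (\<gamma> {u, v})} = {?c, p v}" using drawingD(3)[OF d uv] .
    have "\<exists>g. arc g \<and> pathstart g = p v \<and> pathfinish g = ?c \<and> path_image g = path_image (\<gamma> {u, v})"
    proof (cases "pathstart (\<gamma> {u, v}) = p v")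
      case True
      then have "pathfinish (\<gamma> {u, v}) = ?c" using ends by (auto simp: doubleton_eq_iff)
      then show ?thesis using True drawingD(2)[OF d uv] by blast
    next
      case False
      then have "pathstart (\<gamma> {u, v}) = ?c" "pathfinish (\<gamma> {u, v}) = p v" using ends by (auto simp: doubleton_eq_iff)
      then show ?thesis using drawingD(2)[OF d uv] by (intro exI[of _ "reversepath (\<gamma> {u, v})"]) (auto intro: arc_reversepath)
    qed
    then obtain g where "arc g" "pathstart g = p v" "pathfinish g = ?c" "path_image g = path_image (\<gamma> {u, v})" by blast
    then show ?thesis using radial_end[of g "p v" ?c r] out r by metis
  qed
  then have "\<forall>v\<in>N. \<exists>t. case t of (g', q, A) \<Rightarrow>
      arc g' \<and> pathstart g' = ?c \<and> pathfinish g' = p v \<and> path_image g' = closed_segment ?c q \<union> A \<and>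
      A \<subseteq> path_image (\<gamma> {u, v}) \<and> A \<inter> cball ?c r = {q} \<and> dist ?c q = r"
    by (simp only: split_paired_Ex prod.case) blast
  from bchoice[OF this] obtain F where F: "\<forall>v\<in>N. case F v of (g', q, A) \<Rightarrow>
      arc g' \<and> pathstart g' = ?c \<and> pathfinish g' = p v \<and> path_image g' = closed_segment ?c q \<union> A \<and>
      A \<subseteq> path_image (\<gamma> {u, v}) \<and> A \<inter> cball ?c r = {q} \<and> dist ?c q = r" by (elim exE) (rule that)
  define f q A where "f v = fst (F v)" and "q v = fst (snd (F v))" and "A v = snd (snd (F v))" for v
  have f: "arc (f v)" "pathstart (f v) = ?c" "pathfinish (f v) = p v" "path_image (f v) = closed_segment ?c (q v) \<union> A v"
    and A: "A v \<subseteq> path_image (\<gamma> {u, v})" "A v \<inter> cball ?c r = {q v}"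
    and q: "dist ?c (q v) = r" if "v \<in> N" for v
    using bspec[OF F that] unfolding f_def q_def A_def split_beta by blast+
  \<comment> \<open>For an edge at \<open>u\<close>, \<open>SOME\<close> picks its other
    end.\<close>
  define \<gamma>' where "\<gamma>' e = (if u \<in> e then f (SOME v. v \<noteq> u \<and> v \<in> e) else \<gamma> e)" for e
  have \<gamma>'u: "\<gamma>' {u, v} = f v" "\<gamma>' {v, u} = f v" if "v \<in> N" for v
  proof -
    have "v \<noteq> u" using that V unfolding N_def by blast
    then have "(SOME w. w \<noteq> u \<and> w \<in> {u, v}) = v" by (intro some_equality) auto
    then show "\<gamma>' {u, v} = f v" "\<gamma>' {v, u} = f v" unfolding \<gamma>'_def by (simp_all add: insert_commute)
  qed
  have \<gamma>'n: "\<gamma>' {x, y} = \<gamma> {x, y}" if "u \<noteq> x" "u \<noteq> y" for x y using that unfolding \<gamma>'_def by simp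
  have vert: "p ` pverts G \<inter> cball ?c r = {?c}"
  proof -
    have "x = u" if "x \<in> pverts G" "p x \<in> cball ?c r" for x
      using K1 that by blast
    then have "z = ?c" if "z \<in> p ` pverts G \<inter> cball ?c r" for z using that by blast
    moreover have "?c \<in> p ` pverts G \<inter> cball ?c r" using u r by auto
    ultimately show ?thesis by blast
  qed
  have seg: "closed_segment ?c (q v) \<subseteq> cball ?c r" if "v \<in> N" for v
    by (rule closed_segment_subset) (use q[OF that] r in auto)
  have qneq: "q v \<noteq> q w" if "v \<in> N" "w \<in> N" "v \<noteq> w" for v w
  proof
    assume eq: "q v = q w"
    have uv: "(u, v) \<in> parcs G" "(u, w) \<in> parcs G" "{u, v} \<noteq> {u, w}" using that by (auto simp: N_def doubleton_eq_iff)
    have "q v \<in> A v" "q w \<in> A w" "q v \<in> cball ?c r" using A(2)[OF that(1)] A(2)[OF that(2)] by auto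
    then have "q v \<in> path_image (\<gamma> {u, v}) \<inter> path_image (\<gamma> {u, w})" using A(1) that eq by fastforce
    then have "q v \<in> p ` pverts G" using drawingD(5)[OF d uv] by blast
    then have "q v = ?c" using vert \<open>q v \<in> cball ?c r\<close> by blast
    then show False using q[OF that(1)] r by simp
  qed
  have inc: "path_image (f v) \<inter> path_image (f w) \<subseteq> p ` pverts G" if vw: "v \<in> N" "w \<in> N" "v \<noteq> w" for v w
  proof
    fix z assume z: "z \<in> path_image (f v) \<inter> path_image (f w)"
    have uv: "(u, v) \<in> parcs G" "(u, w) \<in> parcs G" "{u, v} \<noteq> {u, w}" using vw by (auto simp: N_def doubleton_eq_iff)
    have cr: False if "v \<in> N" "w \<in> N" "v \<noteq> w" "z \<in> closed_segment ?c (q v)" "z \<in> A w" for v w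
    proof -
      have "z = q w" using that seg A(2) by blast
      then have "z = q v" using that q radial_segment_sphere[OF q[OF that(1)] r] by metis
      then show False using \<open>z = q w\<close> qneq that by blast
    qed
    consider "z \<in> closed_segment ?c (q v)" "z \<in> closed_segment ?c (q w)" | "z \<in> A v" "z \<in> A w"
      using z f(4) vw cr[OF vw] cr[OF vw(2,1)] by auto
    then show "z \<in> p ` pverts G"
    proof cases
      case 1
      then have "z = ?c" using radial_segments_Int[of ?c "q v" r "q w" z] q r qneq vw by blast
      then show ?thesis using u by blast
    next
      case 2
      then show ?thesis using A(1) drawingD(5)[OF d uv] vw by blast
    qed
  qed
  have nin: "path_image (f v) \<inter> path_image (\<gamma> {x, y}) \<subseteq> p ` pverts G"
    if "v \<in> N" "(x, y) \<in> parcs G" "u \<noteq> x" "u \<noteq> y" for v x y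
  proof
    fix z assume z: "z \<in> path_image (f v) \<inter> path_image (\<gamma> {x, y})"
    have "z \<notin> closed_segment ?c (q v)" using seg[OF that(1)] K2[OF that(2-4)] z by blast
    then have "z \<in> path_image (\<gamma> {u, v})" using z f(4)[OF that(1)] A(1)[OF that(1)] by blast
    moreover have "(u, v) \<in> parcs G" "{u, v} \<noteq> {x, y}" using that by (auto simp: N_def doubleton_eq_iff)
    ultimately show "z \<in> p ` pverts G" using drawingD(5)[OF d] that(2) z by blast
  qed
  have cases: "(x = u \<and> y \<in> N) \<or> (y = u \<and> x \<in> N) \<or> (u \<noteq> x \<and> u \<noteq> y)" if "(x, y) \<in> parcs G" for x y
    using that V[OF that] unfolding N_def by auto
  have cases': "(\<exists>v\<in>N. \<gamma>' {x, y} = f v \<and> {x, y} = {u, v}) \<or> u \<noteq> x \<and> u \<noteq> y" if xy: "(x, y) \<in> parcs G" for x y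
  proof -
    consider "x = u" "y \<in> N" | "y = u" "x \<in> N" | "u \<noteq> x" "u \<noteq> y" using cases[OF xy] by blast
    then show ?thesis
    proof cases
      case 1
      then show ?thesis using \<gamma>'u(1) by blast
    next
      case 2
      then show ?thesis using \<gamma>'u(2) by blast
    qed blast
  qed
  have "drawing G p \<gamma>'"
  proof (rule drawingI)
    show "inj_on p (pverts G)" using drawingD(1)[OF d] .
    fix x y assume xy: "(x, y) \<in> parcs G"
    show "arc (\<gamma>' {x, y})"
      using cases[OF xy] f(1) \<gamma>'u \<gamma>'n drawingD(2)[OF d xy] by auto
    show "{pathstart (\<gamma>' {x, y}), pathfinish (\<gamma>' {x, y})} = {p x, p y}"
    proof -
      consider "x = u" "y \<in> N" | "y = u" "x \<in> N" | "u \<noteq> x" "u \<noteq> y" using cases[OF xy] by blast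
      then show ?thesis
        by cases (simp_all add: f \<gamma>'u \<gamma>'n drawingD(3)[OF d xy] doubleton_eq_iff)
    qed
    have fv: "path_image (f v) \<inter> p ` pverts G \<subseteq> {?c, p v}" if "v \<in> N" for v
    proof
      fix z assume z: "z \<in> path_image (f v) \<inter> p ` pverts G"
      show "z \<in> {?c, p v}"
      proof (cases "z \<in> closed_segment ?c (q v)")
        case True
        then show ?thesis using z seg[OF that] vert by blast
      next
        case False
        then have "z \<in> path_image (\<gamma> {u, v})" using z f(4)[OF that] A(1)[OF that] by blast
        then show ?thesis using z drawingD(4)[OF d, of u v] that unfolding N_def by blast
      qed
    qed
    show "path_image (\<gamma>' {x, y}) \<inter> p ` pverts G \<subseteq> {p x, p y}"
      using cases[OF xy] \<gamma>'u \<gamma>'n drawingD(4)[OF d xy] fv[of x] fv[of y] by (elim disjE conjE) auto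
    fix x' y' assume xy': "(x', y') \<in> parcs G" "{x, y} \<noteq> {x', y'}"
    show "path_image (\<gamma>' {x, y}) \<inter> path_image (\<gamma>' {x', y'}) \<subseteq> p ` pverts G"
      using cases'[OF xy]
    proof (elim disjE bexE conjE)
      fix v assume v: "v \<in> N" "\<gamma>' {x, y} = f v" "{x, y} = {u, v}"
      show ?thesis using cases'[OF xy'(1)]
      proof (elim disjE bexE conjE)
        fix w assume w: "w \<in> N" "\<gamma>' {x', y'} = f w" "{x', y'} = {u, w}"
        have "v \<noteq> w" using xy'(2) unfolding v(3) w(3) by blast
        then show ?thesis unfolding v(2) w(2) using inc v(1) w(1) by blast
      next
        assume "u \<noteq> x'" "u \<noteq> y'"
        then show ?thesis unfolding v(2) using nin[OF v(1) xy'(1)] \<gamma>'n by simp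
      qed
    next
      assume n: "u \<noteq> x" "u \<noteq> y"
      show ?thesis using cases'[OF xy'(1)]
      proof (elim disjE bexE conjE)
        fix w assume w: "w \<in> N" "\<gamma>' {x', y'} = f w" "{x', y'} = {u, w}"
        show ?thesis unfolding w(2) \<gamma>'n[OF n] using nin[OF w(1) xy n] by blast
      next
        assume "u \<noteq> x'" "u \<noteq> y'"
        then show ?thesis using drawingD(5)[OF d xy xy'] \<gamma>'n n by simp
      qed
    qed
  qed (fact g)
  moreover have "finite (q ` N)"
    by (rule finite_imageI, rule finite_subset[OF _ fin(1)]) (use V in \<open>auto simp: N_def\<close>)
  moreover have "q ` N \<subseteq> sphere ?c r" using q by auto
  moreover have "drawn G p \<gamma>' \<inter> cball ?c r \<subseteq> {?c} \<union> (\<Union>q\<in>q ` N. closed_segment ?c q)"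
  proof
    fix z assume z: "z \<in> drawn G p \<gamma>' \<inter> cball ?c r"
    show "z \<in> {?c} \<union> (\<Union>q\<in>q ` N. closed_segment ?c q)"
    proof (cases "z \<in> p ` pverts G")
      case True
      then show ?thesis using z vert by blast
    next
      case False
      then obtain x y where xy: "(x, y) \<in> parcs G" "z \<in> path_image (\<gamma>' {x, y})" using z unfolding drawn_def by auto
      from cases'[OF xy(1)] consider v where "v \<in> N" "\<gamma>' {x, y} = f v" | "u \<noteq> x" "u \<noteq> y" by blast
      then show ?thesis
      proof cases
        case 1
        have "z \<in> A v \<Longrightarrow> z = q v" using A(2)[OF 1(1)] z by blast
        then have "z \<in> closed_segment ?c (q v)" using xy(2) f(4)[OF 1(1)] 1(2) by auto
        then show ?thesis using 1 by blast
      next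
        case 2
        then show ?thesis using K2[OF xy(1)] xy(2) \<gamma>'n z by (metis IntD2)
      qed
    qed
  qed
  ultimately show ?thesis using that r by blast
qed

lemma infinite_sphere_complex:
  assumes "0 < r"
  shows "infinite (sphere (c :: complex) r)"
proof
  assume "finite (sphere c r)"
  moreover have "Topological_Spaces.connected (sphere c r)" by (rule connected_sphere) simp
  moreover have "c + of_real r \<in> sphere c r" "c - of_real r \<in> sphere c r" using assms by (auto simp: dist_norm)
  ultimately have "\<exists>a. sphere c r = {a}" using connected_finite_iff_sing by blast
  then have "c + of_real r = c - of_real r"
    using \<open>c + of_real r \<in> sphere c r\<close> \<open>c - of_real r \<in> sphere c r\<close> by (metis singletonD)
  then show False using assms by (simp add: complex_eq_iff)
qed

text \<open>The circle around \<open>p u\<close> is infinite and the star uses finitely many of its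
  points, so some radius is free.\<close>

lemma drawing_free_segment:
  assumes g: "pair_graph G" and d: "drawing G p \<gamma>" and u: "u \<in> pverts G"
  obtains \<gamma>' q where "drawing G p \<gamma>'" "q \<noteq> p u" "closed_segment (p u) q \<inter> drawn G p \<gamma>' = {p u}"
proof -
  obtain \<gamma>' r Q where *: "0 < r" "drawing G p \<gamma>'" "finite Q" "Q \<subseteq> sphere (p u) r"
    "drawn G p \<gamma>' \<inter> cball (p u) r \<subseteq> {p u} \<union> (\<Union>q\<in>Q. closed_segment (p u) q)"
    by (rule drawing_star[OF assms]) (rule that)
  obtain q where q: "q \<in> sphere (p u) r" "q \<notin> Q"
    using infinite_sphere_complex[OF *(1), of "p u"] *(3) by (meson finite_subset subsetI)
  have "closed_segment (p u) q \<subseteq> cball (p u) r"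
    by (rule closed_segment_subset) (use q *(1) in auto)
  then have "z = p u" if "z \<in> closed_segment (p u) q \<inter> drawn G p \<gamma>'" for z
    using that *(5) radial_segments_Int[of "p u" q r _ z] q *(1,4) by fastforce
  moreover have "p u \<in> drawn G p \<gamma>'" using u unfolding drawn_def by blast
  ultimately have "closed_segment (p u) q \<inter> drawn G p \<gamma>' = {p u}" by auto
  moreover have "q \<noteq> p u" using q *(1) by auto
  ultimately show ?thesis using that *(2) by blast
qed

text \<open>Inverting the plane at the end of a free segment moves the drawing into a half plane and the segment to a ray.\<close>

lemma drawing_half_plane:
  assumes g: "planar G" and u: "u \<in> pverts G"
  obtains p \<gamma> a where "drawing G p \<gamma>" "\<And>z. z \<in> drawn G p \<gamma> \<Longrightarrow> Re z < 0"
    "p u = complex_of_real a" "closed_segment (complex_of_real a) 0 \<inter> drawn G p \<gamma> = {complex_of_real a}"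
proof -
  have pg: "pair_graph G" using g unfolding planar_iff by blast
  obtain p \<gamma> where d0: "drawing G p \<gamma>" using g unfolding planar_iff by blast
  obtain \<gamma>' q where d: "drawing G p \<gamma>'" and q: "q \<noteq> p u" and s: "closed_segment (p u) q \<inter> drawn G p \<gamma>' = {p u}"
    by (rule drawing_free_segment[OF pg d0 u]) (rule that)
  let ?c = "p u" and ?D = "drawn G p \<gamma>'"
  have qD: "q \<notin> ?D" using s q by auto
  \<comment> \<open>This sends \<open>q\<close> to infinity and \<open>p u\<close> to 1; the free
    segment becomes the ray from 1 along the positive real axis.\<close>
  let ?f = "\<lambda>z. (?c - q) / (z - q)"
  have "continuous_on ?D ?f" using qD by (intro continuous_intros) auto
  then have "bounded (?f ` ?D)" using compact_drawn[OF pg d] compact_continuous_image compact_imp_bounded by blast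
  then obtain B where B: "\<And>z. z \<in> ?D \<Longrightarrow> norm (?f z) \<le> B" unfolding bounded_iff by auto
  \<comment> \<open>The image of the drawing lies in the disc of radius \<open>B\<close> around 0,
    so a shift by \<open>B + 1\<close> puts it into the left half plane. The vertex arrives at
    \<open>- B\<close>, and the ray from it passes through 0.\<close>
  let ?K = "B + 1"
  let ?h = "\<lambda>z. ?f z - of_real ?K"
  have cD: "?c \<in> ?D" using s by auto
  have "?f ?c = 1" using q by simp
  then have B1: "1 \<le> B" using B[OF cD] by (metis norm_one)
  have inj: "inj_on ?h (- {q})"
  proof (rule inj_onI)
    fix x y assume "x \<in> - {q}" "y \<in> - {q}" "?h x = ?h y"
    then show "x = y" using q by (auto simp: frac_eq_eq)
  qed
  have cont: "continuous_on (- {q}) ?h" by (intro continuous_intros) auto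
  have sub: "?D \<subseteq> - {q}" using qD by auto
  note d' = drawing_homeo[OF d cont inj sub pg]
  have hc: "?h ?c = complex_of_real (1 - ?K)" using q by simp
  show ?thesis
  proof (rule that[OF d'(1)])
    show "Re z < 0" if "z \<in> drawn G (?h \<circ> p) (\<lambda>e. ?h \<circ> \<gamma>' e)" for z
    proof -
      obtain y where "y \<in> ?D" "z = ?h y" using \<open>z \<in> _\<close> unfolding d'(2) by blast
      then show ?thesis using B[of y] complex_Re_le_cmod[of "?f y"] by simp
    qed
    show "(?h \<circ> p) u = complex_of_real (1 - ?K)" using hc by simp
    have "z = complex_of_real (1 - ?K)"
      if z: "z \<in> closed_segment (complex_of_real (1 - ?K)) 0 \<inter> drawn G (?h \<circ> p) (\<lambda>e. ?h \<circ> \<gamma>' e)" for z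
    proof -
      obtain y where y: "y \<in> ?D" "z = ?h y" using z unfolding d'(2) by blast
      have "z \<in> closed_segment (complex_of_real (1 - ?K)) (complex_of_real 0)" using z by simp
      then obtain t where t: "z = complex_of_real t" "t \<in> closed_segment (1 - ?K) 0"
        unfolding closed_segment_of_real by blast
      let ?w = "t + ?K"
      have w: "1 \<le> ?w" using t(2) B1 by (auto simp: closed_segment_eq_real_ivl split: if_splits)
      have yq: "y \<noteq> q" using y qD by auto
      have "?f y = of_real ?w" using y t by (simp add: algebra_simps)
      then have "?c - q = of_real ?w * (y - q)" using yq by (simp add: field_simps)
      moreover have "y - q = of_real (1 / ?w) * (of_real ?w * (y - q))" using w
        by (simp only: mult.assoc[symmetric] of_real_mult[symmetric]) simp
      ultimately have "y - q = (1 / ?w) *\<^sub>R (?c - q)" by (simp add: scaleR_conv_of_real)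
      then have "y = (1 - (1 - 1 / ?w)) *\<^sub>R ?c + (1 - 1 / ?w) *\<^sub>R q" by (simp add: algebra_simps)
      then have "y \<in> closed_segment ?c q" using w unfolding in_segment by (intro exI[of _ "1 - 1 / ?w"]) auto
      then have "y = ?c" using y s by blast
      then show ?thesis using y hc by simp
    qed
    moreover have "complex_of_real (1 - ?K) \<in> drawn G (?h \<circ> p) (\<lambda>e. ?h \<circ> \<gamma>' e)"
    proof -
      have "?h ?c \<in> ?h ` ?D" using cD by (rule imageI)
      then show ?thesis unfolding d'(2) hc .
    qed
    ultimately show "closed_segment (complex_of_real (1 - ?K)) 0 \<inter> drawn G (?h \<circ> p) (\<lambda>e. ?h \<circ> \<gamma>' e) = {complex_of_real (1 - ?K)}"
      using ends_in_segment(1)[of "complex_of_real (1 - ?K)" 0] by blast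
  qed
qed

section \<open>Joining two graphs by a bridge\<close>

definition bridge_sum :: "'a pair_pre_digraph \<Rightarrow> 'a \<Rightarrow> 'a pair_pre_digraph \<Rightarrow> 'a \<Rightarrow> 'a pair_pre_digraph" where
  "bridge_sum G u H v = \<lparr>pverts = pverts G \<union> pverts H, parcs = parcs G \<union> parcs H \<union> {(u, v), (v, u)}\<rparr>"

lemma pair_graph_bridge_sum:
  assumes "pair_graph G" "pair_graph H" "u \<in> pverts G" "v \<in> pverts H" "pverts G \<inter> pverts H = {}"
  shows "pair_graph (bridge_sum G u H v)"
  using assms unfolding pair_graph_iff bridge_sum_def by auto

text \<open>One drawing is put into the left half plane and the other, reflected, into the right
  one. Both chosen vertices lie on the real axis with a free segment to 0, so the new edge is the
  straight segment through 0.\<close>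

theorem planar_bridge_sum:
  assumes G: "planar G" and H: "planar H" and u: "u \<in> pverts G" and v: "v \<in> pverts H" and disj: "pverts G \<inter> pverts H = {}"
  shows "planar (bridge_sum G u H v)"
proof -
  have g: "pair_graph G" and h: "pair_graph H" using G H unfolding planar_iff by auto
  obtain p1 \<gamma>1 a where d1: "drawing G p1 \<gamma>1" "\<And>z. z \<in> drawn G p1 \<gamma>1 \<Longrightarrow> Re z < 0"
    "p1 u = complex_of_real a" "closed_segment (complex_of_real a) 0 \<inter> drawn G p1 \<gamma>1 = {complex_of_real a}"
    by (rule drawing_half_plane[OF G u]) (rule that)
  obtain p0 \<gamma>0 b' where d0: "drawing H p0 \<gamma>0" "\<And>z. z \<in> drawn H p0 \<gamma>0 \<Longrightarrow> Re z < 0"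
    "p0 v = complex_of_real b'" "closed_segment (complex_of_real b') 0 \<inter> drawn H p0 \<gamma>0 = {complex_of_real b'}"
    by (rule drawing_half_plane[OF H v]) (rule that)
  define p2 where "p2 = uminus \<circ> p0"
  define \<gamma>2 where "\<gamma>2 = (\<lambda>e. uminus \<circ> \<gamma>0 e)"
  define b where "b = - b'"
  have d2: "drawing H p2 \<gamma>2" and D2: "drawn H p2 \<gamma>2 = uminus ` drawn H p0 \<gamma>0"
    unfolding p2_def \<gamma>2_def
    using drawing_homeo[OF d0(1) continuous_on_minus[OF continuous_on_id], of UNIV] h by auto
  have d2pos: "0 < Re z" if "z \<in> drawn H p2 \<gamma>2" for z using that d0(2) unfolding D2 by fastforce
  have d2b: "p2 v = complex_of_real b" unfolding p2_def b_def using d0(3) by simp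
  have d2s: "closed_segment 0 (complex_of_real b) \<inter> drawn H p2 \<gamma>2 = {complex_of_real b}"
  proof -
    have "closed_segment 0 (complex_of_real b) = uminus ` closed_segment (complex_of_real b') 0"
      using closed_segment_linear_image[of uminus "complex_of_real b'" 0]
      by (simp add: b_def closed_segment_commute linear_uminus)
    then show ?thesis unfolding D2 using d0(4) by (simp add: image_Int[symmetric] b_def)
  qed
  have a: "a < 0" using d1(2)[of "p1 u"] d1(3) drawnI(1)[OF u] by fastforce
  have b: "0 < b" using d2pos[of "p2 v"] d2b drawnI(1)[OF v] by fastforce
  let ?l = "linepath (complex_of_real a) (complex_of_real b)"
  have "(0::complex) \<in> closed_segment (complex_of_real a) (complex_of_real b)"
    using closed_segment_of_real[of a b] a b by (auto simp: closed_segment_eq_real_ivl intro!: image_eqI[of _ _ 0])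
  then have lim: "path_image ?l = closed_segment (complex_of_real a) 0 \<union> closed_segment 0 (complex_of_real b)"
    using Un_closed_segment by auto
  have segs: "Re z \<le> 0" if "z \<in> closed_segment (complex_of_real a) 0" for z
    using that a by (auto simp: in_segment mult_nonneg_nonpos)
  have segs': "0 \<le> Re z" if "z \<in> closed_segment 0 (complex_of_real b)" for z
    using that b by (auto simp: in_segment)
  have l1: "path_image ?l \<inter> drawn G p1 \<gamma>1 = {p1 u}" using lim d1(2,4) segs' d1(3) by fastforce
  have l2: "path_image ?l \<inter> drawn H p2 \<gamma>2 = {p2 v}" using lim d2pos d2s segs d2b by fastforce
  have D12: "drawn G p1 \<gamma>1 \<inter> drawn H p2 \<gamma>2 = {}" using d1(2) d2pos by fastforce
  have meet: "A \<inter> L \<subseteq> S \<and> L \<inter> A \<subseteq> S" if "L \<inter> D = {a}" "A \<subseteq> D" "a \<in> S" for A D L S :: "complex set" and a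
    using that by auto
  define p where "p x = (if x \<in> pverts G then p1 x else p2 x)" for x
  define \<gamma> where "\<gamma> e = (if e \<subseteq> pverts G then \<gamma>1 e else if e \<subseteq> pverts H then \<gamma>2 e else ?l)" for e
  have V1: "x \<in> pverts G" "y \<in> pverts G" if "(x, y) \<in> parcs G" for x y using that g unfolding pair_graph_iff by auto
  have V2: "x \<in> pverts H" "y \<in> pverts H" if "(x, y) \<in> parcs H" for x y using that h unfolding pair_graph_iff by auto
  have pG: "p x = p1 x" if "x \<in> pverts G" for x using that by (simp add: p_def)
  have pH: "p x = p2 x" if "x \<in> pverts H" for x using that disj by (auto simp: p_def)
  have \<gamma>G: "\<gamma> {x, y} = \<gamma>1 {x, y}" if "(x, y) \<in> parcs G" for x y using V1[OF that] by (simp add: \<gamma>_def)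
  have \<gamma>H: "\<gamma> {x, y} = \<gamma>2 {x, y}" if "(x, y) \<in> parcs H" for x y using V2[OF that] disj by (auto simp: \<gamma>_def)
  have \<gamma>l: "\<gamma> {u, v} = ?l" "\<gamma> {v, u} = ?l" using u v disj by (auto simp: \<gamma>_def)
  let ?S = "bridge_sum G u H v"
  have im: "p ` pverts ?S = p1 ` pverts G \<union> p2 ` pverts H"
    using pG pH by (auto simp: bridge_sum_def image_Un)
  have sub1: "p1 ` pverts G \<subseteq> drawn G p1 \<gamma>1" and sub2: "p2 ` pverts H \<subseteq> drawn H p2 \<gamma>2" by (auto simp: drawn_def)
  have e1: "path_image (\<gamma>1 {x, y}) \<subseteq> drawn G p1 \<gamma>1" if "(x, y) \<in> parcs G" for x y using drawnI(2)[OF that] .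
  have e2: "path_image (\<gamma>2 {x, y}) \<subseteq> drawn H p2 \<gamma>2" if "(x, y) \<in> parcs H" for x y using drawnI(2)[OF that] .
  have arcs: "(x, y) \<in> parcs G \<or> (x, y) \<in> parcs H \<or> (x = u \<and> y = v) \<or> (x = v \<and> y = u)" if "(x, y) \<in> parcs ?S" for x y
    using that by (auto simp: bridge_sum_def)
  have "drawing ?S p \<gamma>"
  proof (rule drawingI)
    show "inj_on p (pverts ?S)"
    proof -
      have "inj_on p (pverts G)" "inj_on p (pverts H)"
        using drawingD(1)[OF d1(1)] drawingD(1)[OF d2] pG pH by (auto simp: inj_on_def)
      moreover have "p x \<noteq> p y" if "x \<in> pverts G" "y \<in> pverts H" for x y
        using pG pH that sub1 sub2 D12 by fastforce
      ultimately show ?thesis by (auto simp: bridge_sum_def inj_on_def) metis+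
    qed
    fix x y assume xy: "(x, y) \<in> parcs ?S"
    show "arc (\<gamma> {x, y})"
      using arcs[OF xy] drawingD(2)[OF d1(1)] drawingD(2)[OF d2] a b \<gamma>G \<gamma>H \<gamma>l by (auto intro!: arc_linepath)
    have "p u = complex_of_real a" "p v = complex_of_real b" using pG[OF u] pH[OF v] d1(3) d2b by auto
    then show "{pathstart (\<gamma> {x, y}), pathfinish (\<gamma> {x, y})} = {p x, p y}"
      using arcs[OF xy] drawingD(3)[OF d1(1)] drawingD(3)[OF d2] \<gamma>G \<gamma>H \<gamma>l V1 V2 pG pH by (elim disjE) auto
    consider "(x, y) \<in> parcs G" | "(x, y) \<in> parcs H" | "\<gamma> {x, y} = ?l" "{x, y} = {u, v}" using arcs[OF xy] \<gamma>l by auto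
    then show "path_image (\<gamma> {x, y}) \<inter> p ` pverts ?S \<subseteq> {p x, p y}"
    proof cases
      case 1
      then show ?thesis unfolding im \<gamma>G[OF 1] using e1[OF 1] D12 sub2 drawingD(4)[OF d1(1) 1] V1[OF 1] pG by auto
    next
      case 2
      then show ?thesis unfolding im \<gamma>H[OF 2] using e2[OF 2] D12 sub1 drawingD(4)[OF d2 2] V2[OF 2] pH by auto
    next
      case 3
      then have "{p x, p y} = {p u, p v}" by (auto simp: doubleton_eq_iff)
      then show ?thesis unfolding im 3(1) using l1 l2 sub1 sub2 pG[OF u] pH[OF v] by auto
    qed
    fix x' y' assume xy': "(x', y') \<in> parcs ?S" and ne: "{x, y} \<noteq> {x', y'}"
    consider "(x', y') \<in> parcs G" | "(x', y') \<in> parcs H" | "\<gamma> {x', y'} = ?l" "{x', y'} = {u, v}" using arcs[OF xy'] \<gamma>l by auto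
    note c' = this
    have uS: "p1 u \<in> p ` pverts ?S" "p2 v \<in> p ` pverts ?S" unfolding im using u v by auto
    consider "(x, y) \<in> parcs G" | "(x, y) \<in> parcs H" | "\<gamma> {x, y} = ?l" "{x, y} = {u, v}" using arcs[OF xy] \<gamma>l by auto
    then show "path_image (\<gamma> {x, y}) \<inter> path_image (\<gamma> {x', y'}) \<subseteq> p ` pverts ?S"
    proof cases
      case 1
      show ?thesis using c'
      proof cases
        case a: 1
        show ?thesis unfolding im \<gamma>G[OF 1] \<gamma>G[OF a] using drawingD(5)[OF d1(1) 1 a ne] by blast
      next
        case 2
        show ?thesis unfolding \<gamma>G[OF 1] \<gamma>H[OF 2] using D12 e1[OF 1] e2[OF 2] by blast
      next
        case 3
        show ?thesis unfolding \<gamma>G[OF 1] 3(1) using meet[OF l1 e1[OF 1] uS(1)] by blast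
      qed
    next
      case 2
      show ?thesis using c'
      proof cases
        case 1
        show ?thesis unfolding \<gamma>G[OF 1] \<gamma>H[OF 2] using D12 e1[OF 1] e2[OF 2] by blast
      next
        case a: 2
        show ?thesis unfolding im \<gamma>H[OF 2] \<gamma>H[OF a] using drawingD(5)[OF d2 2 a ne] by blast
      next
        case 3
        show ?thesis unfolding \<gamma>H[OF 2] 3(1) using meet[OF l2 e2[OF 2] uS(2)] by blast
      qed
    next
      case 3
      show ?thesis using c'
      proof cases
        case 1
        show ?thesis unfolding \<gamma>G[OF 1] 3(1) using meet[OF l1 e1[OF 1] uS(1)] by blast
      next
        case 2
        show ?thesis unfolding \<gamma>H[OF 2] 3(1) using meet[OF l2 e2[OF 2] uS(2)] by blast
      next
        case a: 3
        then show ?thesis using 3(2) ne by blast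
      qed
    qed
  qed (use pair_graph_bridge_sum[OF g h u v disj] in auto)
  then show ?thesis using pair_graph_bridge_sum[OF g h u v disj] unfolding planar_iff by blast
qed


section \<open>Subgraphs, bridges and forcing assignments\<close>

text \<open>In a pair digraph tail and head are the projections, which leaves the arc component of
  an isomorphism no freedom beyond the vertex component.\<close>

lemma digraph_isoD:
  assumes "digraph_iso (with_proj K) (with_proj H)"
  obtains f where "inj_on f (pverts K)" "pverts H = f ` pverts K" "parcs H = map_prod f f ` parcs K"
proof -
  obtain h where h: "pre_digraph.digraph_isomorphism (with_proj K) h" and H: "with_proj H = app_iso h (with_proj K)"
    using assms unfolding digraph_iso_def by blast
  let ?f = "iso_verts h"
  have "tail (with_proj H) = iso_tail h" "head (with_proj H) = iso_head h" unfolding H by simp_all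
  then have th: "iso_tail h = fst" "iso_head h = snd" by simp_all
  have V: "pverts H = ?f ` pverts K" and E: "parcs H = iso_arcs h ` parcs K"
    using arg_cong[OF H, of verts] arg_cong[OF H, of arcs] by simp_all
  have "iso_arcs h e = map_prod ?f ?f e" if "e \<in> parcs K" for e
  proof -
    have "?f (tail (with_proj K) e) = iso_tail h (iso_arcs h e) \<and> ?f (head (with_proj K) e) = iso_head h (iso_arcs h e)"
      using h that unfolding pre_digraph.digraph_isomorphism_def by simp
    then show ?thesis unfolding th by (simp add: prod_eq_iff)
  qed
  then have "parcs H = map_prod ?f ?f ` parcs K" unfolding E by (rule image_cong[OF refl])
  moreover have "inj_on ?f (pverts K)" using h unfolding pre_digraph.digraph_isomorphism_def by simp
  ultimately show ?thesis using that V by blast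
qed

lemma digraph_isoI:
  assumes "pair_wf_digraph K" "inj_on f (pverts K)" "pverts H = f ` pverts K" "parcs H = map_prod f f ` parcs K"
  shows "digraph_iso (with_proj K) (with_proj H)"
proof -
  let ?h = "\<lparr>iso_verts = f, iso_arcs = map_prod f f, iso_head = snd, iso_tail = fst\<rparr>"
  have "parcs K \<subseteq> pverts K \<times> pverts K"
    using pair_wf_digraph.in_arcsD1[OF assms(1)] pair_wf_digraph.in_arcsD2[OF assms(1)] by auto
  then have "inj_on (map_prod f f) (parcs K)"
    using map_prod_inj_on[OF assms(2) assms(2)] inj_on_subset by blast
  then have "pre_digraph.digraph_isomorphism (with_proj K) ?h"
    using assms(1,2) unfolding pre_digraph.digraph_isomorphism_def by (simp add: wf_digraph_wp_iff)
  moreover have "with_proj H = app_iso ?h (with_proj K)"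
    using assms(3,4) by (simp add: with_proj_def app_iso_def)
  ultimately show ?thesis unfolding digraph_iso_def by blast
qed

lemma subgraph_with_proj_iff:
  "subgraph (with_proj K) (with_proj G) \<longleftrightarrow>
     pverts K \<subseteq> pverts G \<and> parcs K \<subseteq> parcs G \<and> pair_wf_digraph G \<and> pair_wf_digraph K"
  unfolding subgraph_def compatible_def by (simp add: wf_digraph_wp_iff)

lemma pair_wf_digraph_iff: "pair_wf_digraph G \<longleftrightarrow> parcs G \<subseteq> pverts G \<times> pverts G"
  unfolding pair_wf_digraph_def by auto

lemma pair_graph_wf: "pair_graph G \<Longrightarrow> pair_wf_digraph G"
  unfolding pair_graph_iff pair_wf_digraph_iff by auto

text \<open>Subgraph-freeness speaks of literal subgraphs on the vertex type of \<open>G\<close>;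
  this lets a copy on another type, mapped injectively into \<open>G\<close>, count as well.\<close>

lemma not_subgraph_free_embed:
  assumes G: "pair_graph G" and K: "pair_wf_digraph K" and iso: "digraph_iso (with_proj K) (with_proj H)" "H \<in> \<H>"
    and g: "inj_on g (pverts K)" "g ` pverts K \<subseteq> pverts G" "map_prod g g ` parcs K \<subseteq> parcs G"
  shows "\<not> subgraph_free \<H> G"
proof -
  let ?K = "map_graph g K"
  obtain f where f: "inj_on f (pverts K)" "pverts H = f ` pverts K" "parcs H = map_prod f f ` parcs K"
    using digraph_isoD[OF iso(1)] .
  let ?g = "the_inv_into (pverts K) g"
  have inv: "?g (g x) = x" if "x \<in> pverts K" for x using the_inv_into_f_f[OF g(1) that] .
  have KV: "parcs K \<subseteq> pverts K \<times> pverts K" using K unfolding pair_wf_digraph_iff .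
  have wf: "pair_wf_digraph ?K" using KV unfolding pair_wf_digraph_iff by auto
  have "digraph_iso (with_proj ?K) (with_proj H)"
  proof (rule digraph_isoI[OF wf])
    show "inj_on (f \<circ> ?g) (pverts ?K)" using f(1) by (auto simp: inj_on_def inv)
    show "pverts H = (f \<circ> ?g) ` pverts ?K" unfolding f(2) by (auto simp: inv image_image)
    have "map_prod (f \<circ> ?g) (f \<circ> ?g) (map_prod g g e) = map_prod f f e" if "e \<in> parcs K" for e
      using that KV by (auto simp: inv)
    then show "parcs H = map_prod (f \<circ> ?g) (f \<circ> ?g) ` parcs ?K"
      unfolding f(3) map_graph_simps image_image by (intro image_cong) auto
  qed
  moreover have "subgraph (with_proj ?K) (with_proj G)"
    unfolding subgraph_with_proj_iff using g wf pair_graph_wf[OF G] by simp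
  ultimately show ?thesis unfolding subgraph_free_def using iso(2) by blast
qed

lemma subgraph_free_map_graph:
  assumes "subgraph_free \<H> G" "pair_graph G" "inj_on f (pverts G)"
  shows "subgraph_free \<H> (map_graph f G)"
proof (rule ccontr)
  assume "\<not> subgraph_free \<H> (map_graph f G)"
  then obtain K H where K: "subgraph (with_proj K) (with_proj (map_graph f G))" "digraph_iso (with_proj K) (with_proj H)" "H \<in> \<H>"
    unfolding subgraph_free_def by blast
  note K' = K(1)[unfolded subgraph_with_proj_iff map_graph_simps]
  let ?g = "the_inv_into (pverts G) f"
  have inv: "?g (f x) = x" if "x \<in> pverts G" for x using the_inv_into_f_f[OF assms(3) that] .
  have GV: "parcs G \<subseteq> pverts G \<times> pverts G" using pair_graph_wf[OF assms(2)] unfolding pair_wf_digraph_iff .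
  have "inj_on ?g (pverts K)"
    using K' inj_on_subset[OF inj_on_the_inv_into[OF assms(3)]] by blast
  moreover have "?g ` pverts K \<subseteq> pverts G" using K' inv by force
  moreover have "map_prod ?g ?g ` parcs K \<subseteq> parcs G"
  proof
    fix e assume "e \<in> map_prod ?g ?g ` parcs K"
    then obtain k where k: "k \<in> parcs K" "e = map_prod ?g ?g k" by (elim imageE) simp
    have "parcs K \<subseteq> map_prod f f ` parcs G" using K' by simp
    then have "k \<in> map_prod f f ` parcs G" using k(1) by (rule subsetD)
    then obtain e' where e': "e' \<in> parcs G" "k = map_prod f f e'" by (elim imageE) simp
    moreover have "e = map_prod ?g ?g (map_prod f f e')" unfolding k(2) e'(2) ..
    moreover obtain a b where "e' = (a, b)" by fastforce
    moreover from calculation have "a \<in> pverts G" "b \<in> pverts G" using GV by auto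
    ultimately show "e \<in> parcs G" by (simp add: inv)
  qed
  moreover have "pair_wf_digraph K" using K' by blast
  ultimately have "\<not> subgraph_free \<H> G"
    by (intro not_subgraph_free_embed[OF assms(2) _ K(2,3)])
  then show False using assms(1) by blast
qed

text \<open>2-connectedness as a cut condition on a vertex set and an arc set: after removing any
  \<open>v\<close>, some arc leaves every nonempty proper part. A \<open>v\<close> outside
  \<open>V\<close> yields connectedness itself.\<close>

definition biconnected :: "'a set \<Rightarrow> ('a \<times> 'a) set \<Rightarrow> bool" where
  "biconnected V E \<longleftrightarrow> finite V \<and> 3 \<le> card V \<and> E \<subseteq> V \<times> V \<and>
     (\<forall>v X. X \<subseteq> V - {v} \<and> X \<noteq> {} \<and> V - {v} - X \<noteq> {} \<longrightarrow> (\<exists>x\<in>X. \<exists>y\<in>V - {v} - X. (x, y) \<in> E))"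

text \<open>For \<open>v\<close> outside \<open>V\<close> the condition follows from the others:
  among three vertices one side of the cut has two, and removing one of these gives a cut to which
  the assumption applies.\<close>

lemma biconnectedI:
  assumes "finite V" "3 \<le> card V" "E \<subseteq> V \<times> V"
    and step: "\<And>v X. v \<in> V \<Longrightarrow> X \<subseteq> V - {v} \<Longrightarrow> X \<noteq> {} \<Longrightarrow> V - {v} - X \<noteq> {} \<Longrightarrow> \<exists>x\<in>X. \<exists>y\<in>V - {v} - X. (x, y) \<in> E"
  shows "biconnected V E"
  unfolding biconnected_def
proof (intro conjI allI impI)
  fix v X assume X: "X \<subseteq> V - {v} \<and> X \<noteq> {} \<and> V - {v} - X \<noteq> {}"
  show "\<exists>x\<in>X. \<exists>y\<in>V - {v} - X. (x, y) \<in> E"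
  proof (cases "v \<in> V")
    case True
    then show ?thesis using step X by blast
  next
    case False
    then have XV: "X \<subseteq> V" "X \<noteq> {}" "V - X \<noteq> {}" using X by auto
    have "card V = card X + card (V - X)"
      using XV(1) assms(1) by (metis card_Diff_subset card_mono finite_subset le_add_diff_inverse)
    then consider "2 \<le> card X" | "2 \<le> card (V - X)" using assms(2) by linarith
    then show ?thesis
    proof cases
      case 1
      then obtain w where w: "w \<in> X" using XV by blast
      have "X - {w} \<noteq> {}"
      proof
        assume "X - {w} = {}"
        then have "X = {w}" using w by blast
        then show False using 1 by simp
      qed
      moreover have eq: "V - {w} - (X - {w}) = V - X" using w by blast
      moreover have "w \<in> V" "X - {w} \<subseteq> V - {w}" using w XV by auto
      ultimately have "\<exists>x\<in>X - {w}. \<exists>y\<in>V - X. (x, y) \<in> E" using step[of w "X - {w}"] XV(3) by simp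
      then show ?thesis using False by blast
    next
      case 2
      then obtain w where w: "w \<in> V - X" using XV by blast
      have "V - X - {w} \<noteq> {}"
      proof
        assume "V - X - {w} = {}"
        then have "V - X = {w}" using w by blast
        then show False using 2 by simp
      qed
      moreover have "V - {w} - X = V - X - {w}" by blast
      moreover have "w \<in> V" "X \<subseteq> V - {w}" using w XV by auto
      ultimately have "\<exists>x\<in>X. \<exists>y\<in>V - X - {w}. (x, y) \<in> E" using step[of w X] XV(2) by simp
      then show ?thesis using False by blast
    qed
  qed
qed (use assms in auto)

lemma biconnectedD:
  assumes "biconnected V E" "X \<subseteq> V - {v}" "X \<noteq> {}" "V - {v} - X \<noteq> {}"
  obtains x y where "x \<in> X" "y \<in> V" "y \<noteq> v" "y \<notin> X" "(x, y) \<in> E"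
proof -
  have "\<exists>x\<in>X. \<exists>y\<in>V - {v} - X. (x, y) \<in> E" using assms unfolding biconnected_def by simp
  then show ?thesis using that by blast
qed

lemma two_connected_biconnected:
  assumes "two_connected H"
  shows "biconnected (pverts H) (parcs H)"
proof (rule biconnectedI)
  have pg: "pair_graph H" using assms unfolding two_connected_def by blast
  show "finite (pverts H)" "parcs H \<subseteq> pverts H \<times> pverts H" using pg unfolding pair_graph_iff by auto
  show "3 \<le> card (pverts H)" using assms unfolding two_connected_def by blast
  fix v X assume v: "v \<in> pverts H" and X: "X \<subseteq> pverts H - {v}" "X \<noteq> {}" "pverts H - {v} - X \<noteq> {}"
  obtain x y where xy: "x \<in> X" "y \<in> pverts H - {v} - X" using X by blast
  let ?D = "pre_digraph.del_vert (with_proj H) v"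
  let ?M = "mk_symmetric ?D"
  have "Digraph_Component.connected ?D" using assms v unfolding two_connected_def by blast
  then have "strongly_connected (with_proj ?M)" unfolding Digraph_Component.connected_def .
  moreover have V: "verts (with_proj ?M) = pverts H - {v}"
    by (simp add: mk_symmetric_def pre_digraph.del_vert_def)
  ultimately have "x \<rightarrow>\<^sup>*\<^bsub>with_proj ?M\<^esub> y" using xy X(1) unfolding strongly_connected_def by blast
  then have "(x, y) \<in> (parcs ?M)\<^sup>*" unfolding reachable_def with_proj_simps by (rule rtrancl_on_rtranclI)
  then have "\<exists>a\<in>X. \<exists>b. b \<notin> X \<and> (a, b) \<in> parcs ?M"
    using xy by (induction rule: converse_rtrancl_induct) auto
  then obtain a b where ab: "a \<in> X" "b \<notin> X" "(a, b) \<in> parcs ?M" by blast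
  have "(a, b) \<in> parcs H \<and> a \<noteq> v \<and> b \<noteq> v"
    using ab(3) pg unfolding pair_graph_iff
    by (auto simp: mk_symmetric_def pre_digraph.del_vert_def)
  moreover from this have "b \<in> pverts H" using pg unfolding pair_graph_iff by auto
  ultimately show "\<exists>x\<in>X. \<exists>y\<in>pverts H - {v} - X. (x, y) \<in> parcs H" using ab by blast
qed

lemma biconnected_iso:
  assumes b: "biconnected W F" and f: "inj_on f V" "W = f ` V" "F = map_prod f f ` E" and E: "E \<subseteq> V \<times> V"
  shows "biconnected V E"
proof (rule biconnectedI)
  show "finite V" using b f(1,2) unfolding biconnected_def by (simp add: finite_image_iff)
  show "3 \<le> card V" using b f(1,2) unfolding biconnected_def by (simp add: card_image)
  show "E \<subseteq> V \<times> V" by (fact E)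
  fix v X assume v: "v \<in> V" and X: "X \<subseteq> V - {v}" "X \<noteq> {}" "V - {v} - X \<noteq> {}"
  have i: "f x = f y \<longleftrightarrow> x = y" if "x \<in> V" "y \<in> V" for x y using f(1) that by (auto simp: inj_on_def)
  have 1: "f ` X \<subseteq> W - {f v}" using X v i f(2) by blast
  have 2: "W - {f v} - f ` X \<noteq> {}"
  proof -
    obtain y where y: "y \<in> V - {v} - X" using X by blast
    have "f y \<in> W - {f v} - f ` X" using y X v i f(2) by blast
    then show ?thesis by blast
  qed
  obtain x y where xy: "x \<in> f ` X" "y \<in> W" "y \<noteq> f v" "y \<notin> f ` X" "(x, y) \<in> F"
    using biconnectedD[OF b 1 _ 2] X(2) by blast
  then obtain a b where ab: "(a, b) \<in> E" "x = f a" "y = f b" using f(3) by auto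
  have V: "a \<in> V" "b \<in> V" using ab E by auto
  have "a \<in> X" using xy(1) ab(2) V X(1) i by blast
  moreover have "b \<in> V - {v} - X" using xy(3,4) ab(3) V by blast
  ultimately show "\<exists>x\<in>X. \<exists>y\<in>V - {v} - X. (x, y) \<in> E" using ab(1) by blast
qed

text \<open>If \<open>V\<close> met both sides of the bridge, then removing \<open>x\<close> would
  cut \<open>V\<close> unless \<open>x\<close> is its only vertex outside \<open>A\<close>; in that
  case \<open>V\<close> has a vertex in \<open>A\<close> other than \<open>r\<close>, and removing
  \<open>r\<close> cuts it off from \<open>x\<close>.\<close>

lemma biconnected_bridge:
  assumes b: "biconnected V E" and cut: "\<And>p q. (p, q) \<in> E \<Longrightarrow> p \<in> A \<Longrightarrow> q \<notin> A \<Longrightarrow> p = r \<and> q = x"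
    and "x \<notin> A" "r \<in> A"
  shows "V \<inter> A = {} \<or> V \<subseteq> A"
proof (rule ccontr)
  assume *: "\<not> (V \<inter> A = {} \<or> V \<subseteq> A)"
  show False
  proof (cases "V - {x} - V \<inter> A = {}")
    case False
    have "V \<inter> A \<subseteq> V - {x}" using assms(3) by blast
    then obtain p q where "p \<in> V \<inter> A" "q \<in> V" "q \<noteq> x" "q \<notin> V \<inter> A" "(p, q) \<in> E"
      using biconnectedD[OF b _ _ False] * by blast
    then show False using cut by blast
  next
    case True
    let ?X = "V \<inter> A - {r}"
    have x: "x \<in> V" using True * by blast
    have "V \<subseteq> insert x (insert r ?X)" using True by blast
    have "?X \<noteq> {}"
    proof
      assume "?X = {}"
      then have "V \<subseteq> {x, r}" using True by blast
      then have "card V \<le> card {x, r}" by (intro card_mono) auto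
      also have "\<dots> \<le> 2" by (simp add: card_insert_if)
      finally show False using b unfolding biconnected_def by simp
    qed
    moreover have "V - {r} - ?X \<noteq> {}" using x assms(3,4) by blast
    ultimately obtain p q where "p \<in> ?X" "q \<in> V" "q \<noteq> r" "q \<notin> ?X" "(p, q) \<in> E"
      using biconnectedD[OF b, of ?X r] by blast
    then show False using cut by blast
  qed
qed

text \<open>After removal of \<open>p\<close> the vertex \<open>x\<close> still needs an arc to the
  rest. Applied along a path of vertices of degree two, this pulls the whole path into
  \<open>V\<close>.\<close>

lemma biconnected_neighbour:
  assumes b: "biconnected V E" and x: "x \<in> V" and nb: "\<And>y. (x, y) \<in> E \<Longrightarrow> y = p \<or> y = q" and "x \<noteq> p"
  shows "q \<in> V"
proof -
  have "V - {p} - {x} \<noteq> {}"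
  proof
    assume "V - {p} - {x} = {}"
    then have "V \<subseteq> {p, x}" by blast
    then have "card V \<le> card {p, x}" by (intro card_mono) auto
    also have "\<dots> \<le> 2" by (simp add: card_insert_if)
    finally show False using b unfolding biconnected_def by simp
  qed
  then obtain a y where "a \<in> {x}" "y \<in> V" "y \<noteq> p" "(a, y) \<in> E"
    using biconnectedD[OF b, of "{x}" p] x assms(4) by blast
  then show ?thesis using nb by blast
qed

section \<open>Forcing assignments\<close>

definition list_colouring :: "'a pair_pre_digraph \<Rightarrow> ('a \<Rightarrow> nat set) \<Rightarrow> ('a \<Rightarrow> nat) \<Rightarrow> bool" where
  "list_colouring G L c \<longleftrightarrow> colouring G c \<and> respects_lists G L c"

text \<open>
  Among the uncolourable assignments take one that uses as many colours as possible. Exchanging a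
  colour that occurs on both ends of an edge for a new colour \<open>z\<close> on one end \<open>u\<close> makes it
  colourable, and only by giving \<open>u\<close> the colour \<open>z\<close>.
\<close>

lemma forcing_assignment:
  assumes g: "pair_graph G" and nc: "\<not> choosable l G" and l: "0 < l"
  obtains L u z c where "regular_assignment l G L" "u \<in> pverts G" "1 \<le> z" "list_colouring G L c"
    "\<And>c. list_colouring G L c \<Longrightarrow> c u = z"
proof -
  let ?V = "pverts G"
  have fin: "finite ?V" using g unfolding pair_graph_iff by blast
  let ?P = "\<lambda>L. regular_assignment l G L \<and> (\<nexists>c. list_colouring G L c)"
  let ?f = "\<lambda>L. card (\<Union>u\<in>?V. L u :: nat set)"
  have "\<exists>L. ?P L" using nc unfolding choosable_def list_colouring_def by blast
  then obtain L1 where "?P L1" ..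
  \<comment> \<open>At most \<open>l\<close> colours per vertex can occur, so the maximum
    exists.\<close>
  moreover have "\<forall>L. ?P L \<longrightarrow> ?f L < Suc (card ?V * l)"
  proof (intro allI impI)
    fix L assume "?P L"
    then have "card (L u) = l" if "u \<in> ?V" for u using that unfolding regular_assignment_def by blast
    then have "(\<Sum>u\<in>?V. card (L u)) = card ?V * l" by simp
    then show "?f L < Suc (card ?V * l)" using card_UN_le[OF fin, of L] by simp
  qed
  ultimately obtain L where L: "?P L" and max: "\<And>L'. ?P L' \<Longrightarrow> ?f L' \<le> ?f L"
    using ex_has_greatest_nat[of ?P L1 ?f] by blast
  have reg: "L u \<subseteq> {1..}" "finite (L u)" "card (L u) = l" if "u \<in> ?V" for u
    using L that unfolding regular_assignment_def by blast+
  let ?U = "\<Union>u\<in>?V. L u"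
  have finU: "finite ?U" using fin reg(2) by blast
  \<comment> \<open>If no edge had a colour in both lists, any choice from the lists would be a
    colouring.\<close>
  have "\<exists>u v b. (u, v) \<in> parcs G \<and> b \<in> L u \<and> b \<in> L v"
  proof (rule ccontr)
    assume *: "\<nexists>u v b. (u, v) \<in> parcs G \<and> b \<in> L u \<and> b \<in> L v"
    define c where "c u = (SOME a. a \<in> L u)" for u
    have c: "c u \<in> L u" if "u \<in> ?V" for u
    proof -
      have "L u \<noteq> {}" using reg(3)[OF that] l by auto
      then show ?thesis unfolding c_def by (simp add: some_in_eq)
    qed
    have "list_colouring G L c"
      unfolding list_colouring_def colouring_def respects_lists_def
    proof (intro conjI ballI)
      show "1 \<le> c u" if "u \<in> ?V" for u using c[OF that] reg(1)[OF that] by auto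
      show "case e of (u, v) \<Rightarrow> c u \<noteq> c v" if e: "e \<in> parcs G" for e
      proof -
        obtain u v where uv: "e = (u, v)" by fastforce
        then have "u \<in> ?V" "v \<in> ?V" using e g unfolding pair_graph_iff by auto
        then show ?thesis using c * e uv by (metis case_prodI)
      qed
    qed (rule c)
    then show False using L by blast
  qed
  then obtain u v b where uv: "(u, v) \<in> parcs G" and b: "b \<in> L u" "b \<in> L v" by blast
  have V: "u \<in> ?V" "v \<in> ?V" "u \<noteq> v" using uv g unfolding pair_graph_iff by auto
  define z where "z = Suc (Max ?U)"
  have bU: "b \<in> ?U" using b V by blast
  have zU: "z \<notin> ?U"
  proof
    assume "z \<in> ?U"
    then have "z \<le> Max ?U" using finU by (rule Max_ge[rotated])
    then show False unfolding z_def by simp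
  qed
  let ?L = "L(u := insert z (L u - {b}))"
  have reg': "regular_assignment l G ?L"
    unfolding regular_assignment_def
  proof
    fix w assume w: "w \<in> ?V"
    show "?L w \<subseteq> {1..} \<and> finite (?L w) \<and> card (?L w) = l"
    proof (cases "w = u")
      case True
      have "z \<notin> L u" using zU V(1) by blast
      then have "card (insert z (L u - {b})) = l" using reg[OF V(1)] b l by simp
      then show ?thesis using True reg[OF V(1)] by (auto simp: z_def)
    qed (use reg[OF w] in simp)
  qed
  \<comment> \<open>\<open>b\<close> survives in the list of \<open>v\<close>, so the exchange loses
    no colour and gains \<open>z\<close>; by maximality the new assignment is colourable.\<close>
  have "(\<Union>w\<in>?V. ?L w) = insert z ?U"
  proof
    show "(\<Union>w\<in>?V. ?L w) \<subseteq> insert z ?U"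
    proof
      fix a assume "a \<in> (\<Union>w\<in>?V. ?L w)"
      then obtain w where "w \<in> ?V" "a \<in> ?L w" by blast
      then show "a \<in> insert z ?U" by (cases "w = u") auto
    qed
    show "insert z ?U \<subseteq> (\<Union>w\<in>?V. ?L w)"
    proof
      fix a assume "a \<in> insert z ?U"
      then consider "a = z" | "a = b" | w where "w \<in> ?V" "a \<in> L w" "a \<noteq> b" by blast
      then show "a \<in> (\<Union>w\<in>?V. ?L w)"
      proof cases
        case 1
        then show ?thesis using V(1) by (intro UN_I[of u]) auto
      next
        case 2
        then show ?thesis using V b by (intro UN_I[of v]) auto
      next
        case 3
        then show ?thesis by (intro UN_I[of w]) auto
      qed
    qed
  qed
  then have "?f ?L = Suc (?f L)" using finU zU by simp
  then have "\<not> ?f ?L \<le> ?f L" by simp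
  then have "\<not> ?P ?L" using max by (rule contrapos_nn)
  then obtain c where c: "list_colouring G ?L c" using reg' by blast
  have only: "c u = z" if c: "list_colouring G ?L c" for c
  proof (rule ccontr)
    assume n: "c u \<noteq> z"
    have "c w \<in> L w" if "w \<in> ?V" for w
    proof -
      have "c w \<in> ?L w" using c that unfolding list_colouring_def respects_lists_def by blast
      then show ?thesis using n by (cases "w = u") auto
    qed
    then have "list_colouring G L c" using c unfolding list_colouring_def respects_lists_def by blast
    then show False using L by blast
  qed
  have "1 \<le> z" by (simp add: z_def)
  then show ?thesis by (rule that[OF reg' V(1) _ c]) (rule only)
qed

section \<open>The grid\<close>

datatype loc = Cell | Inner nat nat

text \<open>
  Cell \<open>(i, j)\<close> has \<open>16\<close> parallel paths to its right neighbour and \<open>16\<close> to its lower neighbour, one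
  for each pair of colours; \<open>Inner k m\<close> is the \<open>m\<close>-th of the \<open>l\<close> inner vertices of path \<open>k\<close>.
\<close>

fun path_node :: "nat \<Rightarrow> nat \<Rightarrow> nat \<Rightarrow> nat \<Rightarrow> nat \<Rightarrow> nat \<times> nat \<times> loc" where
  "path_node l i j k m =
     (if m = 0 then (i, j, Cell) else if m \<le> l then (i, j, Inner k m)
      else if k < 16 then (i, Suc j, Cell) else (Suc i, j, Cell))"

declare path_node.simps [simp del]

definition scaffold_verts :: "nat \<Rightarrow> nat \<Rightarrow> nat \<Rightarrow> (nat \<times> nat \<times> loc) set" where
  "scaffold_verts l R C = {..<R} \<times> {..<C} \<times> insert Cell {Inner k m | k m. k < 32 \<and> 1 \<le> m \<and> m \<le> l}"

text \<open>The paths that would leave the grid at its right and lower border only lose their final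
  edge. Thus every cell carries the same 32 paths, and the vertex set is a product that can be
  numbered arithmetically.\<close>

definition scaffold_edge :: "nat \<Rightarrow> nat \<Rightarrow> nat \<Rightarrow> nat \<times> nat \<times> loc \<Rightarrow> nat \<times> nat \<times> loc \<Rightarrow> bool" where
  "scaffold_edge l R C x y \<longleftrightarrow> (\<exists>i<R. \<exists>j<C. \<exists>k<32. \<exists>m\<le>l. x = path_node l i j k m \<and> y = path_node l i j k (Suc m)) \<and>
     y \<in> scaffold_verts l R C"

definition scaffold :: "nat \<Rightarrow> nat \<Rightarrow> nat \<Rightarrow> (nat \<times> nat \<times> loc) pair_pre_digraph" where
  "scaffold l R C = \<lparr>pverts = scaffold_verts l R C,
     parcs = {(x, y). scaffold_edge l R C x y \<or> scaffold_edge l R C y x}\<rparr>"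

lemma finite_scaffold_verts: "finite (scaffold_verts l R C)"
proof -
  have "{Inner k m | k m. k < 32 \<and> 1 \<le> m \<and> m \<le> l} = (\<lambda>(k, m). Inner k m) ` ({..<32} \<times> {1..l})" by auto
  then show ?thesis unfolding scaffold_verts_def by simp
qed

lemma scaffold_vertsI:
  "i < R \<Longrightarrow> j < C \<Longrightarrow> (i, j, Cell) \<in> scaffold_verts l R C"
  "i < R \<Longrightarrow> j < C \<Longrightarrow> k < 32 \<Longrightarrow> 1 \<le> m \<Longrightarrow> m \<le> l \<Longrightarrow> (i, j, Inner k m) \<in> scaffold_verts l R C"
  unfolding scaffold_verts_def by auto

lemma scaffold_vertsD:
  assumes "(i, j, x) \<in> scaffold_verts l R C"
  shows "i < R" "j < C" "x = Cell \<or> (\<exists>k m. x = Inner k m \<and> k < 32 \<and> 1 \<le> m \<and> m \<le> l)"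
  using assms unfolding scaffold_verts_def by auto

lemma scaffold_edge_verts:
  assumes "scaffold_edge l R C x y"
  shows "x \<in> scaffold_verts l R C" "y \<in> scaffold_verts l R C" "x \<noteq> y"
proof -
  obtain i j k m where *: "i < R" "j < C" "k < 32" "m \<le> l" "x = path_node l i j k m" "y = path_node l i j k (Suc m)"
    "y \<in> scaffold_verts l R C" using assms unfolding scaffold_edge_def by blast
  show "x \<in> scaffold_verts l R C" using * by (auto simp: path_node.simps intro!: scaffold_vertsI)
  show "y \<in> scaffold_verts l R C" by fact
  show "x \<noteq> y" using * by (auto simp: path_node.simps split: if_splits)
qed

lemma pair_graph_scaffold: "pair_graph (scaffold l R C)"
  unfolding pair_graph_iff scaffold_def by (auto simp: finite_scaffold_verts dest: scaffold_edge_verts)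

section \<open>A plane drawing of the grid\<close>

definition bend :: "nat \<Rightarrow> real \<Rightarrow> real" where
  "bend k t = (real (k mod 16) + 1) / 40 * (t * (1 - t))"

text \<open>The 16 paths of a bundle are flat parabolas of different heights over one side of a unit
  square. The factor in \<open>bend\<close> is at most 16/40, below 1, so
  \<open>bend k t < t\<close>: horizontal paths stay on one side of the diagonal of the square and
  vertical ones on the other.\<close>

definition curve :: "nat \<Rightarrow> nat \<Rightarrow> nat \<Rightarrow> real \<Rightarrow> complex" where
  "curve i j k t = (if k < 16 then Complex (real j + t) (real i + bend k t) else Complex (real j + bend k t) (real i + t))"

lemma bend_bounds:
  assumes "0 < t" "t < 1"
  shows "0 < bend k t" "bend k t < t" "bend k t < 1 - t"
proof -
  let ?c = "(real (k mod 16) + 1) / 40"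
  have "k mod 16 < 16" by simp
  then have c: "0 < ?c" "?c < 1" by simp_all
  have p: "0 < t * (1 - t)" using assms by simp
  show "0 < bend k t" unfolding bend_def using c p by simp
  have "bend k t < 1 * (t * (1 - t))" unfolding bend_def using c p by (intro mult_strict_right_mono) auto
  moreover have "t * (1 - t) \<le> t" "t * (1 - t) \<le> 1 - t" using assms by (simp_all add: mult_left_le mult_left_le_one_le)
  ultimately show "bend k t < t" "bend k t < 1 - t" by linarith+
qed

lemma bend_ends [simp]: "bend k 0 = 0" "bend k 1 = 0"
  unfolding bend_def by simp_all

lemma bend_inj: "0 < t \<Longrightarrow> t < 1 \<Longrightarrow> bend k t = bend k' t \<Longrightarrow> k mod 16 = k' mod 16"
  unfolding bend_def by simp

lemma real_nat_eq_add:
  assumes "real a + s = real b + t" "0 \<le> s" "s < 1" "0 \<le> t" "t < 1"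
  shows "a = b" "s = t"
proof -
  have "real a < real (Suc b)" using assms by simp
  moreover have "real b < real (Suc a)" using assms by simp
  ultimately show "a = b" by simp
  then show "s = t" using assms(1) by simp
qed

text \<open>The integer parts of the coordinates give the cell, the fractional parts the parameter
  and the bend. A horizontal and a vertical curve could only meet with \<open>t = bend k' t'\<close>
  and \<open>t' = bend k t\<close>, and then each parameter would be smaller than the other.\<close>

lemma curve_inj:
  assumes t: "0 < t" "t < 1" "0 < t'" "t' < 1" and k: "k < 32" "k' < 32" and eq: "curve i j k t = curve i' j' k' t'"
  shows "i = i' \<and> j = j' \<and> k = k' \<and> t = t'"
proof -
  note b = bend_bounds[OF t(1,2), of k] and b' = bend_bounds[OF t(3,4), of k']
  consider "k < 16" "k' < 16" | "\<not> k < 16" "\<not> k' < 16" | "k < 16" "\<not> k' < 16" | "\<not> k < 16" "k' < 16" by blast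
  then show ?thesis
  proof cases
    case 1
    then have e: "real j + t = real j' + t'" "real i + bend k t = real i' + bend k' t'" using eq by (simp_all add: curve_def)
    have j: "j = j'" "t = t'" using real_nat_eq_add[OF e(1)] t by simp_all
    have i: "i = i'" "bend k t = bend k' t'" using real_nat_eq_add[OF e(2)] b b' t by simp_all
    have "k mod 16 = k' mod 16" by (rule bend_inj[OF t(1,2)]) (use i(2) j(2) in simp)
    then show ?thesis using 1 i j by simp
  next
    case 2
    then have e: "real i + t = real i' + t'" "real j + bend k t = real j' + bend k' t'" using eq by (simp_all add: curve_def)
    have i: "i = i'" "t = t'" using real_nat_eq_add[OF e(1)] t by simp_all
    have j: "j = j'" "bend k t = bend k' t'" using real_nat_eq_add[OF e(2)] b b' t by simp_all
    have "k mod 16 = k' mod 16" by (rule bend_inj[OF t(1,2)]) (use i(2) j(2) in simp)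
    moreover have "n mod 16 = n - 16" if "\<not> n < 16" "n < 32" for n :: nat using that by (simp add: le_mod_geq)
    ultimately have "k = k'" using 2 k by force
    then show ?thesis using i j by simp
  next
    case 3
    then have e: "real j + t = real j' + bend k' t'" "real i + bend k t = real i' + t'" using eq by (simp_all add: curve_def)
    have "t = bend k' t'" using real_nat_eq_add(2)[OF e(1)] b' t by simp
    moreover have "bend k t = t'" using real_nat_eq_add(2)[OF e(2)] b t by simp
    ultimately show ?thesis using b b' by simp
  next
    case 4
    then have e: "real j + bend k t = real j' + t'" "real i + t = real i' + bend k' t'" using eq by (simp_all add: curve_def)
    have "t' = bend k t" using real_nat_eq_add(2)[OF e(1)] b t by simp
    moreover have "t = bend k' t'" using real_nat_eq_add(2)[OF e(2)] b' t by simp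
    ultimately show ?thesis using b b' by simp
  qed
qed

lemma curve_not_cell:
  assumes t: "0 < t" "t < 1"
  shows "curve i j k t \<noteq> Complex (real j') (real i')"
proof
  assume eq: "curve i j k t = Complex (real j') (real i')"
  show False
  proof (cases "k < 16")
    case True
    then have "real j + t = real j' + 0" using eq by (simp add: curve_def)
    then show False using real_nat_eq_add(2) t by fastforce
  next
    case False
    then have "real i + t = real i' + 0" using eq by (simp add: curve_def)
    then show False using real_nat_eq_add(2) t by fastforce
  qed
qed

lemma curve_0: "curve i j k 0 = Complex (real j) (real i)"
  unfolding curve_def by simp

lemma curve_1: "curve i j k 1 = (if k < 16 then Complex (real (Suc j)) (real i) else Complex (real j) (real (Suc i)))"
  unfolding curve_def by simp

lemma curve_inj_on: "inj_on (curve i j k) {0..1}"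
  unfolding curve_def by (rule inj_onI) (auto split: if_splits)

lemma continuous_on_curve: "continuous_on S (curve i j k)"
proof -
  have "continuous_on S (bend k)" unfolding bend_def by (intro continuous_intros)
  then show ?thesis unfolding curve_def Complex_eq
    by (cases "k < 16") (auto intro!: continuous_intros)
qed

fun scaffold_pos :: "nat \<Rightarrow> nat \<times> nat \<times> loc \<Rightarrow> complex" where
  "scaffold_pos l (i, j, Cell) = Complex (real j) (real i)"
| "scaffold_pos l (i, j, Inner k m) = curve i j k (real m / real (Suc l))"

lemma scaffold_pos_path_node:
  assumes "m \<le> Suc l"
  shows "scaffold_pos l (path_node l i j k m) = curve i j k (real m / real (Suc l))"
proof -
  consider "m = 0" | "0 < m" "m \<le> l" | "m = Suc l" using assms by linarith
  then show ?thesis by cases (auto simp: path_node.simps curve_0 curve_1)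
qed

definition scaffold_arc :: "nat \<Rightarrow> nat \<Rightarrow> nat \<Rightarrow> nat \<Rightarrow> nat \<Rightarrow> real \<Rightarrow> complex" where
  "scaffold_arc l i j k m = curve i j k \<circ> linepath (real m / real (Suc l)) (real (Suc m) / real (Suc l))"

lemma scaffold_arc:
  assumes "m \<le> l"
  shows "arc (scaffold_arc l i j k m)"
    and "pathstart (scaffold_arc l i j k m) = scaffold_pos l (path_node l i j k m)"
    and "pathfinish (scaffold_arc l i j k m) = scaffold_pos l (path_node l i j k (Suc m))"
    and "path_image (scaffold_arc l i j k m) = curve i j k ` {real m / real (Suc l)..real (Suc m) / real (Suc l)}"
proof -
  let ?a = "real m / real (Suc l)" and ?b = "real (Suc m) / real (Suc l)"
  have ab: "?a < ?b" "0 \<le> ?a" "?b \<le> 1" using assms by (simp_all add: divide_strict_right_mono)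
  have im: "path_image (linepath ?a ?b) = {?a..?b}" using ab by (simp add: closed_segment_eq_real_ivl)
  have "arc (linepath ?a ?b)" using ab by (intro arc_linepath) simp
  then have l: "path (linepath ?a ?b)" "inj_on (linepath ?a ?b) {0..1}" unfolding arc_def by auto
  have "path (scaffold_arc l i j k m)" unfolding scaffold_arc_def
    by (rule path_continuous_image[OF l(1) continuous_on_curve])
  moreover have "inj_on (scaffold_arc l i j k m) {0..1}" unfolding scaffold_arc_def
  proof (rule comp_inj_on[OF l(2)])
    have "linepath ?a ?b ` {0..1} \<subseteq> {0..1}" using im ab unfolding path_image_def by auto
    then show "inj_on (curve i j k) (linepath ?a ?b ` {0..1})" by (rule inj_on_subset[OF curve_inj_on])
  qed
  ultimately show "arc (scaffold_arc l i j k m)" unfolding arc_def ..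
  show "pathstart (scaffold_arc l i j k m) = scaffold_pos l (path_node l i j k m)"
    "pathfinish (scaffold_arc l i j k m) = scaffold_pos l (path_node l i j k (Suc m))"
    using assms by (simp_all add: scaffold_arc_def pathstart_compose pathfinish_compose scaffold_pos_path_node del: of_nat_Suc)
  show "path_image (scaffold_arc l i j k m) = curve i j k ` {?a..?b}"
    unfolding scaffold_arc_def path_image_compose im ..
qed

lemma inner_param: "1 \<le> m \<Longrightarrow> m \<le> l \<Longrightarrow> 0 < real m / real (Suc l) \<and> real m / real (Suc l) < 1"
  by simp

lemma inj_on_scaffold_pos: "inj_on (scaffold_pos l) (scaffold_verts l R C)"
proof (rule inj_onI)
  fix x y assume x: "x \<in> scaffold_verts l R C" and y: "y \<in> scaffold_verts l R C" and eq: "scaffold_pos l x = scaffold_pos l y"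
  obtain i j a where xa: "x = (i, j, a)" by (metis surj_pair)
  obtain i' j' b where yb: "y = (i', j', b)" by (metis surj_pair)
  have a: "a = Cell \<or> (\<exists>k m. a = Inner k m \<and> k < 32 \<and> 1 \<le> m \<and> m \<le> l)" using x unfolding xa by (rule scaffold_vertsD)
  have b: "b = Cell \<or> (\<exists>k m. b = Inner k m \<and> k < 32 \<and> 1 \<le> m \<and> m \<le> l)" using y unfolding yb by (rule scaffold_vertsD)
  show "x = y"
  proof (cases a)
    case Cell
    show ?thesis
    proof (cases b)
      case Cell
      then show ?thesis using eq \<open>a = Cell\<close> unfolding xa yb by simp
    next
      case (Inner k m)
      then show ?thesis using eq \<open>a = Cell\<close> b inner_param[of m l] curve_not_cell[of "real m / real (Suc l)"] unfolding xa yb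
        by (metis loc.distinct(1) loc.inject scaffold_pos.simps)
    qed
  next
    case (Inner k m)
    then have m: "k < 32" "1 \<le> m" "m \<le> l" using a by auto
    show ?thesis
    proof (cases b)
      case Cell
      then show ?thesis using eq \<open>a = Inner k m\<close> m inner_param[of m l] curve_not_cell[of "real m / real (Suc l)"] unfolding xa yb
        by (metis scaffold_pos.simps)
    next
      case (Inner k' m')
      then have m': "k' < 32" "1 \<le> m'" "m' \<le> l" using b by auto
      have "curve i j k (real m / real (Suc l)) = curve i' j' k' (real m' / real (Suc l))"
        using eq unfolding xa yb \<open>a = Inner k m\<close> Inner by simp
      then have "i = i' \<and> j = j' \<and> k = k' \<and> real m / real (Suc l) = real m' / real (Suc l)"
        by (rule curve_inj[rotated 6]) (use m m' inner_param[of m l] inner_param[of m' l] in simp_all)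
      then show ?thesis unfolding xa yb \<open>a = Inner k m\<close> Inner by simp
    qed
  qed
qed

lemma curve_vertex:
  assumes t: "0 < t" "t < 1" and k: "k < 32" and v: "v \<in> scaffold_verts l R C" and eq: "curve i j k t = scaffold_pos l v"
  obtains m where "1 \<le> m" "m \<le> l" "t = real m / real (Suc l)" "v = (i, j, Inner k m)"
proof -
  obtain i' j' b where vb: "v = (i', j', b)" by (metis surj_pair)
  have b: "b = Cell \<or> (\<exists>k m. b = Inner k m \<and> k < 32 \<and> 1 \<le> m \<and> m \<le> l)" using v unfolding vb by (rule scaffold_vertsD)
  have "b \<noteq> Cell" using eq curve_not_cell[OF t] unfolding vb by auto
  then obtain k' m where m: "b = Inner k' m" "k' < 32" "1 \<le> m" "m \<le> l" using b by blast
  have "curve i j k t = curve i' j' k' (real m / real (Suc l))" using eq unfolding vb m(1) by simp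
  then have "i = i' \<and> j = j' \<and> k = k' \<and> t = real m / real (Suc l)"
    by (rule curve_inj[rotated 6]) (use m t k inner_param[of m l] in simp_all)
  then show ?thesis using that m vb by simp
qed

lemma param_cases:
  assumes "m \<le> l" "t \<in> {real m / real (Suc l)..real (Suc m) / real (Suc l)}"
  shows "t = 0 \<and> m = 0 \<or> t = 1 \<and> m = l \<or> 0 < t \<and> t < 1"
proof -
  have h: "0 \<le> real m / real (Suc l)" "real (Suc m) / real (Suc l) \<le> 1" using assms(1) by simp_all
  have b: "real m / real (Suc l) \<le> t" "t \<le> real (Suc m) / real (Suc l)"
    using assms(2) unfolding atLeastAtMost_iff by blast+
  have t: "0 \<le> t" "t \<le> 1" using order_trans[OF h(1) b(1)] order_trans[OF b(2) h(2)] by blast+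
  have "m = 0" if "t = 0"
  proof -
    have "real m / real (Suc l) \<le> 0" using b(1) that by simp
    then show ?thesis by (simp add: divide_le_0_iff)
  qed
  moreover have "m = l" if "t = 1"
  proof -
    have "1 \<le> real (Suc m) / real (Suc l)" using b(2) that by simp
    then show ?thesis using assms(1) by (simp add: le_divide_eq)
  qed
  ultimately show ?thesis using t by fastforce
qed

lemma scaffold_arc_vertex:
  assumes m: "m \<le> l" and k: "k < 32" and v: "v \<in> scaffold_verts l R C"
    and z: "scaffold_pos l v \<in> path_image (scaffold_arc l i j k m)"
  shows "scaffold_pos l v \<in> {scaffold_pos l (path_node l i j k m), scaffold_pos l (path_node l i j k (Suc m))}"
proof -
  let ?q = "\<lambda>m. real m / real (Suc l)"
  obtain t where t: "t \<in> {?q m..?q (Suc m)}" "scaffold_pos l v = curve i j k t" using z unfolding scaffold_arc(4)[OF m] by blast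
  have p: "scaffold_pos l (path_node l i j k m) = curve i j k (?q m)"
    "scaffold_pos l (path_node l i j k (Suc m)) = curve i j k (?q (Suc m))"
    using m by (simp_all add: scaffold_pos_path_node del: of_nat_Suc)
  consider "t = 0" "m = 0" | "t = 1" "m = l" | "0 < t" "t < 1" using param_cases[OF m t(1)] by blast
  then show ?thesis
  proof cases
    case 3
    obtain m' where m': "1 \<le> m'" "m' \<le> l" "t = ?q m'" using curve_vertex[OF 3 k v t(2)[symmetric]] by blast
    have "?q m \<le> ?q m'" "?q m' \<le> ?q (Suc m)" using t(1) m'(3) by auto
    then have "m \<le> m'" "m' \<le> Suc m" by (simp_all add: divide_le_cancel del: of_nat_Suc)
    then have "m' = m \<or> m' = Suc m" by linarith
    then show ?thesis unfolding p t(2) m'(3) by blast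
  qed (use p t(2) in auto)
qed

lemma scaffold_arcs_meet:
  assumes m: "m \<le> l" "m' \<le> l" and k: "k < 32" "k' < 32" and ne: "(i, j, k, m) \<noteq> (i', j', k', m')"
    and z: "z \<in> path_image (scaffold_arc l i j k m)" "z \<in> path_image (scaffold_arc l i' j' k' m')"
  shows "z \<in> {scaffold_pos l (path_node l i j k m), scaffold_pos l (path_node l i j k (Suc m))}"
proof -
  let ?q = "\<lambda>m. real m / real (Suc l)"
  obtain t where t: "t \<in> {?q m..?q (Suc m)}" "z = curve i j k t" using z(1) unfolding scaffold_arc(4)[OF m(1)] by blast
  obtain t' where t': "t' \<in> {?q m'..?q (Suc m')}" "z = curve i' j' k' t'" using z(2) unfolding scaffold_arc(4)[OF m(2)] by blast
  have p: "scaffold_pos l (path_node l i j k m) = curve i j k (?q m)"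
    "scaffold_pos l (path_node l i j k (Suc m)) = curve i j k (?q (Suc m))"
    using m by (simp_all add: scaffold_pos_path_node del: of_nat_Suc)
  consider "t = 0" "m = 0" | "t = 1" "m = l" | "0 < t" "t < 1" using param_cases[OF m(1) t(1)] by blast
  then show ?thesis
  proof cases
    case 3
    have "0 < t' \<and> t' < 1"
    proof (rule ccontr)
      assume "\<not> ?thesis"
      then have "t' = 0 \<or> t' = 1" using param_cases[OF m(2) t'(1)] by blast
      then have "\<exists>a b. z = Complex (real a) (real b)" unfolding t'(2) using curve_0 curve_1 by metis
      then show False using curve_not_cell[OF 3] t(2) by metis
    qed
    then have e: "i = i' \<and> j = j' \<and> k = k' \<and> t = t'"
      using curve_inj[OF 3, of t' k k' i j i' j'] k t(2) t'(2) by blast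
    then have "m \<noteq> m'" using ne by blast
    have "?q m \<le> ?q (Suc m')" "?q m' \<le> ?q (Suc m)" using t(1) t'(1) e by auto
    then have "m \<le> Suc m'" "m' \<le> Suc m" by (simp_all add: divide_le_cancel del: of_nat_Suc)
    then consider "m = Suc m'" | "m' = Suc m" using \<open>m \<noteq> m'\<close> by linarith
    then show ?thesis
    proof cases
      case 1
      then have "t = ?q m" using t(1) t'(1) e by auto
      then show ?thesis unfolding p t(2) by blast
    next
      case 2
      then have "t = ?q (Suc m)" using t(1) t'(1) e by auto
      then show ?thesis unfolding p t(2) by blast
    qed
  qed (use p t(2) in auto)
qed

definition edge_index :: "nat \<Rightarrow> nat \<Rightarrow> nat \<Rightarrow> (nat \<times> nat \<times> loc) set \<Rightarrow> nat \<times> nat \<times> nat \<times> nat \<Rightarrow> bool" where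
  "edge_index l R C e = (\<lambda>(i, j, k, m). i < R \<and> j < C \<and> k < 32 \<and> m \<le> l \<and>
     e = {path_node l i j k m, path_node l i j k (Suc m)} \<and> path_node l i j k (Suc m) \<in> scaffold_verts l R C)"

lemma edge_index_ex:
  assumes "(x, y) \<in> parcs (scaffold l R C)"
  shows "\<exists>a. edge_index l R C {x, y} a"
proof -
  have "scaffold_edge l R C x y \<or> scaffold_edge l R C y x" using assms by (simp add: scaffold_def)
  then obtain i j k m where "i < R" "j < C" "k < 32" "m \<le> l" "{x, y} = {path_node l i j k m, path_node l i j k (Suc m)}"
    "path_node l i j k (Suc m) \<in> scaffold_verts l R C"
    unfolding scaffold_edge_def by (elim disjE conjE exE) (auto simp: insert_commute)
  then show ?thesis unfolding edge_index_def by (intro exI[of _ "(i, j, k, m)"]) simp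
qed

theorem planar_scaffold: "planar (scaffold l R C)"
proof -
  let ?S = "scaffold l R C" and ?p = "scaffold_pos l"
  \<comment> \<open>An edge is known only as the set of its ends; some index that produces it is
    chosen once, so both directions get the same arc.\<close>
  define ix where "ix e = (SOME a. edge_index l R C e a)" for e
  define \<gamma> where "\<gamma> e = (case ix e of (i, j, k, m) \<Rightarrow> scaffold_arc l i j k m)" for e
  have V: "pverts ?S = scaffold_verts l R C" by (simp add: scaffold_def)
  have ix: "edge_index l R C {x, y} (ix {x, y})" if "(x, y) \<in> parcs ?S" for x y
    unfolding ix_def using edge_index_ex[OF that] by (rule someI_ex)
  have "drawing ?S ?p \<gamma>"
  proof (rule drawingI[OF _ _ _ _ _ pair_graph_scaffold])
    show "inj_on ?p (pverts ?S)" unfolding V by (rule inj_on_scaffold_pos)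
    fix x y assume xy: "(x, y) \<in> parcs ?S"
    obtain i j k m where a: "ix {x, y} = (i, j, k, m)" by (metis surj_pair)
    have e: "k < 32" "m \<le> l" "{x, y} = {path_node l i j k m, path_node l i j k (Suc m)}"
      using ix[OF xy] unfolding a edge_index_def by auto
    have g: "\<gamma> {x, y} = scaffold_arc l i j k m" unfolding \<gamma>_def a by simp
    have ends: "{?p x, ?p y} = {?p (path_node l i j k m), ?p (path_node l i j k (Suc m))}"
      using arg_cong[OF e(3), of "image ?p"] by simp
    show "arc (\<gamma> {x, y})" unfolding g by (rule scaffold_arc(1)[OF e(2)])
    show "{pathstart (\<gamma> {x, y}), pathfinish (\<gamma> {x, y})} = {?p x, ?p y}"
      unfolding g ends using scaffold_arc(2,3)[OF e(2)] by simp
    show "path_image (\<gamma> {x, y}) \<inter> ?p ` pverts ?S \<subseteq> {?p x, ?p y}"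
      unfolding g ends V using scaffold_arc_vertex[OF e(2,1)] by blast
    fix x' y' assume xy': "(x', y') \<in> parcs ?S" and ne: "{x, y} \<noteq> {x', y'}"
    obtain i' j' k' m' where a': "ix {x', y'} = (i', j', k', m')" by (metis surj_pair)
    have e': "k' < 32" "m' \<le> l" "{x', y'} = {path_node l i' j' k' m', path_node l i' j' k' (Suc m')}"
      using ix[OF xy'] unfolding a' edge_index_def by auto
    have g': "\<gamma> {x', y'} = scaffold_arc l i' j' k' m'" unfolding \<gamma>_def a' by simp
    have "(i, j, k, m) \<noteq> (i', j', k', m')" using ne a a' e(3) e'(3) by auto
    then have "z \<in> {?p x, ?p y}" if "z \<in> path_image (\<gamma> {x, y}) \<inter> path_image (\<gamma> {x', y'})" for z
      using scaffold_arcs_meet[OF e(2) e'(2) e(1) e'(1)] that unfolding ends g g' by blast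
    moreover have "x \<in> pverts ?S" "y \<in> pverts ?S" using xy pair_graph_scaffold[of l R C] unfolding pair_graph_iff by auto
    ultimately show "path_image (\<gamma> {x, y}) \<inter> path_image (\<gamma> {x', y'}) \<subseteq> ?p ` pverts ?S" by blast
  qed
  then show ?thesis using pair_graph_scaffold unfolding planar_iff by blast
qed


section \<open>Attaching forcing gadgets\<close>

text \<open>\<open>(s, None)\<close> is the vertex \<open>s\<close> itself, and
  \<open>(s, Some (e, a))\<close> is vertex \<open>a\<close> in copy \<open>e\<close> at
  \<open>s\<close>, whose root \<open>r\<close> is joined to \<open>s\<close>. Iterated bridge sums
  would hide the vertices and arcs, which the reduction has to write down.\<close>

definition gadget_graph :: "'b pair_pre_digraph \<Rightarrow> 'b \<Rightarrow> 'a pair_pre_digraph \<Rightarrow> ('a \<times> nat) set \<Rightarrow>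
    ('a \<times> (nat \<times> 'b) option) pair_pre_digraph" where
  "gadget_graph G r S Q = \<lparr>
     pverts = {(s, None) | s. s \<in> pverts S} \<union> {(s, Some (e, a)) | s e a. (s, e) \<in> Q \<and> a \<in> pverts G},
     parcs = {((s, None), (t, None)) | s t. (s, t) \<in> parcs S} \<union>
       {((s, Some (e, a)), (s, Some (e, b))) | s e a b. (s, e) \<in> Q \<and> (a, b) \<in> parcs G} \<union>
       {((s, None), (s, Some (e, r))) | s e. (s, e) \<in> Q} \<union>
       {((s, Some (e, r)), (s, None)) | s e. (s, e) \<in> Q}\<rparr>"

lemma gadget_graph_arcD:
  assumes "(x, y) \<in> parcs (gadget_graph G r S Q)"
  shows "(\<exists>s t. x = (s, None) \<and> y = (t, None) \<and> (s, t) \<in> parcs S) \<or>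
    (\<exists>s e a b. x = (s, Some (e, a)) \<and> y = (s, Some (e, b)) \<and> (s, e) \<in> Q \<and> (a, b) \<in> parcs G) \<or>
    (\<exists>s e. (s, e) \<in> Q \<and> (x = (s, None) \<and> y = (s, Some (e, r)) \<or> x = (s, Some (e, r)) \<and> y = (s, None)))"
  using assms unfolding gadget_graph_def by auto

text \<open>Ties the explicit description to \<open>bridge_sum\<close>: each attachment is one
  bridge, which gives planarity by induction on \<open>Q\<close>.\<close>

lemma gadget_graph_insert:
  assumes "(s, e) \<notin> Q"
  shows "gadget_graph G r S (insert (s, e) Q) =
    bridge_sum (gadget_graph G r S Q) (s, None) (map_graph (\<lambda>a. (s, Some (e, a))) G) (s, Some (e, r))"
proof -
  have V: "pverts (gadget_graph G r S (insert (s, e) Q)) =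
      pverts (gadget_graph G r S Q) \<union> (\<lambda>a. (s, Some (e, a))) ` pverts G"
    unfolding gadget_graph_def by auto
  have E: "parcs (gadget_graph G r S (insert (s, e) Q)) =
      parcs (gadget_graph G r S Q) \<union> map_prod (\<lambda>a. (s, Some (e, a))) (\<lambda>a. (s, Some (e, a))) ` parcs G \<union>
      {((s, None), (s, Some (e, r))), ((s, Some (e, r)), (s, None))}"
    unfolding gadget_graph_def by (auto simp: image_iff)
  show ?thesis unfolding bridge_sum_def using V E by simp
qed

lemma planar_gadget_graph:
  assumes "planar G" "r \<in> pverts G" "planar S" "finite Q" "fst ` Q \<subseteq> pverts S"
  shows "planar (gadget_graph G r S Q)"
  using assms(4,5)
proof (induction Q rule: finite_induct)
  case empty
  have "gadget_graph G r S {} = map_graph (\<lambda>s. (s, None)) S"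
    unfolding gadget_graph_def map_graph_def by (auto simp: image_iff)
  moreover have "inj_on (\<lambda>s. (s, None)) (pverts S)" by (simp add: inj_on_def)
  ultimately show ?case using planar_map_graph[OF assms(3)] by metis
next
  case (insert q Q)
  obtain s e where q: "q = (s, e)" by fastforce
  have "planar (map_graph (\<lambda>a. (s, Some (e, a))) G)"
    by (rule planar_map_graph[OF assms(1)]) (simp add: inj_on_def)
  moreover have "planar (gadget_graph G r S Q)" using insert by simp
  moreover have "(s, None) \<in> pverts (gadget_graph G r S Q)"
    using insert.prems unfolding gadget_graph_def q by simp
  moreover have "(s, Some (e, r)) \<in> pverts (map_graph (\<lambda>a. (s, Some (e, a))) G)" using assms(2) by simp
  moreover have "pverts (gadget_graph G r S Q) \<inter> pverts (map_graph (\<lambda>a. (s, Some (e, a))) G) = {}"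
    using insert.hyps(2) unfolding gadget_graph_def q by auto
  ultimately show ?case
    unfolding q gadget_graph_insert[OF insert.hyps(2)[unfolded q]] by (intro planar_bridge_sum)
qed

text \<open>Every copy hangs on a single bridge, and \<open>biconnected_bridge\<close> keeps a
  biconnected set on one side of it.\<close>

lemma gadget_graph_biconnected:
  assumes b: "biconnected V E" and E: "E \<subseteq> parcs (gadget_graph G r S Q)" and V: "V \<subseteq> pverts (gadget_graph G r S Q)"
  shows "V \<subseteq> {(s, None) | s. s \<in> pverts S} \<or> (\<exists>s e. V \<subseteq> {(s, Some (e, a)) | a. a \<in> pverts G})"
proof (rule ccontr)
  assume *: "\<not> ?thesis"
  then obtain x where x: "x \<in> V" "x \<notin> {(s, None) | s. s \<in> pverts S}" by blast
  then have "x \<in> pverts (gadget_graph G r S Q)" using V by blast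
  then obtain s e a where xs: "x = (s, Some (e, a))" using x(2) unfolding gadget_graph_def by auto
  let ?A = "{(s, Some (e, a)) | a. True}"
  have "V \<inter> ?A = {} \<or> V \<subseteq> ?A"
  proof (rule biconnected_bridge[OF b, where r = "(s, Some (e, r))" and x = "(s, None)"])
    fix p q assume pq: "(p, q) \<in> E" "p \<in> ?A" "q \<notin> ?A"
    then have "(p, q) \<in> parcs (gadget_graph G r S Q)" using E by blast
    from gadget_graph_arcD[OF this] show "p = (s, Some (e, r)) \<and> q = (s, None)"
      using pq(2,3) by auto
  qed auto
  moreover have "V \<inter> ?A \<noteq> {}" using x(1) xs by blast
  ultimately have A: "V \<subseteq> ?A" by blast
  have "V \<subseteq> {(s, Some (e, a)) | a. a \<in> pverts G}"
  proof
    fix y assume y: "y \<in> V"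
    then obtain a where a: "y = (s, Some (e, a))" using A by blast
    have "y \<in> pverts (gadget_graph G r S Q)" using V y by blast
    then show "y \<in> {(s, Some (e, a)) | a. a \<in> pverts G}" using a unfolding gadget_graph_def by auto
  qed
  then show False using * by blast
qed

section \<open>Biconnected subgraphs of the grid and of the graph with gadgets\<close>

lemma scaffold_inner_neighbour:
  assumes "((i, j, Inner k m), y) \<in> parcs (scaffold l R C)" "1 \<le> m" "m \<le> l"
  shows "y = path_node l i j k (m - 1) \<or> y = path_node l i j k (Suc m)"
proof -
  have "scaffold_edge l R C (i, j, Inner k m) y \<or> scaffold_edge l R C y (i, j, Inner k m)"
    using assms(1) by (simp add: scaffold_def)
  then show ?thesis
  proof
    assume "scaffold_edge l R C (i, j, Inner k m) y"
    then obtain i' j' k' m' where *: "m' \<le> l" "(i, j, Inner k m) = path_node l i' j' k' m'" "y = path_node l i' j' k' (Suc m')"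
      unfolding scaffold_edge_def by blast
    have "i' = i \<and> j' = j \<and> k' = k \<and> m' = m" using *(2) by (auto simp: path_node.simps split: if_splits)
    then show ?thesis using *(3) by blast
  next
    assume "scaffold_edge l R C y (i, j, Inner k m)"
    then obtain i' j' k' m' where *: "m' \<le> l" "y = path_node l i' j' k' m'" "(i, j, Inner k m) = path_node l i' j' k' (Suc m')"
      unfolding scaffold_edge_def by blast
    have "i' = i \<and> j' = j \<and> k' = k \<and> Suc m' = m" using *(3) by (auto simp: path_node.simps split: if_splits)
    then show ?thesis using *(2) by auto
  qed
qed

text \<open>Cells are never adjacent to each other, as \<open>1 \<le> l\<close>, so some inner
  vertex occurs. It has no neighbours but its two on the path, and
  \<open>biconnected_neighbour\<close> spreads \<open>V\<close> in both directions over all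
  \<open>l\<close> inner vertices.\<close>

lemma scaffold_biconnected_card:
  assumes b: "biconnected V E" and E: "E \<subseteq> parcs (scaffold l R C)" and V: "V \<subseteq> scaffold_verts l R C" and l: "1 \<le> l"
  shows "l \<le> card V"
proof -
  have "\<exists>i j k m. (i, j, Inner k m) \<in> V"
  proof (rule ccontr)
    assume no: "\<nexists>i j k m. (i, j, Inner k m) \<in> V"
    have c: "3 \<le> card V" "E \<subseteq> V \<times> V" using b unfolding biconnected_def by auto
    then have "V \<noteq> {}" by auto
    then obtain x where x: "x \<in> V" by blast
    have "V - {x} \<noteq> {}"
    proof
      assume "V - {x} = {}"
      then have "V = {x}" using x by blast
      then show False using c(1) by simp
    qed
    then obtain v where v: "v \<in> V" "v \<noteq> x" by blast
    have "V - {v} - {x} \<noteq> {}"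
    proof
      assume "V - {v} - {x} = {}"
      then have "V \<subseteq> {v, x}" by blast
      then have "card V \<le> card {v, x}" by (intro card_mono) auto
      also have "\<dots> \<le> 2" by (simp add: card_insert_if)
      finally show False using c(1) by simp
    qed
    then obtain p q where pq: "p \<in> {x}" "q \<in> V" "q \<noteq> v" "q \<notin> {x}" "(p, q) \<in> E"
      using x v by (elim biconnectedD[OF b, rotated 2]) auto
    then have e: "(p, q) \<in> parcs (scaffold l R C)" "p \<in> V" using E x by auto
    have cell: False if e: "scaffold_edge l R C p q" "p \<in> V" "q \<in> V" for p q
    proof -
      obtain i j k m where *: "m \<le> l" "p = path_node l i j k m" "q = path_node l i j k (Suc m)"
        using e(1) unfolding scaffold_edge_def by blast
      show False
      proof (cases "m = 0")
        case True
        then have "q = (i, j, Inner k (Suc 0))" using *(3) l by (simp add: path_node.simps)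
        then show False using e(3) no by blast
      next
        case False
        then have "p = (i, j, Inner k m)" using *(1,2) by (simp add: path_node.simps)
        then show False using e(2) no by blast
      qed
    qed
    show False using e cell[of p q] cell[of q p] pq(2) by (auto simp: scaffold_def)
  qed
  then obtain i j k m where x: "(i, j, Inner k m) \<in> V" by blast
  then have "(i, j, Inner k m) \<in> scaffold_verts l R C" using V by blast
  then have m: "1 \<le> m" "m \<le> l" using scaffold_vertsD(3)[of i j "Inner k m"] by auto
  let ?n = "path_node l i j k"
  have nI: "?n m = (i, j, Inner k m)" if "1 \<le> m" "m \<le> l" for m using that by (simp add: path_node.simps)
  have step: "?n (m - 1) \<in> V \<and> ?n (Suc m) \<in> V" if m: "1 \<le> m" "m \<le> l" and x: "?n m \<in> V" for m
  proof -
    have x': "(i, j, Inner k m) \<in> V" using x nI[OF m] by simp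
    have nb: "y = ?n (m - 1) \<or> y = ?n (Suc m)" if "((i, j, Inner k m), y) \<in> E" for y
      using scaffold_inner_neighbour[OF _ m] that E by blast
    have "(i, j, Inner k m) \<noteq> ?n (m - 1)" "(i, j, Inner k m) \<noteq> ?n (Suc m)"
      using m by (auto simp: path_node.simps split: if_splits)
    then show ?thesis using biconnected_neighbour[OF b x', of "?n (m - 1)" "?n (Suc m)"]
        biconnected_neighbour[OF b x', of "?n (Suc m)" "?n (m - 1)"] nb by blast
  qed
  have up: "m + d \<le> l \<Longrightarrow> ?n (m + d) \<in> V" for d
  proof (induction d)
    case 0
    then show ?case using x nI[OF m] by simp
  next
    case (Suc d)
    then show ?case using step[of "m + d"] m by simp
  qed
  have down: "d < m \<Longrightarrow> ?n (m - d) \<in> V" for d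
  proof (induction d)
    case 0
    then show ?case using x nI[OF m] by simp
  next
    case (Suc d)
    have "?n (m - d - 1) \<in> V" using step[of "m - d"] m Suc by simp
    then show ?case by simp
  qed
  have "(i, j, Inner k n) \<in> V" if n: "1 \<le> n" "n \<le> l" for n
  proof (cases "m \<le> n")
    case True
    then show ?thesis using up[of "n - m"] n nI[OF n] by simp
  next
    case False
    then show ?thesis using down[of "m - n"] n nI[OF n] by simp
  qed
  then have "(\<lambda>n. (i, j, Inner k n)) ` {1..l} \<subseteq> V" by auto
  moreover have "finite V" using b unfolding biconnected_def by blast
  ultimately have "card ((\<lambda>n. (i, j, Inner k n)) ` {1..l}) \<le> card V" by (intro card_mono)
  moreover have "card ((\<lambda>n. (i, j, Inner k n)) ` {1..l}) = l" by (subst card_image) (auto simp: inj_on_def)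
  ultimately show ?thesis by simp
qed

text \<open>A copy of some \<open>H\<close> would lie in one copy of \<open>G\<close>, which is
  \<H>-subgraph-free, or in the grid, where it has too few vertices to be biconnected.\<close>

theorem subgraph_free_gadget_graph:
  assumes H: "\<And>H. H \<in> \<H> \<Longrightarrow> two_connected H \<and> card (pverts H) < l" and l: "1 \<le> l"
    and G: "pair_graph G" "subgraph_free \<H> G"
  shows "subgraph_free \<H> (gadget_graph G r (scaffold l R C) Q)"
proof (rule ccontr)
  let ?F = "gadget_graph G r (scaffold l R C) Q"
  assume "\<not> subgraph_free \<H> ?F"
  then obtain K H where K: "subgraph (with_proj K) (with_proj ?F)" "digraph_iso (with_proj K) (with_proj H)" "H \<in> \<H>"
    unfolding subgraph_free_def by blast
  have KF: "pverts K \<subseteq> pverts ?F" "parcs K \<subseteq> parcs ?F" "pair_wf_digraph K"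
    using K(1) unfolding subgraph_with_proj_iff by blast+
  have KV: "parcs K \<subseteq> pverts K \<times> pverts K" using KF(3) unfolding pair_wf_digraph_iff .
  obtain f where f: "inj_on f (pverts K)" "pverts H = f ` pverts K" "parcs H = map_prod f f ` parcs K"
    using digraph_isoD[OF K(2)] .
  have H': "two_connected H" "card (pverts H) < l" using H[OF K(3)] by auto
  have b: "biconnected (pverts K) (parcs K)"
    by (rule biconnected_iso[OF two_connected_biconnected[OF H'(1)] f KV])
  have card: "card (pverts K) < l" using H'(2) f(1,2) by (simp add: card_image)
  from gadget_graph_biconnected[OF b KF(2,1)]
  consider "pverts K \<subseteq> {(s, None) | s. s \<in> pverts (scaffold l R C)}"
    | s e where "pverts K \<subseteq> {(s, Some (e, a)) | a. a \<in> pverts G}" by blast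
  then show False
  proof cases
    case 1
    let ?V = "fst ` pverts K" and ?E = "map_prod fst fst ` parcs K"
    have inj: "inj_on fst (pverts K)" using 1 by (auto simp: inj_on_def)
    let ?g = "\<lambda>s. (s, None)"
    have g: "?g (fst x) = x" if "x \<in> pverts K" for x using that 1 by auto
    have "biconnected ?V ?E"
    proof (rule biconnected_iso[OF b])
      show "inj_on ?g ?V" by (simp add: inj_on_def)
      show "pverts K = ?g ` ?V" using g by (auto simp: image_image)
      have "map_prod ?g ?g (map_prod fst fst e) = e" if "e \<in> parcs K" for e
      proof -
        have "fst e \<in> pverts K" "snd e \<in> pverts K" using that KV by auto
        then show ?thesis using g[of "fst e"] g[of "snd e"] by (cases e) simp
      qed
      then show "parcs K = map_prod ?g ?g ` ?E" unfolding image_image by simp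
      show "?E \<subseteq> ?V \<times> ?V" using KV by auto
    qed
    moreover have "?E \<subseteq> parcs (scaffold l R C)"
    proof
      fix e' assume "e' \<in> ?E"
      then obtain x y where xy: "(x, y) \<in> parcs K" "e' = (fst x, fst y)" by auto
      then have "x \<in> pverts K" "y \<in> pverts K" using KV by auto
      then obtain s t where st: "x = (s, None)" "y = (t, None)" using 1 by blast
      have "(x, y) \<in> parcs ?F" using KF(2) xy(1) by blast
      from gadget_graph_arcD[OF this] have "(s, t) \<in> parcs (scaffold l R C)" unfolding st by auto
      then show "e' \<in> parcs (scaffold l R C)" using xy(2) st by simp
    qed
    moreover have "?V \<subseteq> scaffold_verts l R C" using 1 by (auto simp: scaffold_def)
    ultimately have "l \<le> card ?V" using scaffold_biconnected_card l by blast
    then show False using card card_image[OF inj] by simp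
  next
    case 2
    let ?g = "\<lambda>x. snd (the (snd x))"
    have "inj_on ?g (pverts K)"
    proof (rule inj_onI)
      fix x y assume "x \<in> pverts K" "y \<in> pverts K" "?g x = ?g y"
      moreover from calculation obtain a b where "x = (s, Some (e, a))" "y = (s, Some (e, b))" using 2 by blast
      ultimately show "x = y" by simp
    qed
    moreover have "?g ` pverts K \<subseteq> pverts G" using 2 by auto
    moreover have "map_prod ?g ?g ` parcs K \<subseteq> parcs G"
    proof
      fix e' assume "e' \<in> map_prod ?g ?g ` parcs K"
      then obtain x y where xy: "(x, y) \<in> parcs K" "e' = (?g x, ?g y)" by auto
      then have "x \<in> pverts K" "y \<in> pverts K" using KV by auto
      then obtain a b where st: "x = (s, Some (e, a))" "y = (s, Some (e, b))" using 2 by blast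
      have "(x, y) \<in> parcs ?F" using KF(2) xy(1) by blast
      from gadget_graph_arcD[OF this] have "(a, b) \<in> parcs G" unfolding st by auto
      then show "e' \<in> parcs G" using xy(2) st by simp
    qed
    ultimately have "\<not> subgraph_free \<H> G"
      by (rule not_subgraph_free_embed[OF G(1) KF(3) K(2,3)])
    then show False using G(2) by blast
  qed
qed

section \<open>Colourings of a graph with gadgets\<close>

lemma transpose_in_iff: "Transposition.transpose a b x \<in> A \<longleftrightarrow> x \<in> Transposition.transpose a b ` A"
  by (metis image_iff transpose_involutory)

text \<open>Exchanging \<open>z\<close> and \<open>\<phi> s e\<close> throughout the lists of a copy
  changes the forced colour of its root from \<open>z\<close> to \<open>\<phi> s e\<close>. Being a
  permutation of colours, it preserves the sizes of the lists.\<close>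

definition gadget_lists :: "('b \<Rightarrow> nat set) \<Rightarrow> nat \<Rightarrow> ('a \<Rightarrow> nat \<Rightarrow> nat) \<Rightarrow> ('a \<Rightarrow> nat set) \<Rightarrow> 'a \<times> (nat \<times> 'b) option \<Rightarrow> nat set" where
  "gadget_lists L z \<phi> B = (\<lambda>(s, y). case y of None \<Rightarrow> B s | Some (e, a) \<Rightarrow> Transposition.transpose z (\<phi> s e) ` L a)"

text \<open>The root of copy \<open>e\<close> at \<open>s\<close> has colour
  \<open>\<phi> s e\<close> in every colouring, and the transposed \<open>c0\<close> colours the
  copy in this way whatever happens elsewhere. The copy thus acts exactly as a deletion of
  \<open>\<phi> s e\<close> from the list of \<open>s\<close>.\<close>

lemma gadget_graph_colourable_iff:
  assumes reg: "regular_assignment n G L" and r: "r \<in> pverts G" and z: "1 \<le> z"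
    and c0: "list_colouring G L c0" and forced: "\<And>c. list_colouring G L c \<Longrightarrow> c r = z"
    and \<phi>: "\<And>s e. 1 \<le> \<phi> s e" and S: "parcs S \<subseteq> pverts S \<times> pverts S" and G: "pair_graph G"
  shows "(\<exists>c. list_colouring (gadget_graph G r S (pverts S \<times> {..<k})) (gadget_lists L z \<phi> B) c) \<longleftrightarrow>
    (\<exists>c. list_colouring S (\<lambda>s. B s - \<phi> s ` {..<k}) c)"
proof
  let ?F = "gadget_graph G r S (pverts S \<times> {..<k})" and ?L = "gadget_lists L z \<phi> B"
  assume "\<exists>c. list_colouring ?F ?L c"
  then obtain c where c: "list_colouring ?F ?L c" ..
  have col: "1 \<le> c v" "c v \<in> ?L v" if "v \<in> pverts ?F" for v
    using c that unfolding list_colouring_def colouring_def respects_lists_def by blast+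
  have ne: "c x \<noteq> c y" if "(x, y) \<in> parcs ?F" for x y
    using c that unfolding list_colouring_def colouring_def by blast
  have root: "c (s, Some (e, r)) = \<phi> s e" if s: "s \<in> pverts S" "e < k" for s e
  proof -
    let ?t = "Transposition.transpose z (\<phi> s e)"
    have "?t (c (s, Some (e, a))) \<in> L a" if a: "a \<in> pverts G" for a
    proof -
      have "(s, Some (e, a)) \<in> pverts ?F" using s a unfolding gadget_graph_def by simp
      from col(2)[OF this] show ?thesis by (simp add: gadget_lists_def transpose_in_iff)
    qed
    moreover have "?t (c (s, Some (e, a))) \<noteq> ?t (c (s, Some (e, b)))" if ab: "(a, b) \<in> parcs G" for a b
    proof -
      have "((s, Some (e, a)), (s, Some (e, b))) \<in> parcs ?F" using s ab unfolding gadget_graph_def by simp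
      from ne[OF this] show ?thesis by (metis transpose_involutory)
    qed
    moreover have "1 \<le> ?t (c (s, Some (e, a)))" if a: "a \<in> pverts G" for a
      using calculation(1)[OF a] reg a unfolding regular_assignment_def by auto
    ultimately have "list_colouring G L (\<lambda>a. ?t (c (s, Some (e, a))))"
      unfolding list_colouring_def colouring_def respects_lists_def by auto
    then have "?t (c (s, Some (e, r))) = z" by (rule forced)
    then show ?thesis by (metis transpose_apply_first transpose_involutory)
  qed
  have "list_colouring S (\<lambda>s. B s - \<phi> s ` {..<k}) (\<lambda>s. c (s, None))"
    unfolding list_colouring_def colouring_def respects_lists_def
  proof (intro conjI ballI)
    fix s assume s: "s \<in> pverts S"
    have v: "(s, None) \<in> pverts ?F" using s unfolding gadget_graph_def by simp
    show "1 \<le> c (s, None)" using col(1)[OF v] .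
    have "c (s, None) \<in> B s" using col(2)[OF v] by (simp add: gadget_lists_def)
    moreover have "c (s, None) \<noteq> \<phi> s e" if e: "e < k" for e
    proof -
      have "((s, None), (s, Some (e, r))) \<in> parcs ?F" using s e unfolding gadget_graph_def by simp
      from ne[OF this] show ?thesis using root[OF s e] by simp
    qed
    ultimately show "c (s, None) \<in> B s - \<phi> s ` {..<k}" by blast
  next
    fix e assume "e \<in> parcs S"
    moreover obtain s t where "e = (s, t)" by fastforce
    moreover from calculation have "((s, None), (t, None)) \<in> parcs ?F" unfolding gadget_graph_def by simp
    ultimately show "case e of (u, v) \<Rightarrow> c (u, None) \<noteq> c (v, None)" using ne by simp
  qed
  then show "\<exists>c. list_colouring S (\<lambda>s. B s - \<phi> s ` {..<k}) c" by (rule exI[where x = "\<lambda>s. c (s, None)"])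
next
  let ?F = "gadget_graph G r S (pverts S \<times> {..<k})" and ?L = "gadget_lists L z \<phi> B"
  assume "\<exists>c. list_colouring S (\<lambda>s. B s - \<phi> s ` {..<k}) c"
  then obtain c' where c': "list_colouring S (\<lambda>s. B s - \<phi> s ` {..<k}) c'" ..
  have c1: "1 \<le> c' s" "c' s \<in> B s" "c' s \<notin> \<phi> s ` {..<k}" if "s \<in> pverts S" for s
    using c' that unfolding list_colouring_def colouring_def respects_lists_def by blast+
  have c2: "c' s \<noteq> c' t" if "(s, t) \<in> parcs S" for s t
    using c' that unfolding list_colouring_def colouring_def by blast
  have g1: "1 \<le> c0 a" "c0 a \<in> L a" if "a \<in> pverts G" for a
    using c0 that unfolding list_colouring_def colouring_def respects_lists_def by blast+
  have g2: "c0 a \<noteq> c0 b" if "(a, b) \<in> parcs G" for a b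
    using c0 that unfolding list_colouring_def colouring_def by blast
  define c where "c = (\<lambda>(s, y). case y of None \<Rightarrow> c' s | Some (e, a) \<Rightarrow> Transposition.transpose z (\<phi> s e) (c0 a))"
  have cN: "c (s, None) = c' s" for s by (simp add: c_def)
  have cS: "c (s, Some (e, a)) = Transposition.transpose z (\<phi> s e) (c0 a)" for s e a by (simp add: c_def)
  have cr: "c (s, Some (e, r)) = \<phi> s e" for s e using forced[OF c0] by (simp add: cS)
  have "list_colouring ?F ?L c"
    unfolding list_colouring_def colouring_def respects_lists_def
  proof (intro conjI ballI)
    fix v assume v: "v \<in> pverts ?F"
    then consider s where "v = (s, None)" "s \<in> pverts S" | s e a where "v = (s, Some (e, a))" "a \<in> pverts G"
      unfolding gadget_graph_def by auto
    note vc = this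
    from vc show "1 \<le> c v"
    proof cases
      case 1
      then show ?thesis using c1 cN by simp
    next
      case 2
      then show ?thesis using g1 z \<phi> cS by (simp add: Transposition.transpose_def)
    qed
    from vc show "c v \<in> ?L v"
    proof cases
      case 1
      then show ?thesis using c1 cN by (simp add: gadget_lists_def)
    next
      case 2
      then show ?thesis using g1 cS by (simp add: gadget_lists_def)
    qed
  next
    fix ed assume ed: "ed \<in> parcs ?F"
    obtain x y where xy: "ed = (x, y)" by (rule prod.exhaust)
    have "c x \<noteq> c y" using gadget_graph_arcD[OF ed[unfolded xy]]
    proof (elim disjE exE conjE)
      fix s t assume "x = (s, None)" "y = (t, None)" "(s, t) \<in> parcs S"
      then show ?thesis using c2 cN by simp
    next
      fix s e a b assume "x = (s, Some (e, a))" "y = (s, Some (e, b))" "(a, b) \<in> parcs G"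
      then show ?thesis using g2[of a b] cS by (metis transpose_involutory)
    next
      fix s e assume *: "(s, e) \<in> pverts S \<times> {..<k}" "x = (s, None)" "y = (s, Some (e, r))"
      then have "c' s \<noteq> \<phi> s e" using c1(3)[of s] by blast
      then show ?thesis unfolding *(2,3) cN cr .
    next
      fix s e assume *: "(s, e) \<in> pverts S \<times> {..<k}" "x = (s, Some (e, r))" "y = (s, None)"
      then have "c' s \<noteq> \<phi> s e" using c1(3)[of s] by blast
      then show ?thesis unfolding *(2,3) cN cr by (rule not_sym)
    qed
    then show "case ed of (u, v) \<Rightarrow> c u \<noteq> c v" using xy by simp
  qed
  then show "\<exists>c. list_colouring ?F ?L c" by blast
qed


section \<open>Colourings of the grid and satisfiability\<close>

definition cnf_sat :: "nat \<Rightarrow> nat \<Rightarrow> (nat \<Rightarrow> nat \<Rightarrow> bool) \<Rightarrow> (nat \<Rightarrow> nat \<Rightarrow> bool) \<Rightarrow> bool" where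
  "cnf_sat R V pos neg \<longleftrightarrow> (\<exists>a. \<forall>i<R. \<exists>j<V. (pos i j \<and> a j) \<or> (neg i j \<and> \<not> a j))"

text \<open>
  The colour of cell \<open>(i, j)\<close> is \<open>1 + 2 s + v\<close>, where the bit \<open>v\<close> is the value of variable \<open>j\<close> and the
  bit \<open>s\<close> tells that one of the variables before \<open>j\<close> satisfies clause \<open>i\<close>. Path \<open>k\<close> is in charge
  of the pair \<open>(fst_colour k, snd_colour k)\<close> of colours of its ends.
\<close>

definition fst_colour :: "nat \<Rightarrow> nat" where "fst_colour k = Suc (k mod 16 div 4)"
definition snd_colour :: "nat \<Rightarrow> nat" where "snd_colour k = Suc (k mod 4)"

text \<open>Even colours mean that the variable is true, and 3 and 4 that the clause is satisfied.
  Going right, the change from {1, 2} to {3, 4} is allowed only where a literal of the current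
  variable is true; going down, the parity is kept. A fall back from {3, 4} is harmless, since every
  row must finally rise from {1, 2} in its first column to {3, 4} in its last.\<close>

definition forbidden :: "bool \<Rightarrow> bool \<Rightarrow> nat \<Rightarrow> bool" where
  "forbidden p n k \<longleftrightarrow>
     (if k < 16 then fst_colour k < 3 \<and> 3 \<le> snd_colour k \<and> \<not> (p \<and> even (fst_colour k)) \<and> \<not> (n \<and> odd (fst_colour k))
      else even (fst_colour k) \<noteq> even (snd_colour k))"

text \<open>
  The inner vertex \<open>m\<close> has the list \<open>{chain (m - 1), chain m}\<close>: if the first end has colour \<open>chain 0\<close>,
  all inner vertices are forced and the last end cannot have colour \<open>chain l\<close>. Colour \<open>7\<close>
  does not occur at cells and disables the path.
\<close>

definition chain :: "nat \<Rightarrow> bool \<Rightarrow> nat \<Rightarrow> nat \<Rightarrow> nat" where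
  "chain l f k m = (if m = 0 then (if f then fst_colour k else 7) else if m < l then 7 + m else snd_colour k)"

fun scaffold_lists :: "nat \<Rightarrow> nat \<Rightarrow> (nat \<Rightarrow> nat \<Rightarrow> bool) \<Rightarrow> (nat \<Rightarrow> nat \<Rightarrow> bool) \<Rightarrow> nat \<times> nat \<times> loc \<Rightarrow> nat set" where
  "scaffold_lists l V pos neg (i, j, Cell) = (if j = 0 then {1, 2} else if j = V then {3, 4} else {1, 2, 3, 4})"
| "scaffold_lists l V pos neg (i, j, Inner k m) =
     {chain l (forbidden (pos i j) (neg i j) k) k (m - 1), chain l (forbidden (pos i j) (neg i j) k) k m}"

lemma colour_bounds: "1 \<le> fst_colour k" "fst_colour k \<le> 4" "1 \<le> snd_colour k" "snd_colour k \<le> 4"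
proof -
  have "k mod 16 < 16" "k mod 4 < 4" by simp_all
  then have "k mod 16 div 4 < 4" by (simp add: less_mult_imp_div_less)
  then show "1 \<le> fst_colour k" "fst_colour k \<le> 4" "1 \<le> snd_colour k" "snd_colour k \<le> 4"
    using \<open>k mod 4 < 4\<close> unfolding fst_colour_def snd_colour_def by simp_all
qed

lemma colour_pair_index:
  assumes "1 \<le> a" "a \<le> 4" "1 \<le> b" "b \<le> 4"
  shows "\<exists>k<16. fst_colour k = a \<and> snd_colour k = b" "\<exists>k<32. \<not> k < 16 \<and> fst_colour k = a \<and> snd_colour k = b"
proof -
  let ?k = "4 * (a - 1) + (b - 1)"
  have k: "?k < 16" using assms by simp
  have "a \<in> {1, 2, 3, 4}" "b \<in> {1, 2, 3, 4}" using assms by auto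
  then have *: "fst_colour ?k = a \<and> snd_colour ?k = b \<and> fst_colour (16 + ?k) = a \<and> snd_colour (16 + ?k) = b"
    unfolding fst_colour_def snd_colour_def by (elim insertE emptyE) simp_all
  then show "\<exists>k<16. fst_colour k = a \<and> snd_colour k = b" using k by blast
  show "\<exists>k<32. \<not> k < 16 \<and> fst_colour k = a \<and> snd_colour k = b" using k * by (intro exI[of _ "16 + ?k"]) simp
qed

lemma chain_step: "2 \<le> l \<Longrightarrow> m < l \<Longrightarrow> chain l f k m \<noteq> chain l f k (Suc m)"
  using colour_bounds[of k] unfolding chain_def by auto

lemma scaffold_parcsI:
  assumes "i < R" "j < C" "k < 32" "m \<le> l" "path_node l i j k (Suc m) \<in> scaffold_verts l R C"
  shows "(path_node l i j k m, path_node l i j k (Suc m)) \<in> parcs (scaffold l R C)"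
proof -
  have "scaffold_edge l R C (path_node l i j k m) (path_node l i j k (Suc m))"
    using assms unfolding scaffold_edge_def by blast
  then show ?thesis unfolding scaffold_def by simp
qed

lemma scaffold_path_forbids:
  assumes c: "list_colouring (scaffold l R C) (scaffold_lists l V pos neg) c" and l: "2 \<le> l"
    and k: "i < R" "j < C" "k < 32" and f: "forbidden (pos i j) (neg i j) k"
    and e: "path_node l i j k (Suc l) \<in> scaffold_verts l R C"
    and fst: "c (i, j, Cell) = fst_colour k"
  shows "c (path_node l i j k (Suc l)) \<noteq> snd_colour k"
proof -
  let ?n = "path_node l i j k" and ?ch = "chain l True k"
  have ne: "c x \<noteq> c y" if "(x, y) \<in> parcs (scaffold l R C)" for x y
    using c that unfolding list_colouring_def colouring_def by blast
  have "m \<le> l \<Longrightarrow> c (?n m) = ?ch m" for m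
  proof (induction m)
    case 0
    then show ?case using fst by (simp add: path_node.simps chain_def)
  next
    case (Suc m)
    have n: "?n (Suc m) = (i, j, Inner k (Suc m))" using Suc.prems by (simp add: path_node.simps)
    have v: "?n (Suc m) \<in> scaffold_verts l R C" unfolding n using k Suc.prems by (intro scaffold_vertsI) auto
    then have "c (?n (Suc m)) \<in> scaffold_lists l V pos neg (?n (Suc m))"
      using c unfolding list_colouring_def respects_lists_def by (simp add: scaffold_def)
    then have "c (?n (Suc m)) \<in> {?ch m, ?ch (Suc m)}" unfolding n using f by simp
    moreover have "c (?n m) \<noteq> c (?n (Suc m))" using Suc.prems v k by (intro ne scaffold_parcsI) auto
    moreover have "c (?n m) = ?ch m" using Suc by simp
    ultimately show ?case by auto
  qed
  from this[of l] have "c (?n l) = snd_colour k" using l by (simp add: chain_def)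
  moreover have "c (?n l) \<noteq> c (?n (Suc l))" using e k by (intro ne scaffold_parcsI) auto
  ultimately show ?thesis by simp
qed

lemma scaffold_colourable_imp_sat:
  assumes c: "list_colouring (scaffold l R (Suc V)) (scaffold_lists l V pos neg) c" and l: "2 \<le> l" and V: "1 \<le> V"
  shows "cnf_sat R V pos neg"
proof -
  let ?C = "Suc V"
  have cell: "c (i, j, Cell) \<in> scaffold_lists l V pos neg (i, j, Cell)" if "i < R" "j < ?C" for i j
  proof -
    have "\<forall>x\<in>scaffold_verts l R ?C. c x \<in> scaffold_lists l V pos neg x"
      using c unfolding list_colouring_def respects_lists_def scaffold_def by simp
    then show ?thesis using scaffold_vertsI(1)[OF that, of l] by (rule bspec)
  qed
  have range: "1 \<le> c (i, j, Cell)" "c (i, j, Cell) \<le> 4" if "i < R" "j < ?C" for i j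
    using cell[OF that] by (auto split: if_splits)
  have right: "\<not> (c (i, j, Cell) < 3 \<and> 3 \<le> c (i, Suc j, Cell)) \<or> (pos i j \<and> even (c (i, j, Cell))) \<or> (neg i j \<and> odd (c (i, j, Cell)))"
    if ij: "i < R" "j < V" for i j
  proof -
    obtain k where k: "k < 16" "fst_colour k = c (i, j, Cell)" "snd_colour k = c (i, Suc j, Cell)"
      using colour_pair_index(1)[OF range range] ij by (metis less_SucI Suc_mono)
    have n: "path_node l i j k (Suc l) = (i, Suc j, Cell)" using k(1) by (simp add: path_node.simps)
    have "\<not> forbidden (pos i j) (neg i j) k"
    proof
      assume f: "forbidden (pos i j) (neg i j) k"
      have "c (path_node l i j k (Suc l)) \<noteq> snd_colour k"
        by (rule scaffold_path_forbids[OF c l _ _ _ f]) (use ij k n in \<open>auto intro: scaffold_vertsI\<close>)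
      then show False using k(3) n by simp
    qed
    then show ?thesis using k unfolding forbidden_def by auto
  qed
  have down: "even (c (i, j, Cell)) = even (c (Suc i, j, Cell))" if ij: "Suc i < R" "j < ?C" for i j
  proof -
    obtain k where k: "k < 32" "\<not> k < 16" "fst_colour k = c (i, j, Cell)" "snd_colour k = c (Suc i, j, Cell)"
      using colour_pair_index(2)[OF range range] ij by (metis Suc_lessD)
    have n: "path_node l i j k (Suc l) = (Suc i, j, Cell)" using k(2) by (simp add: path_node.simps)
    have "\<not> forbidden (pos i j) (neg i j) k"
    proof
      assume f: "forbidden (pos i j) (neg i j) k"
      have "c (path_node l i j k (Suc l)) \<noteq> snd_colour k"
        by (rule scaffold_path_forbids[OF c l _ _ _ f]) (use ij k n in \<open>auto intro: scaffold_vertsI\<close>)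
      then show False using k(4) n by simp
    qed
    then show ?thesis using k unfolding forbidden_def by auto
  qed
  have val: "i < R \<Longrightarrow> j < ?C \<Longrightarrow> even (c (i, j, Cell)) = even (c (0, j, Cell))" for i j
  proof (induction i)
    case (Suc i)
    then show ?case using down[of i j] by simp
  qed simp
  show ?thesis unfolding cnf_sat_def
  proof (intro exI[of _ "\<lambda>j. even (c (0, j, Cell))"] allI impI)
    fix i assume i: "i < R"
    have s0: "c (i, 0, Cell) < 3" using cell[OF i, of 0] by auto
    have sV: "\<not> c (i, V, Cell) < 3" using cell[OF i, of V] V by auto
    \<comment> \<open>The satisfaction bit is 0 in column 0 and 1 in column \<open>V\<close>, so it
      rises at some \<open>j < V\<close>, and \<open>right\<close> supplies a true literal
      there.\<close>
    have "\<exists>j<V. c (i, j, Cell) < 3 \<and> \<not> c (i, Suc j, Cell) < 3"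
    proof (rule ccontr)
      assume no: "\<not> ?thesis"
      have "j \<le> V \<Longrightarrow> c (i, j, Cell) < 3" for j
      proof (induction j)
        case (Suc j)
        then show ?case using no by simp
      qed (use s0 in simp)
      then show False using sV by simp
    qed
    then obtain j where j: "j < V" "c (i, j, Cell) < 3" "3 \<le> c (i, Suc j, Cell)" by auto
    have "(pos i j \<and> even (c (i, j, Cell))) \<or> (neg i j \<and> odd (c (i, j, Cell)))" using right[OF i j(1)] j by blast
    then show "\<exists>j<V. (pos i j \<and> even (c (0, j, Cell))) \<or> (neg i j \<and> \<not> even (c (0, j, Cell)))"
      using j(1) val[OF i, of j] by (intro exI[of _ j]) auto
  qed
qed

text \<open>Cells get the colours that the assignment dictates. A path with a forbidden pair whose
  first end has the dangerous colour is coloured forwards, by \<open>chain m\<close>. Every other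
  path is coloured backwards, by \<open>chain (m - 1)\<close>: its first inner vertex then differs
  from the cell, and its last has a colour above 7, which no cell uses.\<close>

lemma sat_imp_scaffold_colourable:
  assumes "cnf_sat R V pos neg" and l: "2 \<le> l" and V: "1 \<le> V"
  shows "\<exists>c. list_colouring (scaffold l R (Suc V)) (scaffold_lists l V pos neg) c"
proof -
  obtain a where a: "\<And>i. i < R \<Longrightarrow> \<exists>j<V. (pos i j \<and> a j) \<or> (neg i j \<and> \<not> a j)" using assms(1) unfolding cnf_sat_def by blast
  let ?C = "Suc V"
  define lit where "lit i j \<longleftrightarrow> (pos i j \<and> a j) \<or> (neg i j \<and> \<not> a j)" for i j
  define s where "s i j \<longleftrightarrow> (\<exists>j'<j. lit i j')" for i j
  define \<sigma> :: "nat \<Rightarrow> nat \<Rightarrow> nat" where "\<sigma> i j = 1 + 2 * of_bool (s i j) + of_bool (a j)" for i j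
  have \<sigma>: "1 \<le> \<sigma> i j" "\<sigma> i j \<le> 4" "\<sigma> i j < 3 \<longleftrightarrow> \<not> s i j" "even (\<sigma> i j) \<longleftrightarrow> a j" for i j
    unfolding \<sigma>_def by auto
  have sS: "s i (Suc j) \<longleftrightarrow> s i j \<or> lit i j" for i j unfolding s_def by (auto simp: less_Suc_eq)
  have no: False if f: "forbidden (pos i j) (neg i j) k" and x: "\<sigma> i j = fst_colour k"
    and n: "path_node l i j k (Suc l) = (i', j', Cell)" "\<sigma> i' j' = snd_colour k" for i j k i' j'
  proof (cases "k < 16")
    case True
    then have e: "i' = i" "j' = Suc j" using n(1) by (auto simp: path_node.simps)
    have "\<not> s i j" "s i (Suc j)" using f True x n(2) e \<sigma>(3)[of i j] \<sigma>(3)[of i "Suc j"] unfolding forbidden_def by auto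
    then have "lit i j" using sS by blast
    then show False using f True x[symmetric] \<sigma>(4)[of i j] unfolding forbidden_def lit_def by auto
  next
    case False
    then have e: "i' = Suc i" "j' = j" using n(1) by (auto simp: path_node.simps)
    show False using f False x[symmetric] n(2)[symmetric] e \<sigma>(4)[of i j] \<sigma>(4)[of "Suc i" j] unfolding forbidden_def by auto
  qed
  define g where "g i j k \<longleftrightarrow> forbidden (pos i j) (neg i j) k \<and> \<sigma> i j = fst_colour k" for i j k
  let ?ch = "\<lambda>i j. chain l (forbidden (pos i j) (neg i j) k)" 
  define c where "c = (\<lambda>(i, j, x). case x of Cell \<Rightarrow> \<sigma> i j
    | Inner k m \<Rightarrow> chain l (forbidden (pos i j) (neg i j) k) k (if g i j k then m else m - 1))"
  have cC: "c (i, j, Cell) = \<sigma> i j" for i j by (simp add: c_def)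
  have cI: "c (i, j, Inner k m) = chain l (forbidden (pos i j) (neg i j) k) k (if g i j k then m else m - 1)" for i j k m
    by (simp add: c_def)
  have list: "c x \<in> scaffold_lists l V pos neg x" if x: "x \<in> scaffold_verts l R ?C" for x
  proof -
    obtain i j y where y: "x = (i, j, y)" by (metis surj_pair)
    have ij: "i < R" using x unfolding y by (rule scaffold_vertsD)
    show ?thesis
    proof (cases y)
      case Cell
      have "\<not> s i 0" unfolding s_def by simp
      moreover have "s i V" unfolding s_def lit_def using a[OF ij] by blast
      ultimately show ?thesis unfolding y Cell cC \<sigma>_def by auto
    next
      case (Inner k m)
      then show ?thesis unfolding y Inner cI by simp
    qed
  qed
  have pos1: "1 \<le> b" if "b \<in> scaffold_lists l V pos neg x" for b x
  proof -
    have "1 \<le> chain l f k m" for f k m using colour_bounds[of k] unfolding chain_def by simp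
    moreover obtain i j y where y: "x = (i, j, y)" by (metis surj_pair)
    ultimately show ?thesis using that by (cases y) (auto split: if_splits)
  qed
  have edge: "c x \<noteq> c y" if xy: "scaffold_edge l R ?C x y" for x y
  proof -
    obtain i j k m where *: "m \<le> l" "x = path_node l i j k m" "y = path_node l i j k (Suc m)"
      using xy unfolding scaffold_edge_def by blast
    let ?f = "forbidden (pos i j) (neg i j) k"
    consider "m = 0" | "1 \<le> m" "m < l" | "m = l" "0 < l" using *(1) l by linarith
    then show ?thesis
    proof cases
      case 1
      have x: "x = (i, j, Cell)" and y: "y = (i, j, Inner k 1)" using * 1 l by (auto simp: path_node.simps)
      show ?thesis unfolding x y cC cI using l \<sigma>(2)[of i j] by (auto simp: chain_def g_def)
    next
      case 2
      have x: "x = (i, j, Inner k m)" and y: "y = (i, j, Inner k (Suc m))" using * 2 by (auto simp: path_node.simps)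
      have "chain l ?f k m \<noteq> chain l ?f k (Suc m)" using chain_step l 2 by blast
      moreover have "chain l ?f k (m - 1) \<noteq> chain l ?f k m" using chain_step[OF l, of "m - 1" ?f k] 2 by simp
      ultimately show ?thesis unfolding x y cI by simp
    next
      case 3
      have x: "x = (i, j, Inner k l)" using * 3 by (auto simp: path_node.simps)
      obtain i' j' where y: "y = (i', j', Cell)" using * 3 by (auto simp: path_node.simps split: if_splits)
      have n: "path_node l i j k (Suc l) = (i', j', Cell)" using * 3 y by simp
      show ?thesis
      proof (cases "g i j k")
        case True
        then have "c x = snd_colour k" unfolding x cI using l by (simp add: chain_def)
        moreover have "\<sigma> i' j' \<noteq> snd_colour k" using True no[OF _ _ n] unfolding g_def by blast
        ultimately show ?thesis unfolding y cC by simp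
      next
        case False
        then have "c x = 7 + (l - 1)" unfolding x cI using l by (simp add: chain_def)
        then show ?thesis unfolding y cC using \<sigma>(2)[of i' j'] by simp
      qed
    qed
  qed
  have "list_colouring (scaffold l R ?C) (scaffold_lists l V pos neg) c"
    unfolding list_colouring_def colouring_def respects_lists_def
  proof (intro conjI ballI)
    fix x assume x: "x \<in> pverts (scaffold l R ?C)"
    then have x': "x \<in> scaffold_verts l R ?C" by (simp add: scaffold_def)
    show "c x \<in> scaffold_lists l V pos neg x" using list[OF x'] .
    show "1 \<le> c x" using pos1[OF list[OF x']] .
  next
    fix e assume e: "e \<in> parcs (scaffold l R ?C)"
    obtain x y where xy: "e = (x, y)" by (rule prod.exhaust)
    have "scaffold_edge l R ?C x y \<or> scaffold_edge l R ?C y x" using e unfolding xy by (simp add: scaffold_def)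
    then have "c x \<noteq> c y" using edge by metis
    then show "case e of (u, v) \<Rightarrow> c u \<noteq> c v" unfolding xy by simp
  qed
  then show ?thesis by blast
qed

theorem scaffold_colourable_iff:
  assumes "2 \<le> l" "1 \<le> V"
  shows "(\<exists>c. list_colouring (scaffold l R (Suc V)) (scaffold_lists l V pos neg) c) \<longleftrightarrow> cnf_sat R V pos neg"
  using scaffold_colourable_imp_sat sat_imp_scaffold_colourable assms by blast


section \<open>Encodings\<close>

lemma encode_nats_append: "encode_nats (xs @ ys) = encode_nats xs @ encode_nats ys"
  by (induction xs) (auto simp: pair_def)

lemma encode_nats_concat: "encode_nats (concat xss) = concat (map encode_nats xss)"
  by (induction xss) (auto simp: encode_nats_append)

lemma encode_nats_map: "encode_nats (map f xs) = concat (map (\<lambda>x. encode_nats [f x]) xs)"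
  by (induction xs) (auto simp: pair_def)

lemma encode_eq:
  assumes "card (pverts G) = n"
  shows "encode G L = concat (map (\<lambda>b. [b, b]) (bits n)) @ [False, True] @
     concat (map (\<lambda>u. concat (map (\<lambda>v. if (u, v) \<in> parcs G then [True, True, False, True] else [False, True]) [0..<n])) [0..<n]) @
     concat (map (\<lambda>u. encode_nats (sorted_list_of_set (L u))) [0..<n])"
proof -
  have "encode_nats [if b then 1 else 0] = (if b then [True, True, False, True] else [False, True])" for b
    by (simp add: pair_def bits_0 bits_pos[of 1, simplified])
  then have 1: "encode_nats (concat (map (\<lambda>u. map (\<lambda>v. if (u, v) \<in> parcs G then 1 else 0) [0..<n]) [0..<n])) =
      concat (map (\<lambda>u. concat (map (\<lambda>v. if (u, v) \<in> parcs G then [True, True, False, True] else [False, True]) [0..<n])) [0..<n])"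
    unfolding encode_nats_concat map_map comp_apply encode_nats_map by (simp add: o_def)
  show ?thesis
    unfolding encode_def Let_def assms encode_nats.simps(2) encode_nats_append 1
    by (simp add: pair_def encode_nats_concat o_def)
qed

lemma concat_map_inject:
  assumes "concat (map f [0..<n]) = concat (map g [0..<n])" "\<And>i. i < n \<Longrightarrow> length (f i) = length (g i)"
  shows "i < n \<Longrightarrow> f i = g i"
proof -
  have "map f [0..<n] = map g [0..<n]"
    by (rule concat_injective[OF assms(1)]) (use assms(2) in \<open>auto simp: set_zip\<close>)
  then show "i < n \<Longrightarrow> f i = g i" by simp
qed

text \<open>A string belongs to \<open>yes\<close> by virtue of any graph that it encodes.
  Injectivity ensures that this graph is the constructed one, with the same lists on its
  vertices.\<close>

lemma encode_inject:
  assumes G: "regular_input l G L" and G': "regular_input l G' L'" and eq: "encode G L = encode G' L'"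
  shows "G = G'" "\<And>u. u \<in> pverts G \<Longrightarrow> L u = L' u"
proof -
  define n where "n = card (pverts G)"
  define n' where "n' = card (pverts G')"
  let ?a = "\<lambda>G n. concat (map (\<lambda>u. map (\<lambda>v. if (u, v) \<in> parcs G then 1 else 0 :: nat) [0..<n]) [0..<n])"
  let ?l = "\<lambda>L n. concat (map (\<lambda>u. sorted_list_of_set (L u)) [0..<n])"
  have e: "n # ?a G n @ ?l L n = n' # ?a G' n' @ ?l L' n'"
    using eq unfolding encode_def Let_def encode_nats_inject n_def n'_def .
  then have n: "n' = n" by simp
  have len: "length (?a G n) = length (?a G' n)" by (simp add: length_concat o_def)
  have "?a G n @ ?l L n = ?a G' n @ ?l L' n" using e n by simp
  then have a: "?a G n = ?a G' n" and ll: "?l L n = ?l L' n" using len by simp_all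
  have V: "pverts G = {..<n}" "pverts G' = {..<n}" using G G' n unfolding regular_input_def n_def n'_def by auto
  have sub: "parcs G \<subseteq> {..<n} \<times> {..<n}" "parcs G' \<subseteq> {..<n} \<times> {..<n}"
    using G G' V unfolding regular_input_def pair_graph_iff by auto
  have "(u, v) \<in> parcs G \<longleftrightarrow> (u, v) \<in> parcs G'" if "u < n" "v < n" for u v
  proof -
    have "map (\<lambda>v. if (u, v) \<in> parcs G then 1 else 0 :: nat) [0..<n] = map (\<lambda>v. if (u, v) \<in> parcs G' then 1 else 0) [0..<n]"
      using concat_map_inject[OF a _ that(1)] by simp
    then have "(if (u, v) \<in> parcs G then 1 else 0 :: nat) = (if (u, v) \<in> parcs G' then 1 else 0)"
      using that(2) by simp
    then show ?thesis by (simp split: if_splits)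
  qed
  then have "parcs G = parcs G'" using sub by auto
  then show "G = G'" using V by (intro pair_pre_digraph.equality) simp_all
  fix u assume u: "u \<in> pverts G"
  have r: "finite (L u)" "card (L u) = l" "finite (L' u)" "card (L' u) = l" if "u < n" for u
    using G G' V that unfolding regular_input_def regular_assignment_def by auto
  have "sorted_list_of_set (L u) = sorted_list_of_set (L' u)"
    by (rule concat_map_inject[OF ll]) (use r u V in auto)
  then show "L u = L' u" using r[of u] u V by (metis lessThan_iff set_sorted_list_of_set)
qed

section \<open>Adjacency in the grid, split into coordinates and local positions\<close>

definition local_edge :: "nat \<Rightarrow> loc \<Rightarrow> loc \<Rightarrow> bool" where
  "local_edge l y y' \<longleftrightarrow> (\<exists>k<32. (y = Cell \<and> y' = Inner k 1) \<or> (\<exists>m<l. 1 \<le> m \<and> y = Inner k m \<and> y' = Inner k (Suc m)))"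

definition right_edge :: "nat \<Rightarrow> loc \<Rightarrow> loc \<Rightarrow> bool" where
  "right_edge l y y' \<longleftrightarrow> (\<exists>k<16. y = Inner k l \<and> y' = Cell)"

definition down_edge :: "nat \<Rightarrow> loc \<Rightarrow> loc \<Rightarrow> bool" where
  "down_edge l y y' \<longleftrightarrow> (\<exists>k<32. \<not> k < 16 \<and> y = Inner k l \<and> y' = Cell)"

text \<open>Separates the comparison of coordinates, which depend on the input, from relations on
  \<open>loc\<close> that concern finitely many positions for fixed \<open>l\<close> and can be
  tabulated.\<close>

lemma scaffold_edge_iff:
  assumes l: "1 \<le> l"
  shows "scaffold_edge l R C (i, j, y) (i', j', y') \<longleftrightarrow> i < R \<and> j < C \<and> i' < R \<and> j' < C \<and>
    ((i' = i \<and> j' = j \<and> local_edge l y y') \<or> (i' = i \<and> j' = Suc j \<and> right_edge l y y') \<or>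
     (i' = Suc i \<and> j' = j \<and> down_edge l y y'))"
proof
  assume "scaffold_edge l R C (i, j, y) (i', j', y')"
  then obtain a b k m where *: "a < R" "b < C" "k < 32" "m \<le> l" "(i, j, y) = path_node l a b k m"
    "(i', j', y') = path_node l a b k (Suc m)" and v: "(i', j', y') \<in> scaffold_verts l R C"
    unfolding scaffold_edge_def by blast
  have ij': "i' < R" "j' < C" using scaffold_vertsD[OF v] by auto
  consider "m = 0" | "1 \<le> m" "m < l" | "1 \<le> m" "m = l" using *(4) l by linarith
  then show "i < R \<and> j < C \<and> i' < R \<and> j' < C \<and>
    ((i' = i \<and> j' = j \<and> local_edge l y y') \<or> (i' = i \<and> j' = Suc j \<and> right_edge l y y') \<or>
     (i' = Suc i \<and> j' = j \<and> down_edge l y y'))"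
  proof cases
    case 1
    then have "i = a" "j = b" "y = Cell" "i' = a" "j' = b" "y' = Inner k 1" using *(5,6) l by (auto simp: path_node.simps)
    then show ?thesis using * ij' unfolding local_edge_def by blast
  next
    case 2
    then have "i = a" "j = b" "y = Inner k m" "i' = a" "j' = b" "y' = Inner k (Suc m)" using *(5,6) by (auto simp: path_node.simps)
    then show ?thesis using * 2 ij' unfolding local_edge_def by blast
  next
    case 3
    then have e: "i = a" "j = b" "y = Inner k l" "y' = Cell" using *(5,6) by (auto simp: path_node.simps split: if_splits)
    show ?thesis
    proof (cases "k < 16")
      case True
      then have "i' = a" "j' = Suc b" using *(6) 3 by (auto simp: path_node.simps)
      then show ?thesis using * e ij' True unfolding right_edge_def by blast
    next
      case False
      then have "i' = Suc a" "j' = b" using *(6) 3 by (auto simp: path_node.simps)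
      then show ?thesis using * e ij' False unfolding down_edge_def by blast
    qed
  qed
next
  assume a: "i < R \<and> j < C \<and> i' < R \<and> j' < C \<and>
    ((i' = i \<and> j' = j \<and> local_edge l y y') \<or> (i' = i \<and> j' = Suc j \<and> right_edge l y y') \<or>
     (i' = Suc i \<and> j' = j \<and> down_edge l y y'))"
  have I: "scaffold_edge l R C (i, j, y) (i', j', y')"
    if "k < 32" "m \<le> l" "(i, j, y) = path_node l i j k m" "(i', j', y') = path_node l i j k (Suc m)"
      "(i', j', y') \<in> scaffold_verts l R C" for k m
    using that a unfolding scaffold_edge_def by blast
  have b: "i < R" "j < C" "i' < R" "j' < C" using a by blast+
  have "(i' = i \<and> j' = j \<and> local_edge l y y') \<or> (i' = i \<and> j' = Suc j \<and> right_edge l y y') \<or>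
     (i' = Suc i \<and> j' = j \<and> down_edge l y y')" using a by blast
  then show "scaffold_edge l R C (i, j, y) (i', j', y')"
  proof (elim disjE conjE)
    assume e: "i' = i" "j' = j" "local_edge l y y'"
    then obtain k where k: "k < 32" "(y = Cell \<and> y' = Inner k 1) \<or> (\<exists>m<l. 1 \<le> m \<and> y = Inner k m \<and> y' = Inner k (Suc m))"
      unfolding local_edge_def by blast
    from k(2) show ?thesis
    proof (elim disjE exE conjE)
      assume "y = Cell" "y' = Inner k 1"
      then show ?thesis using e b k l by (intro I[of k 0]) (auto simp: path_node.simps intro!: scaffold_vertsI)
    next
      fix m assume "m < l" "1 \<le> m" "y = Inner k m" "y' = Inner k (Suc m)"
      then show ?thesis using e b k l by (intro I[of k m]) (auto simp: path_node.simps intro!: scaffold_vertsI)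
    qed
  next
    assume e: "i' = i" "j' = Suc j" "right_edge l y y'"
    then obtain k where "k < 16" "y = Inner k l" "y' = Cell" unfolding right_edge_def by blast
    then show ?thesis using e b l by (intro I[of k l]) (auto simp: path_node.simps intro!: scaffold_vertsI)
  next
    assume e: "i' = Suc i" "j' = j" "down_edge l y y'"
    then obtain k where "k < 32" "\<not> k < 16" "y = Inner k l" "y' = Cell" unfolding down_edge_def by blast
    then show ?thesis using e b l by (intro I[of k l]) (auto simp: path_node.simps intro!: scaffold_vertsI)
  qed
qed

section \<open>Renumbering of vertices\<close>

definition numbered :: "(nat \<Rightarrow> 'a) \<Rightarrow> nat \<Rightarrow> 'a pair_pre_digraph \<Rightarrow> nat pair_pre_digraph" where
  "numbered D n F = \<lparr>pverts = {..<n}, parcs = {(u, v). u < n \<and> v < n \<and> (D u, D v) \<in> parcs F}\<rparr>"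

lemma numbered_eq_map_graph:
  assumes D: "bij_betw D {..<n} (pverts F)" and F: "pair_graph F"
  shows "numbered D n F = map_graph (the_inv_into {..<n} D) F"
    and "inj_on (the_inv_into {..<n} D) (pverts F)"
proof -
  let ?h = "the_inv_into {..<n} D"
  have bij: "bij_betw ?h (pverts F) {..<n}" by (rule bij_betw_the_inv_into[OF D])
  then show "inj_on ?h (pverts F)" by (rule bij_betw_imp_inj_on)
  have hD: "?h (D u) = u" if "u < n" for u using D that by (simp add: bij_betw_def the_inv_into_f_f)
  have Dh: "D (?h x) = x" if "x \<in> pverts F" for x using f_the_inv_into_f_bij_betw[OF D] that by blast
  have hn: "?h x < n" if "x \<in> pverts F" for x using bij that by (auto dest: bij_betwE)
  have e: "x \<in> pverts F" "y \<in> pverts F" if "(x, y) \<in> parcs F" for x y using F that unfolding pair_graph_iff by auto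
  have "(u, v) \<in> map_prod ?h ?h ` parcs F \<longleftrightarrow> u < n \<and> v < n \<and> (D u, D v) \<in> parcs F" for u v
  proof
    assume "(u, v) \<in> map_prod ?h ?h ` parcs F"
    then obtain x y where xy: "(x, y) \<in> parcs F" "u = ?h x" "v = ?h y" by auto
    show "u < n \<and> v < n \<and> (D u, D v) \<in> parcs F"
      using hn[OF e(1)[OF xy(1)]] hn[OF e(2)[OF xy(1)]] Dh[OF e(1)[OF xy(1)]] Dh[OF e(2)[OF xy(1)]] xy by simp
  next
    assume a: "u < n \<and> v < n \<and> (D u, D v) \<in> parcs F"
    then have "(u, v) = map_prod ?h ?h (D u, D v)" using hD by simp
    then show "(u, v) \<in> map_prod ?h ?h ` parcs F" using a by (intro image_eqI) auto
  qed
  then have "map_prod ?h ?h ` parcs F = {(u, v). u < n \<and> v < n \<and> (D u, D v) \<in> parcs F}" by auto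
  moreover have "?h ` pverts F = {..<n}" using bij by (rule bij_betw_imp_surj_on)
  ultimately show "numbered D n F = map_graph ?h F" unfolding numbered_def map_graph_def by simp
qed

lemma numbered_colourable_iff:
  assumes D: "bij_betw D {..<n} (pverts F)" and F: "pair_graph F"
  shows "(\<exists>c. list_colouring (numbered D n F) (L \<circ> D) c) \<longleftrightarrow> (\<exists>c. list_colouring F L c)"
proof
  assume "\<exists>c. list_colouring (numbered D n F) (L \<circ> D) c"
  then obtain c where c: "list_colouring (numbered D n F) (L \<circ> D) c" ..
  let ?h = "the_inv_into {..<n} D"
  have bij: "bij_betw ?h (pverts F) {..<n}" by (rule bij_betw_the_inv_into[OF D])
  have Dh: "D (?h x) = x" if "x \<in> pverts F" for x using f_the_inv_into_f_bij_betw[OF D] that by blast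
  have hn: "?h x < n" if "x \<in> pverts F" for x using bij that by (auto dest: bij_betwE)
  have e: "x \<in> pverts F" "y \<in> pverts F" if "(x, y) \<in> parcs F" for x y using F that unfolding pair_graph_iff by auto
  have c1: "1 \<le> c u" "c u \<in> L (D u)" if "u < n" for u
    using c that unfolding list_colouring_def colouring_def respects_lists_def numbered_def by auto
  have c2: "c u \<noteq> c v" if "u < n" "v < n" "(D u, D v) \<in> parcs F" for u v
    using c that unfolding list_colouring_def colouring_def numbered_def by auto
  have "list_colouring F L (c \<circ> ?h)"
    unfolding list_colouring_def colouring_def respects_lists_def
  proof (intro conjI ballI)
    fix x assume x: "x \<in> pverts F"
    show "1 \<le> (c \<circ> ?h) x" "(c \<circ> ?h) x \<in> L x" using c1[OF hn[OF x]] Dh[OF x] by simp_all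
  next
    fix ed assume ed: "ed \<in> parcs F"
    obtain x y where xy: "ed = (x, y)" by (rule prod.exhaust)
    show "case ed of (u, v) \<Rightarrow> (c \<circ> ?h) u \<noteq> (c \<circ> ?h) v"
      using c2[of "?h x" "?h y"] ed hn e Dh unfolding xy by auto
  qed
  then show "\<exists>c. list_colouring F L c" by blast
next
  assume "\<exists>c. list_colouring F L c"
  then obtain c where c: "list_colouring F L c" ..
  have "D u \<in> pverts F" if "u < n" for u using D that by (auto dest: bij_betwE)
  then have "list_colouring (numbered D n F) (L \<circ> D) (c \<circ> D)"
    using c unfolding list_colouring_def colouring_def respects_lists_def numbered_def by auto
  then show "\<exists>c. list_colouring (numbered D n F) (L \<circ> D) c" by blast
qed

text \<open>These are the mixed-radix digits of \<open>u = (i * C + j) * T + a\<close> with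
  \<open>y = h a\<close>.\<close>

lemma grid_decode_bij:
  fixes R C T :: nat
  assumes h: "bij_betw h {..<T} Y" and "0 < T" "0 < C"
  shows "bij_betw (\<lambda>u. (u div T div C, u div T mod C, h (u mod T))) {..<R * C * T} ({..<R} \<times> {..<C} \<times> Y)"
proof (rule bij_betwI')
  fix u v assume "u \<in> {..<R * C * T}" "v \<in> {..<R * C * T}"
  have "h (u mod T) = h (v mod T) \<longleftrightarrow> u mod T = v mod T"
    using h assms(2) by (intro inj_on_eq_iff[OF bij_betw_imp_inj_on[OF h]]) auto
  moreover have "u = v" if "u div T = v div T" "u mod T = v mod T"
    using that by (metis div_mult_mod_eq)
  moreover have "u div T = v div T" if "u div T div C = v div T div C" "u div T mod C = v div T mod C"
    using that by (metis div_mult_mod_eq)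
  ultimately show "((u div T div C, u div T mod C, h (u mod T)) = (v div T div C, v div T mod C, h (v mod T))) = (u = v)"
    by auto
next
  fix u assume "u \<in> {..<R * C * T}"
  then have "u div T < R * C" by (simp add: less_mult_imp_div_less)
  then have "u div T div C < R" by (simp add: less_mult_imp_div_less)
  then show "(u div T div C, u div T mod C, h (u mod T)) \<in> {..<R} \<times> {..<C} \<times> Y"
    using h assms(2,3) by (auto dest: bij_betwE)
next
  fix q assume "q \<in> {..<R} \<times> {..<C} \<times> Y"
  then obtain i j y where q: "q = (i, j, y)" "i < R" "j < C" "y \<in> Y" by auto
  then obtain a where a: "a < T" "h a = y" using h by (metis bij_betw_iff_bijections lessThan_iff)
  let ?u = "(i * C + j) * T + a"
  have "i * C + j < R * C"
  proof -
    have "i * C + j < i * C + C" using q(3) by simp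
    also have "\<dots> = Suc i * C" by simp
    also have "\<dots> \<le> R * C" using q(2) by (intro mult_right_mono) auto
    finally show ?thesis .
  qed
  then have "?u < R * C * T"
  proof -
    assume b: "i * C + j < R * C"
    have "?u < (i * C + j) * T + T" using a(1) by simp
    also have "\<dots> = Suc (i * C + j) * T" by simp
    also have "\<dots> \<le> R * C * T" using b by (intro mult_right_mono) auto
    finally show ?thesis .
  qed
  moreover have "?u div T = i * C + j" "?u mod T = a" using a(1) by simp_all
  moreover have "(i * C + j) div C = i" "(i * C + j) mod C = j" using q(3) by simp_all
  ultimately show "\<exists>u\<in>{..<R * C * T}. q = (u div T div C, u div T mod C, h (u mod T))"
    using q(1) a(2) by (intro bexI[of _ ?u]) simp_all
qed


section \<open>The reduction from satisfiability\<close>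

text \<open>The two arguments are packed into the number \<open>a * K + b\<close>, so that a table
  with one argument does.\<close>

lemma pdefb_table2:
  assumes "pdef f" "pdef g"
  shows "pdefb (\<lambda>x \<rho>. f x \<rho> < K \<and> g x \<rho> < K \<and> P (f x \<rho>) (g x \<rho>))"
proof -
  have eq: "a < K \<and> b < K \<and> P a b \<longleftrightarrow> a < K \<and> b < K \<and> a * K + b < K * K \<and> P ((a * K + b) div K) ((a * K + b) mod K)" for a b
  proof -
    have "a * K + b < K * K" if "a < K" "b < K"
    proof -
      have "a * K + b < a * K + K" using that by simp
      also have "\<dots> = Suc a * K" by simp
      also have "\<dots> \<le> K * K" using that by (intro mult_right_mono) auto
      finally show ?thesis .
    qed
    then show ?thesis by auto
  qed
  have t: "pdefb (\<lambda>x \<rho>. f x \<rho> * K + g x \<rho> < K * K \<and> P ((f x \<rho> * K + g x \<rho>) div K) ((f x \<rho> * K + g x \<rho>) mod K))"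
    using pdefb_table[of "\<lambda>x \<rho>. f x \<rho> * K + g x \<rho>" "K * K" "\<lambda>n. P (n div K) (n mod K)"]
    by (simp add: pdef_add pdef_mult pdef_const assms)
  show ?thesis unfolding eq by (intro pdefb_conj pdefb_less assms pdef_const t)
qed

lemma odef_bool:
  assumes "pdefb P" "odef (G True)" "odef (G False)"
  shows "odef (\<lambda>x \<rho>. G (P x \<rho>) x \<rho>)"
proof -
  have "G (P x \<rho>) x \<rho> = (if P x \<rho> then G True x \<rho> else G False x \<rho>)" for x \<rho> by simp
  then show ?thesis using odef_if[OF assms] by simp
qed

text \<open>The four truth values are decided one after the other, which leaves sixteen fixed tables
  indexed by a residue modulo \<open>T\<close>.\<close>

lemma odef_entry:
  assumes P: "pdefb P1" "pdefb P2" "pdefb P3" "pdefb P4" and f: "pdef f" and T: "0 < (T :: nat)"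
  shows "odef (\<lambda>x \<rho>. W (P1 x \<rho>) (P2 x \<rho>) (P3 x \<rho>) (P4 x \<rho>) (f x \<rho> mod T))"
proof -
  have 0: "odef (\<lambda>x \<rho>. W a b c d (f x \<rho> mod T))" for a b c d
  proof -
    have "odef (\<lambda>x \<rho>. if f x \<rho> mod T < T then W a b c d (f x \<rho> mod T) else [])"
      using odef_table[of "\<lambda>x \<rho>. f x \<rho> mod T" T "\<lambda>i x \<rho>. W a b c d i"] f by (simp add: pdef_mod pdef_const odef_Emit)
    then show ?thesis using T by simp
  qed
  have 1: "odef (\<lambda>x \<rho>. W a b c (P4 x \<rho>) (f x \<rho> mod T))" for a b c
    using odef_bool[OF P(4), of "\<lambda>d x \<rho>. W a b c d (f x \<rho> mod T)"] 0 by simp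
  have 2: "odef (\<lambda>x \<rho>. W a b (P3 x \<rho>) (P4 x \<rho>) (f x \<rho> mod T))" for a b
    using odef_bool[OF P(3), of "\<lambda>c x \<rho>. W a b c (P4 x \<rho>) (f x \<rho> mod T)"] 1 by simp
  have 3: "odef (\<lambda>x \<rho>. W a (P2 x \<rho>) (P3 x \<rho>) (P4 x \<rho>) (f x \<rho> mod T))" for a
    using odef_bool[OF P(2), of "\<lambda>b x \<rho>. W a b (P3 x \<rho>) (P4 x \<rho>) (f x \<rho> mod T)"] 2 by simp
  show ?thesis
    using odef_bool[OF P(1), of "\<lambda>a x \<rho>. W a (P2 x \<rho>) (P3 x \<rho>) (P4 x \<rho>) (f x \<rho> mod T)"] 3 by simp
qed

definition pdef2b :: "(bool list \<Rightarrow> nat \<Rightarrow> nat \<Rightarrow> bool) \<Rightarrow> bool" where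
  "pdef2b P \<longleftrightarrow> (\<forall>f g. pdef f \<longrightarrow> pdef g \<longrightarrow> pdefb (\<lambda>x \<rho>. P x (f x \<rho>) (g x \<rho>)))"

lemma pdef2bD: "pdef2b P \<Longrightarrow> pdef f \<Longrightarrow> pdef g \<Longrightarrow> pdefb (\<lambda>x \<rho>. P x (f x \<rho>) (g x \<rho>))"
  unfolding pdef2b_def by blast

section \<open>The reduction for a fixed forcing gadget\<close>

locale forcing_gadget =
  fixes G :: "nat pair_pre_digraph" and L0 :: "nat \<Rightarrow> nat set" and r z l :: nat and c0 :: "nat \<Rightarrow> nat"
  assumes planar: "planar G" and reg: "regular_assignment 4 G L0" and r: "r \<in> pverts G" and z: "1 \<le> z"
    and c0: "list_colouring G L0 c0" and forced: "\<And>c. list_colouring G L0 c \<Longrightarrow> c r = z" and l: "2 \<le> l"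
begin

definition full :: "nat \<Rightarrow> nat \<Rightarrow> ((nat \<times> nat \<times> loc) \<times> (nat \<times> nat) option) pair_pre_digraph" where
  "full R C = gadget_graph G r (scaffold l R C) (pverts (scaffold l R C) \<times> {..<2})"

text \<open>Every grid vertex has a list of four and two gadgets. At cells these delete 3 and 4 in
  the first column, 1 and 2 in the last, and otherwise 5 and 6, which no cell uses. The lists of
  inner vertices are padded with 5 and 6, deleted again by their gadgets; \<open>chain\<close>
  avoids both colours.\<close>

fun local_list :: "bool \<Rightarrow> bool \<Rightarrow> bool \<Rightarrow> bool \<Rightarrow> loc \<times> (nat \<times> nat) option \<Rightarrow> nat set" where
  "local_list first final p n (Cell, None) = {1, 2, 3, 4}"
| "local_list first final p n (Inner k m, None) =
     {chain l (forbidden p n k) k (m - 1), chain l (forbidden p n k) k m, 5, 6}"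
| "local_list first final p n (Cell, Some (e, a)) =
     Transposition.transpose z (if first then 3 + e else if final then 1 + e else 5 + e) ` L0 a"
| "local_list first final p n (Inner k m, Some (e, a)) = Transposition.transpose z (5 + e) ` L0 a"

definition full_lists :: "nat \<Rightarrow> (nat \<Rightarrow> nat \<Rightarrow> bool) \<Rightarrow> (nat \<Rightarrow> nat \<Rightarrow> bool) \<Rightarrow>
    (nat \<times> nat \<times> loc) \<times> (nat \<times> nat) option \<Rightarrow> nat set" where
  "full_lists V pos neg = (\<lambda>((i, j, y), g). local_list (j = 0) (j = V) (pos i j) (neg i j) (y, g))"

text \<open>The vertices that belong to one cell, up to translation. The input determines how many
  cells there are, not this set.\<close>

definition local_types :: "(loc \<times> (nat \<times> nat) option) set" where
  "local_types = insert Cell {Inner k m | k m. k < 32 \<and> 1 \<le> m \<and> m \<le> l} \<times> insert None (Some ` ({..<2} \<times> pverts G))"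

lemma pair_graph_G: "pair_graph G"
  using planar unfolding planar_iff by blast

lemma finite_local_types: "finite local_types"
proof -
  have "{Inner k m | k m. k < 32 \<and> 1 \<le> m \<and> m \<le> l} = (\<lambda>(k, m). Inner k m) ` ({..<32} \<times> {1..l})" by auto
  then show ?thesis using pair_graph_G unfolding local_types_def pair_graph_iff by simp
qed

lemma planar_full: "planar (full R C)"
  unfolding full_def
  by (rule planar_gadget_graph[OF planar r planar_scaffold])
    (auto simp: scaffold_def finite_scaffold_verts)

lemma subgraph_free_full:
  assumes "\<And>H. H \<in> \<H> \<Longrightarrow> two_connected H \<and> card (pverts H) < l" "subgraph_free \<H> G"
  shows "subgraph_free \<H> (full R C)"
  unfolding full_def using subgraph_free_gadget_graph[OF assms(1) _ pair_graph_G assms(2)] l by simp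

lemma pverts_full: "((i, j, y), g) \<in> pverts (full R C) \<longleftrightarrow> i < R \<and> j < C \<and> (y, g) \<in> local_types"
  unfolding full_def gadget_graph_def local_types_def scaffold_def scaffold_verts_def by (cases g) auto

lemma chain_ne_5_6: "chain l f k m \<noteq> 5" "chain l f k m \<noteq> 6" "1 \<le> chain l f k m"
  using colour_bounds[of k] unfolding chain_def by auto

lemma regular_full: "regular_assignment 4 (full R C) (full_lists V pos neg)"
  unfolding regular_assignment_def
proof
  fix v assume v: "v \<in> pverts (full R C)"
  obtain i j y g where vg: "v = ((i, j, y), g)" by (metis surj_pair)
  have lt: "(y, g) \<in> local_types" using v unfolding vg pverts_full by blast
  let ?L = "local_list (j = 0) (j = V) (pos i j) (neg i j) (y, g)"
  have T: "Transposition.transpose z f ` L0 a \<subseteq> {1..} \<and> finite (Transposition.transpose z f ` L0 a) \<and> card (Transposition.transpose z f ` L0 a) = 4"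
    if "a \<in> pverts G" "1 \<le> f" for f a
  proof -
    have "L0 a \<subseteq> {1..}" "finite (L0 a)" "card (L0 a) = 4" using reg that unfolding regular_assignment_def by auto
    moreover have "card (Transposition.transpose z f ` L0 a) = card (L0 a)"
      by (rule card_image) (rule inj_on_transpose)
    moreover have "1 \<le> Transposition.transpose z f b" if "1 \<le> b" for b
      using that z \<open>1 \<le> f\<close> unfolding Transposition.transpose_def by simp
    ultimately show ?thesis by auto
  qed
  have "?L \<subseteq> {1..} \<and> finite ?L \<and> card ?L = 4"
  proof (cases g)
    case None
    show ?thesis
    proof (cases y)
      case Cell
      then show ?thesis using None by simp
    next
      case (Inner k m)
      then have m: "1 \<le> m" "m \<le> l" using lt unfolding local_types_def by auto
      let ?f = "forbidden (pos i j) (neg i j) k"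
      have "chain l ?f k (m - 1) \<noteq> chain l ?f k m" using chain_step[OF l, of "m - 1" ?f k] m by simp
      then show ?thesis using Inner None chain_ne_5_6[of ?f k] by (simp add: card_insert_if)
    qed
  next
    case (Some ea)
    then obtain e a where ea: "g = Some (e, a)" by fastforce
    then have a: "a \<in> pverts G" using lt unfolding local_types_def by auto
    show ?thesis using T[OF a] unfolding ea by (cases y) auto
  qed
  then show "full_lists V pos neg v \<subseteq> {1..} \<and> finite (full_lists V pos neg v) \<and> card (full_lists V pos neg v) = 4"
    unfolding full_lists_def vg by simp
qed

lemma full_colourable_iff:
  assumes "1 \<le> V"
  shows "(\<exists>c. list_colouring (full R (Suc V)) (full_lists V pos neg) c) \<longleftrightarrow> cnf_sat R V pos neg"
proof -
  let ?S = "scaffold l R (Suc V)"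
  define B where "B = (\<lambda>(i, j, y). local_list (j = 0) (j = V) (pos i j) (neg i j) (y, None))"
  define \<phi> where "\<phi> = (\<lambda>(i :: nat, j, y) e. case y of Cell \<Rightarrow> (if j = 0 then 3 + e else if j = V then 1 + e else 5 + e) | Inner k m \<Rightarrow> 5 + (e :: nat))"
  have L: "full_lists V pos neg = gadget_lists L0 z \<phi> B"
  proof
    fix v :: "(nat \<times> nat \<times> loc) \<times> (nat \<times> nat) option"
    obtain i j y g where vg: "v = ((i, j, y), g)" by (metis surj_pair)
    show "full_lists V pos neg v = gadget_lists L0 z \<phi> B v"
    proof (cases g)
      case None
      then show ?thesis unfolding vg full_lists_def gadget_lists_def B_def by simp
    next
      case (Some ea)
      then obtain e a where "g = Some (e, a)" by fastforce
      then show ?thesis unfolding vg full_lists_def gadget_lists_def \<phi>_def by (cases y) auto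
    qed
  qed
  have two: "f ` {..<2} = {f 0, f 1}" for f :: "nat \<Rightarrow> nat"
    by (auto simp: lessThan_Suc numeral_2_eq_2)
  have BL: "B s - \<phi> s ` {..<2} = scaffold_lists l V pos neg s" for s
  proof -
    obtain i j y where s: "s = (i, j, y)" by (metis surj_pair)
    show ?thesis
    proof (cases y)
      case Cell
      then show ?thesis unfolding s two B_def \<phi>_def by auto
    next
      case (Inner k m)
      then show ?thesis unfolding s two B_def \<phi>_def using chain_ne_5_6[of "forbidden (pos i j) (neg i j) k" k] by auto
    qed
  qed
  have "parcs ?S \<subseteq> pverts ?S \<times> pverts ?S" using pair_graph_scaffold unfolding pair_graph_iff by fast
  moreover have "1 \<le> \<phi> s e" for s e unfolding \<phi>_def by (auto split: loc.split prod.split)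
  ultimately have "(\<exists>c. list_colouring (full R (Suc V)) (full_lists V pos neg) c) \<longleftrightarrow>
      (\<exists>c. list_colouring ?S (\<lambda>s. B s - \<phi> s ` {..<2}) c)"
    unfolding full_def L
    by (intro gadget_graph_colourable_iff[OF reg r z c0 _ _ _ pair_graph_G] forced)
  then show ?thesis unfolding BL using scaffold_colourable_iff[OF l assms] by simp
qed

fun same_cell_edge :: "loc \<times> (nat \<times> nat) option \<Rightarrow> loc \<times> (nat \<times> nat) option \<Rightarrow> bool" where
  "same_cell_edge (y, None) (y', None) \<longleftrightarrow> local_edge l y y' \<or> local_edge l y' y"
| "same_cell_edge (y, Some (e, a)) (y', Some (e', a')) \<longleftrightarrow> y = y' \<and> e = e' \<and> (a, a') \<in> parcs G"
| "same_cell_edge (y, None) (y', Some (e, a)) \<longleftrightarrow> y = y' \<and> a = r"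
| "same_cell_edge (y, Some (e, a)) (y', None) \<longleftrightarrow> y = y' \<and> a = r"

definition right_cell_edge :: "loc \<times> (nat \<times> nat) option \<Rightarrow> loc \<times> (nat \<times> nat) option \<Rightarrow> bool" where
  "right_cell_edge p q \<longleftrightarrow> snd p = None \<and> snd q = None \<and> right_edge l (fst p) (fst q)"

definition down_cell_edge :: "loc \<times> (nat \<times> nat) option \<Rightarrow> loc \<times> (nat \<times> nat) option \<Rightarrow> bool" where
  "down_cell_edge p q \<longleftrightarrow> snd p = None \<and> snd q = None \<and> down_edge l (fst p) (fst q)"

lemma parcs_full_iff:
  assumes v: "i < R" "j < C" "(y, g) \<in> local_types" and v': "i' < R" "j' < C" "(y', g') \<in> local_types"
  shows "(((i, j, y), g), ((i', j', y'), g')) \<in> parcs (full R C) \<longleftrightarrow>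
    (i = i' \<and> j = j' \<and> same_cell_edge (y, g) (y', g')) \<or>
    (i' = i \<and> j' = Suc j \<and> right_cell_edge (y, g) (y', g')) \<or>
    (i = i' \<and> j = Suc j' \<and> right_cell_edge (y', g') (y, g)) \<or>
    (i' = Suc i \<and> j' = j \<and> down_cell_edge (y, g) (y', g')) \<or>
    (i = Suc i' \<and> j = j' \<and> down_cell_edge (y', g') (y, g))"
proof -
  have Q: "(i, j, y) \<in> pverts (scaffold l R C)" "(i', j', y') \<in> pverts (scaffold l R C)"
    using v v' unfolding local_types_def scaffold_def scaffold_verts_def by auto
  have e: "e < 2 \<and> a \<in> pverts G" if "(y, Some (e, a)) \<in> local_types" for y e a
    using that unfolding local_types_def by auto
  have l1: "1 \<le> l" using l by simp
  show ?thesis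
  proof (cases g)
    case None
    show ?thesis
    proof (cases g')
      case N': None
      have "(((i, j, y), g), ((i', j', y'), g')) \<in> parcs (full R C) \<longleftrightarrow>
          scaffold_edge l R C (i, j, y) (i', j', y') \<or> scaffold_edge l R C (i', j', y') (i, j, y)"
        unfolding full_def gadget_graph_def None N' by (auto simp: scaffold_def)
      then show ?thesis unfolding scaffold_edge_iff[OF l1] None N' right_cell_edge_def down_cell_edge_def using v v' by auto
    next
      case (Some ea)
      then obtain e a where ea: "g' = Some (e, a)" by fastforce
      then show ?thesis using None Q e[of y' e a] v' unfolding full_def gadget_graph_def right_cell_edge_def down_cell_edge_def by auto
    qed
  next
    case (Some ea)
    then obtain e0 a where ea: "g = Some (e0, a)" by fastforce
    show ?thesis
    proof (cases g')
      case None
      then show ?thesis using ea Q e[of y e0 a] v unfolding full_def gadget_graph_def right_cell_edge_def down_cell_edge_def by auto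
    next
      case (Some ea')
      then obtain e' a' where ea': "g' = Some (e', a')" by fastforce
      then show ?thesis using ea Q e[of y e0 a] v unfolding full_def gadget_graph_def right_cell_edge_def down_cell_edge_def by auto
    qed
  qed
qed

text \<open>By division with remainder a vertex number yields a row, a column and a local type.
  Adjacency compares coordinates and looks up fixed tables, and a list depends only on the type, on
  whether the column is the first or last, and on the two literals of the cell; so each entry of the
  encoding is definable.\<close>

theorem poly_time_reduction:
  assumes R: "pdef (\<lambda>x \<rho>. R x)" and V: "pdef (\<lambda>x \<rho>. V x)" "\<And>x. 1 \<le> V x"
    and pos: "pdef2b pos" and neg: "pdef2b neg"
    and H: "\<And>H. H \<in> \<H> \<Longrightarrow> two_connected H \<and> card (pverts H) < l" "subgraph_free \<H> G"
  shows "\<exists>f. poly_time f \<and> (\<forall>x. \<exists>G' L'. f x = encode G' L' \<and> regular_input 4 G' L' \<and> planar G' \<and> subgraph_free \<H> G' \<and>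
    ((\<exists>c. list_colouring G' L' c) \<longleftrightarrow> cnf_sat (R x) (V x) (pos x) (neg x)))"
proof -
  define T where "T = card local_types"
  have "(Cell, None) \<in> local_types" unfolding local_types_def by simp
  then have T: "0 < T" unfolding T_def using finite_local_types by (auto simp: card_gt_0_iff)
  obtain h where h: "bij_betw h {..<T} local_types"
    unfolding T_def using ex_bij_betw_nat_finite[OF finite_local_types] by (auto simp: atLeast0LessThan)
  define C where "C x = Suc (V x)" for x
  define n where "n x = R x * C x * T" for x
  define I where "I x u = u div T div C x" for x u
  define J where "J x u = u div T mod C x" for x u
  define D where "D x u = ((I x u, J x u, fst (h (u mod T))), snd (h (u mod T)))" for x u
  define G' where "G' x = numbered (D x) (n x) (full (R x) (C x))" for x
  define L' where "L' x = full_lists (V x) (pos x) (neg x) \<circ> D x" for x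
  have D: "bij_betw (D x) {..<n x} (pverts (full (R x) (C x)))" for x
  proof -
    let ?d = "\<lambda>u. (u div T div C x, u div T mod C x, h (u mod T))"
    let ?s = "\<lambda>(i, j, y, g). ((i :: nat, j :: nat, y :: loc), g :: (nat \<times> nat) option)"
    have "bij_betw ?d {..<n x} ({..<R x} \<times> {..<C x} \<times> local_types)"
      unfolding n_def by (rule grid_decode_bij[OF h T]) (simp add: C_def)
    moreover have "bij_betw ?s ({..<R x} \<times> {..<C x} \<times> local_types) (pverts (full (R x) (C x)))"
    proof (rule bij_betwI')
      fix v assume "v \<in> pverts (full (R x) (C x))"
      moreover obtain i j y g where "v = ((i, j, y), g)" by (metis surj_pair)
      ultimately show "\<exists>q\<in>{..<R x} \<times> {..<C x} \<times> local_types. v = ?s q"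
        by (intro bexI[of _ "(i, j, y, g)"]) (auto simp: pverts_full)
    qed (auto simp: pverts_full)
    ultimately have "bij_betw (?s \<circ> ?d) {..<n x} (pverts (full (R x) (C x)))" by (rule bij_betw_trans)
    moreover have "?s \<circ> ?d = D x" by (rule ext) (simp add: D_def I_def J_def split_beta)
    ultimately show ?thesis by simp
  qed
  have pg: "pair_graph (full (R x) (C x))" for x using planar_full unfolding planar_iff by blast
  note nm = numbered_eq_map_graph[OF D pg]
  have pl: "planar (G' x)" for x unfolding G'_def nm(1) by (rule planar_map_graph[OF planar_full nm(2)])
  have sf: "subgraph_free \<H> (G' x)" for x
    unfolding G'_def nm(1) by (rule subgraph_free_map_graph[OF subgraph_free_full[OF H] pg nm(2)])
  have Dv: "D x u \<in> pverts (full (R x) (C x))" if "u < n x" for x u using D[of x] that by (auto dest: bij_betwE)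
  have ri: "regular_input 4 (G' x) (L' x)" for x
    unfolding regular_input_def
  proof (intro conjI)
    show "pair_graph (G' x)" using pl unfolding planar_iff by blast
    show "pverts (G' x) = {..<card (pverts (G' x))}" unfolding G'_def numbered_def by simp
    show "regular_assignment 4 (G' x) (L' x)"
      using regular_full[of "R x" "C x" "V x" "pos x" "neg x"] Dv
      unfolding regular_assignment_def G'_def L'_def numbered_def by simp
  qed
  have col: "(\<exists>c. list_colouring (G' x) (L' x) c) \<longleftrightarrow> cnf_sat (R x) (V x) (pos x) (neg x)" for x
    unfolding G'_def L'_def numbered_colourable_iff[OF D pg] unfolding C_def by (rule full_colourable_iff[OF V(2)])
  \<comment> \<open>The bounds \<open>u mod T < T\<close> and \<open>v mod T < T\<close> bring the
    lookups into the form of \<open>pdefb_table2\<close>.\<close>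
  define adj where "adj x u v \<longleftrightarrow>
    (I x u = I x v \<and> J x u = J x v \<and> (u mod T < T \<and> v mod T < T \<and> same_cell_edge (h (u mod T)) (h (v mod T)))) \<or>
    (I x v = I x u \<and> J x v = Suc (J x u) \<and> (u mod T < T \<and> v mod T < T \<and> right_cell_edge (h (u mod T)) (h (v mod T)))) \<or>
    (I x u = I x v \<and> J x u = Suc (J x v) \<and> (v mod T < T \<and> u mod T < T \<and> right_cell_edge (h (v mod T)) (h (u mod T)))) \<or>
    (I x v = Suc (I x u) \<and> J x v = J x u \<and> (u mod T < T \<and> v mod T < T \<and> down_cell_edge (h (u mod T)) (h (v mod T)))) \<or>
    (I x u = Suc (I x v) \<and> J x u = J x v \<and> (v mod T < T \<and> u mod T < T \<and> down_cell_edge (h (v mod T)) (h (u mod T))))" for x u v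
  have adj: "(u, v) \<in> parcs (G' x) \<longleftrightarrow> adj x u v" if "u < n x" "v < n x" for x u v
  proof -
    have m: "I x u < R x" "J x u < C x" "(fst (h (u mod T)), snd (h (u mod T))) \<in> local_types"
      "I x v < R x" "J x v < C x" "(fst (h (v mod T)), snd (h (v mod T))) \<in> local_types"
      using Dv[OF that(1)] Dv[OF that(2)] unfolding D_def pverts_full by blast+
    have "(u, v) \<in> parcs (G' x) \<longleftrightarrow> (D x u, D x v) \<in> parcs (full (R x) (C x))"
      using that unfolding G'_def numbered_def by simp
    also have "\<dots> \<longleftrightarrow> adj x u v" unfolding D_def parcs_full_iff[OF m] adj_def using T by simp
    finally show ?thesis .
  qed
  have pC: "pdef (\<lambda>x \<rho>. C x)" unfolding C_def by (intro pdef_Suc V(1))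
  have pn: "pdef (\<lambda>x \<rho>. n x)" unfolding n_def by (intro pdef_mult R pC pdef_const)
  have pI: "pdef (\<lambda>x \<rho>. I x (f x \<rho>))" and pJ: "pdef (\<lambda>x \<rho>. J x (f x \<rho>))" and pM: "pdef (\<lambda>x \<rho>. f x \<rho> mod T)" if "pdef f" for f
    unfolding I_def J_def by (intro pdef_div pdef_mod pdef_const pC that)+
  have tab: "pdefb (\<lambda>x \<rho>. f x \<rho> mod T < T \<and> g x \<rho> mod T < T \<and> P (h (f x \<rho> mod T)) (h (g x \<rho> mod T)))"
    if "pdef f" "pdef g" for f g P
    using pdefb_table2[OF pM[OF that(1)] pM[OF that(2)], where P = "\<lambda>a b. P (h a) (h b)"] .
  have padj: "pdefb (\<lambda>x \<rho>. adj x (f x \<rho>) (g x \<rho>))" if "pdef f" "pdef g" for f g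
    unfolding adj_def
    by (intro pdefb_disj; rule pdefb_conj[OF _ pdefb_conj];
      (rule tab[of _ _ same_cell_edge] tab[of _ _ right_cell_edge] tab[of _ _ down_cell_edge])?;
      intro pdefb_eq pdef_Suc pI pJ that)
  define W where "W a b p q y = encode_nats (sorted_list_of_set (local_list a b p q (h y)))" for a b p q y
  have entry: "encode_nats (sorted_list_of_set (L' x u)) = W (J x u = 0) (J x u = V x) (pos x (I x u) (J x u)) (neg x (I x u) (J x u)) (u mod T)" for x u
    unfolding L'_def full_lists_def D_def W_def by simp
  define f where "f x = concat (map (\<lambda>b. [b, b]) (bits (n x))) @ [False, True] @
     concat (map (\<lambda>u. concat (map (\<lambda>v. if adj x u v then [True, True, False, True] else [False, True]) [0..<n x])) [0..<n x]) @
     concat (map (\<lambda>u. W (J x u = 0) (J x u = V x) (pos x (I x u) (J x u)) (neg x (I x u) (J x u)) (u mod T)) [0..<n x])" for x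
  have "f x = encode (G' x) (L' x)" for x
  proof -
    have "card (pverts (G' x)) = n x" unfolding G'_def numbered_def by simp
    note e = encode_eq[OF this, of "L' x"]
    have "concat (map (\<lambda>u. concat (map (\<lambda>v. if (u, v) \<in> parcs (G' x) then [True, True, False, True] else [False, True]) [0..<n x])) [0..<n x]) =
      concat (map (\<lambda>u. concat (map (\<lambda>v. if adj x u v then [True, True, False, True] else [False, True]) [0..<n x])) [0..<n x])"
      by (rule arg_cong[where f = concat], rule map_cong[OF refl], rule arg_cong[where f = concat], rule map_cong[OF refl])
        (simp add: adj)
    then show ?thesis unfolding e f_def entry by (simp only:)
  qed
  moreover have "poly_time f"
  proof -
    have v0: "pdef (\<lambda>x \<rho>. (\<rho> \<circ> Suc) v)" for v using pdef_var[of "Suc v"] by simp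
    have 1: "odef (\<lambda>x \<rho>. concat (map (\<lambda>u. concat (map (\<lambda>v. if adj x u v then [True, True, False, True] else [False, True]) [0..<n x])) [0..<n x]))"
      by (intro odef_for pn odef_if odef_Emit padj v0 pdef_var)
    have 2: "odef (\<lambda>x \<rho>. concat (map (\<lambda>u. W (J x u = 0) (J x u = V x) (pos x (I x u) (J x u)) (neg x (I x u) (J x u)) (u mod T)) [0..<n x]))"
      by (intro odef_for pn odef_entry pdefb_eq pJ pdef_var pdef_const V(1) pdef2bD[OF pos] pdef2bD[OF neg] pI T)
    have "odef (\<lambda>x \<rho>. f x)" unfolding f_def
      by (intro odef_append odef_bits pn odef_Emit 1 2)
    from poly_time_odef[OF this] show ?thesis .
  qed
  ultimately show ?thesis using ri pl sf col by metis
qed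

end


section \<open>Clause templates and machine runs\<close>

type_synonym coord = "bool list \<Rightarrow> nat \<Rightarrow> nat \<Rightarrow> nat \<Rightarrow> nat"
type_synonym template = "(bool list \<Rightarrow> nat \<Rightarrow> nat \<Rightarrow> nat \<Rightarrow> bool) \<times> (bool \<times> nat list \<times> coord \<times> coord) list"

text \<open>
  A template stands for the clauses obtained by instantiating its three parameters below a bound
  \<open>N x\<close>. The atoms \<open>a c t p\<close> are indexed by a kind \<open>c\<close>, a time \<open>t\<close> and a position \<open>p\<close>.
\<close>

definition lit_true :: "(nat list \<Rightarrow> nat \<Rightarrow> nat \<Rightarrow> bool) \<Rightarrow> bool list \<Rightarrow> nat \<Rightarrow> nat \<Rightarrow> nat \<Rightarrow> bool \<times> nat list \<times> coord \<times> coord \<Rightarrow> bool" where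
  "lit_true a x t p q = (\<lambda>(s, c, tf, pf). a c (tf x t p q) (pf x t p q) = s)"

definition template_true :: "(nat list \<Rightarrow> nat \<Rightarrow> nat \<Rightarrow> bool) \<Rightarrow> nat \<Rightarrow> bool list \<Rightarrow> template \<Rightarrow> bool" where
  "template_true a N x T \<longleftrightarrow> (\<forall>t<N. \<forall>p<N. \<forall>q<N. fst T x t p q \<longrightarrow> (\<exists>l\<in>set (snd T). lit_true a x t p q l))"

definition pdef3 :: "coord \<Rightarrow> bool" where
  "pdef3 F \<longleftrightarrow> (\<forall>f g h. pdef f \<longrightarrow> pdef g \<longrightarrow> pdef h \<longrightarrow> pdef (\<lambda>x \<rho>. F x (f x \<rho>) (g x \<rho>) (h x \<rho>)))"

definition pdef3b :: "(bool list \<Rightarrow> nat \<Rightarrow> nat \<Rightarrow> nat \<Rightarrow> bool) \<Rightarrow> bool" where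
  "pdef3b P \<longleftrightarrow> (\<forall>f g h. pdef f \<longrightarrow> pdef g \<longrightarrow> pdef h \<longrightarrow> pdefb (\<lambda>x \<rho>. P x (f x \<rho>) (g x \<rho>) (h x \<rho>)))"

text \<open>Where the guard holds, the coordinates of all atoms have to stay below
  \<open>N x\<close>, because they become digits of the variable numbers in base
  \<open>N x\<close>.\<close>

definition template_ok :: "(bool list \<Rightarrow> nat) \<Rightarrow> template \<Rightarrow> bool" where
  "template_ok N T \<longleftrightarrow> pdef3b (fst T) \<and> (\<forall>(s, c, tf, pf)\<in>set (snd T). pdef3 tf \<and> pdef3 pf \<and>
     (\<forall>x t p q. fst T x t p q \<longrightarrow> t < N x \<longrightarrow> p < N x \<longrightarrow> q < N x \<longrightarrow> tf x t p q < N x \<and> pf x t p q < N x))"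

text \<open>If the guard fails, every variable matches with both signs, so the clause is a
  tautology. Otherwise variable \<open>j\<close> is split into kind, time and position.\<close>

definition template_match :: "(bool list \<Rightarrow> nat) \<Rightarrow> bool \<Rightarrow> template \<Rightarrow> bool list \<Rightarrow> nat \<Rightarrow> nat \<Rightarrow> nat \<Rightarrow> nat \<Rightarrow> bool" where
  "template_match N b T x t p q j \<longleftrightarrow> \<not> fst T x t p q \<or>
     (\<exists>(s, c, tf, pf)\<in>set (snd T). s = b \<and> j div N x div N x = to_nat c \<and> j div N x mod N x = tf x t p q \<and> j mod N x = pf x t p q)"

text \<open>The leading digit of the clause number selects the template, the other three digits in
  base \<open>N x\<close> are the parameters. As there are finitely many templates, the selection is
  a finite disjunction.\<close>

definition clause_match :: "(bool list \<Rightarrow> nat) \<Rightarrow> template list \<Rightarrow> bool \<Rightarrow> bool list \<Rightarrow> nat \<Rightarrow> nat \<Rightarrow> bool" where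
  "clause_match N Ts b x i j \<longleftrightarrow> (\<exists>e\<in>set [0..<length Ts]. i div N x div N x div N x = e \<and>
     template_match N b (Ts ! e) x (i div N x div N x mod N x) (i div N x mod N x) (i mod N x) j)"

lemma pdef2b_clause_match:
  assumes N: "pdef (\<lambda>x \<rho>. N x)" and ok: "\<forall>T\<in>set Ts. template_ok N T"
  shows "pdef2b (clause_match N Ts b)"
  unfolding pdef2b_def
proof (intro allI impI)
  fix f g assume f: "pdef f" and g: "pdef g"
  have d: "pdef (\<lambda>x \<rho>. h x \<rho> div N x)" "pdef (\<lambda>x \<rho>. h x \<rho> mod N x)" if "pdef h" for h
    by (intro pdef_div pdef_mod that N)+
  have "pdefb (\<lambda>x \<rho>. template_match N b T x (f x \<rho> div N x div N x mod N x) (f x \<rho> div N x mod N x) (f x \<rho> mod N x) (g x \<rho>))"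
    if T: "T \<in> set Ts" for T
  proof -
    have o: "template_ok N T" using ok T by blast
    have "pdefb (\<lambda>x \<rho>. fst T x (f x \<rho> div N x div N x mod N x) (f x \<rho> div N x mod N x) (f x \<rho> mod N x))"
      using o d[OF f] d[OF d(1)[OF f]] d[OF d(1)[OF d(1)[OF f]]] unfolding template_ok_def pdef3b_def by blast
    moreover have "pdefb (\<lambda>x \<rho>. case l of (s, c, tf, pf) \<Rightarrow> s = b \<and> g x \<rho> div N x div N x = to_nat c \<and>
        g x \<rho> div N x mod N x = tf x (f x \<rho> div N x div N x mod N x) (f x \<rho> div N x mod N x) (f x \<rho> mod N x) \<and>
        g x \<rho> mod N x = pf x (f x \<rho> div N x div N x mod N x) (f x \<rho> div N x mod N x) (f x \<rho> mod N x))"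
      if l: "l \<in> set (snd T)" for l
    proof -
      obtain s c tf pf where lc: "l = (s, c, tf, pf)" by (metis surj_pair)
      have "pdef3 tf" "pdef3 pf" using o l unfolding lc template_ok_def by auto
      then have "pdef (\<lambda>x \<rho>. tf x (f x \<rho> div N x div N x mod N x) (f x \<rho> div N x mod N x) (f x \<rho> mod N x))"
        "pdef (\<lambda>x \<rho>. pf x (f x \<rho> div N x div N x mod N x) (f x \<rho> div N x mod N x) (f x \<rho> mod N x))"
        using d[OF f] d[OF d(1)[OF f]] d[OF d(1)[OF d(1)[OF f]]] unfolding pdef3_def by blast+
      then show ?thesis unfolding lc prod.case using d[OF g] d[OF d(1)[OF g]]
        by (intro pdefb_conj pdefb_eq pdefb_const pdef_const)
    qed
    ultimately show ?thesis unfolding template_match_def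
      by (intro pdefb_disj pdefb_not pdefb_Bex_list)
  qed
  then have "pdefb (\<lambda>x \<rho>. f x \<rho> div N x div N x div N x = e \<and>
     template_match N b (Ts ! e) x (f x \<rho> div N x div N x mod N x) (f x \<rho> div N x mod N x) (f x \<rho> mod N x) (g x \<rho>))"
    if "e \<in> set [0..<length Ts]" for e
    using that d(1)[OF d(1)[OF d(1)[OF f]]] by (intro pdefb_conj pdefb_eq pdef_const) auto
  then show "pdefb (\<lambda>x \<rho>. clause_match N Ts b x (f x \<rho>) (g x \<rho>))"
    unfolding clause_match_def by (rule pdefb_Bex_list)
qed

lemma digits_less:
  fixes a b K N :: nat
  assumes "a < K" "b < N"
  shows "a * N + b < K * N"
proof -
  have "a * N + b < a * N + N" using assms(2) by simp
  also have "\<dots> = Suc a * N" by simp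
  also have "\<dots> \<le> K * N" using assms(1) by (intro mult_right_mono) auto
  finally show ?thesis .
qed

lemma cnf_sat_clause_match:
  assumes ok: "\<forall>T\<in>set Ts. template_ok N T" and N: "0 < N x"
    and K: "0 < K" "\<forall>T\<in>set Ts. \<forall>(s, c, tf, pf)\<in>set (snd T). to_nat c < K"
  shows "cnf_sat (length Ts * N x * N x * N x) (K * N x * N x) (clause_match N Ts True x) (clause_match N Ts False x) \<longleftrightarrow>
    (\<exists>a. \<forall>T\<in>set Ts. template_true a (N x) x T)"
    (is "cnf_sat ?R ?V _ _ \<longleftrightarrow> _")
proof
  let ?N = "N x"
  assume "cnf_sat ?R ?V (clause_match N Ts True x) (clause_match N Ts False x)"
  then obtain a where a: "\<And>i. i < ?R \<Longrightarrow> \<exists>j<?V. (clause_match N Ts True x i j \<and> a j) \<or> (clause_match N Ts False x i j \<and> \<not> a j)"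
    unfolding cnf_sat_def by blast
  let ?a = "\<lambda>c t p. a ((to_nat c * ?N + t) * ?N + p)"
  have "template_true ?a ?N x T" if T: "T \<in> set Ts" for T
    unfolding template_true_def
  proof (intro allI impI)
    fix t p q assume tpq: "t < ?N" "p < ?N" "q < ?N" and g: "fst T x t p q"
    obtain e where e: "e < length Ts" "Ts ! e = T" using T by (auto simp: in_set_conv_nth)
    let ?i = "((e * ?N + t) * ?N + p) * ?N + q"
    have i: "?i < ?R" using e tpq by (intro digits_less)
    have dg: "?i mod ?N = q" "?i div ?N mod ?N = p" "?i div ?N div ?N mod ?N = t" "?i div ?N div ?N div ?N = e"
      using tpq by simp_all
    have cm: "clause_match N Ts b x ?i j \<longleftrightarrow> template_match N b T x t p q j" for b j
      unfolding clause_match_def dg using e by auto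
    obtain j where j: "(template_match N True T x t p q j \<and> a j) \<or> (template_match N False T x t p q j \<and> \<not> a j)"
      using a[OF i] unfolding cm by blast
    then obtain b where b: "template_match N b T x t p q j" "a j = b" by blast
    then obtain c tf pf where l: "(b, c, tf, pf) \<in> set (snd T)" "j div ?N div ?N = to_nat c"
      "j div ?N mod ?N = tf x t p q" "j mod ?N = pf x t p q" using g unfolding template_match_def by auto
    have "j = (to_nat c * ?N + tf x t p q) * ?N + pf x t p q"
      unfolding l(2,3,4)[symmetric] by simp
    then have "lit_true ?a x t p q (b, c, tf, pf)" using b(2) unfolding lit_true_def by simp
    then show "\<exists>l\<in>set (snd T). lit_true ?a x t p q l" using l(1) by blast
  qed
  then show "\<exists>a. \<forall>T\<in>set Ts. template_true a ?N x T" by blast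
next
  let ?N = "N x"
  assume "\<exists>a. \<forall>T\<in>set Ts. template_true a ?N x T"
  then obtain a where a: "\<And>T. T \<in> set Ts \<Longrightarrow> template_true a ?N x T" by blast
  \<comment> \<open>The digits of a variable number in base \<open>N x\<close> give back the atom;
    kinds are lists, decoded by \<open>from_nat\<close>.\<close>
  let ?a = "\<lambda>j. a (from_nat (j div ?N div ?N)) (j div ?N mod ?N) (j mod ?N)"
  show "cnf_sat ?R ?V (clause_match N Ts True x) (clause_match N Ts False x)"
    unfolding cnf_sat_def
  proof (intro exI[of _ ?a] allI impI)
    fix i assume i: "i < ?R"
    let ?e = "i div ?N div ?N div ?N" and ?t = "i div ?N div ?N mod ?N" and ?p = "i div ?N mod ?N" and ?q = "i mod ?N"
    have e: "?e < length Ts" using i by (simp add: less_mult_imp_div_less)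
    let ?T = "Ts ! ?e"
    have T: "?T \<in> set Ts" using e by simp
    have cm: "clause_match N Ts b x i j \<longleftrightarrow> template_match N b ?T x ?t ?p ?q j" for b j
      unfolding clause_match_def using e by auto
    show "\<exists>j<?V. (clause_match N Ts True x i j \<and> ?a j) \<or> (clause_match N Ts False x i j \<and> \<not> ?a j)"
    proof (cases "fst ?T x ?t ?p ?q")
      case False
      then have "clause_match N Ts b x i 0" for b unfolding cm template_match_def by blast
      moreover have "0 < ?V" using N K(1) by simp
      ultimately show ?thesis by blast
    next
      case True
      have b: "?t < ?N" "?p < ?N" "?q < ?N" using N by simp_all
      then obtain l where l: "l \<in> set (snd ?T)" "lit_true a x ?t ?p ?q l"
        using a[OF T] True unfolding template_true_def by blast
      obtain s c tf pf where lc: "l = (s, c, tf, pf)" by (metis surj_pair)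
      have r: "tf x ?t ?p ?q < ?N" "pf x ?t ?p ?q < ?N"
        using ok T l(1) True b unfolding lc template_ok_def by fastforce+
      have c: "to_nat c < K" using K(2) T l(1) unfolding lc by fastforce
      let ?j = "(to_nat c * ?N + tf x ?t ?p ?q) * ?N + pf x ?t ?p ?q"
      have j: "?j < ?V" using c r by (intro digits_less)
      have dj: "?j mod ?N = pf x ?t ?p ?q" "?j div ?N mod ?N = tf x ?t ?p ?q" "?j div ?N div ?N = to_nat c" using r by simp_all
      have m: "clause_match N Ts s x i ?j" unfolding cm template_match_def using l(1) dj unfolding lc by blast
      have v: "?a ?j = s" unfolding dj using l(2) unfolding lc lit_true_def by simp
      have "\<exists>j<?V. P j" if "P ?j" for P by (rule exI[of _ ?j]) (rule conjI[OF j that])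
      moreover have "(clause_match N Ts True x i ?j \<and> ?a ?j) \<or> (clause_match N Ts False x i ?j \<and> \<not> ?a ?j)"
        unfolding v using m by (cases s) (simp_all only: simp_thms)
      ultimately show ?thesis .
    qed
  qed
qed

lemma templates_reduction:
  assumes N: "pdef (\<lambda>x \<rho>. N x)" "\<And>x. 0 < N x" and \<T>: "finite \<T>" "\<forall>T\<in>\<T>. template_ok N T"
  shows "\<exists>R V pos neg. pdef (\<lambda>x \<rho>. R x) \<and> pdef (\<lambda>x \<rho>. V x) \<and> (\<forall>x. 1 \<le> V x) \<and> pdef2b pos \<and> pdef2b neg \<and>
    (\<forall>x. cnf_sat (R x) (V x) (pos x) (neg x) \<longleftrightarrow> (\<exists>a. \<forall>T\<in>\<T>. template_true a (N x) x T))"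
proof -
  obtain Ts where Ts: "set Ts = \<T>" using finite_list[OF \<T>(1)] by blast
  let ?C = "\<Union>T\<in>\<T>. (\<lambda>(s, c, tf, pf). to_nat c) ` set (snd T)"
  define K where "K = Suc (Max (insert 0 ?C))"
  have fin: "finite (insert 0 ?C)" using \<T>(1) by simp
  have K: "\<forall>T\<in>set Ts. \<forall>(s, c, tf, pf)\<in>set (snd T). to_nat c < K"
  proof (intro ballI)
    fix T l assume T: "T \<in> set Ts" and l: "l \<in> set (snd T)"
    obtain s c tf pf where lc: "l = (s, c, tf, pf)" by (metis surj_pair)
    have "to_nat c \<in> (\<lambda>(s, c, tf, pf). to_nat c) ` set (snd T)" using l unfolding lc by (force intro: image_eqI)
    then have "to_nat c \<in> insert 0 ?C" using T Ts by blast
    then have "to_nat c \<le> Max (insert 0 ?C)" by (rule Max_ge[OF fin])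
    then show "case l of (s, c, tf, pf) \<Rightarrow> to_nat c < K" unfolding lc K_def by simp
  qed
  have ok: "\<forall>T\<in>set Ts. template_ok N T" using \<T>(2) Ts by simp
  have "0 < K" unfolding K_def by simp
  show ?thesis
  proof (intro exI conjI allI)
    show "pdef (\<lambda>x \<rho>. length Ts * N x * N x * N x)" "pdef (\<lambda>x \<rho>. K * N x * N x)"
      by (intro pdef_mult pdef_const N(1))+
    show "1 \<le> K * N x * N x" for x using N(2)[of x] \<open>0 < K\<close> by (simp add: Suc_le_eq)
    show "pdef2b (clause_match N Ts True)" "pdef2b (clause_match N Ts False)"
      by (rule pdef2b_clause_match[OF N(1) ok])+
    show "cnf_sat (length Ts * N x * N x * N x) (K * N x * N x) (clause_match N Ts True x) (clause_match N Ts False x) \<longleftrightarrow>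
      (\<exists>a. \<forall>T\<in>\<T>. template_true a (N x) x T)" for x
      using cnf_sat_clause_match[OF ok N(2) \<open>0 < K\<close> K] unfolding Ts .
  qed
qed

text \<open>A transition that idles in the halting state, so that one set of templates describes a
  run also after it has halted.\<close>

definition tm_step :: "tm \<Rightarrow> nat \<Rightarrow> nat list \<Rightarrow> nat \<times> (nat \<times> move) list" where
  "tm_step M q rs = (if q < states M then delta M q rs else (q, map (\<lambda>s. (s, Stay)) rs))"

lemma tm_step_ok:
  assumes "wf_tm M" "q \<le> states M" "length rs = tapes M" "set rs \<subseteq> {..<symbols M}"
  shows "fst (tm_step M q rs) \<le> states M" "length (snd (tm_step M q rs)) = tapes M"
    "\<tau> < tapes M \<Longrightarrow> fst (snd (tm_step M q rs) ! \<tau>) < symbols M"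
proof -
  have *: "fst (tm_step M q rs) \<le> states M \<and> length (snd (tm_step M q rs)) = tapes M \<and> fst ` set (snd (tm_step M q rs)) \<subseteq> {..<symbols M}"
  proof (cases "q < states M")
    case True
    have "case delta M q rs of (q', acts) \<Rightarrow> q' \<le> states M \<and> length acts = tapes M \<and> fst ` set acts \<subseteq> {..<symbols M}"
      by (rule conjunct2[OF conjunct2[OF assms(1)[unfolded wf_tm_def]], rule_format, OF True conjI[OF assms(3,4)]])
    then show ?thesis using True unfolding tm_step_def by (simp add: split_beta)
  next
    case False
    then show ?thesis using assms unfolding tm_step_def by (auto simp: image_image)
  qed
  then show "fst (tm_step M q rs) \<le> states M" "length (snd (tm_step M q rs)) = tapes M" by auto
  show "\<tau> < tapes M \<Longrightarrow> fst (snd (tm_step M q rs) ! \<tau>) < symbols M"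
  proof -
    assume "\<tau> < tapes M"
    then have "snd (tm_step M q rs) ! \<tau> \<in> set (snd (tm_step M q rs))" using * by simp
    then have "fst (snd (tm_step M q rs) ! \<tau>) \<in> {..<symbols M}" using * by blast
    then show ?thesis by simp
  qed
qed

lemma step_eq_tm_step:
  assumes "length ts = tapes M"
  shows "step M (q, ts) = (case tm_step M q (map (\<lambda>(t, h). t h) ts) of (q', acts) \<Rightarrow> (q', map2 act acts ts))"
proof (cases "q < states M")
  case False
  have "map2 act (map (\<lambda>s. (s, Stay)) (map (\<lambda>(t, h). t h) ts)) ts = ts"
    by (induction ts) auto
  then show ?thesis using False by (simp add: tm_step_def)
qed (simp add: tm_step_def)

section \<open>The run of a machine as functions of time\<close>

locale machine_run =
  fixes M :: tm and y :: "bool list"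
  assumes wf: "wf_tm M"
begin

definition cf :: "nat \<Rightarrow> nat \<times> tape list" where "cf t = (step M ^^ t) (start M y)"
definition st :: "nat \<Rightarrow> nat" where "st t = fst (cf t)"
definition tp :: "nat \<Rightarrow> nat \<Rightarrow> int \<Rightarrow> nat" where "tp t \<tau> = fst (snd (cf t) ! \<tau>)"
definition hp :: "nat \<Rightarrow> nat \<Rightarrow> int" where "hp t \<tau> = snd (snd (cf t) ! \<tau>)"
definition rd :: "nat \<Rightarrow> nat list" where "rd t = map (\<lambda>\<tau>. tp t \<tau> (hp t \<tau>)) [0..<tapes M]"
definition nx :: "nat \<Rightarrow> nat \<times> (nat \<times> move) list" where "nx t = tm_step M (st t) (rd t)"

lemma tapes_pos: "1 \<le> tapes M" and symbols_ge: "3 \<le> symbols M"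
  using wf unfolding wf_tm_def by auto

lemma start_conf:
  "st 0 = 0" "hp 0 \<tau> = 0 \<or> tapes M \<le> \<tau>" "tp 0 0 = written y" "1 \<le> \<tau> \<Longrightarrow> \<tau> < tapes M \<Longrightarrow> tp 0 \<tau> = (\<lambda>_. 0)"
  "length (snd (cf 0)) = tapes M"
  using tapes_pos by (auto simp: st_def hp_def tp_def cf_def start_def nth_Cons split: nat.split)

text \<open>The bounds and the equations for the next step are proved in one induction: the
  equations at \<open>t\<close> need the bounds at \<open>t\<close>, which come from the equations
  at the step before.\<close>

lemma run_inv:
  "length (snd (cf t)) = tapes M \<and> st t \<le> states M \<and>
   (\<forall>\<tau><tapes M. (\<forall>i. tp t \<tau> i < symbols M) \<and> \<bar>hp t \<tau>\<bar> \<le> int t) \<and>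
   st (Suc t) = fst (nx t) \<and>
   (\<forall>\<tau><tapes M. tp (Suc t) \<tau> = (tp t \<tau>)(hp t \<tau> := fst (snd (nx t) ! \<tau>)) \<and> hp (Suc t) \<tau> = shift (snd (snd (nx t) ! \<tau>)) (hp t \<tau>))"
proof (induction t rule: nat_less_induct)
  case (1 t)
  have A: "length (snd (cf t)) = tapes M \<and> st t \<le> states M \<and> (\<forall>\<tau><tapes M. (\<forall>i. tp t \<tau> i < symbols M) \<and> \<bar>hp t \<tau>\<bar> \<le> int t)"
  proof (cases t)
    case 0
    have "tp 0 \<tau> i < symbols M" if "\<tau> < tapes M" for \<tau> i
    proof (cases "\<tau> = 0")
      case True
      then show ?thesis using symbols_ge start_conf(3) unfolding written_def by simp
    next
      case False
      then show ?thesis using symbols_ge start_conf(4)[of \<tau>] that by simp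
    qed
    then show ?thesis using 0 start_conf(1,2,5) by fastforce
  next
    case (Suc t')
    have IH: "length (snd (cf t')) = tapes M" "st t' \<le> states M"
      "\<And>\<tau>. \<tau> < tapes M \<Longrightarrow> (\<forall>i. tp t' \<tau> i < symbols M) \<and> \<bar>hp t' \<tau>\<bar> \<le> int t'"
      "st (Suc t') = fst (nx t')"
      "\<And>\<tau>. \<tau> < tapes M \<Longrightarrow> tp (Suc t') \<tau> = (tp t' \<tau>)(hp t' \<tau> := fst (snd (nx t') ! \<tau>)) \<and> hp (Suc t') \<tau> = shift (snd (snd (nx t') ! \<tau>)) (hp t' \<tau>)"
      using 1 Suc by blast+
    have rd: "length (rd t') = tapes M" "set (rd t') \<subseteq> {..<symbols M}" using IH(3) unfolding rd_def by auto
    note ok = tm_step_ok[OF wf IH(2) rd, folded nx_def]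
    have "length (snd (cf (Suc t'))) = tapes M"
    proof -
      have "cf (Suc t') = step M (fst (cf t'), snd (cf t'))" unfolding cf_def by simp
      also have "\<dots> = (case tm_step M (fst (cf t')) (map (\<lambda>(t, h). t h) (snd (cf t'))) of (q', acts) \<Rightarrow> (q', map2 act acts (snd (cf t'))))"
        by (rule step_eq_tm_step[OF IH(1)])
      also have "map (\<lambda>(t, h). t h) (snd (cf t')) = rd t'"
        by (rule nth_equalityI) (auto simp: IH(1) rd_def tp_def hp_def split_beta)
      finally show ?thesis using ok(2) IH(1) unfolding nx_def st_def by (simp add: split_beta)
    qed
    moreover have "st (Suc t') \<le> states M" unfolding IH(4) by (rule ok(1))
    moreover have "(\<forall>i. tp (Suc t') \<tau> i < symbols M) \<and> \<bar>hp (Suc t') \<tau>\<bar> \<le> int (Suc t')" if \<tau>: "\<tau> < tapes M" for \<tau>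
    proof -
      have "\<bar>shift m h\<bar> \<le> \<bar>h\<bar> + 1" for m h by (cases m) auto
      then have "\<bar>hp (Suc t') \<tau>\<bar> \<le> \<bar>hp t' \<tau>\<bar> + 1" using IH(5)[OF \<tau>] by simp
      then show ?thesis using IH(3,5)[OF \<tau>] ok(3)[OF \<tau>] by auto
    qed
    ultimately show ?thesis using Suc by simp
  qed
  then have len: "length (snd (cf t)) = tapes M" and stt: "st t \<le> states M" by auto
  have rd: "length (rd t) = tapes M" "set (rd t) \<subseteq> {..<symbols M}" using A unfolding rd_def by auto
  note ok = tm_step_ok[OF wf stt rd, folded nx_def]
  have "cf (Suc t) = step M (fst (cf t), snd (cf t))" unfolding cf_def by simp
  also have "\<dots> = (case tm_step M (fst (cf t)) (map (\<lambda>(t, h). t h) (snd (cf t))) of (q', acts) \<Rightarrow> (q', map2 act acts (snd (cf t))))"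
    by (rule step_eq_tm_step[OF len])
  also have "map (\<lambda>(t, h). t h) (snd (cf t)) = rd t"
    by (rule nth_equalityI) (auto simp: len rd_def tp_def hp_def split_beta)
  finally have c: "cf (Suc t) = (fst (nx t), map2 act (snd (nx t)) (snd (cf t)))"
    unfolding nx_def st_def by (simp add: split_beta)
  have "tp (Suc t) \<tau> = (tp t \<tau>)(hp t \<tau> := fst (snd (nx t) ! \<tau>)) \<and> hp (Suc t) \<tau> = shift (snd (snd (nx t) ! \<tau>)) (hp t \<tau>)"
    if \<tau>: "\<tau> < tapes M" for \<tau>
  proof -
    have "act a tph = ((fst tph)(snd tph := fst a), shift (snd a) (snd tph))" for a tph by (cases a; cases tph) simp
    then have "snd (cf (Suc t)) ! \<tau> = ((tp t \<tau>)(hp t \<tau> := fst (snd (nx t) ! \<tau>)), shift (snd (snd (nx t) ! \<tau>)) (hp t \<tau>))"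
      unfolding c using \<tau> len ok(2) by (simp add: tp_def hp_def)
    then show ?thesis unfolding tp_def[of "Suc t"] hp_def[of "Suc t"] by simp
  qed
  moreover have "st (Suc t) = fst (nx t)" unfolding st_def c by simp
  ultimately show ?case using A by blast
qed

lemma run_len: "length (snd (cf t)) = tapes M"
  and run_st: "st t \<le> states M"
  and run_symbols: "\<tau> < tapes M \<Longrightarrow> tp t \<tau> i < symbols M"
  and run_head: "\<tau> < tapes M \<Longrightarrow> \<bar>hp t \<tau>\<bar> \<le> int t"
  and run_st_Suc: "st (Suc t) = fst (nx t)"
  and run_tp_Suc: "\<tau> < tapes M \<Longrightarrow> tp (Suc t) \<tau> = (tp t \<tau>)(hp t \<tau> := fst (snd (nx t) ! \<tau>))"
  and run_hp_Suc: "\<tau> < tapes M \<Longrightarrow> hp (Suc t) \<tau> = shift (snd (snd (nx t) ! \<tau>)) (hp t \<tau>)"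
  using run_inv[of t] by blast+

lemma rd_ok: "length (rd t) = tapes M" "set (rd t) \<subseteq> {..<symbols M}" "\<tau> < tapes M \<Longrightarrow> rd t ! \<tau> = tp t \<tau> (hp t \<tau>)"
  using run_symbols unfolding rd_def by auto

lemma cf_stable:
  assumes "st t = states M" "t \<le> t'"
  shows "cf t' = cf t"
proof -
  have "step M (cf t) = cf t" using assms(1) unfolding st_def by (cases "cf t") simp
  then have "(step M ^^ d) (cf t) = cf t" for d by (induction d) auto
  moreover have "cf t' = (step M ^^ (t' - t)) (cf t)"
    unfolding cf_def using assms(2) by (metis comp_apply funpow_add le_add_diff_inverse2)
  ultimately show ?thesis by simp
qed

end


section \<open>The bits of a pair\<close>

lemma length_pair: "length (pair x w) = 2 * length x + 2 + length w"
  by (induction x) (auto simp: pair_def)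

lemma nth_doubled: "i < 2 * length x \<Longrightarrow> concat (map (\<lambda>b. [b, b]) x) ! i = x ! (i div 2)"
proof (induction x arbitrary: i)
  case (Cons a x)
  show ?case
  proof (cases "i < 2")
    case True
    then have "i = 0 \<or> i = 1" by auto
    then show ?thesis by auto
  next
    case False
    then obtain i' where i: "i = Suc (Suc i')" by (metis Suc_pred less_2_cases_iff not_gr0 less_Suc_eq_0_disj One_nat_def old.nat.exhaust)
    then show ?thesis using Cons by simp
  qed
qed simp

lemma length_doubled: "length (concat (map (\<lambda>b. [b, b]) x)) = 2 * length x"
  by (induction x) auto

lemma nth_pair:
  "i < 2 * length x \<Longrightarrow> pair x w ! i = x ! (i div 2)"
  "pair x w ! (2 * length x) = False"
  "pair x w ! Suc (2 * length x) = True"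
  "pair x w ! (2 * length x + 2 + d) = w ! d"
  unfolding pair_def using nth_doubled[of i x] length_doubled[of x] by (auto simp: nth_append)


section \<open>The Cook-Levin theorem\<close>

lemma pdef3I: "(\<And>f g h. pdef f \<Longrightarrow> pdef g \<Longrightarrow> pdef h \<Longrightarrow> pdef (\<lambda>x \<rho>. F x (f x \<rho>) (g x \<rho>) (h x \<rho>))) \<Longrightarrow> pdef3 F"
  unfolding pdef3_def by blast

lemma pdef3bI: "(\<And>f g h. pdef f \<Longrightarrow> pdef g \<Longrightarrow> pdef h \<Longrightarrow> pdefb (\<lambda>x \<rho>. P x (f x \<rho>) (g x \<rho>) (h x \<rho>))) \<Longrightarrow> pdef3b P"
  unfolding pdef3b_def by blast

locale cook_levin =
  fixes M :: tm and pt pq :: "nat poly" and A B :: "bool list set"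
  assumes wf: "wf_tm M"
    and dec: "\<And>y. case (step M ^^ poly pt (length y)) (start M y) of (q, ts) \<Rightarrow> q = states M \<and> fst (last ts) = written [y \<in> B]"
    and A: "\<And>x. x \<in> A \<longleftrightarrow> (\<exists>w. length w \<le> poly pq (length x) \<and> pair x w \<in> B)"
begin

abbreviation "k \<equiv> tapes M"

definition qn :: "bool list \<Rightarrow> nat" where "qn x = poly pq (length x)"
definition ws :: "bool list \<Rightarrow> nat" where "ws x = 2 * length x + 2"
text \<open>Exceeds the running time on the longest possible pair as well as the length of that
  pair, so the cells from \<open>- TT x\<close> to \<open>TT x\<close> contain the whole input and
  every head position up to time \<open>TT x\<close>.\<close>

definition TT :: "bool list \<Rightarrow> nat" where "TT x = poly pt (ws x + qn x) + ws x + qn x + 1"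
text \<open>Positions go up to \<open>2 * TT x\<close>; the slack accommodates the successors that
  occur in templates.\<close>

definition N :: "bool list \<Rightarrow> nat" where "N x = 2 * TT x + 4"

definition guess_pos :: "bool list \<Rightarrow> nat \<Rightarrow> bool" where
  "guess_pos x p \<longleftrightarrow> TT x + ws x \<le> p \<and> p < TT x + ws x + qn x"

text \<open>The cells of \<open>pair x w\<close> that do not depend on \<open>w\<close>: the doubled
  bits of \<open>x\<close>, the separator \<open>01\<close> as the symbols 1 and 2, and blanks
  outside.\<close>

definition input_symbol :: "bool list \<Rightarrow> nat \<Rightarrow> nat" where
  "input_symbol x p =
     (if TT x \<le> p \<and> p < TT x + 2 * length x then (if (p - TT x) div 2 < length x \<and> x ! ((p - TT x) div 2) then 2 else 1)
      else if p = TT x + 2 * length x then 1 else if p = TT x + 2 * length x + 1 then 2 else 0)"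

definition cZ :: coord where "cZ x t p q = 0"
definition cT :: coord where "cT x t p q = t"
definition cT1 :: coord where "cT1 x t p q = Suc t"
definition cP :: coord where "cP x t p q = p"
definition cP1 :: coord where "cP1 x t p q = Suc p"
definition cPm :: coord where "cPm x t p q = p - 1"
definition cQ :: coord where "cQ x t p q = q"
definition cC :: coord where "cC x t p q = TT x"

lemmas coord_defs = cZ_def cT_def cT1_def cP_def cP1_def cPm_def cQ_def cC_def

primrec move_coord :: "move \<Rightarrow> coord" where
  "move_coord MoveLeft = cPm"
| "move_coord Stay = cP"
| "move_coord MoveRight = cP1"

text \<open>
  Position \<open>p\<close> is cell \<open>p - TT x\<close>. Kinds: \<open>[0, q]\<close> state \<open>q\<close>, \<open>[1, \<tau>]\<close> head of tape \<open>\<tau>\<close>,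
  \<open>[2, \<tau>, s]\<close> symbol \<open>s\<close> on tape \<open>\<tau>\<close>, \<open>[3, \<tau>, s]\<close> symbol \<open>s\<close> read on tape \<open>\<tau>\<close>. All templates but
  \<open>t_guess\<close> are Horn, so a satisfying assignment contains all facts about the run on a guessed certificate.
\<close>

definition t_state :: template where "t_state = (\<lambda>x t p q. True, [(True, [0, 0], cZ, cZ)])"
definition t_head :: "nat \<Rightarrow> template" where "t_head \<tau> = (\<lambda>x t p q. True, [(True, [1, \<tau>], cZ, cC)])"
definition t_blank :: "nat \<Rightarrow> template" where
  "t_blank \<tau> = (\<lambda>x t p q. p \<le> 2 * TT x, [(True, [2, \<tau>, 0], cZ, cP)])"
definition t_input :: "nat \<Rightarrow> template" where
  "t_input s = (\<lambda>x t p q. p \<le> 2 * TT x \<and> \<not> guess_pos x p \<and> input_symbol x p = s, [(True, [2, 0, s], cZ, cP)])"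
definition t_guess :: template where
  "t_guess = (\<lambda>x t p q. guess_pos x p, [(True, [2, 0, 0], cZ, cP), (True, [2, 0, 1], cZ, cP), (True, [2, 0, 2], cZ, cP)])"
text \<open>Blanks propagate to the right, so the guessed word may be shorter than
  \<open>qn x\<close> but has no gaps.\<close>

definition t_guess_end :: template where
  "t_guess_end = (\<lambda>x t p q. guess_pos x p \<and> guess_pos x (Suc p), [(False, [2, 0, 0], cZ, cP), (True, [2, 0, 0], cZ, cP1)])"
text \<open>The scanned symbol is copied to an atom without position. Otherwise a transition clause
  would have to mention the head positions of all tapes at once, and a template has only three
  parameters.\<close>

definition t_read :: "nat \<Rightarrow> nat \<Rightarrow> template" where
  "t_read \<tau> s = (\<lambda>x t p q. t \<le> TT x \<and> p \<le> 2 * TT x, [(False, [1, \<tau>], cT, cP), (False, [2, \<tau>, s], cT, cP), (True, [3, \<tau>, s], cT, cZ)])"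
definition prem :: "nat \<Rightarrow> nat list \<Rightarrow> (bool \<times> nat list \<times> coord \<times> coord) list" where
  "prem q0 rs = (False, [0, q0], cT, cZ) # map (\<lambda>\<tau>. (False, [3, \<tau>, rs ! \<tau>], cT, cZ)) [0..<k]"
definition t_next :: "nat \<Rightarrow> nat list \<Rightarrow> template" where
  "t_next q0 rs = (\<lambda>x t p q. t < TT x, prem q0 rs @ [(True, [0, fst (tm_step M q0 rs)], cT1, cZ)])"
definition t_move :: "nat \<Rightarrow> nat list \<Rightarrow> nat \<Rightarrow> template" where
  "t_move q0 rs \<tau> = (\<lambda>x t p q. t < TT x \<and> 1 \<le> p \<and> p < 2 * TT x,
     prem q0 rs @ [(False, [1, \<tau>], cT, cP), (True, [1, \<tau>], cT1, move_coord (snd (snd (tm_step M q0 rs) ! \<tau>)))])"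
definition t_write :: "nat \<Rightarrow> nat list \<Rightarrow> nat \<Rightarrow> template" where
  "t_write q0 rs \<tau> = (\<lambda>x t p q. t < TT x \<and> p \<le> 2 * TT x,
     prem q0 rs @ [(False, [1, \<tau>], cT, cP), (True, [2, \<tau>, fst (snd (tm_step M q0 rs) ! \<tau>)], cT1, cP)])"
text \<open>That the head is not at \<open>p\<close> is expressed by a position
  \<open>q \<noteq> p\<close> that it occupies; its absence from \<open>p\<close> would be a second
  positive literal.\<close>

definition t_keep :: "nat \<Rightarrow> nat \<Rightarrow> template" where
  "t_keep \<tau> s = (\<lambda>x t p q. t < TT x \<and> p \<le> 2 * TT x \<and> q \<le> 2 * TT x \<and> p \<noteq> q,
     [(False, [1, \<tau>], cT, cQ), (False, [2, \<tau>, s], cT, cP), (True, [2, \<tau>, s], cT1, cP)])"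
text \<open>The symbol 1 in the first output cell is the answer \<open>False\<close>. Excluding it
  is enough, since a satisfying assignment contains the symbol that is really there.\<close>

definition t_accept :: template where "t_accept = (\<lambda>x t p q. True, [(False, [2, k - 1, 1], cC, cC)])"

definition RS :: "nat list set" where "RS = {rs. set rs \<subseteq> {..<symbols M} \<and> length rs = k}"

definition templates :: "template set" where
  "templates = {t_state, t_guess, t_guess_end, t_accept} \<union> t_head ` {..<k} \<union> t_blank ` {1..<k} \<union> t_input ` {..<3} \<union>
     (\<Union>\<tau>\<in>{..<k}. t_read \<tau> ` {..<symbols M}) \<union> (\<Union>q0\<in>{..states M}. t_next q0 ` RS) \<union>
     (\<Union>q0\<in>{..states M}. \<Union>rs\<in>RS. t_move q0 rs ` {..<k}) \<union>
     (\<Union>q0\<in>{..states M}. \<Union>rs\<in>RS. t_write q0 rs ` {..<k}) \<union> (\<Union>\<tau>\<in>{..<k}. t_keep \<tau> ` {..<symbols M})"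

lemma finite_templates: "finite templates"
proof -
  have "finite RS" unfolding RS_def by (rule finite_lists_length_eq) simp
  then show ?thesis unfolding templates_def by simp
qed

lemma pdef_bounds:
  "pdef (\<lambda>x \<rho>. length x)" "pdef (\<lambda>x \<rho>. ws x)" "pdef (\<lambda>x \<rho>. qn x)" "pdef (\<lambda>x \<rho>. TT x)" "pdef (\<lambda>x \<rho>. N x)"
proof -
  show 1: "pdef (\<lambda>x \<rho>. length x)" by (rule pdef_len)
  show 2: "pdef (\<lambda>x \<rho>. ws x)" unfolding ws_def by (intro pdef_add pdef_mult pdef_const 1)
  show 3: "pdef (\<lambda>x \<rho>. qn x)" unfolding qn_def by (intro pdef_poly 1)
  show 4: "pdef (\<lambda>x \<rho>. TT x)" unfolding TT_def by (intro pdef_add pdef_poly pdef_const 2 3)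
  show "pdef (\<lambda>x \<rho>. N x)" unfolding N_def by (intro pdef_add pdef_mult pdef_const 4)
qed

lemma pdefb_guess_pos: "pdef f \<Longrightarrow> pdefb (\<lambda>x \<rho>. guess_pos x (f x \<rho>))"
  unfolding guess_pos_def by (intro pdefb_conj pdefb_le pdefb_less pdef_add pdef_bounds)

lemma pdef_input_symbol: "pdef f \<Longrightarrow> pdef (\<lambda>x \<rho>. input_symbol x (f x \<rho>))"
proof -
  assume f: "pdef f"
  have b: "pdefb (\<lambda>x \<rho>. (f x \<rho> - TT x) div 2 < length x \<and> x ! ((f x \<rho> - TT x) div 2))"
    by (intro pdefb_bit pdef_div pdef_sub pdef_const pdef_bounds f)
  have c: "pdefb (\<lambda>x \<rho>. TT x \<le> f x \<rho> \<and> f x \<rho> < TT x + 2 * length x)"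
    by (rule pdefb_conj) (intro pdefb_le pdefb_less pdef_add pdef_mult pdef_const pdef_bounds f)+
  show ?thesis unfolding input_symbol_def
    by (intro pdef_if b c pdefb_eq pdef_add pdef_mult pdef_const pdef_bounds f)
qed

lemma pdef3_coord: "pdef3 cZ" "pdef3 cT" "pdef3 cT1" "pdef3 cP" "pdef3 cP1" "pdef3 cPm" "pdef3 cQ" "pdef3 cC" "pdef3 (move_coord mv)"
proof -
  show *: "pdef3 cZ" "pdef3 cT" "pdef3 cT1" "pdef3 cP" "pdef3 cP1" "pdef3 cPm" "pdef3 cQ" "pdef3 cC"
    unfolding coord_defs by (auto intro!: pdef3I intro: pdef_const pdef_Suc pdef_sub pdef_bounds)
  show "pdef3 (move_coord mv)" using * by (cases mv) simp_all
qed

lemma templates_ok: "\<forall>T\<in>templates. template_ok N T"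
proof -
  have r: "cZ x t p q < N x" "t < TT x \<Longrightarrow> cT1 x t p q < N x" "t < N x \<Longrightarrow> cT x t p q < N x" "p < N x \<Longrightarrow> cP x t p q < N x"
    "p \<le> 2 * TT x \<Longrightarrow> cP1 x t p q < N x" "p < N x \<Longrightarrow> cPm x t p q < N x" "q < N x \<Longrightarrow> cQ x t p q < N x" "cC x t p q < N x"
    for x t p q unfolding coord_defs N_def by simp_all
  have mv: "move_coord m x t p q < N x" if "p \<le> 2 * TT x" for m x t p q
    using that unfolding N_def by (cases m) (simp_all add: coord_defs)
  have g: "p \<le> 2 * TT x" if "guess_pos x p" for x p using that unfolding guess_pos_def TT_def by simp
  have ok: "template_ok N (gd, ls)" if "pdef3b gd"
      "\<And>s c tf pf x t p q. (s, c, tf, pf) \<in> set ls \<Longrightarrow> pdef3 tf \<and> pdef3 pf \<and>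
        (gd x t p q \<longrightarrow> t < N x \<longrightarrow> p < N x \<longrightarrow> q < N x \<longrightarrow> tf x t p q < N x \<and> pf x t p q < N x)" for gd ls
    unfolding template_ok_def using that by fastforce
  have P: "s = False \<and> tf = cT \<and> pf = cZ" if "(s, c, tf, pf) \<in> set (prem q0 rs)" for s c tf pf q0 rs
    using that unfolding prem_def by auto
  note pi = pdefb_conj pdefb_not pdefb_le pdefb_less pdefb_eq pdefb_guess_pos pdef_input_symbol pdef_Suc pdef_mult pdef_const pdef_bounds(4) pdefb_const
  have "template_ok N t_state" unfolding t_state_def by (rule ok, rule pdef3bI, intro pi) (auto simp: pdef3_coord r)
  moreover have "template_ok N t_accept" unfolding t_accept_def by (rule ok, rule pdef3bI, intro pi) (auto simp: pdef3_coord r)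
  moreover have "template_ok N t_guess" unfolding t_guess_def
    by (rule ok, rule pdef3bI, intro pi, assumption) (auto simp: pdef3_coord r)
  moreover have "template_ok N t_guess_end" unfolding t_guess_end_def
    by (rule ok, rule pdef3bI, intro pi, assumption, assumption) (auto simp: pdef3_coord r dest: g)
  moreover have "template_ok N (t_head \<tau>)" for \<tau> unfolding t_head_def by (rule ok, rule pdef3bI, intro pi) (auto simp: pdef3_coord r)
  moreover have "template_ok N (t_blank \<tau>)" for \<tau> unfolding t_blank_def
    by (rule ok, rule pdef3bI, intro pi, assumption) (auto simp: pdef3_coord r)
  moreover have "template_ok N (t_input s)" for s unfolding t_input_def
    by (rule ok, rule pdef3bI, intro pi, assumption+) (auto simp: pdef3_coord r)
  moreover have "template_ok N (t_read \<tau> s)" for \<tau> s unfolding t_read_def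
    by (rule ok, rule pdef3bI, intro pi, assumption+) (auto simp: pdef3_coord r)
  moreover have "template_ok N (t_next q0 rs)" for q0 rs unfolding t_next_def
    by (rule ok, rule pdef3bI, intro pi, assumption+) (auto simp: pdef3_coord r dest: P)
  moreover have "template_ok N (t_move q0 rs \<tau>)" for q0 rs \<tau> unfolding t_move_def
    by (rule ok, rule pdef3bI, intro pi, assumption+) (auto simp: pdef3_coord r mv dest: P)
  moreover have "template_ok N (t_write q0 rs \<tau>)" for q0 rs \<tau> unfolding t_write_def
    by (rule ok, rule pdef3bI, intro pi, assumption+) (auto simp: pdef3_coord r dest: P)
  moreover have "template_ok N (t_keep \<tau> s)" for \<tau> s unfolding t_keep_def
    by (rule ok, rule pdef3bI, intro pi, assumption+) (auto simp: pdef3_coord r)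
  ultimately show ?thesis unfolding templates_def by blast
qed

lemma templatesI:
  "t_state \<in> templates" "t_guess \<in> templates" "t_guess_end \<in> templates" "t_accept \<in> templates"
  "\<tau> < k \<Longrightarrow> t_head \<tau> \<in> templates" "1 \<le> \<tau> \<Longrightarrow> \<tau> < k \<Longrightarrow> t_blank \<tau> \<in> templates" "s < 3 \<Longrightarrow> t_input s \<in> templates"
  "\<tau> < k \<Longrightarrow> s < symbols M \<Longrightarrow> t_read \<tau> s \<in> templates"
  "q0 \<le> states M \<Longrightarrow> rs \<in> RS \<Longrightarrow> t_next q0 rs \<in> templates"
  "q0 \<le> states M \<Longrightarrow> rs \<in> RS \<Longrightarrow> \<tau> < k \<Longrightarrow> t_move q0 rs \<tau> \<in> templates"
  "q0 \<le> states M \<Longrightarrow> rs \<in> RS \<Longrightarrow> \<tau> < k \<Longrightarrow> t_write q0 rs \<tau> \<in> templates"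
  "\<tau> < k \<Longrightarrow> s < symbols M \<Longrightarrow> t_keep \<tau> s \<in> templates"
proof -
  have sub: "(\<Union>q0\<in>{..states M}. \<Union>rs\<in>RS. t_move q0 rs ` {..<k}) \<subseteq> templates"
    "(\<Union>q0\<in>{..states M}. \<Union>rs\<in>RS. t_write q0 rs ` {..<k}) \<subseteq> templates"
    unfolding templates_def by (simp_all only: Un_subset_iff Un_upper1 Un_upper2 le_supI1 le_supI2 order_refl)
  assume i: "q0 \<le> states M" "rs \<in> RS" "\<tau> < k"
  show "t_move q0 rs \<tau> \<in> templates" by (rule subsetD[OF sub(1)]) (use i in blast)
  show "t_write q0 rs \<tau> \<in> templates" by (rule subsetD[OF sub(2)]) (use i in blast)
qed (auto simp: templates_def)

lemma input_symbol_less: "input_symbol x p < 3"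
  unfolding input_symbol_def by simp

lemma written_pair:
  assumes w: "length w \<le> qn x"
  shows "\<not> guess_pos x p \<Longrightarrow> written (pair x w) (int p - int (TT x)) = input_symbol x p"
    and "guess_pos x p \<Longrightarrow> written (pair x w) (int p - int (TT x)) =
      (if p - TT x - ws x < length w then if w ! (p - TT x - ws x) then 2 else 1 else 0)"
proof -
  have len: "length (pair x w) = ws x + length w" unfolding length_pair ws_def by simp
  have wr: "written (pair x w) (int p - int (TT x)) = (if p < TT x then 0 else if p - TT x < ws x + length w then if pair x w ! (p - TT x) then 2 else 1 else 0)"
  proof (cases "p < TT x")
    case True
    then show ?thesis by (simp add: written_def)
  next
    case False
    then have "int p - int (TT x) = int (p - TT x)" by simp
    then show ?thesis using False unfolding written_def len by (simp del: of_nat_diff)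
  qed
  show "written (pair x w) (int p - int (TT x)) = input_symbol x p" if g: "\<not> guess_pos x p"
  proof -
    consider "p < TT x" | "TT x \<le> p" "p < TT x + 2 * length x" | "p = TT x + 2 * length x" | "p = TT x + 2 * length x + 1"
      | "TT x + ws x + qn x \<le> p" using g unfolding guess_pos_def ws_def by linarith
    then show ?thesis
    proof cases
      case 1
      then show ?thesis unfolding wr input_symbol_def by simp
    next
      case 2
      then have "p - TT x < 2 * length x" "(p - TT x) div 2 < length x" by linarith+
      then show ?thesis using 2 unfolding wr input_symbol_def by (simp add: nth_pair(1) ws_def)
    next
      case 3
      then show ?thesis unfolding wr input_symbol_def by (simp add: nth_pair(2) ws_def)
    next
      case 4
      then show ?thesis unfolding wr input_symbol_def by (simp add: nth_pair(3) ws_def)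
    next
      case 5
      then have "\<not> p - TT x < ws x + length w" using w by simp
      then show ?thesis using 5 unfolding wr input_symbol_def by (simp add: ws_def)
    qed
  qed
  show "written (pair x w) (int p - int (TT x)) =
      (if p - TT x - ws x < length w then if w ! (p - TT x - ws x) then 2 else 1 else 0)" if g: "guess_pos x p"
  proof -
    define d where "d = p - TT x - ws x"
    have d: "p - TT x = ws x + d" "\<not> p < TT x" using g unfolding guess_pos_def d_def by linarith+
    show ?thesis unfolding wr d_def[symmetric] d(1) using d(2) nth_pair(4)[of x w d] by (simp add: ws_def)
  qed
qed

text \<open>By monotonicity of polynomials the machine has halted by time \<open>TT x\<close>, and
  from then on its configuration does not change.\<close>

lemma accept_symbol:
  assumes "length w \<le> qn x"
  shows "machine_run.tp M (pair x w) (TT x) (k - 1) 0 = (if pair x w \<in> B then 2 else 1)"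
proof -
  interpret R: machine_run M "pair x w" by unfold_locales (rule wf)
  let ?t = "poly pt (length (pair x w))"
  have "poly pt (length (pair x w)) \<le> poly pt (ws x + qn x)"
    using assms by (intro poly_nat_mono) (simp add: length_pair ws_def)
  then have t: "?t \<le> TT x" unfolding TT_def by simp
  have d: "R.st ?t = states M" "fst (last (snd (R.cf ?t))) = written [pair x w \<in> B]"
    using dec[of "pair x w"] unfolding R.st_def R.cf_def by (auto simp: split_beta)
  have "R.cf (TT x) = R.cf ?t" by (rule R.cf_stable[OF d(1) t])
  moreover have "last (snd (R.cf ?t)) = snd (R.cf ?t) ! (k - 1)"
    using R.run_len[of ?t] R.tapes_pos by (subst last_conv_nth) auto
  ultimately have "R.tp (TT x) (k - 1) = written [pair x w \<in> B]" unfolding R.tp_def using d(2) by simp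
  then show ?thesis by (simp add: written_def)
qed

text \<open>A certificate is read off up to the first guessed blank; by induction on time all facts
  about the run on it are true under \<open>a\<close>. Further atoms may be true as well, but the
  negative clause of \<open>t_accept\<close> already contradicts the fact that a rejecting run would
  contribute.\<close>

lemma sat_imp_accept:
  assumes a: "\<forall>T\<in>templates. template_true a (N x) x T"
  shows "x \<in> A"
proof -
  let ?T = "TT x"
  have D: "\<exists>l\<in>set (snd T). lit_true a x t p q l"
    if "T \<in> templates" "t \<le> ?T" "p \<le> Suc (2 * ?T)" "q \<le> Suc (2 * ?T)" "fst T x t p q" for T t p q
  proof -
    have "t < N x" "p < N x" "q < N x" using that(2-4) unfolding N_def by simp_all
    then show ?thesis using a that(1,5) unfolding template_true_def by blast
  qed
  have guess: "a [2, 0, 0] 0 p \<or> a [2, 0, 1] 0 p \<or> a [2, 0, 2] 0 p" if "guess_pos x p" for p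
    using D[OF templatesI(2), of 0 p 0] that unfolding t_guess_def
    by (simp add: lit_true_def coord_defs guess_pos_def TT_def)
  have guess_end: "a [2, 0, 0] 0 (Suc p)" if "guess_pos x p" "guess_pos x (Suc p)" "a [2, 0, 0] 0 p" for p
    using D[OF templatesI(3), of 0 p 0] that unfolding t_guess_end_def
    by (simp add: lit_true_def coord_defs guess_pos_def TT_def)
  let ?P = "\<lambda>d. qn x \<le> d \<or> a [2, 0, 0] 0 (?T + ws x + d)"
  \<comment> \<open>The first guessed blank, or \<open>qn x\<close> if there is none.\<close>
  define lw where "lw = (LEAST d. ?P d)"
  have lw: "?P lw" unfolding lw_def by (rule LeastI[of ?P "qn x"]) simp
  have lw_le: "lw \<le> qn x" unfolding lw_def by (rule Least_le) simp
  have before: "\<not> ?P d" if "d < lw" for d using not_less_Least[of d ?P] that unfolding lw_def by blast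
  have after: "lw + e < qn x \<Longrightarrow> a [2, 0, 0] 0 (?T + ws x + (lw + e))" for e
  proof (induction e)
    case 0
    then show ?case using lw by simp
  next
    case (Suc e)
    then show ?case using guess_end[of "?T + ws x + (lw + e)"] unfolding guess_pos_def by simp
  qed
  \<comment> \<open>If both bit symbols are true at a cell, \<open>w\<close> takes
    \<open>True\<close>; all that matters is that the chosen symbol is among the true ones.\<close>
  define w where "w = map (\<lambda>d. a [2, 0, 2] 0 (?T + ws x + d)) [0..<lw]"
  have lenw: "length w = lw" "length w \<le> qn x" unfolding w_def using lw_le by simp_all
  let ?y = "pair x w"
  interpret R: machine_run M ?y by unfold_locales (rule wf)
  have init: "a [2, \<tau>, R.tp 0 \<tau> (int p - int ?T)] 0 p" if \<tau>: "\<tau> < k" and p: "p \<le> 2 * ?T" for \<tau> p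
  proof (cases "\<tau> = 0")
    case False
    have "a [2, \<tau>, 0] 0 p"
      using D[OF templatesI(6), of \<tau> 0 p 0] False \<tau> p unfolding t_blank_def by (simp add: lit_true_def coord_defs)
    then show ?thesis using R.start_conf(4)[of \<tau>] False \<tau> by simp
  next
    case True
    show ?thesis
    proof (cases "guess_pos x p")
      case False
      have "a [2, 0, input_symbol x p] 0 p"
        using D[OF templatesI(7)[OF input_symbol_less], of 0 p 0] p False unfolding t_input_def by (simp add: lit_true_def coord_defs)
      then show ?thesis unfolding True R.start_conf(3) written_pair(1)[OF lenw(2) False] .
    next
      case g: True
      define d where "d = p - ?T - ws x"
      have d: "p = ?T + ws x + d" "d < qn x" using g unfolding guess_pos_def d_def by linarith+
      have wp: "written ?y (int p - int ?T) = (if d < lw then if w ! d then 2 else 1 else 0)"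
        unfolding written_pair(2)[OF lenw(2) g] d_def[symmetric] lenw(1) ..
      show ?thesis
      proof (cases "d < lw")
        case True
        have "\<not> a [2, 0, 0] 0 p" using before[OF True] d by blast
        then have "a [2, 0, 1] 0 p \<or> a [2, 0, 2] 0 p" using guess[OF g] by blast
        moreover have "w ! d \<longleftrightarrow> a [2, 0, 2] 0 p" unfolding w_def d(1) using True by simp
        ultimately show ?thesis unfolding \<open>\<tau> = 0\<close> R.start_conf(3) wp using True by auto
      next
        case False
        then have "a [2, 0, 0] 0 p" using after[of "d - lw"] d by simp
        then show ?thesis unfolding \<open>\<tau> = 0\<close> R.start_conf(3) wp using False by simp
      qed
    qed
  qed
  have inv: "t \<le> ?T \<Longrightarrow> a [0, R.st t] t 0 \<and> (\<forall>\<tau><k. a [1, \<tau>] t (nat (R.hp t \<tau> + int ?T)) \<and>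
      (\<forall>p\<le>2 * ?T. a [2, \<tau>, R.tp t \<tau> (int p - int ?T)] t p))" for t
  proof (induction t)
    case 0
    have "a [0, 0] 0 0" using D[OF templatesI(1), of 0 0 0] unfolding t_state_def by (simp add: lit_true_def coord_defs)
    moreover have "a [1, \<tau>] 0 ?T" if "\<tau> < k" for \<tau>
      using D[OF templatesI(5)[OF that], of 0 0 0] unfolding t_head_def by (simp add: lit_true_def coord_defs)
    moreover have "R.hp 0 \<tau> = 0" if "\<tau> < k" for \<tau> using R.start_conf(2)[of \<tau>] that by simp
    ultimately show ?case using init R.start_conf(1) by simp
  next
    case (Suc t)
    then have t: "t < ?T" "t \<le> ?T" by simp_all
    have IH: "a [0, R.st t] t 0" "\<And>\<tau>. \<tau> < k \<Longrightarrow> a [1, \<tau>] t (nat (R.hp t \<tau> + int ?T))"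
      "\<And>\<tau> p. \<tau> < k \<Longrightarrow> p \<le> 2 * ?T \<Longrightarrow> a [2, \<tau>, R.tp t \<tau> (int p - int ?T)] t p"
      using Suc.IH t(2) by blast+
    define P where "P \<tau> = nat (R.hp t \<tau> + int ?T)" for \<tau>
    have P: "int (P \<tau>) - int ?T = R.hp t \<tau>" "1 \<le> P \<tau>" "P \<tau> < 2 * ?T" if "\<tau> < k" for \<tau>
    proof -
      have "\<bar>R.hp t \<tau>\<bar> \<le> int t" using R.run_head[OF that] .
      then have "1 \<le> R.hp t \<tau> + int ?T" "R.hp t \<tau> + int ?T < 2 * int ?T" using t(1) by linarith+
      then show "int (P \<tau>) - int ?T = R.hp t \<tau>" "1 \<le> P \<tau>" "P \<tau> < 2 * ?T" unfolding P_def by linarith+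
    qed
    have hd: "a [1, \<tau>] t (P \<tau>)" if "\<tau> < k" for \<tau> using IH(2)[OF that] unfolding P_def .
    have rd: "a [3, \<tau>, R.rd t ! \<tau>] t 0" if \<tau>: "\<tau> < k" for \<tau>
    proof -
      let ?s = "R.tp t \<tau> (R.hp t \<tau>)"
      have "a [2, \<tau>, ?s] t (P \<tau>)" using IH(3)[OF \<tau>, of "P \<tau>"] P[OF \<tau>] by simp
      then have "a [3, \<tau>, ?s] t 0"
        using D[OF templatesI(8)[OF \<tau> R.run_symbols[OF \<tau>]], of t "P \<tau>" 0 t "R.hp t \<tau>"] t hd[OF \<tau>] P[OF \<tau>]
        unfolding t_read_def by (simp add: lit_true_def coord_defs)
      then show ?thesis using R.rd_ok(3)[OF \<tau>] by simp
    qed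
    have rs: "R.rd t \<in> RS" unfolding RS_def using R.rd_ok by simp
    have prem: "\<not> lit_true a x t p q l" if "l \<in> set (prem (R.st t) (R.rd t))" for l p q
      using that IH(1) rd unfolding prem_def by (auto simp: lit_true_def coord_defs)
    have nx: "tm_step M (R.st t) (R.rd t) = R.nx t" unfolding R.nx_def ..
    have DP: "\<exists>l\<in>set ls. lit_true a x t p q l"
      if "T \<in> templates" "snd T = prem (R.st t) (R.rd t) @ ls" "p \<le> Suc (2 * ?T)" "q \<le> Suc (2 * ?T)" "fst T x t p q" for T ls p q
      using D[OF that(1) t(2) that(3-5)] prem unfolding that(2) set_append by blast
    have "a [0, R.st (Suc t)] (Suc t) 0"
      using DP[OF templatesI(9)[OF R.run_st[of t] rs], of _ 0 0] t unfolding t_next_def R.run_st_Suc R.nx_def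
      by (simp add: lit_true_def coord_defs)
    moreover have "a [1, \<tau>] (Suc t) (nat (R.hp (Suc t) \<tau> + int ?T))" if \<tau>: "\<tau> < k" for \<tau>
    proof -
      let ?mv = "snd (snd (R.nx t) ! \<tau>)"
      have "a [1, \<tau>] (Suc t) (move_coord ?mv x t (P \<tau>) 0)"
        using D[OF templatesI(10)[OF R.run_st[of t] rs \<tau>], of t "P \<tau>" 0] t P[OF \<tau>] hd[OF \<tau>] prem[of _ "P \<tau>" 0] unfolding t_move_def nx
        by (auto simp: lit_true_def cT_def cP_def cT1_def)
      moreover have "move_coord m x t (P \<tau>) 0 = nat (shift m (R.hp t \<tau>) + int ?T)" for m
        using P[OF \<tau>] by (cases m; simp only: move_coord.simps shift.simps coord_defs; linarith)
      ultimately show ?thesis unfolding R.run_hp_Suc[OF \<tau>] by simp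
    qed
    moreover have "a [2, \<tau>, R.tp (Suc t) \<tau> (int p - int ?T)] (Suc t) p" if \<tau>: "\<tau> < k" and p: "p \<le> 2 * ?T" for \<tau> p
    proof (cases "p = P \<tau>")
      case True
      have "a [2, \<tau>, fst (snd (R.nx t) ! \<tau>)] (Suc t) p"
        using D[OF templatesI(11)[OF R.run_st[of t] rs \<tau>], of t p 0] t p hd[OF \<tau>] prem[of _ p 0] unfolding t_write_def nx
        by (auto simp: lit_true_def coord_defs True)
      then show ?thesis unfolding R.run_tp_Suc[OF \<tau>] using P(1)[OF \<tau>] True by simp
    next
      case False
      let ?s = "R.tp t \<tau> (int p - int ?T)"
      have "a [2, \<tau>, ?s] (Suc t) p"
        using D[OF templatesI(12)[OF \<tau> R.run_symbols[OF \<tau>]], of t p "P \<tau>" t "int p - int ?T"] t p hd[OF \<tau>] P[OF \<tau>] False IH(3)[OF \<tau> p]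
        unfolding t_keep_def by (simp add: lit_true_def coord_defs)
      moreover have "int p - int ?T \<noteq> R.hp t \<tau>" using P(1)[OF \<tau>] False by linarith
      ultimately show ?thesis unfolding R.run_tp_Suc[OF \<tau>] by simp
    qed
    ultimately show ?case by blast
  qed
  have "\<not> a [2, k - 1, 1] ?T ?T" using D[OF templatesI(4), of 0 0 0] unfolding t_accept_def by (simp add: lit_true_def coord_defs)
  moreover have "a [2, k - 1, R.tp ?T (k - 1) 0] ?T ?T"
  proof -
    have "k - 1 < k" using R.tapes_pos by simp
    moreover have "?T \<le> 2 * ?T" by simp
    ultimately have "a [2, k - 1, R.tp ?T (k - 1) (int ?T - int ?T)] ?T ?T" using inv[OF order_refl] by blast
    then show ?thesis by simp
  qed
  ultimately have "R.tp ?T (k - 1) 0 \<noteq> 1" by metis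
  then have "?y \<in> B" using accept_symbol[OF lenw(2)] by (simp split: if_splits)
  then show ?thesis using A lenw(2) unfolding qn_def by blast
qed

text \<open>Each atom is given its meaning in the run on an accepted pair, and each template then
  expresses a fact about runs.\<close>

lemma accept_imp_sat:
  assumes "x \<in> A"
  shows "\<exists>a. \<forall>T\<in>templates. template_true a (N x) x T"
proof -
  let ?T = "TT x"
  obtain w where w: "length w \<le> qn x" "pair x w \<in> B" using assms A unfolding qn_def by blast
  interpret R: machine_run M "pair x w" by unfold_locales (rule wf)
  define a where "a c t p \<longleftrightarrow> (if hd c = 0 then R.st t = c ! 1
     else if hd c = 1 then R.hp t (c ! 1) = int p - int ?T
     else if hd c = 2 then R.tp t (c ! 1) (int p - int ?T) = c ! 2
     else R.rd t ! (c ! 1) = c ! 2)" for c :: "nat list" and t p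
  have a: "a [0, q0] t p \<longleftrightarrow> R.st t = q0" "a [1, \<tau>] t p \<longleftrightarrow> R.hp t \<tau> = int p - int ?T"
    "a [2, \<tau>, s] t p \<longleftrightarrow> R.tp t \<tau> (int p - int ?T) = s" "a [3, \<tau>, s] t p \<longleftrightarrow> R.rd t ! \<tau> = s" for q0 \<tau> s t p
    by (simp_all add: a_def)
  \<comment> \<open>The simplifier rewrites the kind \<open>1\<close> to \<open>Suc 0\<close>, so
    the rule is kept in both forms.\<close>
  note a = a a(2)[unfolded One_nat_def]
  have prem: "R.nx t = tm_step M q0 rs" if rs: "rs \<in> RS" and no: "\<forall>l\<in>set (prem q0 rs). \<not> lit_true a x t p q l" for q0 rs t p q
  proof -
    have "R.st t = q0" using no unfolding prem_def by (simp add: lit_true_def coord_defs a)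
    moreover have "R.rd t = rs"
      by (rule nth_equalityI) (use no rs R.rd_ok(1)[of t] in \<open>auto simp: prem_def lit_true_def coord_defs a RS_def\<close>)
    ultimately show ?thesis unfolding R.nx_def by simp
  qed
  \<comment> \<open>Either a premise is violated, which makes the clause true, or the premises fix
    the state and the scanned symbols and thereby the transition.\<close>
  have PT: "template_true a (N x) x (gd, prem q0 rs @ ls)"
    if "rs \<in> RS" "\<And>t p q. gd x t p q \<Longrightarrow> R.nx t = tm_step M q0 rs \<Longrightarrow> \<exists>l\<in>set ls. lit_true a x t p q l" for gd q0 rs ls
    unfolding template_true_def
  proof (intro allI impI)
    fix t p q assume g: "fst (gd, prem q0 rs @ ls) x t p q"
    show "\<exists>l\<in>set (snd (gd, prem q0 rs @ ls)). lit_true a x t p q l"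
    proof (cases "\<forall>l\<in>set (prem q0 rs). \<not> lit_true a x t p q l")
      case True
      then have "R.nx t = tm_step M q0 rs" using prem[OF that(1)] by blast
      then show ?thesis using that(2)[of t p q] g by auto
    next
      case False
      then show ?thesis by auto
    qed
  qed
  have tg: "R.tp 0 0 (int p - int ?T) = (if p - ?T - ws x < length w then if w ! (p - ?T - ws x) then 2 else 1 else 0)"
    if "guess_pos x p" for p
    unfolding R.start_conf(3) by (rule written_pair(2)[OF w(1) that])
  have "template_true a (N x) x t_state" unfolding template_true_def t_state_def by (simp add: lit_true_def coord_defs a R.start_conf(1))
  moreover have "template_true a (N x) x (t_head \<tau>)" if "\<tau> < k" for \<tau>
    using that R.start_conf(2)[of \<tau>] unfolding template_true_def t_head_def by (simp add: lit_true_def coord_defs a)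
  moreover have "template_true a (N x) x (t_blank \<tau>)" if "1 \<le> \<tau>" "\<tau> < k" for \<tau>
    using that R.start_conf(4)[of \<tau>] unfolding template_true_def t_blank_def by (simp add: lit_true_def coord_defs a)
  moreover have "template_true a (N x) x (t_input s)" for s
    unfolding template_true_def t_input_def by (simp add: lit_true_def coord_defs a R.start_conf(3) written_pair(1)[OF w(1)])
  moreover have "template_true a (N x) x t_guess"
    unfolding template_true_def t_guess_def by (auto simp: lit_true_def coord_defs a tg)
  moreover have "template_true a (N x) x t_guess_end"
    unfolding template_true_def t_guess_end_def by (auto simp: lit_true_def coord_defs a tg simp del: of_nat_Suc split: if_splits)
  moreover have "template_true a (N x) x (t_read \<tau> s)" if "\<tau> < k" for \<tau> s
    using R.rd_ok(3)[OF that] unfolding template_true_def t_read_def by (auto simp: lit_true_def coord_defs a)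
  moreover have "template_true a (N x) x (t_next q0 rs)" if "rs \<in> RS" for q0 rs
    unfolding t_next_def by (rule PT[OF that]) (simp add: lit_true_def coord_defs a R.run_st_Suc)
  moreover have "template_true a (N x) x (t_move q0 rs \<tau>)" if \<tau>: "\<tau> < k" and rs: "rs \<in> RS" for q0 rs \<tau>
    unfolding t_move_def
  proof (rule PT[OF rs])
    fix t p q assume g: "t < ?T \<and> 1 \<le> p \<and> p < 2 * ?T" and n: "R.nx t = tm_step M q0 rs"
    have "int (move_coord m x t p q) - int ?T = shift m (int p - int ?T)" for m
      using g by (cases m) (simp_all add: coord_defs of_nat_diff)
    then show "\<exists>l\<in>set [(False, [1, \<tau>], cT, cP), (True, [1, \<tau>], cT1, move_coord (snd (snd (tm_step M q0 rs) ! \<tau>)))]. lit_true a x t p q l"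
      by (simp add: lit_true_def cT_def cP_def cT1_def a R.run_hp_Suc[OF \<tau>] n)
  qed
  moreover have "template_true a (N x) x (t_write q0 rs \<tau>)" if \<tau>: "\<tau> < k" and rs: "rs \<in> RS" for q0 rs \<tau>
    unfolding t_write_def by (rule PT[OF rs]) (simp add: lit_true_def coord_defs a R.run_tp_Suc[OF \<tau>])
  moreover have "template_true a (N x) x (t_keep \<tau> s)" if \<tau>: "\<tau> < k" for \<tau> s
    unfolding template_true_def t_keep_def by (auto simp: lit_true_def coord_defs a R.run_tp_Suc[OF \<tau>])
  moreover have "template_true a (N x) x t_accept"
    using accept_symbol[OF w(1)] w(2) unfolding template_true_def t_accept_def by (simp add: lit_true_def coord_defs a)
  ultimately have "\<forall>T\<in>templates. template_true a (N x) x T" unfolding templates_def by auto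
  then show ?thesis by blast
qed

end

theorem NP_cnf_sat:
  assumes "A \<in> class_NP"
  shows "\<exists>R V pos neg. pdef (\<lambda>x \<rho>. R x) \<and> pdef (\<lambda>x \<rho>. V x) \<and> (\<forall>x. 1 \<le> V x) \<and> pdef2b pos \<and> pdef2b neg \<and>
    (\<forall>x. cnf_sat (R x) (V x) (pos x) (neg x) \<longleftrightarrow> x \<in> A)"
proof -
  obtain B pq where B: "B \<in> class_P" and A: "\<forall>x. x \<in> A \<longleftrightarrow> (\<exists>w. length w \<le> poly pq (length x) \<and> pair x w \<in> B)"
    using assms unfolding class_NP_def by blast
  obtain M pt where M: "wf_tm M" "\<forall>y. case (step M ^^ poly pt (length y)) (start M y) of (q, ts) \<Rightarrow>
      q = states M \<and> fst (last ts) = written [y \<in> B]"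
    using B unfolding class_P_def poly_time_def by blast
  interpret cook_levin M pt pq A B by (rule cook_levin.intro[OF M(1) M(2)[THEN spec] A[THEN spec]])
  have "(\<exists>a. \<forall>T\<in>templates. template_true a (N x) x T) \<longleftrightarrow> x \<in> A" for x
    using sat_imp_accept accept_imp_sat by blast
  moreover have "0 < N x" for x by (simp add: N_def)
  ultimately show ?thesis using templates_reduction[OF pdef_bounds(5) _ finite_templates templates_ok] by simp
qed


section \<open>Membership in NP\<close>

lemma nth_concat_const:
  assumes "\<And>u. u < n \<Longrightarrow> length (f u) = l" "i < n" "j < l"
  shows "concat (map f [0..<n]) ! (i * l + j) = f i ! j"
  using assms
proof (induction n)
  case (Suc n)
  have len: "length (concat (map f [0..<n])) = n * l"
    using Suc.prems(1) by (simp add: length_concat o_def interv_sum_list_conv_sum_set_nat)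
  show ?case
  proof (cases "i < n")
    case True
    then have "Suc i * l \<le> n * l" by (intro mult_le_mono1) simp
    then have "i * l + j < n * l" using Suc.prems(3) by simp
    then show ?thesis using Suc True len by (simp add: nth_append)
  next
    case False
    then have "i = n" using Suc.prems(2) by simp
    then show ?thesis using len by (simp add: nth_append)
  qed
qed simp

text \<open>
  In \<open>encode_nats ns\<close> every bit of a field is doubled and every field ends with the unequal pair
  \<open>01\<close>; \<open>b\<close> is the encoded string, and \<open>offset b m k\<close> is the number of pairs before field \<open>k\<close>.
\<close>

definition separators :: "(nat \<Rightarrow> bool) \<Rightarrow> nat \<Rightarrow> nat" where
  "separators b i = (\<Sum>j<i. if b (2 * j) \<longleftrightarrow> b (Suc (2 * j)) then 0 else 1)"

definition offset :: "(nat \<Rightarrow> bool) \<Rightarrow> nat \<Rightarrow> nat \<Rightarrow> nat" where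
  "offset b m k = (\<Sum>i<m. if separators b i < k then 1 else 0)"

text \<open>Fields are compared bit by bit and never decoded: colours are written in binary, and the
  values of expressions are only polynomial in the length.\<close>

definition same_field :: "(nat \<Rightarrow> bool) \<Rightarrow> nat \<Rightarrow> nat \<Rightarrow> nat \<Rightarrow> bool" where
  "same_field b m k l \<longleftrightarrow>
     offset b m (Suc k) - offset b m k = offset b m (Suc l) - offset b m l \<and>
     (\<forall>d<offset b m (Suc k) - offset b m k. b (2 * (offset b m k + d)) \<longleftrightarrow> b (2 * (offset b m l + d)))"

lemma separators_cong: "(\<And>j. j < 2 * i \<Longrightarrow> b j = b' j) \<Longrightarrow> separators b i = separators b' i"
  unfolding separators_def by (rule sum.cong) auto

lemma offset_cong: "(\<And>j. j < 2 * m \<Longrightarrow> b j = b' j) \<Longrightarrow> offset b m k = offset b' m k"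
  unfolding offset_def by (rule sum.cong) (auto simp: separators_cong[of _ b b'])

text \<open>The verifier sees the encoded graph through \<open>first_bit\<close>, which is known to
  agree with it only below its length.\<close>

lemma same_field_cong:
  assumes b: "\<And>j. j < 2 * m \<Longrightarrow> b j = b' j"
  shows "same_field b m k l \<longleftrightarrow> same_field b' m k l"
proof -
  have off: "offset b m k = offset b' m k" for k by (rule offset_cong) (rule b)
  have "offset b' m k \<le> (\<Sum>i<m. 1)" for k unfolding offset_def by (rule sum_mono) simp
  then have le: "offset b' m k \<le> m" for k by simp
  have "b (2 * (offset b' m k + d)) = b' (2 * (offset b' m k + d))"
    if "d < offset b' m (Suc k) - offset b' m k" for k d
  proof (rule b)
    have "offset b' m k + d < m" using that le[of "Suc k"] by linarith
    then show "2 * (offset b' m k + d) < 2 * m" by simp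
  qed
  then show ?thesis unfolding same_field_def off by metis
qed

text \<open>Data pairs consist of equal bits and only the final \<open>01\<close> is unequal, so
  counting unequal pairs counts completed fields; a field put in front raises the count by
  one.\<close>

lemma separators_cons:
  fixes L n :: nat
  defines "L \<equiv> length (bits n)"
  shows "i \<le> L \<Longrightarrow> separators ((!) (pair (bits n) w)) i = 0"
    and "separators ((!) (pair (bits n) w)) (Suc (L + i)) = Suc (separators ((!) w) i)"
proof -
  let ?b = "(!) (pair (bits n) w)"
  have b: "?b (2 * j) \<longleftrightarrow> ?b (Suc (2 * j))" if "j < L" for j
    using that nth_pair(1)[of "2 * j" "bits n" w] nth_pair(1)[of "Suc (2 * j)" "bits n" w] unfolding L_def by simp
  then show z: "separators ?b i = 0" if "i \<le> L" for i using that unfolding separators_def by auto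
  have "separators ?b (Suc L) = 1"
    using z[of L] nth_pair(2,3)[of "bits n" w] unfolding separators_def L_def by simp
  moreover have "separators ?b (Suc (L + i)) = separators ?b (Suc L) + separators ((!) w) i"
  proof (induction i)
    case (Suc i)
    have "?b (2 * Suc (L + i)) = w ! (2 * i)" "?b (Suc (2 * Suc (L + i))) = w ! Suc (2 * i)"
      using nth_pair(4)[of "bits n" w "2 * i"] nth_pair(4)[of "bits n" w "Suc (2 * i)"] unfolding L_def by (simp_all add: algebra_simps)
    then show ?case using Suc unfolding separators_def by simp
  qed (simp add: separators_def)
  ultimately show "separators ?b (Suc (L + i)) = Suc (separators ((!) w) i)" by simp
qed

lemma offset_cons:
  "offset ((!) (pair (bits n) w)) (Suc (length (bits n) + m)) (Suc k) = Suc (length (bits n)) + offset ((!) w) m k"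
proof -
  let ?L = "length (bits n)"
  have "offset ((!) (pair (bits n) w)) (Suc (?L + i)) (Suc k) = Suc ?L + offset ((!) w) i k" for i
  proof (induction i)
    case 0
    show ?case unfolding offset_def using separators_cons(1)[of _ n w] by simp
  next
    case (Suc i)
    then show ?case using separators_cons(2)[of n w i] unfolding offset_def by simp
  qed
  then show ?thesis .
qed

lemma length_encode_nats_ge: "2 * length ns \<le> length (encode_nats ns)"
  by (induction ns) (simp_all add: length_pair)

lemma separators_encode_nats: "separators ((!) (encode_nats ns)) (length (encode_nats ns) div 2) = length ns"
proof (induction ns)
  case (Cons n ns)
  have "length (encode_nats (n # ns)) div 2 = Suc (length (bits n) + length (encode_nats ns) div 2)"
    by (simp add: length_pair)
  then show ?case using Cons separators_cons(2)[of n "encode_nats ns"] by simp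
qed (simp add: separators_def)

lemma offset_encode_nats:
  assumes "k < length ns"
  defines "b \<equiv> (!) (encode_nats ns)" and "m \<equiv> length (encode_nats ns) div 2"
  shows "offset b m (Suc k) = Suc (offset b m k + length (bits (ns ! k)))"
    and "d < length (bits (ns ! k)) \<Longrightarrow> b (2 * (offset b m k + d)) = bits (ns ! k) ! d"
    and "b (2 * (offset b m k + length (bits (ns ! k)))) = False"
proof -
  have "offset b m (Suc k) = Suc (offset b m k + length (bits (ns ! k))) \<and>
    (d < length (bits (ns ! k)) \<longrightarrow> b (2 * (offset b m k + d)) = bits (ns ! k) ! d) \<and>
    b (2 * (offset b m k + length (bits (ns ! k)))) = False" for d
    using assms(1) unfolding b_def m_def
  proof (induction ns arbitrary: k)
    case (Cons n ns)
    let ?w = "encode_nats ns" and ?L = "length (bits n)"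
    have m: "length (pair (bits n) ?w) div 2 = Suc (?L + length ?w div 2)" by (simp add: length_pair)
    have o: "offset ((!) (pair (bits n) ?w)) (Suc (?L + length ?w div 2)) (Suc k) =
      Suc ?L + offset ((!) ?w) (length ?w div 2) k" for k by (rule offset_cons)
    have z: "offset b m 0 = 0" for b m unfolding offset_def by simp
    show ?case
    proof (cases k)
      case 0
      then show ?thesis unfolding encode_nats.simps(2) m o
        by (simp add: z nth_pair)
    next
      case (Suc k')
      have sh: "pair (bits n) ?w ! (2 * (Suc ?L + i)) = ?w ! (2 * i)" for i
        using nth_pair(4)[of "bits n" ?w "2 * i"] by (simp add: algebra_simps)
      have "k' < length ns" using Cons.prems Suc by simp
      from Cons.IH[OF this] show ?thesis
        unfolding encode_nats.simps(2) m Suc o nth_Cons_Suc add.assoc sh by simp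
    qed
  qed simp
  then show "offset b m (Suc k) = Suc (offset b m k + length (bits (ns ! k)))"
    "d < length (bits (ns ! k)) \<Longrightarrow> b (2 * (offset b m k + d)) = bits (ns ! k) ! d"
    "b (2 * (offset b m k + length (bits (ns ! k)))) = False" by blast+
qed

lemma same_field_encode_nats:
  assumes "k < length ns" "l < length ns"
  shows "same_field ((!) (encode_nats ns)) (length (encode_nats ns) div 2) k l \<longleftrightarrow> ns ! k = ns ! l"
proof -
  let ?b = "(!) (encode_nats ns)" and ?m = "length (encode_nats ns) div 2"
  note k = offset_encode_nats[OF assms(1)] and l = offset_encode_nats[OF assms(2)]
  \<comment> \<open>One more than the number of bits, because the separator belongs to its field;
    its first bit is \<open>False\<close> in both fields and does not disturb the
    comparison.\<close>
  have d: "offset ?b ?m (Suc k) - offset ?b ?m k = Suc (length (bits (ns ! k)))"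
    "offset ?b ?m (Suc l) - offset ?b ?m l = Suc (length (bits (ns ! l)))"
    unfolding k(1) l(1) by simp_all
  have "same_field ?b ?m k l \<longleftrightarrow> bits (ns ! k) = bits (ns ! l)"
    unfolding same_field_def d list_eq_iff_nth_eq using k(2,3) l(2,3) by (auto simp: less_Suc_eq)
  then show ?thesis unfolding bits_inject .
qed

section \<open>The verifier\<close>

definition bit_at :: "bool list \<Rightarrow> nat \<Rightarrow> bool" where
  "bit_at y i \<longleftrightarrow> i < length y \<and> y ! i"

text \<open>In \<open>y = pair x w\<close> the bits of \<open>x\<close> are doubled, and \<open>length x\<close> is the index of the first unequal pair.\<close>

definition first_length :: "bool list \<Rightarrow> nat" where
  "first_length y = (\<Sum>i<length y. if \<forall>j<Suc i. bit_at y (2 * j) \<longleftrightarrow> bit_at y (Suc (2 * j)) then 1 else 0)"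

definition first_bit :: "bool list \<Rightarrow> nat \<Rightarrow> bool" where
  "first_bit y i \<longleftrightarrow> bit_at y (2 * i)"

text \<open>The certificate has two bits for each vertex, the index of its colour in its sorted list; missing bits count as \<open>0\<close>.\<close>

definition certified_index :: "bool list \<Rightarrow> nat \<Rightarrow> nat" where
  "certified_index y u =
     (if bit_at y (2 * first_length y + 2 + 2 * u) then 2 else 0) +
     (if bit_at y (2 * first_length y + 3 + 2 * u) then 1 else 0)"

text \<open>
  For \<open>n\<close> vertices, field \<open>1 + u * n + v\<close> is the adjacency of \<open>u\<close> and \<open>v\<close>; it occupies two pairs iff it is
  \<open>1\<close>. Field \<open>1 + n * n + 4 * u + j\<close> is the colour \<open>j\<close> of \<open>u\<close>.
\<close>

definition verify :: "bool list \<Rightarrow> bool" where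
  "verify y \<longleftrightarrow> (let b = first_bit y; m = first_length y div 2 in
     \<exists>n<length y. separators b m = 1 + n * n + 4 * n \<and>
       (\<forall>u<n. \<forall>v<n.
          offset b m (Suc (1 + (u * n + v))) - offset b m (1 + (u * n + v)) = 2 \<longrightarrow>
          \<not> same_field b m (1 + n * n + (u * 4 + certified_index y u)) (1 + n * n + (v * 4 + certified_index y v))))"

lemma first_pair:
  shows "first_length (pair x w) = length x"
    and "i < length x \<Longrightarrow> first_bit (pair x w) i = x ! i"
    and "bit_at (pair x w) (2 * length x + 2 + d) \<longleftrightarrow> d < length w \<and> w ! d"
proof -
  have b: "bit_at (pair x w) (2 * j) = x ! j" "bit_at (pair x w) (Suc (2 * j)) = x ! j" if "j < length x" for j
    using that nth_pair(1)[of "2 * j" x w] nth_pair(1)[of "Suc (2 * j)" x w] unfolding bit_at_def length_pair by simp_all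
  then show "i < length x \<Longrightarrow> first_bit (pair x w) i = x ! i" unfolding first_bit_def by blast
  show "bit_at (pair x w) (2 * length x + 2 + d) \<longleftrightarrow> d < length w \<and> w ! d"
    unfolding bit_at_def length_pair nth_pair(4) by simp
  have e: "\<not> (bit_at (pair x w) (2 * length x) \<longleftrightarrow> bit_at (pair x w) (Suc (2 * length x)))"
    unfolding bit_at_def length_pair nth_pair(2,3) by simp
  have "(\<forall>j<Suc i. bit_at (pair x w) (2 * j) \<longleftrightarrow> bit_at (pair x w) (Suc (2 * j))) \<longleftrightarrow> i < length x" for i
  proof (cases "i < length x")
    case True
    then show ?thesis using b by simp
  next
    case False
    then show ?thesis using e by (metis not_less_eq)
  qed
  then have "first_length (pair x w) = (\<Sum>i<length (pair x w). if i < length x then 1 else 0)"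
    unfolding first_length_def by simp
  also have "\<dots> = card ({..<length (pair x w)} \<inter> {i. i < length x})" by (simp add: sum.If_cases)
  also have "{..<length (pair x w)} \<inter> {i. i < length x} = {..<length x}" unfolding length_pair by auto
  finally show "first_length (pair x w) = length x" by simp
qed

lemma pdefb_bit_at: "pdef f \<Longrightarrow> pdefb (\<lambda>y \<rho>. bit_at y (f y \<rho>))"
  unfolding bit_at_def by (rule pdefb_bit)

lemma pdef_double: "pdef f \<Longrightarrow> pdef (\<lambda>y \<rho>. 2 * f y \<rho>)"
  by (intro pdef_mult pdef_const)

lemma pdef_first_length: "pdef (\<lambda>y \<rho>. first_length y)"
  unfolding first_length_def
  by (intro pdef_sum pdef_if pdefb_all pdefb_iff pdefb_bit_at pdef_Suc pdef_double pdef_len pdef_var pdef_const)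

lemma pdefb_first_bit: "pdef f \<Longrightarrow> pdefb (\<lambda>y \<rho>. first_bit y (f y \<rho>))"
  unfolding first_bit_def by (intro pdefb_bit_at pdef_double)

lemma pdef_separators: "pdef f \<Longrightarrow> pdef (\<lambda>y \<rho>. separators (first_bit y) (f y \<rho>))"
  unfolding separators_def
  by (intro pdef_sum pdef_if pdefb_iff pdefb_first_bit pdef_Suc pdef_double pdef_var pdef_const)

lemma pdef_offset:
  assumes "pdef f"
  shows "pdef (\<lambda>y \<rho>. offset (first_bit y) (first_length y div 2) (f y \<rho>))"
  unfolding offset_def
  by (intro pdef_sum pdef_if pdefb_less pdef_separators pdef_div pdef_first_length pdef_var pdef_const pdef_weaken assms)

lemma pdefb_same_field:
  assumes "pdef f" "pdef g"
  shows "pdefb (\<lambda>y \<rho>. same_field (first_bit y) (first_length y div 2) (f y \<rho>) (g y \<rho>))"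
  unfolding same_field_def
  by (intro pdefb_conj pdefb_all pdefb_eq pdefb_iff pdefb_first_bit pdef_double pdef_add pdef_sub pdef_offset pdef_Suc pdef_var
      pdef_weaken assms)

lemma pdef_certified_index: "pdef f \<Longrightarrow> pdef (\<lambda>y \<rho>. certified_index y (f y \<rho>))"
  unfolding certified_index_def
  by (intro pdef_add pdef_if pdefb_bit_at pdef_double pdef_first_length pdef_const)

lemma verify_in_class_P: "{y. verify y} \<in> class_P"
proof (rule class_P_pdefb)
  have var: "pdef (\<lambda>y \<rho>. (\<rho> \<circ> Suc) v)" "pdef (\<lambda>y \<rho>. ((\<rho> \<circ> Suc) \<circ> Suc) v)" for v
    using pdef_var[of "Suc v"] pdef_var[of "Suc (Suc v)"] by simp_all
  show "pdefb (\<lambda>y \<rho>. verify y)"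
    unfolding verify_def Let_def
    by (intro pdefb_ex pdefb_conj pdefb_all pdefb_imp pdefb_not pdefb_eq pdefb_same_field pdef_sub pdef_offset pdef_separators
        pdef_certified_index pdef_add pdef_Suc pdef_mult pdef_div pdef_first_length pdef_len pdef_const var pdef_var)
qed

section \<open>Correctness of the verifier\<close>

lemma verify_pair_encode:
  assumes G: "regular_input 4 G L"
  defines "n \<equiv> card (pverts G)"
  shows "verify (pair (encode G L) w) \<longleftrightarrow> (\<forall>(u, v)\<in>parcs G.
    sorted_list_of_set (L u) ! certified_index (pair (encode G L) w) u \<noteq>
    sorted_list_of_set (L v) ! certified_index (pair (encode G L) w) v)"
proof -
  let ?x = "encode G L" and ?y = "pair (encode G L) w"
  let ?S = "\<lambda>u. sorted_list_of_set (L u)" and ?e = "certified_index (pair (encode G L) w)"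
  let ?adj = "\<lambda>u. map (\<lambda>v. if (u, v) \<in> parcs G then 1 else 0 :: nat) [0..<n]"
  define ns where "ns = n # concat (map ?adj [0..<n]) @ concat (map ?S [0..<n])"
  have x: "?x = encode_nats ns" unfolding encode_def Let_def n_def ns_def ..
  have V: "pverts G = {..<n}" using G unfolding regular_input_def n_def by simp
  have arcs: "u < n \<and> v < n" if "(u, v) \<in> parcs G" for u v
    using that G V unfolding regular_input_def pair_graph_iff by auto
  have S: "length (?S u) = 4" if "u < n" for u
    using that G V unfolding regular_input_def regular_assignment_def by auto
  have la: "length (concat (map ?adj [0..<n])) = n * n" by (simp add: length_concat o_def interv_sum_list_conv_sum_set_nat)
  have ls: "length (concat (map ?S [0..<n])) = 4 * n" using S by (simp add: length_concat o_def interv_sum_list_conv_sum_set_nat)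
  have len: "length ns = 1 + n * n + 4 * n" unfolding ns_def using la ls by simp
  have in1: "u * n + v < n * n" if "u < n" "v < n" for u v
    using mult_le_mono1[of "Suc u" n n] that by simp
  have in2: "u * 4 + j < 4 * n" if "u < n" "j < 4" for u j using that by simp
  have e: "?e u < 4" for u unfolding certified_index_def by simp
  have nth1: "ns ! (1 + (u * n + v)) = (if (u, v) \<in> parcs G then 1 else 0)" if "u < n" "v < n" for u v
    unfolding ns_def using in1[OF that] la nth_concat_const[of n ?adj n u v] that by (simp add: nth_append)
  have nth2: "ns ! (1 + n * n + (u * 4 + j)) = ?S u ! j" if "u < n" "j < 4" for u j
    unfolding ns_def using la nth_concat_const[of n ?S 4 u j] S that by (simp add: nth_append)
  have k1: "1 + (u * n + v) < length ns" if "u < n" "v < n" for u v using in1[OF that] len by simp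
  have k2: "1 + n * n + (u * 4 + j) < length ns" if "u < n" "j < 4" for u j using in2[OF that] len by simp
  let ?b = "first_bit ?y" and ?m = "first_length ?y div 2"
  have m: "?m = length ?x div 2" by (simp add: first_pair(1))
  have b: "?b j = ?x ! j" if "j < 2 * ?m" for j
    using that first_pair(2)[of j ?x w] unfolding m by simp
  have sep: "separators ?b ?m = length ns"
    using separators_cong[of ?m ?b "(!) ?x"] b separators_encode_nats[of ns] unfolding m unfolding x by simp
  have off: "offset ?b ?m k = offset ((!) ?x) ?m k" for k by (rule offset_cong) (rule b)
  have adj: "offset ?b ?m (Suc (1 + (u * n + v))) - offset ?b ?m (1 + (u * n + v)) = 2 \<longleftrightarrow> (u, v) \<in> parcs G"
    if "u < n" "v < n" for u v
    unfolding off unfolding m unfolding x offset_encode_nats(1)[OF k1[OF that]] nth1[OF that] by (simp add: bits_0 bits_pos)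
  have same: "same_field ?b ?m k l \<longleftrightarrow> ns ! k = ns ! l" if "k < length ns" "l < length ns" for k l
  proof -
    have "same_field ?b ?m k l \<longleftrightarrow> same_field ((!) ?x) ?m k l" by (rule same_field_cong) (rule b)
    then show ?thesis using same_field_encode_nats[OF that] unfolding m unfolding x by simp
  qed
  have "n \<le> length ns" using len by simp
  then have n: "n < length ?y" using length_encode_nats_ge[of ns] unfolding length_pair x by linarith
  \<comment> \<open>\<open>verify\<close> obtains the number of vertices from the number of fields,
    a strictly increasing function of it, and so does not decode the first field.\<close>
  have uniq: "n' = n" if "1 + n' * n' + 4 * n' = 1 + n * n + 4 * n" for n'
  proof (rule ccontr)
    assume "n' \<noteq> n"
    then consider "n' < n" | "n < n'" by linarith
    then show False using that mult_le_mono[of n' n n' n] mult_le_mono[of n n' n n'] by cases auto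
  qed
  have "verify ?y \<longleftrightarrow> (\<forall>u<n. \<forall>v<n. (u, v) \<in> parcs G \<longrightarrow> ?S u ! ?e u \<noteq> ?S v ! ?e v)"
  proof
    assume "verify ?y"
    then obtain n' where n': "1 + n * n + 4 * n = 1 + n' * n' + 4 * n'"
      and all: "\<forall>u<n'. \<forall>v<n'.
          offset ?b ?m (Suc (1 + (u * n' + v))) - offset ?b ?m (1 + (u * n' + v)) = 2 \<longrightarrow>
          \<not> same_field ?b ?m (1 + n' * n' + (u * 4 + ?e u)) (1 + n' * n' + (v * 4 + ?e v))"
      unfolding verify_def Let_def sep len by blast
    have "n' = n" using uniq n' by simp
    then show "\<forall>u<n. \<forall>v<n. (u, v) \<in> parcs G \<longrightarrow> ?S u ! ?e u \<noteq> ?S v ! ?e v"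
      using all adj same[OF k2[OF _ e] k2[OF _ e]] nth2[OF _ e] by simp
  next
    assume "\<forall>u<n. \<forall>v<n. (u, v) \<in> parcs G \<longrightarrow> ?S u ! ?e u \<noteq> ?S v ! ?e v"
    then have "\<forall>u<n. \<forall>v<n.
          offset ?b ?m (Suc (1 + (u * n + v))) - offset ?b ?m (1 + (u * n + v)) = 2 \<longrightarrow>
          \<not> same_field ?b ?m (1 + n * n + (u * 4 + ?e u)) (1 + n * n + (v * 4 + ?e v))"
      using adj same[OF k2[OF _ e] k2[OF _ e]] nth2[OF _ e] by simp
    then show "verify ?y" unfolding verify_def Let_def sep len using n by blast
  qed
  then show ?thesis using arcs by blast
qed

lemma verify_iff_colourable:
  assumes G: "regular_input 4 G L"
  shows "(\<exists>w. length w \<le> length (encode G L) \<and> verify (pair (encode G L) w)) \<longleftrightarrow>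
    (\<exists>c. colouring G c \<and> respects_lists G L c)"
proof
  let ?S = "\<lambda>u. sorted_list_of_set (L u)"
  define n where "n = card (pverts G)"
  have V: "pverts G = {..<n}" using G unfolding regular_input_def n_def by simp
  have arcs: "u < n \<and> v < n" if "(u, v) \<in> parcs G" for u v
    using that G V unfolding regular_input_def pair_graph_iff by auto
  have L: "L u \<subseteq> {1..}" "set (?S u) = L u" "length (?S u) = 4" if "u < n" for u
    using that G V unfolding regular_input_def regular_assignment_def by auto
  {
    assume "\<exists>w. length w \<le> length (encode G L) \<and> verify (pair (encode G L) w)"
    then obtain w where "verify (pair (encode G L) w)" by blast
    then have ne: "\<forall>(u, v)\<in>parcs G. ?S u ! certified_index (pair (encode G L) w) u \<noteq>
        ?S v ! certified_index (pair (encode G L) w) v"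
      unfolding verify_pair_encode[OF G] .
    define c where "c u = ?S u ! certified_index (pair (encode G L) w) u" for u
    have "certified_index (pair (encode G L) w) u < 4" for u unfolding certified_index_def by simp
    then have "c u \<in> L u" if "u < n" for u unfolding c_def using nth_mem[of _ "?S u"] L(2,3)[OF that] by simp
    then have "colouring G c \<and> respects_lists G L c"
      using ne L(1) unfolding colouring_def respects_lists_def V c_def[symmetric] by fastforce
    then show "\<exists>c. colouring G c \<and> respects_lists G L c" by blast
  }
  assume "\<exists>c. colouring G c \<and> respects_lists G L c"
  then obtain c where c: "colouring G c" "respects_lists G L c" by blast
  have "\<forall>u. \<exists>e. u < n \<longrightarrow> e < 4 \<and> ?S u ! e = c u"
    using c(2) L unfolding respects_lists_def V by (metis in_set_conv_nth lessThan_iff)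
  then obtain e where e: "\<And>u. u < n \<Longrightarrow> e u < 4 \<and> ?S u ! e u = c u" by metis
  \<comment> \<open>The two bits of an index below 4, high bit first.\<close>
  let ?f = "\<lambda>u. [2 \<le> e u, odd (e u)]"
  define w where "w = concat (map ?f [0..<n])"
  have lw: "length w = 2 * n" unfolding w_def by (simp add: length_concat o_def interv_sum_list_conv_sum_set_nat)
  have wn: "w ! (2 * u) = (2 \<le> e u)" "w ! Suc (2 * u) = odd (e u)" if "u < n" for u
    using nth_concat_const[of n ?f 2 u 0] nth_concat_const[of n ?f 2 u 1] that unfolding w_def by (simp_all add: mult.commute)
  have ce: "certified_index (pair (encode G L) w) u = e u" if u: "u < n" for u
  proof -
    have "certified_index (pair (encode G L) w) u = (if 2 \<le> e u then 2 else 0) + (if odd (e u) then 1 else 0)"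
      using first_pair(3)[of "encode G L" w "2 * u"] first_pair(3)[of "encode G L" w "Suc (2 * u)"] wn[OF u] lw u
      unfolding certified_index_def first_pair(1) by (simp add: numeral_3_eq_3)
    moreover have "e u \<in> {0, 1, 2, 3}" using e[OF u] by auto
    ultimately show ?thesis by auto
  qed
  have "c u \<noteq> c v" if "(u, v) \<in> parcs G" for u v using c(1) that unfolding colouring_def by blast
  then have "verify (pair (encode G L) w)" unfolding verify_pair_encode[OF G] using arcs ce e by fastforce
  \<comment> \<open>Two bits per vertex fit, since the encoding has at least one field per vertex
    and each field takes at least two symbols.\<close>
  moreover have "length w \<le> length (encode G L)"
  proof -
    let ?ns = "n # concat (map (\<lambda>u. map (\<lambda>v. if (u, v) \<in> parcs G then 1 else 0 :: nat) [0..<n]) [0..<n]) @ concat (map ?S [0..<n])"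
    have "encode G L = encode_nats ?ns" unfolding encode_def Let_def n_def ..
    moreover have "n \<le> length ?ns" using L(3) by (simp add: length_concat o_def interv_sum_list_conv_sum_set_nat)
    ultimately show ?thesis using length_encode_nats_ge[of ?ns] lw by simp
  qed
  ultimately show "\<exists>w. length w \<le> length (encode G L) \<and> verify (pair (encode G L) w)" by blast
qed

lemma in_NP_regular_list_colouring: "in_NP (regular_list_colouring 4 \<G>)"
proof -
  define A where "A = {x. \<exists>w. length w \<le> length x \<and> verify (pair x w)}"
  have "A \<in> class_NP"
    unfolding class_NP_def A_def using verify_in_class_P
    by (intro CollectI bexI[of _ "{y. verify y}"] exI[of _ "[:0, 1:]"]) simp_all
  moreover have "yes (regular_list_colouring 4 \<G>) = instances (regular_list_colouring 4 \<G>) \<inter> A"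
    unfolding regular_list_colouring_def problem.simps A_def using verify_iff_colourable by fastforce
  ultimately show ?thesis unfolding in_NP_def by blast
qed


section \<open>NP-completeness\<close>

theorem theorem5:
  fixes \<H> :: "'a pair_pre_digraph set"
  assumes "finite \<H>"
    and "\<forall>H\<in>\<H>. two_connected H \<and> planar H"
    and "\<exists>G :: nat pair_pre_digraph. planar G \<and> subgraph_free \<H> G \<and> \<not> choosable 4 G"
  shows "NP_complete (regular_list_colouring 4 {G. planar G \<and> subgraph_free \<H> G})"
proof -
  let ?Q = "regular_list_colouring 4 {G. planar G \<and> subgraph_free \<H> G}"
  obtain G :: "nat pair_pre_digraph" where G: "planar G" "subgraph_free \<H> G" "\<not> choosable 4 G" using assms(3) by blast
  have "pair_graph G" using G(1) unfolding planar_def by blast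
  then obtain L0 r z c0 where gadget: "regular_assignment 4 G L0" "r \<in> pverts G" "1 \<le> z" "list_colouring G L0 c0"
      "\<And>c. list_colouring G L0 c \<Longrightarrow> c r = z"
    by (rule forcing_assignment[OF _ G(3)]) (simp, rule that)
  \<comment> \<open>Larger than the order of every member of \<H>, and at least 2, so that the
    colours along a path change at every step.\<close>
  define l where "l = Suc (Suc (\<Sum>H\<in>\<H>. card (pverts H)))"
  interpret forcing_gadget G L0 r z l c0 by unfold_locales (use G(1) gadget in \<open>simp_all add: l_def\<close>)
  have H: "two_connected H \<and> card (pverts H) < l" if "H \<in> \<H>" for H
    using assms(1,2) that member_le_sum[of H \<H> "\<lambda>H. card (pverts H)"] unfolding l_def by fastforce
  have "NP_hard ?Q"
    unfolding NP_hard_def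
  proof
    fix A assume "A \<in> class_NP"
    then obtain R V pos neg where cnf: "pdef (\<lambda>x \<rho>. R x)" "pdef (\<lambda>x \<rho>. V x)" "\<And>x. 1 \<le> V x" "pdef2b pos" "pdef2b neg"
      "\<And>x. cnf_sat (R x) (V x) (pos x) (neg x) \<longleftrightarrow> x \<in> A"
      using NP_cnf_sat by blast
    obtain f where f: "poly_time f" "\<forall>x. \<exists>G' L'. f x = encode G' L' \<and> regular_input 4 G' L' \<and> planar G' \<and>
        subgraph_free \<H> G' \<and> ((\<exists>c. list_colouring G' L' c) \<longleftrightarrow> cnf_sat (R x) (V x) (pos x) (neg x))"
      using poly_time_reduction[OF cnf(1-5) H G(2)] by blast
    have "f x \<in> instances ?Q \<and> (x \<in> A \<longleftrightarrow> f x \<in> yes ?Q)" for x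
    proof -
      obtain G' L' where x: "f x = encode G' L'" "regular_input 4 G' L'" "planar G'" "subgraph_free \<H> G'"
        "(\<exists>c. list_colouring G' L' c) \<longleftrightarrow> x \<in> A" using f(2) cnf(6) by blast
      have "f x \<in> yes ?Q \<longleftrightarrow> (\<exists>c. list_colouring G' L' c)"
      proof
        assume "f x \<in> yes ?Q"
        then obtain G2 L2 c where y: "encode G' L' = encode G2 L2" "regular_input 4 G2 L2" "colouring G2 c" "respects_lists G2 L2 c"
          unfolding regular_list_colouring_def x(1) by auto
        note eq = encode_inject[OF x(2) y(2,1)]
        have "list_colouring G' L' c" using y(3,4) eq unfolding list_colouring_def respects_lists_def by metis
        then show "\<exists>c. list_colouring G' L' c" by blast
      next
        assume "\<exists>c. list_colouring G' L' c"
        then show "f x \<in> yes ?Q" unfolding regular_list_colouring_def list_colouring_def x(1) using x(2-4) by auto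
      qed
      then show ?thesis using x unfolding regular_list_colouring_def by auto
    qed
    then show "\<exists>f. poly_time f \<and> (\<forall>x. f x \<in> instances ?Q \<and> (x \<in> A \<longleftrightarrow> f x \<in> yes ?Q))" using f(1) by blast
  qed
  then show ?thesis unfolding NP_complete_def using in_NP_regular_list_colouring by blast
qed

end
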